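(* Let $P$ be a finite poset of height at most one. Then $P$ and $P^{\mathrm{op}}$ are universally derived equivalent. More precisely, if $A=\operatorname{Min}(P)$ is the set of minimal elements of $P$ and $B=P\setminus A$, then $P=A\sqcup B$ is an admissible cut and the associated negative poset is $P^-=P^{\mathrm{op}}$.
   Context: A finite poset has height at most one if it contains no chain $x<y<z$ of three distinct elements. $P^{\mathrm{op}}$ is the poset on the same set with $x\leq_{P^{\mathrm{op}}}y\iff y\leq_P x$. Let $P$ be a finite poset with underlying set $P=A\sqcup B$ (i.e. $A\cup B=P$, $A\cap B=\emptyset$), with induced orders $\leq_A,\leq_B$. For $b\in B$ put $[b,\bullet]_B=\{b'\in B: b\leq_B b'\}$ and $[\bullet,b]_B=\{b'\in B: b'\leq_B b\}$. For $a\in A$ let $U_B(a)=\{b\in B: a\leq_P b\}$ and let $M(a)$ be the set of minimal elements of $U_B(a)$ with respect to $\leq_B$. The partition is an admissible cut if: (a) $A$ is an ideal (downward closed) of $P$ and $B$ is a filter (upward closed) of $P$; (b) for every $a\in A$ and all distinct $m,m'\in M(a)$: $[m,\bullet]_B\cap[m',\bullet]_B=\emptyset$ and $[\bullet,m]_B\cap[\bullet,m']_B=\emptyset$; (c) for all $a\leq_A a'$ in $A$ and every $m\in M(a)$ there exists $m'\in M(a')$ with $m\leq_B m'$. For an admissible cut $P=A\sqcup B$, the associated negative poset $P^-$ is the set $A\sqcup B$ with the partial order $\leq_-$ that restricts to $\leq_A$ on $A$ and $\leq_B$ on $B$ and whose only relations between elements of $A$ and $B$ are: for $a\in A$, $b\in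 B$, $b\leq_- a$ if and only if there exists $m\in M(a)$ with $b\leq_B m$ (so $a\leq_- b$ never holds). For a finite poset $X$ (viewed as a category with a unique morphism $x\to x'$ when $x\leq x'$) and an abelian category $\mathcal{A}$, $\mathcal{A}^X$ is the functor category and $D(\mathcal{A}^X)$ its derived category. Finite posets $X,Y$ are universally derived equivalent if for every abelian category $\mathcal{A}$ there is an equivalence of triangulated categories $D(\mathcal{A}^X)\simeq D(\mathcal{A}^Y)$. *)

theory Defs
  imports Main "HOL-Library.FuncSet"
begin

section \<open>Posets, admissible cuts\<close>

text \<open>A poset is a carrier \<open>P\<close> with a relation \<open>r\<close> such that \<^term>\<open>partial_order_on P r\<close>
  (which includes \<^prop>\<open>r \<subseteq> P \<times> P\<close>); its opposite is \<open>P\<close> with \<^term>\<open>r\<inverse>\<close>.\<close>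

definition height_at_most_one :: "'p rel \<Rightarrow> bool" where
  "height_at_most_one r \<longleftrightarrow> \<not> (\<exists>x y z. (x, y) \<in> r \<and> (y, z) \<in> r \<and> x \<noteq> y \<and> y \<noteq> z \<and> x \<noteq> z)"

definition minimal_elements :: "'p rel \<Rightarrow> 'p set \<Rightarrow> 'p set" where
  "minimal_elements r S = {x \<in> S. \<forall>y\<in>S. (y, x) \<in> r \<longrightarrow> y = x}"

text \<open>\<open>upper_in r B x\<close> is \<open>U\<^sub>B(x)\<close> for \<open>x \<in> A\<close> and \<open>[x, \<bullet>]\<^sub>B\<close> for \<open>x \<in> B\<close>; \<open>min_upper r B a\<close>
  is \<open>M(a)\<close>.\<close>

definition upper_in :: "'p rel \<Rightarrow> 'p set \<Rightarrow> 'p \<Rightarrow> 'p set" where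
  "upper_in r B a = {b \<in> B. (a, b) \<in> r}"

definition lower_in :: "'p rel \<Rightarrow> 'p set \<Rightarrow> 'p \<Rightarrow> 'p set" where
  "lower_in r B b = {b' \<in> B. (b', b) \<in> r}"

definition min_upper :: "'p rel \<Rightarrow> 'p set \<Rightarrow> 'p \<Rightarrow> 'p set" where
  "min_upper r B a = minimal_elements (Restr r B) (upper_in r B a)"

definition admissible_cut :: "'p set \<Rightarrow> 'p rel \<Rightarrow> 'p set \<Rightarrow> 'p set \<Rightarrow> bool" where
  "admissible_cut P r A B \<longleftrightarrow>
     A \<union> B = P \<and> A \<inter> B = {} \<and>
     (\<forall>a\<in>A. \<forall>x\<in>P. (x, a) \<in> r \<longrightarrow> x \<in> A) \<and>
     (\<forall>b\<in>B. \<forall>x\<in>P. (b, x) \<in> r \<longrightarrow> x \<in> B) \<and>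
     (\<forall>a\<in>A. \<forall>m\<in>min_upper r B a. \<forall>m'\<in>min_upper r B a. m \<noteq> m' \<longrightarrow>
        upper_in r B m \<inter> upper_in r B m' = {} \<and> lower_in r B m \<inter> lower_in r B m' = {}) \<and>
     (\<forall>a\<in>A. \<forall>a'\<in>A. (a, a') \<in> r \<longrightarrow>
        (\<forall>m\<in>min_upper r B a. \<exists>m'\<in>min_upper r B a'. (m, m') \<in> Restr r B))"

text \<open>The order of the negative poset, whose carrier is again \<open>A \<union> B\<close>.\<close>

definition negative_order :: "'p rel \<Rightarrow> 'p set \<Rightarrow> 'p set \<Rightarrow> 'p rel" where
  "negative_order r A B = Restr r A \<union> Restr r B \<union>
     {(b, a). b \<in> B \<and> a \<in> A \<and> (\<exists>m\<in>min_upper r B a. (b, m) \<in> Restr r B)}"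


section \<open>Categories, functors, natural transformations\<close>

record ('o, 'a) cat =
  Obj :: "'o set"
  Arr :: "'a set"
  Dom :: "'a \<Rightarrow> 'o"
  Cod :: "'a \<Rightarrow> 'o"
  Idn :: "'o \<Rightarrow> 'a"
  Comp :: "'a \<Rightarrow> 'a \<Rightarrow> 'a"  (infixl "\<cdot>\<index>" 70)

definition hom :: "('o, 'a, 'z) cat_scheme \<Rightarrow> 'o \<Rightarrow> 'o \<Rightarrow> 'a set" where
  "hom C X Y = {f \<in> Arr C. Dom C f = X \<and> Cod C f = Y}"

locale category =
  fixes C :: "('o, 'a, 'z) cat_scheme" (structure)
  assumes Dom_Obj: "f \<in> Arr C \<Longrightarrow> Dom C f \<in> Obj C"
    and Cod_Obj: "f \<in> Arr C \<Longrightarrow> Cod C f \<in> Obj C"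
    and Idn_hom: "X \<in> Obj C \<Longrightarrow> Idn C X \<in> hom C X X"
    and Comp_hom: "\<lbrakk>f \<in> hom C X Y; g \<in> hom C Y Z\<rbrakk> \<Longrightarrow> g \<cdot> f \<in> hom C X Z"
    and Comp_Idn_right: "f \<in> hom C X Y \<Longrightarrow> f \<cdot> Idn C X = f"
    and Comp_Idn_left: "f \<in> hom C X Y \<Longrightarrow> Idn C Y \<cdot> f = f"
    and Comp_assoc: "\<lbrakk>f \<in> hom C W X; g \<in> hom C X Y; h \<in> hom C Y Z\<rbrakk> \<Longrightarrow> h \<cdot> (g \<cdot> f) = (h \<cdot> g) \<cdot> f"

definition is_iso :: "('o, 'a, 'z) cat_scheme \<Rightarrow> 'a \<Rightarrow> bool" where
  "is_iso C f \<longleftrightarrow> f \<in> Arr C \<and> (\<exists>g \<in> hom C (Cod C f) (Dom C f).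
     Comp C g f = Idn C (Dom C f) \<and> Comp C f g = Idn C (Cod C f))"

text \<open>Functors and natural transformations are raw data; equality on them is only meaningful
  after restricting to extensional data, as done for \<open>functor_category\<close> below.\<close>

type_synonym ('o, 'a, 'p, 'b) ftr = "('o \<Rightarrow> 'p) \<times> ('a \<Rightarrow> 'b)"

definition is_functor ::
  "('o, 'a, 'z) cat_scheme \<Rightarrow> ('p, 'b, 'y) cat_scheme \<Rightarrow> ('o, 'a, 'p, 'b) ftr \<Rightarrow> bool" where
  "is_functor C D F \<longleftrightarrow>
     (\<forall>X\<in>Obj C. fst F X \<in> Obj D) \<and>
     (\<forall>f\<in>Arr C. snd F f \<in> hom D (fst F (Dom C f)) (fst F (Cod C f))) \<and>
     (\<forall>X\<in>Obj C. snd F (Idn C X) = Idn D (fst F X)) \<and>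
     (\<forall>f\<in>Arr C. \<forall>g\<in>Arr C. Cod C f = Dom C g \<longrightarrow>
        snd F (Comp C g f) = Comp D (snd F g) (snd F f))"

definition id_functor :: "('o, 'a, 'o, 'a) ftr" where
  "id_functor = (id, id)"

definition comp_functor ::
  "('p, 'b, 'q, 'c) ftr \<Rightarrow> ('o, 'a, 'p, 'b) ftr \<Rightarrow> ('o, 'a, 'q, 'c) ftr" where
  "comp_functor G F = (fst G \<circ> fst F, snd G \<circ> snd F)"

definition is_nat_trans :: "('o, 'a, 'z) cat_scheme \<Rightarrow> ('p, 'b, 'y) cat_scheme \<Rightarrow>
    ('o, 'a, 'p, 'b) ftr \<Rightarrow> ('o, 'a, 'p, 'b) ftr \<Rightarrow> ('o \<Rightarrow> 'b) \<Rightarrow> bool" where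
  "is_nat_trans C D F G \<eta> \<longleftrightarrow>
     (\<forall>X\<in>Obj C. \<eta> X \<in> hom D (fst F X) (fst G X)) \<and>
     (\<forall>f\<in>Arr C. Comp D (\<eta> (Cod C f)) (snd F f) = Comp D (snd G f) (\<eta> (Dom C f)))"

definition is_nat_iso :: "('o, 'a, 'z) cat_scheme \<Rightarrow> ('p, 'b, 'y) cat_scheme \<Rightarrow>
    ('o, 'a, 'p, 'b) ftr \<Rightarrow> ('o, 'a, 'p, 'b) ftr \<Rightarrow> ('o \<Rightarrow> 'b) \<Rightarrow> bool" where
  "is_nat_iso C D F G \<eta> \<longleftrightarrow> is_nat_trans C D F G \<eta> \<and> (\<forall>X\<in>Obj C. is_iso D (\<eta> X))"

definition is_equivalence ::
  "('o, 'a, 'z) cat_scheme \<Rightarrow> ('p, 'b, 'y) cat_scheme \<Rightarrow> ('o, 'a, 'p, 'b) ftr \<Rightarrow> bool" where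
  "is_equivalence C D F \<longleftrightarrow> is_functor C D F \<and>
     (\<exists>G \<eta> \<epsilon>. is_functor D C G \<and>
        is_nat_iso C C id_functor (comp_functor G F) \<eta> \<and>
        is_nat_iso D D (comp_functor F G) id_functor \<epsilon>)"


section \<open>Abelian categories\<close>

record ('o, 'a) addcat = "('o, 'a) cat" +
  Add :: "'a \<Rightarrow> 'a \<Rightarrow> 'a"  (infixl "\<oplus>\<index>" 65)
  Zero :: "'o \<Rightarrow> 'o \<Rightarrow> 'a"
  Neg :: "'a \<Rightarrow> 'a"

locale preadditive_category = category C
  for C :: "('o, 'a, 'z) addcat_scheme" (structure) +
  assumes Add_hom: "\<lbrakk>f \<in> hom C X Y; g \<in> hom C X Y\<rbrakk> \<Longrightarrow> f \<oplus> g \<in> hom C X Y"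
    and Zero_hom: "\<lbrakk>X \<in> Obj C; Y \<in> Obj C\<rbrakk> \<Longrightarrow> Zero C X Y \<in> hom C X Y"
    and Neg_hom: "f \<in> hom C X Y \<Longrightarrow> Neg C f \<in> hom C X Y"
    and Add_assoc: "\<lbrakk>f \<in> hom C X Y; g \<in> hom C X Y; h \<in> hom C X Y\<rbrakk>
        \<Longrightarrow> (f \<oplus> g) \<oplus> h = f \<oplus> (g \<oplus> h)"
    and Add_commute: "\<lbrakk>f \<in> hom C X Y; g \<in> hom C X Y\<rbrakk> \<Longrightarrow> f \<oplus> g = g \<oplus> f"
    and Add_Zero: "f \<in> hom C X Y \<Longrightarrow> f \<oplus> Zero C X Y = f"
    and Add_Neg: "f \<in> hom C X Y \<Longrightarrow> f \<oplus> Neg C f = Zero C X Y"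
    and Comp_Add_left: "\<lbrakk>f \<in> hom C X Y; g \<in> hom C X Y; h \<in> hom C Y Z\<rbrakk>
        \<Longrightarrow> h \<cdot> (f \<oplus> g) = h \<cdot> f \<oplus> h \<cdot> g"
    and Comp_Add_right: "\<lbrakk>f \<in> hom C X Y; g \<in> hom C X Y; h \<in> hom C W X\<rbrakk>
        \<Longrightarrow> (f \<oplus> g) \<cdot> h = f \<cdot> h \<oplus> g \<cdot> h"

definition is_zero_object :: "('o, 'a, 'z) cat_scheme \<Rightarrow> 'o \<Rightarrow> bool" where
  "is_zero_object C Z \<longleftrightarrow> Z \<in> Obj C \<and>
     (\<forall>X\<in>Obj C. (\<exists>!f. f \<in> hom C X Z) \<and> (\<exists>!f. f \<in> hom C Z X))"

definition is_mono :: "('o, 'a, 'z) cat_scheme \<Rightarrow> 'a \<Rightarrow> bool" where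
  "is_mono C f \<longleftrightarrow> f \<in> Arr C \<and> (\<forall>X. \<forall>g\<in>hom C X (Dom C f). \<forall>h\<in>hom C X (Dom C f).
     Comp C f g = Comp C f h \<longrightarrow> g = h)"

definition is_epi :: "('o, 'a, 'z) cat_scheme \<Rightarrow> 'a \<Rightarrow> bool" where
  "is_epi C f \<longleftrightarrow> f \<in> Arr C \<and> (\<forall>Y. \<forall>g\<in>hom C (Cod C f) Y. \<forall>h\<in>hom C (Cod C f) Y.
     Comp C g f = Comp C h f \<longrightarrow> g = h)"

definition is_kernel :: "('o, 'a, 'z) addcat_scheme \<Rightarrow> 'a \<Rightarrow> 'a \<Rightarrow> bool" where
  "is_kernel C f k \<longleftrightarrow> f \<in> Arr C \<and> k \<in> Arr C \<and> Cod C k = Dom C f \<and>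
     Comp C f k = Zero C (Dom C k) (Cod C f) \<and>
     (\<forall>X. \<forall>g\<in>hom C X (Dom C f). Comp C f g = Zero C X (Cod C f) \<longrightarrow>
        (\<exists>!u. u \<in> hom C X (Dom C k) \<and> Comp C k u = g))"

definition is_cokernel :: "('o, 'a, 'z) addcat_scheme \<Rightarrow> 'a \<Rightarrow> 'a \<Rightarrow> bool" where
  "is_cokernel C f q \<longleftrightarrow> f \<in> Arr C \<and> q \<in> Arr C \<and> Dom C q = Cod C f \<and>
     Comp C q f = Zero C (Dom C f) (Cod C q) \<and>
     (\<forall>Y. \<forall>g\<in>hom C (Cod C f) Y. Comp C g f = Zero C (Dom C f) Y \<longrightarrow>
        (\<exists>!u. u \<in> hom C (Cod C q) Y \<and> Comp C u q = g))"

definition is_biproduct ::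
  "('o, 'a, 'z) addcat_scheme \<Rightarrow> 'o \<Rightarrow> 'o \<Rightarrow> 'o \<Rightarrow> 'a \<Rightarrow> 'a \<Rightarrow> 'a \<Rightarrow> 'a \<Rightarrow> bool" where
  "is_biproduct C X Y S i j p q \<longleftrightarrow>
     i \<in> hom C X S \<and> j \<in> hom C Y S \<and> p \<in> hom C S X \<and> q \<in> hom C S Y \<and>
     Comp C p i = Idn C X \<and> Comp C q j = Idn C Y \<and>
     Comp C q i = Zero C X Y \<and> Comp C p j = Zero C Y X \<and>
     Add C (Comp C i p) (Comp C j q) = Idn C S"

locale abelian_category = preadditive_category C
  for C :: "('o, 'a, 'z) addcat_scheme" (structure) +
  assumes ex_zero_object: "\<exists>Z. is_zero_object C Z"
    and ex_biproduct: "\<lbrakk>X \<in> Obj C; Y \<in> Obj C\<rbrakk> \<Longrightarrow> \<exists>S i j p q. is_biproduct C X Y S i j p q"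
    and ex_kernel: "f \<in> Arr C \<Longrightarrow> \<exists>k. is_kernel C f k"
    and ex_cokernel: "f \<in> Arr C \<Longrightarrow> \<exists>q. is_cokernel C f q"
    and mono_normal: "is_mono C k \<Longrightarrow> \<exists>f. is_kernel C f k"
    and epi_conormal: "is_epi C q \<Longrightarrow> \<exists>f. is_cokernel C f q"


section \<open>Functor categories on posets\<close>

definition poset_category :: "'p set \<Rightarrow> 'p rel \<Rightarrow> ('p, 'p \<times> 'p) cat" where
  "poset_category P r = \<lparr>Obj = P, Arr = r, Dom = fst, Cod = snd,
     Idn = (\<lambda>x. (x, x)), Comp = (\<lambda>g f. (fst f, snd g))\<rparr>"

text \<open>An arrow of a functor category is a triple of source, target and components.\<close>

definition functor_category :: "('i, 'j, 'y) cat_scheme \<Rightarrow> ('o, 'a, 'z) addcat_scheme \<Rightarrow>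
    (('i, 'j, 'o, 'a) ftr,
     ('i, 'j, 'o, 'a) ftr \<times> ('i, 'j, 'o, 'a) ftr \<times> ('i \<Rightarrow> 'a)) addcat" where
  "functor_category I C = (let
      Ob = {F. is_functor I C F \<and> fst F \<in> extensional (Obj I) \<and> snd F \<in> extensional (Arr I)}
    in \<lparr>Obj = Ob,
      Arr = {(F, G, \<eta>). F \<in> Ob \<and> G \<in> Ob \<and> is_nat_trans I C F G \<eta> \<and> \<eta> \<in> extensional (Obj I)},
      Dom = (\<lambda>(F, G, \<eta>). F),
      Cod = (\<lambda>(F, G, \<eta>). G),
      Idn = (\<lambda>F. (F, F, \<lambda>i\<in>Obj I. Idn C (fst F i))),
      Comp = (\<lambda>(G', H, \<theta>) (F, G, \<eta>). (F, H, \<lambda>i\<in>Obj I. Comp C (\<theta> i) (\<eta> i))),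
      Add = (\<lambda>(F, G, \<eta>) (F', G', \<theta>). (F, G, \<lambda>i\<in>Obj I. Add C (\<eta> i) (\<theta> i))),
      Zero = (\<lambda>F G. (F, G, \<lambda>i\<in>Obj I. Zero C (fst F i) (fst G i))),
      Neg = (\<lambda>(F, G, \<eta>). (F, G, \<lambda>i\<in>Obj I. Neg C (\<eta> i)))\<rparr>)"


section \<open>Complexes, quasi-isomorphisms, mapping cones\<close>

text \<open>Unbounded cochain complexes: the objects and the differentials
  \<^term>\<open>snd X n\<close> from degree \<^term>\<open>n\<close> to degree \<^term>\<open>n + 1\<close>.\<close>

type_synonym ('o, 'a) cpx = "(int \<Rightarrow> 'o) \<times> (int \<Rightarrow> 'a)"
type_synonym ('o, 'a) cpx_map = "('o, 'a) cpx \<times> ('o, 'a) cpx \<times> (int \<Rightarrow> 'a)"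

abbreviation components :: "('o, 'a) cpx_map \<Rightarrow> int \<Rightarrow> 'a" where
  "components f \<equiv> snd (snd f)"

definition complexes :: "('o, 'a, 'z) addcat_scheme \<Rightarrow> (('o, 'a) cpx, ('o, 'a) cpx_map) cat" where
  "complexes C = (let
      Ob = {X. \<forall>n. fst X n \<in> Obj C \<and> snd X n \<in> hom C (fst X n) (fst X (n + 1)) \<and>
              Comp C (snd X (n + 1)) (snd X n) = Zero C (fst X n) (fst X (n + 2))}
    in \<lparr>Obj = Ob,
      Arr = {(X, Y, f). X \<in> Ob \<and> Y \<in> Ob \<and> (\<forall>n. f n \<in> hom C (fst X n) (fst Y n) \<and>
              Comp C (snd Y n) (f n) = Comp C (f (n + 1)) (snd X n))},
      Dom = (\<lambda>(X, Y, f). X),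
      Cod = (\<lambda>(X, Y, f). Y),
      Idn = (\<lambda>X. (X, X, \<lambda>n. Idn C (fst X n))),
      Comp = (\<lambda>(Y', Z, g) (X, Y, f). (X, Z, \<lambda>n. Comp C (g n) (f n)))\<rparr>)"

text \<open>\<open>p\<close> exhibits \<^term>\<open>Cod C p\<close> as the \<open>n\<close>-th cohomology of \<open>X\<close>: \<open>i\<close> is a kernel of the
  differential leaving degree \<open>n\<close>, and \<open>p\<close> a cokernel of the map \<open>u\<close> into that kernel
  induced by the incoming differential.\<close>

definition is_cohomology ::
  "('o, 'a, 'z) addcat_scheme \<Rightarrow> ('o, 'a) cpx \<Rightarrow> int \<Rightarrow> 'a \<Rightarrow> 'a \<Rightarrow> bool" where
  "is_cohomology C X n i p \<longleftrightarrow> is_kernel C (snd X n) i \<and>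
     (\<exists>u \<in> hom C (fst X (n - 1)) (Dom C i). Comp C i u = snd X (n - 1) \<and> is_cokernel C u p)"

text \<open>\<open>z\<close> and \<open>h\<close> are the maps induced on cocycles and cohomology; \<open>h\<close> has to be invertible.
  Kernels and cokernels are unique up to isomorphism, so the choice is immaterial.\<close>

definition quasi_isos :: "('o, 'a, 'z) addcat_scheme \<Rightarrow> ('o, 'a) cpx_map set" where
  "quasi_isos C = {f \<in> Arr (complexes C). \<forall>n i p i' p' z h.
     is_cohomology C (Dom (complexes C) f) n i p \<longrightarrow>
     is_cohomology C (Cod (complexes C) f) n i' p' \<longrightarrow>
     z \<in> hom C (Dom C i) (Dom C i') \<longrightarrow> Comp C i' z = Comp C (components f n) i \<longrightarrow>
     h \<in> hom C (Cod C p) (Cod C p') \<longrightarrow> Comp C h p = Comp C p' z \<longrightarrow>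
     is_iso C h}"

definition shift_cpx :: "('o, 'a, 'z) addcat_scheme \<Rightarrow> ('o, 'a) cpx \<Rightarrow> ('o, 'a) cpx" where
  "shift_cpx C X = (\<lambda>n. fst X (n + 1), \<lambda>n. Neg C (snd X (n + 1)))"

definition shift_map :: "('o, 'a, 'z) addcat_scheme \<Rightarrow> ('o, 'a) cpx_map \<Rightarrow> ('o, 'a) cpx_map" where
  "shift_map C = (\<lambda>(X, Y, f). (shift_cpx C X, shift_cpx C Y, \<lambda>n. f (n + 1)))"

text \<open>\<open>X \<rightarrow> Y \<rightarrow> K \<rightarrow> X[1]\<close>, given by \<open>f\<close>, \<open>g\<close>, \<open>h\<close>, is a standard triangle: in degree \<open>n\<close>,
  \<open>K\<close> is the biproduct of the components of \<open>X[1]\<close> and \<open>Y\<close> with differential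
  \<open>(x, y) \<mapsto> (- d x, f x + d y)\<close>; \<open>g\<close> is the inclusion and \<open>h\<close> the projection.\<close>

definition is_cone_triangle ::
  "('o, 'a, 'z) addcat_scheme \<Rightarrow> ('o, 'a) cpx_map \<Rightarrow> ('o, 'a) cpx_map \<Rightarrow> ('o, 'a) cpx_map \<Rightarrow> bool"
  where
  "is_cone_triangle C f g h \<longleftrightarrow> (\<exists>X Y K i q.
     f \<in> hom (complexes C) X Y \<and>
     g \<in> hom (complexes C) Y K \<and>
     h \<in> hom (complexes C) K (shift_cpx C X) \<and>
     (\<forall>n. is_biproduct C (fst X (n + 1)) (fst Y n) (fst K n)
            (i n) (components g n) (components h n) (q n) \<and>
          snd K n =
            Add C
              (Add C (Comp C (i (n + 1)) (Comp C (Neg C (snd X (n + 1))) (components h n)))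
                     (Comp C (components g (n + 1)) (Comp C (components f (n + 1)) (components h n))))
              (Comp C (components g (n + 1)) (Comp C (snd Y n) (q n)))))"


section \<open>Localization of a category\<close>

text \<open>Gabriel--Zisman: arrows of \<open>C[W\<inverse>]\<close> are zigzags of arrows of \<open>C\<close> and formally inverted
  arrows of \<open>W\<close>, modulo the congruence \<open>zz_eq\<close>. Zigzags are composed from left to right.\<close>

datatype 'a step = Fwd 'a | Bwd 'a

inductive zigzag :: "('o, 'a, 'z) cat_scheme \<Rightarrow> 'a set \<Rightarrow> 'o \<Rightarrow> 'o \<Rightarrow> 'a step list \<Rightarrow> bool"
  for C W where
  Nil: "X \<in> Obj C \<Longrightarrow> zigzag C W X X []"
| Fwd: "\<lbrakk>f \<in> hom C X Y; zigzag C W Y Z p\<rbrakk> \<Longrightarrow> zigzag C W X Z (Fwd f # p)"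
| Bwd: "\<lbrakk>s \<in> W; s \<in> hom C Y X; zigzag C W Y Z p\<rbrakk> \<Longrightarrow> zigzag C W X Z (Bwd s # p)"

inductive zz_eq ::
  "('o, 'a, 'z) cat_scheme \<Rightarrow> 'a set \<Rightarrow> 'o \<Rightarrow> 'o \<Rightarrow> 'a step list \<Rightarrow> 'a step list \<Rightarrow> bool"
  for C W where
  refl: "zigzag C W X Y p \<Longrightarrow> zz_eq C W X Y p p"
| sym: "zz_eq C W X Y p q \<Longrightarrow> zz_eq C W X Y q p"
| trans: "\<lbrakk>zz_eq C W X Y p q; zz_eq C W X Y q t\<rbrakk> \<Longrightarrow> zz_eq C W X Y p t"
| append: "\<lbrakk>zz_eq C W X Y p p'; zz_eq C W Y Z q q'\<rbrakk> \<Longrightarrow> zz_eq C W X Z (p @ q) (p' @ q')"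
| Idn: "X \<in> Obj C \<Longrightarrow> zz_eq C W X X [Fwd (Idn C X)] []"
| Comp: "\<lbrakk>f \<in> hom C X Y; g \<in> hom C Y Z\<rbrakk> \<Longrightarrow> zz_eq C W X Z [Fwd f, Fwd g] [Fwd (Comp C g f)]"
| Fwd_Bwd: "\<lbrakk>s \<in> W; s \<in> hom C X Y\<rbrakk> \<Longrightarrow> zz_eq C W X X [Fwd s, Bwd s] []"
| Bwd_Fwd: "\<lbrakk>s \<in> W; s \<in> hom C X Y\<rbrakk> \<Longrightarrow> zz_eq C W Y Y [Bwd s, Fwd s] []"

type_synonym ('o, 'a) loc_arr = "'o \<times> 'o \<times> 'a step list set"

definition zz_arr ::
  "('o, 'a, 'z) cat_scheme \<Rightarrow> 'a set \<Rightarrow> 'o \<Rightarrow> 'o \<Rightarrow> 'a step list \<Rightarrow> ('o, 'a) loc_arr" where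
  "zz_arr C W X Y p = (X, Y, {q. zz_eq C W X Y p q})"

definition localization ::
  "('o, 'a, 'z) cat_scheme \<Rightarrow> 'a set \<Rightarrow> ('o, ('o, 'a) loc_arr) cat" where
  "localization C W = \<lparr>Obj = Obj C,
     Arr = {zz_arr C W X Y p | X Y p. zigzag C W X Y p},
     Dom = (\<lambda>(X, Y, c). X),
     Cod = (\<lambda>(X, Y, c). Y),
     Idn = (\<lambda>X. zz_arr C W X X []),
     Comp = (\<lambda>(Y', Z, d) (X, Y, c). (X, Z, {t. \<exists>p\<in>c. \<exists>q\<in>d. zz_eq C W X Z (p @ q) t}))\<rparr>"

definition loc_proj :: "('o, 'a, 'z) cat_scheme \<Rightarrow> 'a set \<Rightarrow> 'a \<Rightarrow> ('o, 'a) loc_arr" where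
  "loc_proj C W f = zz_arr C W (Dom C f) (Cod C f) [Fwd f]"

text \<open>The functor induced between localizations by a functor mapping \<open>W\<close> into \<open>V\<close>.\<close>

definition loc_functor :: "('p, 'b, 'z) cat_scheme \<Rightarrow> 'b set \<Rightarrow> ('o, 'a, 'p, 'b) ftr \<Rightarrow>
    ('o, ('o, 'a) loc_arr, 'p, ('p, 'b) loc_arr) ftr" where
  "loc_functor D V F = (fst F, \<lambda>(X, Y, c).
     (fst F X, fst F Y, {t. \<exists>p\<in>c. zz_eq D V (fst F X) (fst F Y) (map (map_step (snd F)) p) t}))"


section \<open>Triangulated categories and derived categories\<close>

text \<open>The data of a triangulated category: shift functor and distinguished triangles
  \<open>X \<rightarrow> Y \<rightarrow> Z \<rightarrow> X[1]\<close>, the latter given by their three arrows. The group structure on arrows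
  of an additive category is determined by the category (\<open>is_arrow_sum\<close> below) and not
  recorded.\<close>

record ('o, 'a) tricat = "('o, 'a) cat" +
  Shift :: "('o, 'a, 'o, 'a) ftr"
  Triangles :: "('a \<times> 'a \<times> 'a) set"

definition is_triangle_iso :: "('o, 'a, 'z) cat_scheme \<Rightarrow> ('o, 'a, 'o, 'a) ftr \<Rightarrow>
    'a \<times> 'a \<times> 'a \<Rightarrow> 'a \<times> 'a \<times> 'a \<Rightarrow> 'a \<Rightarrow> 'a \<Rightarrow> 'a \<Rightarrow> bool" where
  "is_triangle_iso C T = (\<lambda>(u, v, w) (u', v', w') a b c.
     a \<in> hom C (Dom C u) (Dom C u') \<and> is_iso C a \<and>
     b \<in> hom C (Dom C v) (Dom C v') \<and> is_iso C b \<and>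
     c \<in> hom C (Dom C w) (Dom C w') \<and> is_iso C c \<and>
     Comp C b u = Comp C u' a \<and> Comp C c v = Comp C v' b \<and> Comp C (snd T a) w = Comp C w' c)"

definition derived_category :: "('o, 'a, 'z) addcat_scheme \<Rightarrow>
    (('o, 'a) cpx, (('o, 'a) cpx, ('o, 'a) cpx_map) loc_arr) tricat" where
  "derived_category C = (let
      K = complexes C; W = quasi_isos C; D = localization K W; Q = loc_proj K W;
      T = loc_functor K W (shift_cpx C, shift_map C)
    in cat.extend D \<lparr>Shift = T,
      Triangles = {(u, v, w). \<exists>X Y Z.
        u \<in> hom D X Y \<and> v \<in> hom D Y Z \<and> w \<in> hom D Z (fst T X) \<and>
        (\<exists>f g h a b c. is_cone_triangle C f g h \<and>
           is_triangle_iso D T (u, v, w) (Q f, Q g, Q h) a b c)}\<rparr>)"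

definition is_zero_arrow :: "('o, 'a, 'z) cat_scheme \<Rightarrow> 'a \<Rightarrow> bool" where
  "is_zero_arrow C f \<longleftrightarrow> (\<exists>Z. is_zero_object C Z \<and>
     (\<exists>g\<in>hom C (Dom C f) Z. \<exists>h\<in>hom C Z (Cod C f). f = Comp C h g))"

text \<open>In an additive category, \<open>h = f + g\<close>: the composite of \<open>(f, g) : X \<rightarrow> Y \<oplus> Y\<close> with the
  codiagonal \<open>s : Y \<oplus> Y \<rightarrow> Y\<close>.\<close>

definition is_arrow_sum :: "('o, 'a, 'z) cat_scheme \<Rightarrow> 'a \<Rightarrow> 'a \<Rightarrow> 'a \<Rightarrow> bool" where
  "is_arrow_sum C f g h \<longleftrightarrow> (\<exists>X Y S i j p q u s.
     f \<in> hom C X Y \<and> g \<in> hom C X Y \<and>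
     i \<in> hom C Y S \<and> j \<in> hom C Y S \<and> p \<in> hom C S Y \<and> q \<in> hom C S Y \<and>
     Comp C p i = Idn C Y \<and> Comp C q j = Idn C Y \<and>
     is_zero_arrow C (Comp C q i) \<and> is_zero_arrow C (Comp C p j) \<and>
     (\<forall>V. \<forall>a\<in>hom C V Y. \<forall>b\<in>hom C V Y.
        \<exists>!c. c \<in> hom C V S \<and> Comp C p c = a \<and> Comp C q c = b) \<and>
     (\<forall>V. \<forall>a\<in>hom C Y V. \<forall>b\<in>hom C Y V.
        \<exists>!c. c \<in> hom C S V \<and> Comp C c i = a \<and> Comp C c j = b) \<and>
     u \<in> hom C X S \<and> Comp C p u = f \<and> Comp C q u = g \<and>
     s \<in> hom C S Y \<and> Comp C s i = Idn C Y \<and> Comp C s j = Idn C Y \<and>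
     h = Comp C s u)"

definition is_additive_functor ::
  "('o, 'a, 'z) cat_scheme \<Rightarrow> ('p, 'b, 'y) cat_scheme \<Rightarrow> ('o, 'a, 'p, 'b) ftr \<Rightarrow> bool" where
  "is_additive_functor C D F \<longleftrightarrow> is_functor C D F \<and>
     (\<forall>f g h. is_arrow_sum C f g h \<longrightarrow> is_arrow_sum D (snd F f) (snd F g) (snd F h))"

text \<open>\<open>\<phi>\<close> is the structure isomorphism \<open>F(X[1]) \<cong> F(X)[1]\<close>.\<close>

definition is_triangulated_functor :: "('o, 'a, 'z) tricat_scheme \<Rightarrow> ('p, 'b, 'y) tricat_scheme \<Rightarrow>
    ('o, 'a, 'p, 'b) ftr \<Rightarrow> ('o \<Rightarrow> 'b) \<Rightarrow> bool" where
  "is_triangulated_functor C D F \<phi> \<longleftrightarrow> is_additive_functor C D F \<and>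
     is_nat_iso C D (comp_functor F (Shift C)) (comp_functor (Shift D) F) \<phi> \<and>
     (\<forall>(u, v, w) \<in> Triangles C.
        (snd F u, snd F v, Comp D (\<phi> (Dom C u)) (snd F w)) \<in> Triangles D)"

definition triangulated_equivalent ::
  "('o, 'a, 'z) tricat_scheme \<Rightarrow> ('p, 'b, 'y) tricat_scheme \<Rightarrow> bool" where
  "triangulated_equivalent C D \<longleftrightarrow>
     (\<exists>F \<phi>. is_triangulated_functor C D F \<phi> \<and> is_equivalence C D F)"

text \<open>The quantifier over all abelian categories ranges over those whose objects and arrows are
  taken from given types; these types are parameters, since HOL cannot quantify over types
  inside a formula. A theorem in which they are type variables covers all abelian categories.\<close>

definition universally_derived_equivalent ::
  "'o itself \<Rightarrow> 'a itself \<Rightarrow> 'p set \<Rightarrow> 'p rel \<Rightarrow> 'q set \<Rightarrow> 'q rel \<Rightarrow> bool" where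
  "universally_derived_equivalent TO TA P r Q s \<longleftrightarrow>
     (\<forall>C :: ('o, 'a) addcat. abelian_category C \<longrightarrow>
        triangulated_equivalent
          (derived_category (functor_category (poset_category P r) C))
          (derived_category (functor_category (poset_category Q s) C)))"

end

theory Submission
  imports Defs
begin

text \<open>
  Let \<open>A\<close> be the set of minimal elements of a poset \<open>P\<close> of height at most one and \<open>B\<close> its complement.
  A complex \<open>X\<close> of diagrams on \<open>P\<close> gives a complex \<open>F X\<close> of diagrams on the opposite poset: its value
  at \<open>b \<in> B\<close> is \<open>X\<^sub>b\<close>, its value at \<open>a \<in> A\<close> is the mapping cone of \<open>X\<^sub>a \<rightarrow> \<Oplus>\<^sub>b X\<^sub>b\<close>, where \<open>b\<close> runs over
  the elements above \<open>a\<close>, and the transition maps are the inclusions of \<open>X\<^sub>b\<close> into these cones.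
  Conversely, a complex \<open>Y\<close> of diagrams on the opposite poset gives a complex \<open>G Y\<close> of diagrams on
  \<open>P\<close>: the value at \<open>b\<close> is \<open>Y\<^sub>b\<close>, the value at \<open>a\<close> is the cone of \<open>\<Oplus>\<^sub>b Y\<^sub>b \<rightarrow> Y\<^sub>a\<close> shifted by \<open>-1\<close>, and
  the transition maps are the projections to \<open>Y\<^sub>b\<close>. The value of \<open>G (F X)\<close> at \<open>a\<close> is the shifted cone
  of the inclusion of \<open>\<Oplus>\<^sub>b X\<^sub>b\<close> into the cone of \<open>X\<^sub>a \<rightarrow> \<Oplus>\<^sub>b X\<^sub>b\<close>, which is \<open>X\<^sub>a\<close> up to homotopy, and
  similarly for \<open>F (G Y)\<close>. The two functors use only finite biproducts and signs, so that they exist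
  over every abelian category, and they become mutually inverse on derived categories.

  Both are instances of one construction, the locale \<open>twisted_product\<close>: the value at a point is a
  finite product of shifted values of \<open>X\<close>, and the differential has off-diagonal entries given by the
  structure maps of \<open>X\<close>. It preserves quasi-isomorphisms (\<open>Totm_quasi_iso\<close>) and standard triangles
  (\<open>Tot_cone\<close>) and commutes with the shift on the nose (\<open>Tot_shift\<close>, \<open>Totm_shift\<close>). The unit \<open>X \<rightarrow> G (F X)\<close>
  and the counit \<open>F (G Y) \<rightarrow> Y\<close> are natural quasi-isomorphisms (\<open>unit_map_quasi_iso\<close>,
  \<open>counit_map_quasi_iso\<close>). Localization inverts them, whence a triangulated equivalence
  (\<open>derived_equivalence_criterion\<close>).

  Quasi-isomorphisms are handled through generalized elements: the mapping cone is acyclic if and only if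
  each of its cocycles is a coboundary after composition with an epimorphism. In a functor category kernels and
  cokernels are computed pointwise, so this can be tested at each point of the poset
  (\<open>quasi_isos_FC\<close>).

  The second assertion holds because \<open>B\<close> is an antichain: every element of \<open>B\<close> above \<open>a\<close> is minimal
  among them, the segments of \<open>B\<close> are singletons, and \<open>b \<le>\<^sub>- a\<close> says just that \<open>a \<le> b\<close>.
\<close>

section \<open>Localizations\<close>

lemma homD:
  assumes "f \<in> hom C X Y"
  shows "f \<in> Arr C" "Dom C f = X" "Cod C f = Y"
  using assms by (auto simp: hom_def)

lemma homI: "\<lbrakk>f \<in> Arr C; Dom C f = X; Cod C f = Y\<rbrakk> \<Longrightarrow> f \<in> hom C X Y"
  by (simp add: hom_def)

lemma Arr_hom: "f \<in> Arr C \<Longrightarrow> f \<in> hom C (Dom C f) (Cod C f)"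
  by (simp add: hom_def)

lemma is_isoI:
  "\<lbrakk>f \<in> hom C X Y; g \<in> hom C Y X; Comp C g f = Idn C X; Comp C f g = Idn C Y\<rbrakk> \<Longrightarrow> is_iso C f"
  by (auto simp: is_iso_def hom_def)

lemma (in category) hom_Obj: "f \<in> hom C X Y \<Longrightarrow> X \<in> Obj C \<and> Y \<in> Obj C"
  using Dom_Obj Cod_Obj by (auto simp: hom_def)

lemma zigzag_append:
  "\<lbrakk>zigzag C W X Y p; zigzag C W Y Z q\<rbrakk> \<Longrightarrow> zigzag C W X Z (p @ q)"
  by (induction rule: zigzag.induct) (auto intro: zigzag.intros)

lemma (in category) zigzag_Obj: "zigzag C W X Y p \<Longrightarrow> X \<in> Obj C \<and> Y \<in> Obj C"
  by (induction rule: zigzag.induct) (auto dest: hom_Obj)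

lemma (in category) zigzag_Fwd: "f \<in> hom C X Y \<Longrightarrow> zigzag C W X Y [Fwd f]"
  using hom_Obj by (auto intro!: zigzag.intros)

lemma (in category) zigzag_Bwd: "\<lbrakk>s \<in> W; s \<in> hom C X Y\<rbrakk> \<Longrightarrow> zigzag C W Y X [Bwd s]"
  using hom_Obj by (auto intro!: zigzag.intros)

lemma zz_arr_eqI: "zz_eq C W X Y p q \<Longrightarrow> zz_arr C W X Y p = zz_arr C W X Y q"
  by (auto simp: zz_arr_def intro: zz_eq.sym zz_eq.trans)

lemma localization_sel:
  "Obj (localization C W) = Obj C"
  "Dom (localization C W) (zz_arr C W X Y p) = X"
  "Cod (localization C W) (zz_arr C W X Y p) = Y"
  "Idn (localization C W) X = zz_arr C W X X []"
  by (auto simp: localization_def zz_arr_def)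

lemma hom_localization:
  "hom (localization C W) X Y = {zz_arr C W X Y p | p. zigzag C W X Y p}"
  by (auto simp: hom_def localization_def zz_arr_def)

lemma (in category) Comp_zz_arr:
  assumes "zigzag C W X Y p" "zigzag C W Y Z q"
  shows "Comp (localization C W) (zz_arr C W Y Z q) (zz_arr C W X Y p) = zz_arr C W X Z (p @ q)"
proof -
  have "zz_eq C W X Z (p @ q) t" if "zz_eq C W X Y p p'" "zz_eq C W Y Z q q'"
      "zz_eq C W X Z (p' @ q') t" for p' q' t
    using that by (blast intro: zz_eq.append zz_eq.trans)
  then show ?thesis using assms
    by (auto simp: localization_def zz_arr_def intro: zz_eq.refl)
qed

lemma (in category) category_localization: "category (localization C W)"
proof
  fix f assume "f \<in> Arr (localization C W)"
  then obtain X Y p where f: "f = zz_arr C W X Y p" "zigzag C W X Y p"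
    by (auto simp: localization_def)
  then show "Dom (localization C W) f \<in> Obj (localization C W)"
    "Cod (localization C W) f \<in> Obj (localization C W)"
    using zigzag_Obj by (auto simp: localization_sel)
next
  fix X assume "X \<in> Obj (localization C W)"
  then show "Idn (localization C W) X \<in> hom (localization C W) X X"
    by (auto simp: localization_sel hom_localization intro!: zigzag.Nil exI[of _ "[]"])
next
  fix f g X Y Z assume "f \<in> hom (localization C W) X Y" "g \<in> hom (localization C W) Y Z"
  then show "Comp (localization C W) g f \<in> hom (localization C W) X Z"
    by (force simp: hom_localization Comp_zz_arr intro: zigzag_append)
next
  fix f X Y assume "f \<in> hom (localization C W) X Y"
  then show "Comp (localization C W) f (Idn (localization C W) X) = f"
    "Comp (localization C W) (Idn (localization C W) Y) f = f"
    using zigzag_Obj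
    by (auto simp: hom_localization localization_sel Comp_zz_arr zigzag.Nil)
next
  fix f g h X Y Z V
  assume "f \<in> hom (localization C W) V X" "g \<in> hom (localization C W) X Y"
    "h \<in> hom (localization C W) Y Z"
  then show "Comp (localization C W) h (Comp (localization C W) g f) =
    Comp (localization C W) (Comp (localization C W) h g) f"
    by (auto simp: hom_localization Comp_zz_arr zigzag_append)
qed

lemma (in category) loc_proj_hom:
  "f \<in> hom C X Y \<Longrightarrow> loc_proj C W f \<in> hom (localization C W) X Y"
  using homD[of f C X Y] by (auto simp: loc_proj_def hom_localization intro: zigzag_Fwd)

lemma loc_proj_eq: "f \<in> hom C X Y \<Longrightarrow> loc_proj C W f = zz_arr C W X Y [Fwd f]"
  using homD[of f C X Y] by (auto simp: loc_proj_def)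

lemma (in category) loc_proj_iso:
  assumes s: "s \<in> W" "s \<in> hom C X Y"
  shows "is_iso (localization C W) (loc_proj C W s)"
proof -
  have "zz_arr C W Y X [Bwd s] \<in> hom (localization C W) Y X"
    using zigzag_Bwd[OF s] by (auto simp: hom_localization)
  moreover have "loc_proj C W s \<in> hom (localization C W) X Y" using s loc_proj_hom by simp
  moreover have "Comp (localization C W) (zz_arr C W Y X [Bwd s]) (loc_proj C W s) = zz_arr C W X X []"
    "Comp (localization C W) (loc_proj C W s) (zz_arr C W Y X [Bwd s]) = zz_arr C W Y Y []"
    using s zigzag_Bwd[OF s] zigzag_Fwd[OF s(2)]
    by (auto simp: loc_proj_eq[OF s(2)] Comp_zz_arr
        intro!: zz_arr_eqI zz_eq.Fwd_Bwd zz_eq.Bwd_Fwd)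
  ultimately show ?thesis using is_isoI[of "loc_proj C W s" "localization C W"]
    unfolding localization_sel by blast
qed

text \<open>Functors between localizations arise from functors that respect the inverted arrows.\<close>

locale localizable_functor = C: category C + D: category D
  for C :: "('o, 'a, 'z) cat_scheme" and D :: "('p, 'b, 'y) cat_scheme" +
  fixes W V F
  assumes F: "is_functor C D F" and F_W: "s \<in> W \<Longrightarrow> s \<in> Arr C \<Longrightarrow> snd F s \<in> V"
begin

lemma F_Obj: "X \<in> Obj C \<Longrightarrow> fst F X \<in> Obj D"
  using F by (auto simp: is_functor_def)

lemma F_hom: "f \<in> hom C X Y \<Longrightarrow> snd F f \<in> hom D (fst F X) (fst F Y)"
  using F by (auto simp: is_functor_def hom_def)

lemma F_Idn: "X \<in> Obj C \<Longrightarrow> snd F (Idn C X) = Idn D (fst F X)"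
  using F by (auto simp: is_functor_def)

lemma F_Comp: "f \<in> hom C X Y \<Longrightarrow> g \<in> hom C Y Z \<Longrightarrow> snd F (Comp C g f) = Comp D (snd F g) (snd F f)"
  using F by (auto simp: is_functor_def hom_def)

lemma zigzag_map:
  "zigzag C W X Y p \<Longrightarrow> zigzag D V (fst F X) (fst F Y) (map (map_step (snd F)) p)"
  by (induction rule: zigzag.induct)
    (auto intro!: zigzag.intros F_Obj intro: F_hom F_W dest: homD(1))

lemma zz_eq_map:
  "zz_eq C W X Y p q \<Longrightarrow>
    zz_eq D V (fst F X) (fst F Y) (map (map_step (snd F)) p) (map (map_step (snd F)) q)"
proof (induction rule: zz_eq.induct)
  case (Comp f X Y g Z)
  then show ?case using zz_eq.Comp[OF F_hom F_hom, of f X Y g Z V] by (simp add: F_Comp)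
next
  case (Fwd_Bwd s X Y)
  then show ?case using zz_eq.Fwd_Bwd[OF F_W F_hom, of s X Y] by (auto dest: homD(1))
next
  case (Bwd_Fwd s X Y)
  then show ?case using zz_eq.Bwd_Fwd[OF F_W F_hom, of s X Y] by (auto dest: homD(1))
qed (auto intro: zz_eq.refl zz_eq.sym zz_eq.trans zz_eq.append zigzag_map zz_eq.Idn
    simp: F_Obj F_Idn)

text \<open>The choice of the representative of a class does not matter, since the functor preserves
  equivalence of zigzags.\<close>

lemma loc_functor_zz_arr:
  assumes "zigzag C W X Y p"
  shows "snd (loc_functor D V F) (zz_arr C W X Y p) =
    zz_arr D V (fst F X) (fst F Y) (map (map_step (snd F)) p)"
  using assms by (auto simp: loc_functor_def zz_arr_def
      intro: zz_eq_map zz_eq.trans zz_eq.refl)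

lemma loc_functor_Obj: "fst (loc_functor D V F) X = fst F X"
  by (simp add: loc_functor_def)

lemma loc_functor_proj:
  "f \<in> Arr C \<Longrightarrow> snd (loc_functor D V F) (loc_proj C W f) = loc_proj D V (snd F f)"
  using C.zigzag_Fwd[OF Arr_hom, of f W] homD(2,3)[OF F_hom[OF Arr_hom], of f]
  by (simp add: loc_proj_def loc_functor_zz_arr)

lemma is_functor_loc: "is_functor (localization C W) (localization D V) (loc_functor D V F)"
proof -
  have "snd (loc_functor D V F) f \<in>
      hom (localization D V) (fst F (Dom (localization C W) f)) (fst F (Cod (localization C W) f))"
    if f: "f \<in> Arr (localization C W)" for f
  proof -
    from f obtain X Y p where "f = zz_arr C W X Y p" "zigzag C W X Y p"
      by (auto simp: localization_def)
    then show ?thesis by (auto simp: loc_functor_zz_arr localization_sel hom_localization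
          intro: zigzag_map)
  qed
  moreover have "snd (loc_functor D V F) (Comp (localization C W) g f) =
      Comp (localization D V) (snd (loc_functor D V F) g) (snd (loc_functor D V F) f)"
    if "f \<in> Arr (localization C W)" "g \<in> Arr (localization C W)"
      "Cod (localization C W) f = Dom (localization C W) g" for f g
  proof -
    from that obtain X Y p where f: "f = zz_arr C W X Y p" "zigzag C W X Y p"
      by (auto simp: localization_def)
    from that obtain X' Y' q where g: "g = zz_arr C W X' Y' q" "zigzag C W X' Y' q"
      by (auto simp: localization_def)
    have "X' = Y" using that f g by (simp add: localization_sel)
    then show ?thesis using f g zigzag_append[of C W X Y p Y' q]
      by (simp add: C.Comp_zz_arr loc_functor_zz_arr D.Comp_zz_arr zigzag_map)
  qed
  ultimately show ?thesis
    by (auto simp: is_functor_def localization_sel loc_functor_zz_arr zigzag.Nil F_Obj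
        loc_functor_Obj)
qed

end

text \<open>A natural transformation that the localization inverts becomes natural also with respect to
  the formal inverses, since a commuting square may be read backwards.\<close>

lemma loc_nat:
  assumes F: "localizable_functor C D W V F" and G: "localizable_functor C D W V G"
    and \<alpha>: "is_nat_trans C D F G \<alpha>" and p: "zigzag C W X Y p"
  shows "Comp (localization D V) (loc_proj D V (\<alpha> Y)) (snd (loc_functor D V F) (zz_arr C W X Y p)) =
    Comp (localization D V) (snd (loc_functor D V G) (zz_arr C W X Y p)) (loc_proj D V (\<alpha> X))"
proof -
  interpret F: localizable_functor C D W V F by (rule F)
  interpret G: localizable_functor C D W V G by (rule G)
  let ?F = "map (map_step (snd F))" and ?G = "map (map_step (snd G))"
  have \<alpha>_hom: "\<alpha> Z \<in> hom D (fst F Z) (fst G Z)" if "Z \<in> Obj C" for Z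
    using \<alpha> that by (auto simp: is_nat_trans_def)
  have \<alpha>_nat: "Comp D (\<alpha> Z') (snd F f) = Comp D (snd G f) (\<alpha> Z)" if "f \<in> hom C Z Z'" for Z Z' f
    using \<alpha> that by (auto simp: is_nat_trans_def hom_def)
  have sq: "zz_eq D V (fst F Z) (fst G Z') [Fwd (snd F f), Fwd (\<alpha> Z')] [Fwd (\<alpha> Z), Fwd (snd G f)]"
    if f: "f \<in> hom C Z Z'" for Z Z' f
    using zz_eq.Comp[OF F.F_hom[OF f] \<alpha>_hom[of Z'], of V] zz_eq.Comp[OF \<alpha>_hom[of Z] G.F_hom[OF f], of V]
      F.C.hom_Obj[OF f] \<alpha>_nat[OF f] by (auto intro: zz_eq.trans zz_eq.sym)
  have "zz_eq D V (fst F X) (fst G Y) (?F p @ [Fwd (\<alpha> Y)]) (Fwd (\<alpha> X) # ?G p)"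
    using p
  proof (induction rule: zigzag.induct)
    case (Nil X)
    then show ?case using \<alpha>_hom[of X] by (auto intro!: zz_eq.refl F.D.zigzag_Fwd)
  next
    case (Fwd f X Y Z p)
    have "zz_eq D V (fst F X) (fst G Z) ([Fwd (snd F f)] @ (?F p @ [Fwd (\<alpha> Z)]))
        ([Fwd (snd F f)] @ (Fwd (\<alpha> Y) # ?G p))"
      using Fwd by (intro zz_eq.append[OF zz_eq.refl]) (auto intro: F.D.zigzag_Fwd F.F_hom)
    moreover have "zz_eq D V (fst F X) (fst G Z) ([Fwd (snd F f), Fwd (\<alpha> Y)] @ ?G p)
        ([Fwd (\<alpha> X), Fwd (snd G f)] @ ?G p)"
      using Fwd G.zigzag_map by (intro zz_eq.append[OF sq[OF Fwd(1)] zz_eq.refl]) auto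
    ultimately show ?case by (auto intro: zz_eq.trans)
  next
    case (Bwd s Y X Z p)
    then have Y: "X \<in> Obj C" "Y \<in> Obj C" using F.C.hom_Obj by auto
    have sV: "snd F s \<in> V" "snd G s \<in> V" using Bwd F.F_W G.F_W by (auto dest: homD(1))
    have Fs: "snd F s \<in> hom D (fst F Y) (fst F X)" and Gs: "snd G s \<in> hom D (fst G Y) (fst G X)"
      using Bwd F.F_hom G.F_hom by auto
    note z = F.D.zigzag_Fwd[OF \<alpha>_hom] F.D.zigzag_Bwd[OF sV(1) Fs] F.D.zigzag_Bwd[OF sV(2) Gs]
      zz_eq.refl Y
    have "zz_eq D V (fst F X) (fst G Y) ([] @ [Fwd (\<alpha> X), Bwd (snd G s)])
        ([Bwd (snd F s), Fwd (snd F s)] @ [Fwd (\<alpha> X), Bwd (snd G s)])"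
      using zigzag_append[OF z(1) z(3)] Y
      by (intro zz_eq.append[OF zz_eq.sym[OF zz_eq.Bwd_Fwd[OF sV(1) Fs]] zz_eq.refl]) auto
    moreover have "zz_eq D V (fst F X) (fst G Y)
        ([Bwd (snd F s)] @ ([Fwd (snd F s), Fwd (\<alpha> X)] @ [Bwd (snd G s)]))
        ([Bwd (snd F s)] @ ([Fwd (\<alpha> Y), Fwd (snd G s)] @ [Bwd (snd G s)]))"
      by (rule zz_eq.append[OF zz_eq.refl[OF z(2)] zz_eq.append[OF sq zz_eq.refl[OF z(3)]]]) (rule Bwd)
    moreover have "zz_eq D V (fst F X) (fst G Y)
        (([Bwd (snd F s)] @ [Fwd (\<alpha> Y)]) @ [Fwd (snd G s), Bwd (snd G s)])
        (([Bwd (snd F s)] @ [Fwd (\<alpha> Y)]) @ [])"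
      using z by (intro zz_eq.append[OF _ zz_eq.Fwd_Bwd[OF sV(2) Gs]] zz_eq.append zz_eq.refl) auto
    ultimately have *: "zz_eq D V (fst F X) (fst G Y)
        [Bwd (snd F s), Fwd (\<alpha> Y)] [Fwd (\<alpha> X), Bwd (snd G s)]"
      by simp (meson zz_eq.sym zz_eq.trans)
    have "zz_eq D V (fst F X) (fst G Z) ([Bwd (snd F s)] @ (?F p @ [Fwd (\<alpha> Z)]))
        ([Bwd (snd F s)] @ (Fwd (\<alpha> Y) # ?G p))"
      using Bwd z by (intro zz_eq.append[OF zz_eq.refl]) auto
    moreover have "zz_eq D V (fst F X) (fst G Z) ([Bwd (snd F s), Fwd (\<alpha> Y)] @ ?G p)
        ([Fwd (\<alpha> X), Bwd (snd G s)] @ ?G p)"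
      using Bwd G.zigzag_map by (intro zz_eq.append[OF * zz_eq.refl]) auto
    ultimately show ?case by (auto intro: zz_eq.trans)
  qed
  moreover have "X \<in> Obj C" "Y \<in> Obj C" using F.C.zigzag_Obj[OF p] by auto
  ultimately show ?thesis
    using p F.zigzag_map[OF p] G.zigzag_map[OF p] F.D.zigzag_Fwd[OF \<alpha>_hom]
    by (simp add: F.loc_functor_zz_arr G.loc_functor_zz_arr loc_proj_eq[OF \<alpha>_hom]
        F.D.Comp_zz_arr zz_arr_eqI)
qed

section \<open>Equivalences of categories\<close>

context category
begin

lemma is_isoE:
  assumes "is_iso C f" "f \<in> hom C X Y"
  obtains g where "g \<in> hom C Y X" "g \<cdot> f = Idn C X" "f \<cdot> g = Idn C Y"
  using assms by (auto simp: is_iso_def hom_def)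

lemma iso_cancel_left:
  assumes f: "is_iso C f" "f \<in> hom C X Y" and "g \<in> hom C V X" "h \<in> hom C V X" "f \<cdot> g = f \<cdot> h"
  shows "g = h"
proof -
  obtain k where k: "k \<in> hom C Y X" "k \<cdot> f = Idn C X" using is_isoE[OF f] by blast
  have "g = (k \<cdot> f) \<cdot> g" using k assms by (simp add: Comp_Idn_left)
  also have "\<dots> = k \<cdot> (f \<cdot> h)" using Comp_assoc[OF assms(3) f(2) k(1)] assms(5) by simp
  also have "\<dots> = h" using Comp_assoc[OF assms(4) f(2) k(1)] k assms by (simp add: Comp_Idn_left)
  finally show ?thesis .
qed

lemma iso_cancel_right:
  assumes f: "is_iso C f" "f \<in> hom C X Y" and "g \<in> hom C Y V" "h \<in> hom C Y V" "g \<cdot> f = h \<cdot> f"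
  shows "g = h"
proof -
  obtain k where k: "k \<in> hom C Y X" "f \<cdot> k = Idn C Y" using is_isoE[OF f] by blast
  have "g = g \<cdot> (f \<cdot> k)" using k assms by (simp add: Comp_Idn_right)
  also have "\<dots> = (h \<cdot> f) \<cdot> k" using Comp_assoc[OF k(1) f(2) assms(3)] assms(5) by simp
  also have "\<dots> = h" using Comp_assoc[OF k(1) f(2) assms(4)] k assms by (simp add: Comp_Idn_right)
  finally show ?thesis .
qed

end

lemma is_functor_iso:
  assumes "category C" and F: "is_functor C D F" and f: "is_iso C f"
  shows "is_iso D (snd F f)"
proof -
  interpret category C by (rule assms)
  obtain g where g: "f \<in> Arr C" "g \<in> hom C (Cod C f) (Dom C f)" "Comp C g f = Idn C (Dom C f)"
      "Comp C f g = Idn C (Cod C f)"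
    using f by (auto simp: is_iso_def)
  have [simp]: "Dom C f \<in> Obj C" "Cod C f \<in> Obj C" using g Dom_Obj Cod_Obj by auto
  have "Comp D (snd F g) (snd F f) = snd F (Idn C (Dom C f))" "Comp D (snd F f) (snd F g) = snd F (Idn C (Cod C f))"
    using F g unfolding is_functor_def hom_def by (metis (mono_tags, lifting) mem_Collect_eq)+
  moreover have "snd F f \<in> hom D (fst F (Dom C f)) (fst F (Cod C f))"
    "snd F g \<in> hom D (fst F (Cod C f)) (fst F (Dom C f))"
    using F g by (auto simp: is_functor_def hom_def)
  moreover have "snd F (Idn C X) = Idn D (fst F X)" if "X \<in> Obj C" for X
    using F that by (auto simp: is_functor_def)
  ultimately show ?thesis using g by (intro is_isoI) auto
qed

locale equivalence = C: category C + D: category D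
  for C :: "('o, 'a, 'z) cat_scheme" and D :: "('p, 'b, 'y) cat_scheme" +
  fixes F
  assumes equiv: "is_equivalence C D F"
begin

lemma F: "is_functor C D F" using equiv by (simp add: is_equivalence_def)

lemma F_Obj: "X \<in> Obj C \<Longrightarrow> fst F X \<in> Obj D"
  using F by (auto simp: is_functor_def)

lemma F_hom: "f \<in> hom C X Y \<Longrightarrow> snd F f \<in> hom D (fst F X) (fst F Y)"
  using F by (auto simp: is_functor_def hom_def)

lemma F_Idn: "X \<in> Obj C \<Longrightarrow> snd F (Idn C X) = Idn D (fst F X)"
  using F by (auto simp: is_functor_def)

lemma F_Comp: "f \<in> hom C X Y \<Longrightarrow> g \<in> hom C Y Z \<Longrightarrow> snd F (Comp C g f) = Comp D (snd F g) (snd F f)"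
  using F by (auto simp: is_functor_def hom_def)

lemma surj:
  assumes "V \<in> Obj D"
  obtains X s t where "X \<in> Obj C" "s \<in> hom D (fst F X) V" "t \<in> hom D V (fst F X)"
    "Comp D s t = Idn D V" "Comp D t s = Idn D (fst F X)"
proof -
  obtain G \<epsilon> where G: "is_functor D C G" and \<epsilon>: "is_nat_iso D D (comp_functor F G) id_functor \<epsilon>"
    using equiv unfolding is_equivalence_def by blast
  have "\<epsilon> V \<in> hom D (fst F (fst G V)) V" "is_iso D (\<epsilon> V)"
    using \<epsilon> assms by (auto simp: is_nat_iso_def is_nat_trans_def comp_functor_def id_functor_def)
  moreover obtain t where "t \<in> hom D V (fst F (fst G V))" "Comp D t (\<epsilon> V) = Idn D (fst F (fst G V))"
      "Comp D (\<epsilon> V) t = Idn D V"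
    using D.is_isoE[OF calculation(2,1)] by blast
  moreover have "fst G V \<in> Obj C" using G assms by (auto simp: is_functor_def)
  ultimately show ?thesis by (intro that[of "fst G V" "\<epsilon> V" t])
qed

text \<open>Naturality of the unit makes \<open>F\<close> faithful, naturality of the counit makes its quasi-inverse \<open>G\<close>
  faithful. A preimage of \<open>k\<close> is \<open>G k\<close> transported along the unit: its image agrees with \<open>k\<close> after
  applying \<open>G\<close>.\<close>

lemma fully_faithful:
  assumes "X \<in> Obj C" "Y \<in> Obj C" "k \<in> hom D (fst F X) (fst F Y)"
  shows "\<exists>!f. f \<in> hom C X Y \<and> snd F f = k"
proof -
  obtain G \<eta> \<epsilon> where G: "is_functor D C G"
    and \<eta>: "is_nat_iso C C id_functor (comp_functor G F) \<eta>"
    and \<epsilon>: "is_nat_iso D D (comp_functor F G) id_functor \<epsilon>"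
    using equiv unfolding is_equivalence_def by blast
  have G_hom: "snd G f \<in> hom C (fst G X) (fst G Y)" if "f \<in> hom D X Y" for f X Y
    using G that by (auto simp: is_functor_def hom_def)
  have \<eta>': "\<eta> X \<in> hom C X (fst G (fst F X))" "is_iso C (\<eta> X)" if "X \<in> Obj C" for X
    using \<eta> that by (auto simp: is_nat_iso_def is_nat_trans_def comp_functor_def id_functor_def)
  have \<epsilon>': "\<epsilon> X \<in> hom D (fst F (fst G X)) X" "is_iso D (\<epsilon> X)" if "X \<in> Obj D" for X
    using \<epsilon> that by (auto simp: is_nat_iso_def is_nat_trans_def comp_functor_def id_functor_def)
  have \<eta>_nat: "Comp C (\<eta> Y) f = Comp C (snd G (snd F f)) (\<eta> X)" if "f \<in> hom C X Y" for X Y f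
    using \<eta> that by (auto simp: is_nat_iso_def is_nat_trans_def comp_functor_def id_functor_def hom_def)
  have \<epsilon>_nat: "Comp D (\<epsilon> Y) (snd F (snd G f)) = Comp D f (\<epsilon> X)" if "f \<in> hom D X Y" for X Y f
    using \<epsilon> that by (auto simp: is_nat_iso_def is_nat_trans_def comp_functor_def id_functor_def hom_def)
  have faithful: "f = g" if "f \<in> hom C X Y" "g \<in> hom C X Y" "snd F f = snd F g" for f g
    using C.iso_cancel_left[OF \<eta>'(2,1)[OF assms(2)] that(1,2)] \<eta>_nat[OF that(1)] \<eta>_nat[OF that(2)] that(3)
    by simp
  have faithful_G: "f = g" if "f \<in> hom D V W" "g \<in> hom D V W" "snd G f = snd G g" for f g V W
  proof -
    have V: "V \<in> Obj D" using D.hom_Obj[OF that(1)] by simp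
    show ?thesis
      using D.iso_cancel_right[OF \<epsilon>'(2,1)[OF V] that(1,2)] \<epsilon>_nat[OF that(1)] \<epsilon>_nat[OF that(2)] that(3)
      by simp
  qed
  obtain s where s: "s \<in> hom C (fst G (fst F Y)) Y" "Comp C (\<eta> Y) s = Idn C (fst G (fst F Y))"
    using C.is_isoE[OF \<eta>'(2,1)[OF assms(2)]] by blast
  define f where "f = Comp C s (Comp C (snd G k) (\<eta> X))"
  have k\<eta>: "Comp C (snd G k) (\<eta> X) \<in> hom C X (fst G (fst F Y))"
    using C.Comp_hom[OF \<eta>'(1)[OF assms(1)] G_hom[OF assms(3)]] .
  have f: "f \<in> hom C X Y" unfolding f_def using C.Comp_hom[OF k\<eta> s(1)] .
  have "Comp C (snd G (snd F f)) (\<eta> X) = Comp C (\<eta> Y) f" using \<eta>_nat[OF f] by simp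
  also have "\<dots> = Comp C (snd G k) (\<eta> X)"
    unfolding f_def using C.Comp_assoc[OF k\<eta> s(1) \<eta>'(1)] s(2) C.Comp_Idn_left[OF k\<eta>] assms by simp
  finally have "snd G (snd F f) = snd G k"
    using C.iso_cancel_right[OF \<eta>'(2,1)[OF assms(1)] G_hom[OF F_hom[OF f]] G_hom[OF assms(3)]] by simp
  then have "snd F f = k" using faithful_G[OF F_hom[OF f] assms(3)] by simp
  with f faithful show ?thesis by blast
qed

lemma faithful:
  assumes "f \<in> hom C X Y" "g \<in> hom C X Y" "snd F f = snd F g"
  shows "f = g"
proof -
  have "\<exists>!h. h \<in> hom C X Y \<and> snd F h = snd F g"
    using fully_faithful[OF _ _ F_hom[OF assms(2)]] C.hom_Obj[OF assms(2)] by simp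
  then show ?thesis using assms by auto
qed

lemma full:
  assumes "X \<in> Obj C" "Y \<in> Obj C" "k \<in> hom D (fst F X) (fst F Y)"
  obtains f where "f \<in> hom C X Y" "snd F f = k"
  using fully_faithful[OF assms] by blast

lemma zero_object:
  assumes "is_zero_object C Z"
  shows "is_zero_object D (fst F Z)"
proof -
  have Z: "Z \<in> Obj C" using assms by (simp add: is_zero_object_def)
  have "(\<exists>!f. f \<in> hom D V (fst F Z)) \<and> (\<exists>!f. f \<in> hom D (fst F Z) V)" if V: "V \<in> Obj D" for V
  proof -
    obtain X s t where X: "X \<in> Obj C" and st: "s \<in> hom D (fst F X) V" "t \<in> hom D V (fst F X)"
      "Comp D s t = Idn D V" "Comp D t s = Idn D (fst F X)"
      using surj[OF V] by blast
    obtain f g where f: "f \<in> hom C X Z" "\<And>f'. f' \<in> hom C X Z \<Longrightarrow> f' = f"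
      and g: "g \<in> hom C Z X" "\<And>f'. f' \<in> hom C Z X \<Longrightarrow> f' = g"
    proof -
      have "(\<exists>!f. f \<in> hom C X Z) \<and> (\<exists>!f. f \<in> hom C Z X)"
        using assms X unfolding is_zero_object_def by simp
      then obtain f g where "f \<in> hom C X Z" "\<forall>f'. f' \<in> hom C X Z \<longrightarrow> f' = f"
          "g \<in> hom C Z X" "\<forall>f'. f' \<in> hom C Z X \<longrightarrow> f' = g"
        unfolding Ex1_def by (elim conjE exE)
      then show ?thesis by (intro that) auto
    qed
    have 1: "h = Comp D (snd F f) t" if h: "h \<in> hom D V (fst F Z)" for h
    proof -
      obtain h' where "h' \<in> hom C X Z" "snd F h' = Comp D h s"
        using full[OF X Z D.Comp_hom[OF st(1) h]] by blast
      then have "Comp D h s = snd F f" using f by auto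
      then show ?thesis using D.Comp_assoc[OF st(2,1) h] st(3) D.Comp_Idn_right[OF h] by simp
    qed
    have 2: "h = Comp D s (snd F g)" if h: "h \<in> hom D (fst F Z) V" for h
    proof -
      obtain h' where "h' \<in> hom C Z X" "snd F h' = Comp D t h"
        using full[OF Z X D.Comp_hom[OF h st(2)]] by blast
      then have "Comp D t h = snd F g" using g by auto
      then show ?thesis using D.Comp_assoc[OF h st(2,1)] st(3) D.Comp_Idn_left[OF h] by simp
    qed
    show ?thesis
      using 1 2 D.Comp_hom[OF st(2) F_hom[OF f(1)]] D.Comp_hom[OF F_hom[OF g(1)] st(1)] by blast
  qed
  then show ?thesis using F_Obj[OF Z] by (simp add: is_zero_object_def)
qed

lemma zero_arrow:
  assumes f: "f \<in> Arr C" and "is_zero_arrow C f"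
  shows "is_zero_arrow D (snd F f)"
proof -
  obtain Z g h where Z: "is_zero_object C Z" "g \<in> hom C (Dom C f) Z" "h \<in> hom C Z (Cod C f)"
    "f = Comp C h g"
    using assms(2) unfolding is_zero_arrow_def by blast
  have "snd F f = Comp D (snd F h) (snd F g)" using F_Comp[OF Z(2,3)] Z(4) by simp
  then show ?thesis unfolding is_zero_arrow_def homD(2,3)[OF F_hom[OF Arr_hom[OF f]]]
    using zero_object[OF Z(1)] F_hom[OF Z(2)] F_hom[OF Z(3)] by blast
qed

text \<open>A test object \<open>V\<close> may be replaced by an isomorphic object in the image of \<open>F\<close>, where full
  faithfulness transports the universal property.\<close>

lemma product:
  assumes pq: "p \<in> hom C S Y" "q \<in> hom C S Y'"
    and univ: "\<And>V a b. a \<in> hom C V Y \<Longrightarrow> b \<in> hom C V Y' \<Longrightarrow>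
      \<exists>!c. c \<in> hom C V S \<and> Comp C p c = a \<and> Comp C q c = b"
    and ab: "a \<in> hom D V (fst F Y)" "b \<in> hom D V (fst F Y')"
  shows "\<exists>!c. c \<in> hom D V (fst F S) \<and> Comp D (snd F p) c = a \<and> Comp D (snd F q) c = b"
proof -
  note [simp] = C.hom_Obj[OF pq(1)] C.hom_Obj[OF pq(2)]
  obtain X s t where X: "X \<in> Obj C" and st: "s \<in> hom D (fst F X) V" "t \<in> hom D V (fst F X)"
    "Comp D s t = Idn D V" "Comp D t s = Idn D (fst F X)"
    using surj D.hom_Obj[OF ab(1)] by blast
  obtain a' where a': "a' \<in> hom C X Y" "snd F a' = Comp D a s"
    using full[OF X _ D.Comp_hom[OF st(1) ab(1)]] by auto
  obtain b' where b': "b' \<in> hom C X Y'" "snd F b' = Comp D b s"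
    using full[OF X _ D.Comp_hom[OF st(1) ab(2)]] by auto
  obtain c where c: "c \<in> hom C X S" "Comp C p c = a'" "Comp C q c = b'"
    "\<And>c'. c' \<in> hom C X S \<Longrightarrow> Comp C p c' = a' \<Longrightarrow> Comp C q c' = b' \<Longrightarrow> c' = c"
    using univ[OF a'(1) b'(1)] by blast
  have back_eq: "Comp D (Comp D h s) t = h" if "h \<in> hom D V W" for h W
    using D.Comp_assoc[OF st(2,1) that] st(3) D.Comp_Idn_right[OF that] by simp
  let ?c = "Comp D (snd F c) t"
  have "?c \<in> hom D V (fst F S)" using D.Comp_hom[OF st(2) F_hom[OF c(1)]] .
  moreover have "Comp D (snd F p) ?c = a"
    using D.Comp_assoc[OF st(2) F_hom[OF c(1)] F_hom[OF pq(1)]] F_Comp[OF c(1) pq(1)] c(2) a'(2)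
      back_eq[OF ab(1)] by simp
  moreover have "Comp D (snd F q) ?c = b"
    using D.Comp_assoc[OF st(2) F_hom[OF c(1)] F_hom[OF pq(2)]] F_Comp[OF c(1) pq(2)] c(3) b'(2)
      back_eq[OF ab(2)] by simp
  moreover have "d = ?c" if d: "d \<in> hom D V (fst F S)" "Comp D (snd F p) d = a" "Comp D (snd F q) d = b" for d
  proof -
    obtain c' where c': "c' \<in> hom C X S" "snd F c' = Comp D d s"
      using full[OF X _ D.Comp_hom[OF st(1) d(1)]] by auto
    have "snd F (Comp C p c') = snd F a'" "snd F (Comp C q c') = snd F b'"
      using F_Comp[OF c'(1) pq(1)] F_Comp[OF c'(1) pq(2)] c'(2) a'(2) b'(2)
        D.Comp_assoc[OF st(1) d(1) F_hom[OF pq(1)]] D.Comp_assoc[OF st(1) d(1) F_hom[OF pq(2)]] d(2,3)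
      by simp_all
    then have "Comp C p c' = a'" "Comp C q c' = b'"
      using faithful[OF C.Comp_hom[OF c'(1) pq(1)] a'(1)] faithful[OF C.Comp_hom[OF c'(1) pq(2)] b'(1)]
      by auto
    then have "c' = c" using c c' by blast
    then show ?thesis using c'(2) back_eq[OF d(1)] by simp
  qed
  ultimately show ?thesis by blast
qed

lemma coproduct:
  assumes pq: "p \<in> hom C Y S" "q \<in> hom C Y' S"
    and univ: "\<And>V a b. a \<in> hom C Y V \<Longrightarrow> b \<in> hom C Y' V \<Longrightarrow>
      \<exists>!c. c \<in> hom C S V \<and> Comp C c p = a \<and> Comp C c q = b"
    and ab: "a \<in> hom D (fst F Y) V" "b \<in> hom D (fst F Y') V"
  shows "\<exists>!c. c \<in> hom D (fst F S) V \<and> Comp D c (snd F p) = a \<and> Comp D c (snd F q) = b"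
proof -
  note [simp] = C.hom_Obj[OF pq(1)] C.hom_Obj[OF pq(2)]
  obtain X s t where X: "X \<in> Obj C" and st: "s \<in> hom D (fst F X) V" "t \<in> hom D V (fst F X)"
    "Comp D s t = Idn D V" "Comp D t s = Idn D (fst F X)"
    using surj D.hom_Obj[OF ab(1)] by blast
  obtain a' where a': "a' \<in> hom C Y X" "snd F a' = Comp D t a"
    using full[OF _ X D.Comp_hom[OF ab(1) st(2)]] by auto
  obtain b' where b': "b' \<in> hom C Y' X" "snd F b' = Comp D t b"
    using full[OF _ X D.Comp_hom[OF ab(2) st(2)]] by auto
  obtain c where c: "c \<in> hom C S X" "Comp C c p = a'" "Comp C c q = b'"
    "\<And>c'. c' \<in> hom C S X \<Longrightarrow> Comp C c' p = a' \<Longrightarrow> Comp C c' q = b' \<Longrightarrow> c' = c"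
    using univ[OF a'(1) b'(1)] by blast
  have back_eq: "Comp D s (Comp D t h) = h" if "h \<in> hom D W V" for h W
    using D.Comp_assoc[OF that st(2,1)] st(3) D.Comp_Idn_left[OF that] by simp
  let ?c = "Comp D s (snd F c)"
  have "?c \<in> hom D (fst F S) V" using D.Comp_hom[OF F_hom[OF c(1)] st(1)] .
  moreover have "Comp D ?c (snd F p) = a"
    using D.Comp_assoc[OF F_hom[OF pq(1)] F_hom[OF c(1)] st(1)] F_Comp[OF pq(1) c(1)] c(2) a'(2)
      back_eq[OF ab(1)] by simp
  moreover have "Comp D ?c (snd F q) = b"
    using D.Comp_assoc[OF F_hom[OF pq(2)] F_hom[OF c(1)] st(1)] F_Comp[OF pq(2) c(1)] c(3) b'(2)
      back_eq[OF ab(2)] by simp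
  moreover have "d = ?c" if d: "d \<in> hom D (fst F S) V" "Comp D d (snd F p) = a" "Comp D d (snd F q) = b" for d
  proof -
    obtain c' where c': "c' \<in> hom C S X" "snd F c' = Comp D t d"
      using full[OF _ X D.Comp_hom[OF d(1) st(2)]] by auto
    have "snd F (Comp C c' p) = snd F a'" "snd F (Comp C c' q) = snd F b'"
      using F_Comp[OF pq(1) c'(1)] F_Comp[OF pq(2) c'(1)] c'(2) a'(2) b'(2)
        D.Comp_assoc[OF F_hom[OF pq(1)] d(1) st(2)] D.Comp_assoc[OF F_hom[OF pq(2)] d(1) st(2)] d(2,3)
      by simp_all
    then have "Comp C c' p = a'" "Comp C c' q = b'"
      using faithful[OF C.Comp_hom[OF pq(1) c'(1)] a'(1)] faithful[OF C.Comp_hom[OF pq(2) c'(1)] b'(1)]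
      by auto
    then have "c' = c" using c c' by blast
    then show ?thesis using c'(2) back_eq[OF d(1)] by simp
  qed
  ultimately show ?thesis by blast
qed

text \<open>Zero objects, products and coproducts determine the sum of two arrows, and an equivalence
  preserves all three.\<close>

lemma additive: "is_additive_functor C D F"
  unfolding is_additive_functor_def
proof (intro conjI F allI impI)
  fix f g h assume "is_arrow_sum C f g h"
  then obtain X Y S i j p q u s where
    fg: "f \<in> hom C X Y" "g \<in> hom C X Y" and
    ij: "i \<in> hom C Y S" "j \<in> hom C Y S" and pq: "p \<in> hom C S Y" "q \<in> hom C S Y" and
    id: "Comp C p i = Idn C Y" "Comp C q j = Idn C Y" and
    zero: "is_zero_arrow C (Comp C q i)" "is_zero_arrow C (Comp C p j)" and
    prod: "\<forall>V. \<forall>a\<in>hom C V Y. \<forall>b\<in>hom C V Y.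
        \<exists>!c. c \<in> hom C V S \<and> Comp C p c = a \<and> Comp C q c = b" and
    coprod: "\<forall>V. \<forall>a\<in>hom C Y V. \<forall>b\<in>hom C Y V.
        \<exists>!c. c \<in> hom C S V \<and> Comp C c i = a \<and> Comp C c j = b" and
    us: "u \<in> hom C X S" "Comp C p u = f" "Comp C q u = g"
      "s \<in> hom C S Y" "Comp C s i = Idn C Y" "Comp C s j = Idn C Y" "h = Comp C s u"
    unfolding is_arrow_sum_def by (elim exE conjE) (rule that; assumption)
  have Y: "Y \<in> Obj C" using C.hom_Obj[OF fg(1)] by simp
  note z = zero_arrow[OF homD(1)[OF C.Comp_hom[OF ij(1) pq(2)]] zero(1)]
    zero_arrow[OF homD(1)[OF C.Comp_hom[OF ij(2) pq(1)]] zero(2)]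
  note e = F_Comp[OF ij(1) pq(1)] F_Comp[OF ij(2) pq(2)] F_Comp[OF us(1) pq(1)] F_Comp[OF us(1) pq(2)]
    F_Comp[OF ij(1) us(4)] F_Comp[OF ij(2) us(4)] F_Comp[OF us(1,4)] F_Comp[OF ij(1) pq(2)]
    F_Comp[OF ij(2) pq(1)]
  show "is_arrow_sum D (snd F f) (snd F g) (snd F h)"
    unfolding is_arrow_sum_def
    apply (rule exI[of _ "fst F X"], rule exI[of _ "fst F Y"], rule exI[of _ "fst F S"],
      rule exI[of _ "snd F i"], rule exI[of _ "snd F j"], rule exI[of _ "snd F p"],
      rule exI[of _ "snd F q"], rule exI[of _ "snd F u"], rule exI[of _ "snd F s"])
    apply (intro conjI allI ballI F_hom fg ij pq us product[OF pq prod[rule_format]] coproduct[OF ij coprod[rule_format]])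
    using z e id us F_Idn[OF Y] by simp_all
qed

end

section \<open>Preadditive categories\<close>

context category
begin

text \<open>Premises on \<^term>\<open>Arr C\<close>, \<^term>\<open>Dom C\<close> and \<^term>\<open>Cod C\<close> can be discharged by rewriting, whereas a
  premise \<^prop>\<open>f \<in> hom C X Y\<close> would leave \<open>X\<close> or \<open>Y\<close> to be guessed. Hence the axioms are restated in
  this form before they serve as rewrite rules.\<close>

lemma Comp_Arr:
  assumes "f \<in> Arr C" "g \<in> Arr C" "Cod C f = Dom C g"
  shows "g \<cdot> f \<in> Arr C" "Dom C (g \<cdot> f) = Dom C f" "Cod C (g \<cdot> f) = Cod C g"
  using Comp_hom[of f "Dom C f" "Dom C g" g "Cod C g"] assms by (auto simp: hom_def)

lemma Idn_Arr:
  assumes "X \<in> Obj C"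
  shows "Idn C X \<in> Arr C" "Dom C (Idn C X) = X" "Cod C (Idn C X) = X"
  using Idn_hom[OF assms] by (auto simp: hom_def)

lemma Comp_Idn:
  "\<lbrakk>f \<in> Arr C; Dom C f = X\<rbrakk> \<Longrightarrow> f \<cdot> Idn C X = f"
  "\<lbrakk>f \<in> Arr C; Cod C f = X\<rbrakk> \<Longrightarrow> Idn C X \<cdot> f = f"
  using Comp_Idn_right[of f "Dom C f" "Cod C f"] Comp_Idn_left[of f "Dom C f" "Cod C f"]
  by (auto simp: hom_def)

lemma Comp_reassoc:
  "\<lbrakk>f \<in> Arr C; g \<in> Arr C; h \<in> Arr C; Cod C f = Dom C g; Cod C g = Dom C h\<rbrakk>
    \<Longrightarrow> (h \<cdot> g) \<cdot> f = h \<cdot> (g \<cdot> f)"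
  using Comp_assoc[of f "Dom C f" "Dom C g" g "Dom C h" h "Cod C h"] by (simp add: hom_def)

lemmas cat_simps = Comp_Arr Idn_Arr Comp_Idn Comp_reassoc Dom_Obj Cod_Obj

end

context preadditive_category
begin

lemma Add_Arr:
  assumes "f \<in> Arr C" "g \<in> Arr C" "Dom C f = Dom C g" "Cod C f = Cod C g"
  shows "f \<oplus> g \<in> Arr C" "Dom C (f \<oplus> g) = Dom C g" "Cod C (f \<oplus> g) = Cod C g"
  using Add_hom[of f "Dom C g" "Cod C g" g] assms by (auto simp: hom_def)

lemma Zero_Arr:
  assumes "X \<in> Obj C" "Y \<in> Obj C"
  shows "Zero C X Y \<in> Arr C" "Dom C (Zero C X Y) = X" "Cod C (Zero C X Y) = Y"
  using Zero_hom[OF assms] by (auto simp: hom_def)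

lemma Neg_Arr:
  assumes "f \<in> Arr C"
  shows "Neg C f \<in> Arr C" "Dom C (Neg C f) = Dom C f" "Cod C (Neg C f) = Cod C f"
  using Neg_hom[OF Arr_hom[OF assms]] by (auto simp: hom_def)

lemma Add_reassoc:
  "\<lbrakk>f \<in> Arr C; g \<in> Arr C; h \<in> Arr C; Dom C f = Dom C g; Cod C f = Cod C g; Dom C g = Dom C h;
    Cod C g = Cod C h\<rbrakk> \<Longrightarrow> (f \<oplus> g) \<oplus> h = f \<oplus> (g \<oplus> h)"
  using Add_assoc[of f "Dom C g" "Cod C g" g h] by (simp add: hom_def)

lemma Add_comm:
  "\<lbrakk>f \<in> Arr C; g \<in> Arr C; Dom C f = Dom C g; Cod C f = Cod C g\<rbrakk> \<Longrightarrow> f \<oplus> g = g \<oplus> f"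
  using Add_commute[of f "Dom C g" "Cod C g" g] by (simp add: hom_def)

lemma Add_left_comm:
  "\<lbrakk>f \<in> Arr C; g \<in> Arr C; h \<in> Arr C; Dom C f = Dom C g; Cod C f = Cod C g; Dom C g = Dom C h;
    Cod C g = Cod C h\<rbrakk> \<Longrightarrow> f \<oplus> (g \<oplus> h) = g \<oplus> (f \<oplus> h)"
  using Add_reassoc[of f g h] Add_reassoc[of g f h] Add_comm[of f g] by simp

lemma Add_0:
  assumes "f \<in> Arr C" "Dom C f = X" "Cod C f = Y"
  shows "f \<oplus> Zero C X Y = f" "Zero C X Y \<oplus> f = f"
  using Add_Zero[of f X Y] Add_comm[of f "Zero C X Y"] assms Zero_Arr[of X Y] Dom_Obj Cod_Obj
  by (auto simp: hom_def)

lemma Add_inverse: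
  assumes "f \<in> Arr C"
  shows "f \<oplus> Neg C f = Zero C (Dom C f) (Cod C f)" "Neg C f \<oplus> f = Zero C (Dom C f) (Cod C f)"
  using Add_Neg[OF Arr_hom[OF assms]] Add_comm[of f "Neg C f"] Neg_Arr[OF assms] assms by auto

lemma Add_inverse_left:
  assumes "f \<in> Arr C" "g \<in> Arr C" "Dom C f = Dom C g" "Cod C f = Cod C g"
  shows "f \<oplus> (Neg C f \<oplus> g) = g" "Neg C f \<oplus> (f \<oplus> g) = g"
  using Add_reassoc[of f "Neg C f" g] Add_reassoc[of "Neg C f" f g] assms
  by (simp_all add: Neg_Arr Add_inverse Add_0)

lemma Add_cancel:
  assumes "f \<in> Arr C" "g \<in> Arr C" "h \<in> Arr C" "Dom C f = Dom C g" "Cod C f = Cod C g"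
    "Dom C f = Dom C h" "Cod C f = Cod C h"
  shows "f \<oplus> g = f \<oplus> h \<longleftrightarrow> g = h"
  using Add_inverse_left(2)[of f g] Add_inverse_left(2)[of f h] assms by metis

lemma Add_cancel_cross:
  assumes "f \<in> Arr C" "g \<in> Arr C" "h \<in> Arr C" "Dom C f = Dom C g" "Cod C f = Cod C g"
    "Dom C h = Dom C g" "Cod C h = Cod C g"
  shows "(f \<oplus> Neg C h) \<oplus> (g \<oplus> h) = f \<oplus> g"
proof -
  have "(f \<oplus> Neg C h) \<oplus> (h \<oplus> g) = f \<oplus> g"
    using assms by (simp add: Add_reassoc Add_inverse_left Neg_Arr Add_Arr)
  then show ?thesis using Add_comm[of g h] assms by simp
qed

lemma Neg_unique:
  assumes "f \<in> Arr C" "g \<in> Arr C" "Dom C f = Dom C g" "Cod C f = Cod C g"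
    "f \<oplus> g = Zero C (Dom C g) (Cod C g)"
  shows "g = Neg C f"
  using Add_cancel[of f g "Neg C f"] assms by (simp add: Add_inverse Neg_Arr)

lemma Neg_Neg: "f \<in> Arr C \<Longrightarrow> Neg C (Neg C f) = f"
  using Neg_unique[of "Neg C f" f] by (simp add: Neg_Arr Add_inverse)

lemma Neg_Zero: "\<lbrakk>X \<in> Obj C; Y \<in> Obj C\<rbrakk> \<Longrightarrow> Neg C (Zero C X Y) = Zero C X Y"
  using Neg_unique[of "Zero C X Y" "Zero C X Y"] by (simp add: Zero_Arr Add_0)

lemma Neg_Add:
  assumes "f \<in> Arr C" "g \<in> Arr C" "Dom C f = Dom C g" "Cod C f = Cod C g"
  shows "Neg C (f \<oplus> g) = Neg C f \<oplus> Neg C g"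
  by (rule Neg_unique[symmetric])
    (use assms in \<open>simp_all add: Add_Arr Neg_Arr Add_reassoc Add_left_comm[of g "Neg C f"] Add_inverse Add_0\<close>)

lemma Comp_distrib:
  "\<lbrakk>f \<in> Arr C; g \<in> Arr C; h \<in> Arr C; Dom C f = Dom C g; Cod C f = Cod C g; Cod C g = Dom C h\<rbrakk>
    \<Longrightarrow> h \<cdot> (f \<oplus> g) = h \<cdot> f \<oplus> h \<cdot> g"
  "\<lbrakk>f \<in> Arr C; g \<in> Arr C; h \<in> Arr C; Dom C f = Dom C g; Cod C f = Cod C g; Cod C h = Dom C g\<rbrakk>
    \<Longrightarrow> (f \<oplus> g) \<cdot> h = f \<cdot> h \<oplus> g \<cdot> h"
  using Comp_Add_left[of f "Dom C g" "Cod C g" g h "Cod C h"]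
    Comp_Add_right[of f "Dom C g" "Cod C g" g h "Dom C h"] by (auto simp: hom_def)

lemma Comp_Zero:
  assumes "h \<in> Arr C" "X \<in> Obj C"
  shows "Dom C h = Y \<Longrightarrow> h \<cdot> Zero C X Y = Zero C X (Cod C h)"
    "Cod C h = Y \<Longrightarrow> Zero C Y X \<cdot> h = Zero C (Dom C h) X"
proof -
  show "h \<cdot> Zero C X Y = Zero C X (Cod C h)" if "Dom C h = Y"
  proof -
    have Y: "Y \<in> Obj C" using that assms Dom_Obj by blast
    let ?z = "h \<cdot> Zero C X Y"
    have z: "?z \<in> Arr C" "Dom C ?z = X" "Cod C ?z = Cod C h"
      using assms that Y by (auto simp: cat_simps Zero_Arr)
    have "?z \<oplus> ?z = h \<cdot> (Zero C X Y \<oplus> Zero C X Y)"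
      using assms that Y by (subst Comp_distrib) (auto simp: Zero_Arr)
    then have "?z \<oplus> ?z = ?z \<oplus> Zero C X (Cod C h)"
      using z assms Y by (simp add: Add_0 Zero_Arr)
    then show ?thesis using z assms Cod_Obj[OF assms(1)] by (subst (asm) Add_cancel) (auto simp: Zero_Arr)
  qed
  show "Zero C Y X \<cdot> h = Zero C (Dom C h) X" if "Cod C h = Y"
  proof -
    have Y: "Y \<in> Obj C" using that assms Cod_Obj by blast
    let ?z = "Zero C Y X \<cdot> h"
    have z: "?z \<in> Arr C" "Cod C ?z = X" "Dom C ?z = Dom C h"
      using assms that Y by (auto simp: cat_simps Zero_Arr)
    have "?z \<oplus> ?z = (Zero C Y X \<oplus> Zero C Y X) \<cdot> h"
      using assms that Y by (subst Comp_distrib) (auto simp: Zero_Arr)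
    then have "?z \<oplus> ?z = ?z \<oplus> Zero C (Dom C h) X"
      using z assms Y by (simp add: Add_0 Zero_Arr)
    then show ?thesis using z assms Dom_Obj[OF assms(1)] by (subst (asm) Add_cancel) (auto simp: Zero_Arr)
  qed
qed

lemma Comp_Neg:
  assumes "f \<in> Arr C" "h \<in> Arr C"
  shows "Cod C f = Dom C h \<Longrightarrow> h \<cdot> Neg C f = Neg C (h \<cdot> f)"
    "Cod C h = Dom C f \<Longrightarrow> Neg C f \<cdot> h = Neg C (f \<cdot> h)"
  by (rule Neg_unique; use assms in \<open>simp add: cat_simps Neg_Arr Add_inverse Comp_Zero
        Comp_distrib[symmetric]\<close>)+

lemmas add_simps = cat_simps Add_Arr Zero_Arr Neg_Arr Add_0 Neg_Neg Neg_Zero Neg_Add Comp_distrib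
  Comp_Zero Comp_Neg

lemmas add_ac = Add_reassoc Add_comm Add_left_comm Add_inverse Add_inverse_left

end

section \<open>Categories of complexes\<close>

lemma complexes_Obj:
  "X \<in> Obj (complexes C) \<longleftrightarrow> (\<forall>n. fst X n \<in> Obj C \<and> snd X n \<in> hom C (fst X n) (fst X (n + 1)) \<and>
     Comp C (snd X (n + 1)) (snd X n) = Zero C (fst X n) (fst X (n + 2)))"
  by (simp add: complexes_def)

lemma complexes_Arr:
  "(X, Y, f) \<in> Arr (complexes C) \<longleftrightarrow> X \<in> Obj (complexes C) \<and> Y \<in> Obj (complexes C) \<and>
    (\<forall>n. f n \<in> hom C (fst X n) (fst Y n) \<and> Comp C (snd Y n) (f n) = Comp C (f (n + 1)) (snd X n))"
  by (simp add: complexes_def)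

lemma complexes_sel:
  "Dom (complexes C) (X, Y, f) = X" "Cod (complexes C) (X, Y, f) = Y"
  "Idn (complexes C) X = (X, X, \<lambda>n. Idn C (fst X n))"
  "Comp (complexes C) (Y', Z, g) (X, Y, f) = (X, Z, \<lambda>n. Comp C (g n) (f n))"
  by (simp_all add: complexes_def)

lemma complexes_Dom: "Dom (complexes C) f = fst f" "Cod (complexes C) f = fst (snd f)"
  by (cases f; simp add: complexes_sel)+

lemma complexes_hom:
  "f \<in> hom (complexes C) X Y \<longleftrightarrow> X \<in> Obj (complexes C) \<and> Y \<in> Obj (complexes C) \<and>
    f = (X, Y, components f) \<and>
    (\<forall>n. components f n \<in> hom C (fst X n) (fst Y n) \<and>
      Comp C (snd Y n) (components f n) = Comp C (components f (n + 1)) (snd X n))"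
  by (cases f) (auto simp: hom_def complexes_sel complexes_Arr)

context preadditive_category
begin

lemma category_complexes: "category (complexes C)"
proof
  fix f assume f: "f \<in> Arr (complexes C)"
  show "Dom (complexes C) f \<in> Obj (complexes C)" "Cod (complexes C) f \<in> Obj (complexes C)"
    using f by (cases f; auto simp: complexes_sel complexes_Arr)+
next
  fix X assume X: "X \<in> Obj (complexes C)"
  then show "Idn (complexes C) X \<in> hom (complexes C) X X"
    by (auto simp: complexes_sel hom_def complexes_Arr complexes_Obj cat_simps)
next
  fix f g X Y Z assume "f \<in> hom (complexes C) X Y" "g \<in> hom (complexes C) Y Z"
  then have *: "X \<in> Obj (complexes C)" "Z \<in> Obj (complexes C)" "f = (X, Y, components f)"
    "g = (Y, Z, components g)"
    "\<And>n. components f n \<in> hom C (fst X n) (fst Y n)"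
    "\<And>n. components g n \<in> hom C (fst Y n) (fst Z n)"
    "\<And>n. snd Y n \<cdot> components f n = components f (n + 1) \<cdot> snd X n"
    "\<And>n. snd Z n \<cdot> components g n = components g (n + 1) \<cdot> snd Y n"
    "\<And>n. snd X n \<in> hom C (fst X n) (fst X (n + 1))" "\<And>n. snd Y n \<in> hom C (fst Y n) (fst Y (n + 1))"
    "\<And>n. snd Z n \<in> hom C (fst Z n) (fst Z (n + 1))"
    by (simp_all add: complexes_hom complexes_Obj)
  have "snd Z n \<cdot> (components g n \<cdot> components f n) =
      (components g (n + 1) \<cdot> components f (n + 1)) \<cdot> snd X n" for n
    using Comp_assoc[OF *(5)[of n] *(6)[of n] *(11)[of n]] Comp_assoc[OF *(5)[of n] *(10)[of n] *(6)]
      Comp_assoc[OF *(9)[of n] *(5)[of "n+1"] *(6)] *(7)[of n] *(8)[of n] by simp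
  then have "(X, Z, \<lambda>n. components g n \<cdot> components f n) \<in> hom (complexes C) X Z"
    unfolding complexes_hom using *(1,2) Comp_hom[OF *(5,6)] by simp
  then show "Comp (complexes C) g f \<in> hom (complexes C) X Z"
    by (subst *(3), subst *(4), simp add: complexes_sel)
next
  fix f X Y assume "f \<in> hom (complexes C) X Y"
  then have *: "f = (X, Y, components f)" "\<And>n. components f n \<in> hom C (fst X n) (fst Y n)"
    by (simp_all add: complexes_hom)
  show "Comp (complexes C) f (Idn (complexes C) X) = f"
    "Comp (complexes C) (Idn (complexes C) Y) f = f"
    by (subst *(1), subst (2) *(1), simp add: complexes_sel Comp_Idn_right[OF *(2)] Comp_Idn_left[OF *(2)])+
next
  fix f g h X Y Z V
  assume "f \<in> hom (complexes C) V X" "g \<in> hom (complexes C) X Y" "h \<in> hom (complexes C) Y Z"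
  then have *: "f = (V, X, components f)" "\<And>n. components f n \<in> hom C (fst V n) (fst X n)"
    "g = (X, Y, components g)" "\<And>n. components g n \<in> hom C (fst X n) (fst Y n)"
    "h = (Y, Z, components h)" "\<And>n. components h n \<in> hom C (fst Y n) (fst Z n)"
    by (simp_all add: complexes_hom)
  show "Comp (complexes C) h (Comp (complexes C) g f) = Comp (complexes C) (Comp (complexes C) h g) f"
    by (subst *(1), subst (2) *(1), subst *(3), subst (2) *(3), subst *(5), subst (2) *(5),
      simp only: complexes_sel Comp_assoc[OF *(2,4,6)])
qed

lemma shift_cpx_Obj:
  assumes "X \<in> Obj (complexes C)"
  shows "shift_cpx C X \<in> Obj (complexes C)"
proof -
  have X: "fst X n \<in> Obj C" "snd X n \<in> hom C (fst X n) (fst X (n + 1))"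
    "snd X (n + 1) \<cdot> snd X n = Zero C (fst X n) (fst X (n + 2))" for n
    using assms by (simp_all add: complexes_Obj)
  have "Neg C (snd X (n + 1 + 1)) \<cdot> Neg C (snd X (n + 1)) = Zero C (fst X (n + 1)) (fst X (n + 2 + 1))" for n
    using X(1)[of "n + 1"] X(1)[of "3 + n"] X(2)[of "n + 1"] X(2)[of "n + 1 + 1"] X(3)[of "n + 1"]
    by (simp add: hom_def add_simps)
  moreover have "Neg C (snd X (n + 1)) \<in> hom C (fst X (n + 1)) (fst X (n + 1 + 1))" for n
    using Neg_hom[OF X(2)] .
  ultimately show ?thesis using X(1) by (simp add: complexes_Obj shift_cpx_def)
qed

lemma shift_map_hom:
  assumes "f \<in> hom (complexes C) X Y"
  shows "shift_map C f \<in> hom (complexes C) (shift_cpx C X) (shift_cpx C Y)"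
proof -
  have X: "X \<in> Obj (complexes C)" "Y \<in> Obj (complexes C)" "f = (X, Y, components f)"
    "\<And>n. components f n \<in> hom C (fst X n) (fst Y n)"
    "\<And>n. snd Y n \<cdot> components f n = components f (n + 1) \<cdot> snd X n"
    using assms by (simp_all add: complexes_hom)
  have d: "snd X n \<in> hom C (fst X n) (fst X (n + 1))" "snd Y n \<in> hom C (fst Y n) (fst Y (n + 1))" for n
    using X by (simp_all add: complexes_Obj)
  have "Neg C (snd Y n) \<cdot> components f n = components f (n + 1) \<cdot> Neg C (snd X n)" for n
    using X(4)[of n] X(4)[of "n + 1"] X(5)[of n] d[of n] by (simp add: hom_def add_simps)
  then have "(shift_cpx C X, shift_cpx C Y, \<lambda>n. components f (n + 1)) \<in>
      hom (complexes C) (shift_cpx C X) (shift_cpx C Y)"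
    unfolding complexes_hom using X(4) shift_cpx_Obj[OF X(1)] shift_cpx_Obj[OF X(2)]
    by (simp add: shift_cpx_def)
  then show ?thesis by (subst X(3)) (simp add: shift_map_def)
qed

lemma is_functor_shift: "is_functor (complexes C) (complexes C) (shift_cpx C, shift_map C)"
  unfolding is_functor_def
proof (intro conjI ballI impI)
  fix f g assume f: "f \<in> Arr (complexes C)" and g: "g \<in> Arr (complexes C)"
  show "snd (shift_cpx C, shift_map C) (Comp (complexes C) g f) =
    Comp (complexes C) (snd (shift_cpx C, shift_map C) g) (snd (shift_cpx C, shift_map C) f)"
    by (cases f; cases g) (simp add: complexes_sel shift_map_def)
qed (simp_all add: shift_cpx_Obj shift_map_hom Arr_hom, simp add: complexes_sel shift_map_def shift_cpx_def)

text \<open>A map and its negative have the same kernels and cokernels, so the sign in the shifted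
  differential does not affect cohomology.\<close>

lemma Neg_eq_Zero:
  assumes "f \<in> Arr C" "Dom C f = X" "Cod C f = Y"
  shows "Neg C f = Zero C X Y \<longleftrightarrow> f = Zero C X Y"
  using Neg_Neg[of f] Neg_Zero[of X Y] Dom_Obj Cod_Obj assms by metis

lemma is_kernel_Neg:
  assumes "f \<in> Arr C"
  shows "is_kernel C (Neg C f) k \<longleftrightarrow> is_kernel C f k"
proof -
  have "Neg C f \<cdot> g = Zero C X (Cod C f) \<longleftrightarrow> f \<cdot> g = Zero C X (Cod C f)"
    if "g \<in> hom C X (Dom C f)" for g X
    using that assms Neg_eq_Zero[of "f \<cdot> g" X "Cod C f"] by (auto simp: hom_def add_simps)
  from this this[OF homI[of k _ _ "Dom C f"], of "Dom C k"] show ?thesis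
    using assms by (auto simp: is_kernel_def Neg_Arr)
qed

lemma is_cokernel_Neg:
  assumes "f \<in> Arr C"
  shows "is_cokernel C (Neg C f) k \<longleftrightarrow> is_cokernel C f k"
proof -
  have "g \<cdot> Neg C f = Zero C (Dom C f) Y \<longleftrightarrow> g \<cdot> f = Zero C (Dom C f) Y"
    if "g \<in> hom C (Cod C f) Y" for g Y
    using that assms Neg_eq_Zero[of "g \<cdot> f" "Dom C f" Y] by (auto simp: hom_def add_simps)
  from this this[OF homI[of k _ "Cod C f"], of "Cod C k"] show ?thesis
    using assms by (auto simp: is_cokernel_def Neg_Arr)
qed

lemma is_cohomology_shift:
  assumes X: "X \<in> Obj (complexes C)" and "is_cohomology C (shift_cpx C X) n i p"
  shows "is_cohomology C X (n + 1) i p"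
proof -
  have d: "snd X m \<in> hom C (fst X m) (fst X (m + 1))" for m using X by (simp add: complexes_Obj)
  from assms(2) obtain u where k: "is_kernel C (Neg C (snd X (n + 1))) i"
    and u: "u \<in> hom C (fst X n) (Dom C i)" "i \<cdot> u = Neg C (snd X n)" "is_cokernel C u p"
    by (auto simp: is_cohomology_def shift_cpx_def)
  from k have k': "is_kernel C (snd X (n + 1)) i" using is_kernel_Neg[OF homD(1)[OF d]] by simp
  then have "i \<in> Arr C" by (simp add: is_kernel_def)
  with u d[of n] have "i \<cdot> Neg C u = snd X n" by (auto simp: hom_def add_simps)
  moreover have "is_cokernel C (Neg C u) p" using u is_cokernel_Neg by (auto simp: hom_def)
  ultimately show ?thesis using k' Neg_hom[OF u(1)] by (auto simp: is_cohomology_def)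
qed

lemma quasi_isos_shift:
  assumes "f \<in> quasi_isos C"
  shows "shift_map C f \<in> quasi_isos C"
proof -
  have f: "f \<in> Arr (complexes C)" using assms by (simp add: quasi_isos_def)
  obtain X Y f' where f': "f = (X, Y, f')" by (cases f)
  have XY: "X \<in> Obj (complexes C)" "Y \<in> Obj (complexes C)" using f by (auto simp: f' complexes_Arr)
  have sf: "shift_map C f \<in> Arr (complexes C)" using homD(1)[OF shift_map_hom[OF Arr_hom[OF f]]] .
  show ?thesis unfolding quasi_isos_def
  proof (intro CollectI conjI sf allI impI)
    fix n i p i' p' z h
    assume "is_cohomology C (Dom (complexes C) (shift_map C f)) n i p"
      "is_cohomology C (Cod (complexes C) (shift_map C f)) n i' p'"
      "z \<in> hom C (Dom C i) (Dom C i')" "i' \<cdot> z = components (shift_map C f) n \<cdot> i"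
      "h \<in> hom C (Cod C p) (Cod C p')" "h \<cdot> p = p' \<cdot> z"
    then have "is_cohomology C X (n + 1) i p" "is_cohomology C Y (n + 1) i' p'" "i' \<cdot> z = f' (n + 1) \<cdot> i"
      "z \<in> hom C (Dom C i) (Dom C i')" "h \<in> hom C (Cod C p) (Cod C p')" "h \<cdot> p = p' \<cdot> z"
      using XY by (simp_all add: f' shift_map_def complexes_sel is_cohomology_shift)
    then show "is_iso C h" using assms
      unfolding quasi_isos_def f' by (simp add: complexes_sel)
  qed
qed

end

section \<open>A criterion for derived equivalence\<close>

lemma derived_category_sel:
  "Obj (derived_category C) = Obj (localization (complexes C) (quasi_isos C))"
  "Arr (derived_category C) = Arr (localization (complexes C) (quasi_isos C))"
  "Dom (derived_category C) = Dom (localization (complexes C) (quasi_isos C))"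
  "Cod (derived_category C) = Cod (localization (complexes C) (quasi_isos C))"
  "Idn (derived_category C) = Idn (localization (complexes C) (quasi_isos C))"
  "Comp (derived_category C) = Comp (localization (complexes C) (quasi_isos C))"
  "Shift (derived_category C) = loc_functor (complexes C) (quasi_isos C) (shift_cpx C, shift_map C)"
  by (simp_all add: derived_category_def cat.defs Let_def localization_def)

lemma derived_category_hom:
  "hom (derived_category C) = hom (localization (complexes C) (quasi_isos C))"
  by (simp add: hom_def derived_category_sel fun_eq_iff)

lemma derived_category_Triangles:
  "(u, v, w) \<in> Triangles (derived_category C) \<longleftrightarrow> (let
      K = complexes C; W = quasi_isos C; D = localization K W; Q = loc_proj K W;
      T = loc_functor K W (shift_cpx C, shift_map C)
    in \<exists>X Y Z. u \<in> hom D X Y \<and> v \<in> hom D Y Z \<and> w \<in> hom D Z (fst T X) \<and>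
        (\<exists>f g h a b c. is_cone_triangle C f g h \<and>
           is_triangle_iso D T (u, v, w) (Q f, Q g, Q h) a b c))"
  by (simp add: derived_category_def cat.defs Let_def)

text \<open>In the localizations \<open>\<eta>\<close> and \<open>\<epsilon>\<close> become natural isomorphisms, so \<open>F\<close> induces an equivalence,
  which is additive like every equivalence. A distinguished triangle is isomorphic to the image of a cone
  triangle, and \<open>F\<close> carries this isomorphism to another one of the same kind.\<close>

theorem derived_equivalence_criterion:
  assumes "preadditive_category C" "preadditive_category D"
    and F: "is_functor (complexes C) (complexes D) F"
    and F_qis: "\<And>s. s \<in> quasi_isos C \<Longrightarrow> snd F s \<in> quasi_isos D"
    and G: "is_functor (complexes D) (complexes C) G"
    and G_qis: "\<And>s. s \<in> quasi_isos D \<Longrightarrow> snd G s \<in> quasi_isos C"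
    and \<eta>: "is_nat_trans (complexes C) (complexes C) id_functor (comp_functor G F) \<eta>"
      "\<And>X. X \<in> Obj (complexes C) \<Longrightarrow> \<eta> X \<in> quasi_isos C"
    and \<epsilon>: "is_nat_trans (complexes D) (complexes D) (comp_functor F G) id_functor \<epsilon>"
      "\<And>X. X \<in> Obj (complexes D) \<Longrightarrow> \<epsilon> X \<in> quasi_isos D"
    and F_shift: "\<And>X. X \<in> Obj (complexes C) \<Longrightarrow> fst F (shift_cpx C X) = shift_cpx D (fst F X)"
      "\<And>f. f \<in> Arr (complexes C) \<Longrightarrow> snd F (shift_map C f) = shift_map D (snd F f)"
    and F_cone: "\<And>f g h. is_cone_triangle C f g h \<Longrightarrow> is_cone_triangle D (snd F f) (snd F g) (snd F h)"
  shows "triangulated_equivalent (derived_category C) (derived_category D)"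
proof -
  interpret C: preadditive_category C by (rule assms)
  interpret D: preadditive_category D by (rule assms)
  let ?K = "complexes C" and ?W = "quasi_isos C" and ?L = "complexes D" and ?V = "quasi_isos D"
  interpret K: category ?K by (rule C.category_complexes)
  interpret L: category ?L by (rule D.category_complexes)
  let ?DK = "localization ?K ?W" and ?DL = "localization ?L ?V"
  interpret DK: category ?DK by (rule K.category_localization)
  interpret DL: category ?DL by (rule L.category_localization)
  interpret F: localizable_functor ?K ?L ?W ?V F by unfold_locales (use F F_qis in auto)
  interpret G: localizable_functor ?L ?K ?V ?W G by unfold_locales (use G G_qis in auto)
  have GF: "localizable_functor ?K ?K ?W ?W (comp_functor G F)"
    by unfold_locales (use F F_qis G G_qis in \<open>auto simp: is_functor_def comp_functor_def hom_def\<close>)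
  have FG: "localizable_functor ?L ?L ?V ?V (comp_functor F G)"
    by unfold_locales (use F F_qis G G_qis in \<open>auto simp: is_functor_def comp_functor_def hom_def\<close>)
  have IK: "localizable_functor ?K ?K ?W ?W id_functor"
    by unfold_locales (auto simp: is_functor_def id_functor_def hom_def)
  have IL: "localizable_functor ?L ?L ?V ?V id_functor"
    by unfold_locales (auto simp: is_functor_def id_functor_def hom_def)
  interpret SK: localizable_functor ?K ?K ?W ?W "(shift_cpx C, shift_map C)"
    by unfold_locales (use C.is_functor_shift C.quasi_isos_shift in auto)
  interpret SL: localizable_functor ?L ?L ?V ?V "(shift_cpx D, shift_map D)"
    by unfold_locales (use D.is_functor_shift D.quasi_isos_shift in auto)
  let ?F = "loc_functor ?L ?V F" and ?G = "loc_functor ?K ?W G"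
  let ?S = "loc_functor ?K ?W (shift_cpx C, shift_map C)" and ?T = "loc_functor ?L ?V (shift_cpx D, shift_map D)"

  have \<eta>_hom: "\<eta> X \<in> hom ?K X (fst G (fst F X))" if "X \<in> Obj ?K" for X
    using \<eta>(1) that by (auto simp: is_nat_trans_def id_functor_def comp_functor_def)
  have \<epsilon>_hom: "\<epsilon> X \<in> hom ?L (fst F (fst G X)) X" if "X \<in> Obj ?L" for X
    using \<epsilon>(1) that by (auto simp: is_nat_trans_def id_functor_def comp_functor_def)
  have "is_nat_iso ?DK ?DK id_functor (comp_functor ?G ?F) (\<lambda>X. loc_proj ?K ?W (\<eta> X))"
    unfolding is_nat_iso_def is_nat_trans_def
  proof (intro conjI ballI)
    fix f assume "f \<in> Arr ?DK"
    then obtain X Y p where p: "f = zz_arr ?K ?W X Y p" "zigzag ?K ?W X Y p"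
      by (auto simp: localization_def)
    show "Comp ?DK (loc_proj ?K ?W (\<eta> (Cod ?DK f))) (snd id_functor f) =
        Comp ?DK (snd (comp_functor ?G ?F) f) (loc_proj ?K ?W (\<eta> (Dom ?DK f)))"
      using loc_nat[OF IK GF \<eta>(1) p(2),
          unfolded localizable_functor.loc_functor_zz_arr[OF IK p(2)]
          localizable_functor.loc_functor_zz_arr[OF GF p(2)]] p F.zigzag_map[OF p(2)]
      by (simp add: localization_sel comp_functor_def F.loc_functor_zz_arr G.loc_functor_zz_arr
          id_functor_def step.map_id step.map_comp step.map_id0 comp_def)
  qed (use K.loc_proj_hom[OF \<eta>_hom] K.loc_proj_iso[OF \<eta>(2) \<eta>_hom] in
      \<open>simp_all add: localization_sel id_functor_def comp_functor_def loc_functor_def\<close>)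
  moreover have "is_nat_iso ?DL ?DL (comp_functor ?F ?G) id_functor (\<lambda>X. loc_proj ?L ?V (\<epsilon> X))"
    unfolding is_nat_iso_def is_nat_trans_def
  proof (intro conjI ballI)
    fix f assume "f \<in> Arr ?DL"
    then obtain X Y p where p: "f = zz_arr ?L ?V X Y p" "zigzag ?L ?V X Y p"
      by (auto simp: localization_def)
    show "Comp ?DL (loc_proj ?L ?V (\<epsilon> (Cod ?DL f))) (snd (comp_functor ?F ?G) f) =
        Comp ?DL (snd id_functor f) (loc_proj ?L ?V (\<epsilon> (Dom ?DL f)))"
      using loc_nat[OF FG IL \<epsilon>(1) p(2),
          unfolded localizable_functor.loc_functor_zz_arr[OF FG p(2)]
          localizable_functor.loc_functor_zz_arr[OF IL p(2)]] p G.zigzag_map[OF p(2)]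
      by (simp add: localization_sel comp_functor_def F.loc_functor_zz_arr G.loc_functor_zz_arr
          id_functor_def step.map_id step.map_comp step.map_id0 comp_def)
  qed (use L.loc_proj_hom[OF \<epsilon>_hom] L.loc_proj_iso[OF \<epsilon>(2) \<epsilon>_hom] in
      \<open>simp_all add: localization_sel id_functor_def comp_functor_def loc_functor_def\<close>)
  ultimately have equiv: "is_equivalence ?DK ?DL ?F"
    using F.is_functor_loc G.is_functor_loc unfolding is_equivalence_def by blast
  interpret E: equivalence ?DK ?DL ?F by unfold_locales (rule equiv)

  have shift: "snd ?T (snd ?F f) = snd ?F (snd ?S f)" if f: "f \<in> Arr ?DK" for f
  proof -
    from f obtain X Y p where p: "f = zz_arr ?K ?W X Y p" "zigzag ?K ?W X Y p"
      by (auto simp: localization_def)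
    have "map (map_step (snd (shift_cpx D, shift_map D))) (map (map_step (snd F)) p) =
        map (map_step (snd F)) (map (map_step (snd (shift_cpx C, shift_map C))) p)"
      using p(2) by (induction rule: zigzag.induct) (auto simp: F_shift dest: homD(1))
    then show ?thesis using p K.zigzag_Obj[OF p(2)] F.zigzag_map[OF p(2)] SK.zigzag_map[OF p(2)]
      by (simp add: F.loc_functor_zz_arr SK.loc_functor_zz_arr SL.loc_functor_zz_arr F_shift del: map_map)
  qed
  \<comment> \<open>Since F commutes strictly with the shift, identities serve as structure isomorphism.\<close>
  let ?\<phi> = "\<lambda>X. Idn ?DL (fst F (shift_cpx C X))"
  have \<phi>: "is_nat_iso ?DK ?DL (comp_functor ?F ?S) (comp_functor ?T ?F) ?\<phi>"
    unfolding is_nat_iso_def is_nat_trans_def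
  proof (intro conjI ballI)
    fix X assume "X \<in> Obj ?DK"
    then have X: "fst F (shift_cpx C X) \<in> Obj ?DL" and "X \<in> Obj ?K"
      using F.F_Obj C.shift_cpx_Obj by (simp_all add: localization_sel)
    then show "?\<phi> X \<in> hom ?DL (fst (comp_functor ?F ?S) X) (fst (comp_functor ?T ?F) X)"
      using DL.Idn_hom[OF X] by (simp add: comp_functor_def loc_functor_def F_shift)
    show "is_iso ?DL (?\<phi> X)"
      by (rule is_isoI) (use DL.Idn_hom[OF X] DL.Comp_Idn_left[OF DL.Idn_hom[OF X]] in auto)
  next
    fix f assume f: "f \<in> Arr ?DK"
    then have X: "Dom ?DK f \<in> Obj ?K" "Cod ?DK f \<in> Obj ?K"
      using DK.Dom_Obj DK.Cod_Obj by (simp_all add: localization_sel)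
    have Tf: "snd ?F (snd ?S f) \<in> hom ?DL (fst F (shift_cpx C (Dom ?DK f))) (fst F (shift_cpx C (Cod ?DK f)))"
      using f F.is_functor_loc SK.is_functor_loc
      by (auto simp: is_functor_def hom_def loc_functor_def)
    show "Comp ?DL (?\<phi> (Cod ?DK f)) (snd (comp_functor ?F ?S) f) =
        Comp ?DL (snd (comp_functor ?T ?F) f) (?\<phi> (Dom ?DK f))"
      using DL.Comp_Idn_left[OF Tf] DL.Comp_Idn_right[OF Tf] shift[OF f]
      by (simp add: comp_functor_def)
  qed
  have F_iso: "is_iso ?DL (snd ?F f)" if "is_iso ?DK f" for f
    using is_functor_iso[OF DK.category_axioms F.is_functor_loc that] .
  have tri: "(snd ?F u, snd ?F v, Comp ?DL (?\<phi> (Dom ?DK u)) (snd ?F w)) \<in> Triangles (derived_category D)"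
    if "(u, v, w) \<in> Triangles (derived_category C)" for u v w
  proof -
    from that obtain X Y Z f g h a b c where
      uvw: "u \<in> hom ?DK X Y" "v \<in> hom ?DK Y Z" "w \<in> hom ?DK Z (fst ?S X)" and
      fgh: "is_cone_triangle C f g h" and
      abc: "is_triangle_iso ?DK ?S (u, v, w) (loc_proj ?K ?W f, loc_proj ?K ?W g, loc_proj ?K ?W h) a b c"
      unfolding derived_category_Triangles Let_def by blast
    obtain X' Y' Z' where fgh': "f \<in> hom ?K X' Y'" "g \<in> hom ?K Y' Z'" "h \<in> hom ?K Z' (shift_cpx C X')"
      using fgh unfolding is_cone_triangle_def by blast
    note Q = K.loc_proj_hom[OF fgh'(1), of ?W] K.loc_proj_hom[OF fgh'(2), of ?W]
      K.loc_proj_hom[OF fgh'(3), of ?W]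
    have a: "a \<in> hom ?DK X X'" "is_iso ?DK a" and b: "b \<in> hom ?DK Y Y'" "is_iso ?DK b"
      and c: "c \<in> hom ?DK Z Z'" "is_iso ?DK c"
      and sq: "Comp ?DK b u = Comp ?DK (loc_proj ?K ?W f) a"
        "Comp ?DK c v = Comp ?DK (loc_proj ?K ?W g) b"
        "Comp ?DK (snd ?S a) w = Comp ?DK (loc_proj ?K ?W h) c"
      using abc uvw Q by (auto simp: is_triangle_iso_def homD(2))
    have X: "X \<in> Obj ?K" using DK.hom_Obj[OF uvw(1)] by (simp add: localization_sel)
    have Sa: "snd ?S a \<in> hom ?DK (shift_cpx C X) (shift_cpx C X')"
      using SK.is_functor_loc a(1) by (auto simp: is_functor_def hom_def loc_functor_def)
    have w: "w \<in> hom ?DK Z (shift_cpx C X)" using uvw(3) by (simp add: loc_functor_def)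
    have Fw: "snd ?F w \<in> hom ?DL (fst F Z) (shift_cpx D (fst F X))"
      using E.F_hom[OF w] by (simp add: F.loc_functor_Obj F_shift X)
    then have "Comp ?DL (?\<phi> (Dom ?DK u)) (snd ?F w) = snd ?F w"
      using DL.Comp_Idn_left[OF Fw] homD(2)[OF uvw(1)] by (simp add: F_shift X)
    moreover have "(snd ?F u, snd ?F v, snd ?F w) \<in> Triangles (derived_category D)"
      unfolding derived_category_Triangles Let_def
    proof (intro exI conjI)
      show "snd ?F u \<in> hom ?DL (fst F X) (fst F Y)" "snd ?F v \<in> hom ?DL (fst F Y) (fst F Z)"
        "snd ?F w \<in> hom ?DL (fst F Z) (fst ?T (fst F X))"
        using E.F_hom[OF uvw(1)] E.F_hom[OF uvw(2)] Fw by (simp_all add: loc_functor_def)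
      show "is_cone_triangle D (snd F f) (snd F g) (snd F h)" using F_cone[OF fgh] .
      have "snd ?T (snd ?F a) = snd ?F (snd ?S a)" using shift homD(1)[OF a(1)] by blast
      then show "is_triangle_iso ?DL ?T (snd ?F u, snd ?F v, snd ?F w)
          (loc_proj ?L ?V (snd F f), loc_proj ?L ?V (snd F g), loc_proj ?L ?V (snd F h))
          (snd ?F a) (snd ?F b) (snd ?F c)"
        unfolding is_triangle_iso_def
        using F_iso[OF a(2)] F_iso[OF b(2)] F_iso[OF c(2)] E.F_hom[OF a(1)] E.F_hom[OF b(1)] E.F_hom[OF c(1)]
          E.F_Comp[OF uvw(1) b(1)] E.F_Comp[OF uvw(2) c(1)] E.F_Comp[OF w Sa]
          E.F_Comp[OF a(1) Q(1)] E.F_Comp[OF b(1) Q(2)] E.F_Comp[OF c(1) Q(3)] sq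
          homD(2)[OF E.F_hom[OF uvw(1)]] homD(2)[OF E.F_hom[OF uvw(2)]] homD(2)[OF E.F_hom[OF uvw(3)]]
          homD(2)[OF E.F_hom[OF Q(1)]] homD(2)[OF E.F_hom[OF Q(2)]] homD(2)[OF E.F_hom[OF Q(3)]]
          F.loc_functor_proj[OF homD(1)[OF fgh'(1)]] F.loc_functor_proj[OF homD(1)[OF fgh'(2)]]
          F.loc_functor_proj[OF homD(1)[OF fgh'(3)]]
        by simp
    qed
    ultimately show ?thesis by simp
  qed
  \<comment> \<open>The derived category extends the record of the localization; the notions below do not
    look at the added fields.\<close>
  note defs = is_additive_functor_def is_functor_def is_arrow_sum_def is_zero_arrow_def
    is_zero_object_def is_equivalence_def is_nat_iso_def is_nat_trans_def is_iso_def
    derived_category_sel derived_category_hom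
  have "is_additive_functor (derived_category C) (derived_category D) ?F = is_additive_functor ?DK ?DL ?F"
    by (simp only: defs)
  moreover have "is_nat_iso (derived_category C) (derived_category D)
      (comp_functor ?F ?S) (comp_functor ?T ?F) ?\<phi> =
      is_nat_iso ?DK ?DL (comp_functor ?F ?S) (comp_functor ?T ?F) ?\<phi>"
    by (simp only: defs)
  ultimately have "is_triangulated_functor (derived_category C) (derived_category D) ?F ?\<phi>"
    using tri E.additive \<phi> unfolding is_triangulated_functor_def derived_category_sel by blast
  moreover have "is_equivalence (derived_category C) (derived_category D) ?F = is_equivalence ?DK ?DL ?F"
    by (simp only: defs)
  ultimately show ?thesis using equiv unfolding triangulated_equivalent_def by blast
qed

section \<open>Exactness up to epimorphic refinement\<close>

text \<open>An arrow \<open>T \<rightarrow> X\<close> is regarded as an element of \<open>X\<close> at stage \<open>T\<close>. Composing with an epimorphism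
  \<open>T' \<rightarrow> T\<close> refines the stage, and this loses no information about equality. After a refinement,
  elements lift along epimorphisms (\<open>epi_pullback\<close>) and exactness has its familiar elementwise meaning
  (\<open>exact_lift\<close>), so diagrams can be chased as for modules.\<close>

lemma is_kernel_lift:
  assumes "is_kernel C f k" "g \<in> hom C X (Dom C f)" "Comp C f g = Zero C X (Cod C f)"
  obtains u where "u \<in> hom C X (Dom C k)" "Comp C k u = g"
  using assms unfolding is_kernel_def by blast

lemma is_cokernel_desc:
  assumes "is_cokernel C f q" "g \<in> hom C (Cod C f) Y" "Comp C g f = Zero C (Dom C f) Y"
  obtains u where "u \<in> hom C (Cod C q) Y" "Comp C u q = g"
  using assms unfolding is_cokernel_def by blast

context preadditive_category
begin

lemma kernel_mono:
  assumes k: "is_kernel C f k"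
  shows "is_mono C k"
  unfolding is_mono_def
proof (intro conjI allI ballI impI)
  show "k \<in> Arr C" using k by (simp add: is_kernel_def)
  fix X g h assume g: "g \<in> hom C X (Dom C k)" and h: "h \<in> hom C X (Dom C k)" and eq: "k \<cdot> g = k \<cdot> h"
  have kf: "f \<in> Arr C" "k \<in> Arr C" "Cod C k = Dom C f" "f \<cdot> k = Zero C (Dom C k) (Cod C f)"
    using k by (auto simp: is_kernel_def)
  have "f \<cdot> (k \<cdot> g) = Zero C X (Cod C f)"
    using kf g Comp_reassoc[of g k f, symmetric] by (auto simp: hom_def add_simps)
  moreover have "k \<cdot> g \<in> hom C X (Dom C f)" using kf g by (auto simp: hom_def add_simps)
  ultimately have "\<exists>!u. u \<in> hom C X (Dom C k) \<and> k \<cdot> u = k \<cdot> g"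
    using k unfolding is_kernel_def by blast
  then show "g = h" using g h eq by auto
qed

lemma cokernel_epi:
  assumes q: "is_cokernel C f q"
  shows "is_epi C q"
  unfolding is_epi_def
proof (intro conjI allI ballI impI)
  show "q \<in> Arr C" using q by (simp add: is_cokernel_def)
  fix Y g h assume g: "g \<in> hom C (Cod C q) Y" and h: "h \<in> hom C (Cod C q) Y" and eq: "g \<cdot> q = h \<cdot> q"
  have kf: "f \<in> Arr C" "q \<in> Arr C" "Dom C q = Cod C f" "q \<cdot> f = Zero C (Dom C f) (Cod C q)"
    using q by (auto simp: is_cokernel_def)
  have "(g \<cdot> q) \<cdot> f = Zero C (Dom C f) Y"
    using kf g by (auto simp: hom_def add_simps)
  moreover have "g \<cdot> q \<in> hom C (Cod C f) Y" using kf g by (auto simp: hom_def add_simps)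
  ultimately have "\<exists>!u. u \<in> hom C (Cod C q) Y \<and> u \<cdot> q = g \<cdot> q"
    using q unfolding is_cokernel_def by blast
  then show "g = h" using g h eq by auto
qed

lemma epi_cancel:
  assumes "is_epi C e" "e \<in> hom C X Y" "g \<in> hom C Y Z" "h \<in> hom C Y Z" "g \<cdot> e = h \<cdot> e"
  shows "g = h"
  using assms(1)[unfolded is_epi_def, THEN conjunct2, rule_format, of g Z h] assms(2-) by (simp add: hom_def)

lemma mono_cancel:
  assumes "is_mono C e" "e \<in> hom C X Y" "g \<in> hom C Z X" "h \<in> hom C Z X" "e \<cdot> g = e \<cdot> h"
  shows "g = h"
  using assms(1)[unfolded is_mono_def, THEN conjunct2, rule_format, of g Z h] assms(2-) by (simp add: hom_def)

lemma Sub_Zero: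
  assumes "f \<in> Arr C" "g \<in> Arr C" "Dom C f = X" "Dom C g = X" "Cod C f = Y" "Cod C g = Y"
  shows "f \<oplus> Neg C g = Zero C X Y \<longleftrightarrow> f = g"
proof
  assume "f \<oplus> Neg C g = Zero C X Y"
  then have "Neg C g = Neg C f" using Neg_unique[of f "Neg C g"] assms by (simp add: Neg_Arr)
  then show "f = g" using Neg_Neg[of f] Neg_Neg[of g] assms by simp
qed (use assms in \<open>simp add: Add_inverse\<close>)

lemma epiI:
  assumes e: "e \<in> hom C X Y"
    and *: "\<And>Z s. s \<in> hom C Y Z \<Longrightarrow> s \<cdot> e = Zero C X Z \<Longrightarrow> s = Zero C Y Z"
  shows "is_epi C e"
  unfolding is_epi_def
proof (intro conjI allI ballI impI)
  show "e \<in> Arr C" using e by (simp add: hom_def)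
  fix Z g h assume "g \<in> hom C (Cod C e) Z" "h \<in> hom C (Cod C e) Z" "g \<cdot> e = h \<cdot> e"
  then show "g = h"
    using e *[of "g \<oplus> Neg C h" Z] Sub_Zero[of g h Y Z] Sub_Zero[of "g \<cdot> e" "h \<cdot> e" X Z]
    by (auto simp: hom_def add_simps)
qed

lemma epi_Zero:
  assumes "is_epi C e" "e \<in> hom C X Y" "s \<in> hom C Y Z" "s \<cdot> e = Zero C X Z"
  shows "s = Zero C Y Z"
  using epi_cancel[OF assms(1-3), of "Zero C Y Z"] assms hom_Obj[OF assms(2)] hom_Obj[OF assms(3)]
  by (auto simp: hom_def add_simps)

lemma monoI:
  assumes e: "e \<in> hom C X Y"
    and *: "\<And>Z s. s \<in> hom C Z X \<Longrightarrow> e \<cdot> s = Zero C Z Y \<Longrightarrow> s = Zero C Z X"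
  shows "is_mono C e"
  unfolding is_mono_def
proof (intro conjI allI ballI impI)
  show "e \<in> Arr C" using e by (simp add: hom_def)
  fix Z g h assume "g \<in> hom C Z (Dom C e)" "h \<in> hom C Z (Dom C e)" "e \<cdot> g = e \<cdot> h"
  then show "g = h"
    using e *[of "g \<oplus> Neg C h" Z] Sub_Zero[of g h Z X] Sub_Zero[of "e \<cdot> g" "e \<cdot> h" Z Y]
    by (auto simp: hom_def add_simps)
qed

lemma epi_Comp:
  assumes "is_epi C e" "e \<in> hom C X Y" "is_epi C e'" "e' \<in> hom C Y Z"
  shows "is_epi C (e' \<cdot> e)"
proof (rule epiI[OF Comp_hom[OF assms(2,4)]])
  fix W s assume s: "s \<in> hom C Z W" "s \<cdot> (e' \<cdot> e) = Zero C X W"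
  then have "s \<cdot> e' = Zero C Y W"
    using assms by (intro epi_Zero[OF assms(1,2)]) (auto simp: hom_def add_simps)
  then show "s = Zero C Z W" using assms s epi_Zero by blast
qed

lemma epi_Idn: "X \<in> Obj C \<Longrightarrow> is_epi C (Idn C X)"
  by (rule epiI[OF Idn_hom]) (auto simp: hom_def add_simps)

end

context abelian_category
begin

text \<open>An epimorphism is the cokernel of its kernel.\<close>

lemma epi_desc:
  assumes e: "is_epi C e" "e \<in> hom C X Y" and k: "is_kernel C e k"
    and s: "s \<in> hom C X Z" "s \<cdot> k = Zero C (Dom C k) Z"
  obtains u where "u \<in> hom C Y Z" "u \<cdot> e = s"
proof -
  obtain f where f: "is_cokernel C f e" using epi_conormal[OF e(1)] by blast
  have fe: "f \<in> hom C (Dom C f) X" "e \<cdot> f = Zero C (Dom C f) (Cod C e)"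
    using f e(2) by (auto simp: is_cokernel_def hom_def)
  have k': "k \<in> Arr C" "Cod C k = X" using k e(2) by (auto simp: is_kernel_def hom_def)
  have "f \<in> hom C (Dom C f) (Dom C e)" using fe e by (simp add: hom_def)
  then obtain f' where f': "f' \<in> hom C (Dom C f) (Dom C k)" "k \<cdot> f' = f"
    using is_kernel_lift[OF k _ fe(2)] by blast
  have "s \<cdot> f = (s \<cdot> k) \<cdot> f'" using f' k' s(1) by (auto simp: hom_def add_simps)
  then have "s \<cdot> f = Zero C (Dom C f) Z"
    using f' k' s hom_Obj[OF s(1)] by (auto simp: hom_def add_simps)
  then obtain u where "u \<in> hom C (Cod C e) Z" "u \<cdot> e = s"
    using is_cokernel_desc[OF f] s(1) fe(1) by (metis homD(3))
  then show ?thesis using that e(2) homD(3) by metis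
qed

text \<open>Epimorphisms are stable under pullback: for the pullback, the kernel of
  \<^term>\<open>g \<cdot> p \<oplus> Neg C (t \<cdot> q)\<close> on a biproduct, this reduces to the fact that the latter map
  is epi and therefore the cokernel of its kernel.\<close>

lemma epi_pullback:
  assumes g: "is_epi C g" "g \<in> hom C B Z" and t: "t \<in> hom C T Z"
  obtains T' e b where "is_epi C e" "e \<in> hom C T' T" "b \<in> hom C T' B" "g \<cdot> b = t \<cdot> e"
proof -
  have Obj: "B \<in> Obj C" "T \<in> Obj C" "Z \<in> Obj C" using hom_Obj[OF g(2)] hom_Obj[OF t] by auto
  obtain S i j p q where bi: "is_biproduct C B T S i j p q" using ex_biproduct[OF Obj(1,2)] by blast
  then have h: "i \<in> hom C B S" "j \<in> hom C T S" "p \<in> hom C S B" "q \<in> hom C S T"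
    and eq: "p \<cdot> i = Idn C B" "q \<cdot> j = Idn C T" "q \<cdot> i = Zero C B T" "p \<cdot> j = Zero C T B"
    by (auto simp: is_biproduct_def)
  have S: "S \<in> Obj C" using hom_Obj[OF h(1)] by simp
  note hs = h[unfolded hom_def, simplified] g(2)[unfolded hom_def, simplified] t[unfolded hom_def, simplified]
  define m where "m = g \<cdot> p \<oplus> Neg C (t \<cdot> q)"
  have m: "m \<in> hom C S Z" using hs by (auto simp: m_def hom_def add_simps)
  have mi: "m \<cdot> i = g" using hs Obj S eq by (simp add: m_def add_simps)
  have m_epi: "is_epi C m"
  proof (rule epiI[OF m])
    fix W s assume s: "s \<in> hom C Z W" "s \<cdot> m = Zero C S W"
    have "(s \<cdot> m) \<cdot> i = s \<cdot> g" using s(1) m mi hs by (simp add: hom_def add_simps)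
    then have "s \<cdot> g = Zero C B W" using s hs hom_Obj[OF s(1)] S by (simp add: add_simps)
    then show "s = Zero C Z W" using epi_Zero[OF g s(1)] by simp
  qed
  obtain k where k: "is_kernel C m k" using ex_kernel m by (auto simp: hom_def)
  define T' where "T' = Dom C k"
  have kh: "k \<in> hom C T' S" "m \<cdot> k = Zero C T' Z" using k m by (auto simp: is_kernel_def hom_def T'_def)
  have T': "T' \<in> Obj C" using hom_Obj[OF kh(1)] by simp
  note hs' = hs kh(1)[unfolded hom_def, simplified]
  have "g \<cdot> (p \<cdot> k) \<oplus> Neg C (t \<cdot> (q \<cdot> k)) = m \<cdot> k" using hs' by (simp add: m_def add_simps)
  then have "g \<cdot> (p \<cdot> k) = t \<cdot> (q \<cdot> k)"
    using kh(2) Sub_Zero[of "g \<cdot> (p \<cdot> k)" "t \<cdot> (q \<cdot> k)" T' Z] hs' by (simp add: add_simps)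
  moreover have "is_epi C (q \<cdot> k)"
  proof (rule epiI[OF Comp_hom[OF kh(1) h(4)]])
    fix W s assume s: "s \<in> hom C T W" "s \<cdot> (q \<cdot> k) = Zero C T' W"
    have W: "W \<in> Obj C" using hom_Obj[OF s(1)] by simp
    have "s \<cdot> q \<in> hom C S W" using Comp_hom[OF h(4) s(1)] .
    moreover have "(s \<cdot> q) \<cdot> k = Zero C (Dom C k) W" using s hs' by (simp add: hom_def add_simps)
    ultimately obtain r where r: "r \<in> hom C Z W" "r \<cdot> m = s \<cdot> q"
      using epi_desc[OF m_epi m k] by blast
    have "r \<cdot> g = (r \<cdot> m) \<cdot> i" using r(1) m mi hs by (simp add: hom_def add_simps)
    also have "\<dots> = Zero C B W" using s(1) r(2) hs eq W Obj by (simp add: hom_def add_simps)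
    finally have "r = Zero C Z W" using epi_Zero[OF g r(1)] by simp
    then have "s \<cdot> q = Zero C S W" using r m W by (simp add: hom_def add_simps)
    then have "(s \<cdot> q) \<cdot> j = Zero C T W" using hs W S by (simp add: add_simps)
    then show "s = Zero C T W" using s hs eq by (simp add: hom_def add_simps)
  qed
  ultimately show ?thesis using that Comp_hom[OF kh(1) h(4)] Comp_hom[OF kh(1) h(3)] by blast
qed

text \<open>Exactness at the middle term: an element killed by the cokernel of \<^term>\<open>u\<close> comes from
  \<^term>\<open>u\<close> after a refinement. The factor \<open>m\<close> of \<^term>\<open>u\<close> through the kernel of its cokernel is epi,
  because any subobject that contains the image of \<^term>\<open>u\<close> is a kernel and hence contains the
  kernel of \<^term>\<open>p\<close>.\<close>

lemma exact_lift:
  assumes u: "u \<in> hom C X Z" and p: "is_cokernel C u p"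
    and x: "x \<in> hom C T Z" "p \<cdot> x = Zero C T (Cod C p)"
  obtains T' e w where "is_epi C e" "e \<in> hom C T' T" "w \<in> hom C T' X" "x \<cdot> e = u \<cdot> w"
proof -
  define H where "H = Cod C p"
  have ph: "p \<in> hom C Z H" "p \<cdot> u = Zero C X H"
    using p u by (auto simp: is_cokernel_def hom_def H_def)
  obtain k where k: "is_kernel C p k" using ex_kernel ph by (auto simp: hom_def)
  define K where "K = Dom C k"
  have kh: "k \<in> hom C K Z" "p \<cdot> k = Zero C K H" using k ph by (auto simp: is_kernel_def hom_def K_def)
  have Dp: "Dom C p = Z" "Cod C p = H" using ph by (auto simp: hom_def)
  obtain m where m: "m \<in> hom C X K" "k \<cdot> m = u"
    using is_kernel_lift[OF k, of u X] u ph Dp by (auto simp: K_def)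
  obtain x' where x': "x' \<in> hom C T K" "k \<cdot> x' = x"
    using is_kernel_lift[OF k, of x T] x Dp by (auto simp: K_def)
  have Obj: "X \<in> Obj C" "Z \<in> Obj C" "H \<in> Obj C" "K \<in> Obj C"
    using hom_Obj[OF u] hom_Obj[OF kh(1)] hom_Obj[OF ph(1)] by auto
  have "is_epi C m"
  proof (rule epiI[OF m(1)])
    fix Y s assume s: "s \<in> hom C K Y" "s \<cdot> m = Zero C X Y"
    have Y: "Y \<in> Obj C" using hom_Obj[OF s(1)] by simp
    obtain j where j: "is_kernel C s j" using ex_kernel s by (auto simp: hom_def)
    define J where "J = Dom C j"
    have jh: "j \<in> hom C J K" "s \<cdot> j = Zero C J Y" using j s by (auto simp: is_kernel_def hom_def J_def)
    have Ds: "Dom C s = K" "Cod C s = Y" using s by (auto simp: hom_def)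
    obtain m' where m': "m' \<in> hom C X J" "j \<cdot> m' = m"
      using is_kernel_lift[OF j, of m X] m s Ds by (auto simp: J_def)
    have J: "J \<in> Obj C" using hom_Obj[OF jh(1)] by simp
    note hs = jh(1)[unfolded hom_def, simplified] kh(1)[unfolded hom_def, simplified]
      m'(1)[unfolded hom_def, simplified] ph(1)[unfolded hom_def, simplified]
    have "is_mono C (k \<cdot> j)"
    proof (rule monoI[OF Comp_hom[OF jh(1) kh(1)]])
      fix V t assume t: "t \<in> hom C V J" "(k \<cdot> j) \<cdot> t = Zero C V Z"
      have V: "V \<in> Obj C" using hom_Obj[OF t(1)] by simp
      have "k \<cdot> (j \<cdot> t) = k \<cdot> Zero C V K" using t hs V Obj by (simp add: hom_def add_simps)
      then have "j \<cdot> t = j \<cdot> Zero C V J"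
        using mono_cancel[OF kernel_mono[OF k] kh(1) Comp_hom[OF t(1) jh(1)] Zero_hom[OF V Obj(4)]]
          hs V J by (simp add: add_simps)
      then show "t = Zero C V J"
        using mono_cancel[OF kernel_mono[OF j] jh(1) t(1) Zero_hom[OF V J]] by simp
    qed
    then obtain g where g: "is_kernel C g (k \<cdot> j)" using mono_normal by blast
    define G where "G = Cod C g"
    have gh: "g \<in> hom C Z G" "g \<cdot> (k \<cdot> j) = Zero C J G"
      using g hs by (auto simp: is_kernel_def hom_def G_def cat_simps)
    have G: "G \<in> Obj C" using hom_Obj[OF gh(1)] by simp
    have Dg: "Dom C g = Z" "Cod C g = G" using gh by (auto simp: hom_def)
    have "g \<cdot> u = (g \<cdot> (k \<cdot> j)) \<cdot> m'"
      using m m' hs gh(1) by (auto simp: hom_def add_simps)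
    also have "\<dots> = Zero C X G" using gh hs G by (simp add: add_simps)
    finally obtain g' where g': "g' \<in> hom C H G" "g' \<cdot> p = g"
      using is_cokernel_desc[OF p, of g G] gh u Dp by (auto simp: hom_def)
    have "g \<cdot> k = g' \<cdot> (p \<cdot> k)" using g' hs by (auto simp: hom_def add_simps)
    then have "g \<cdot> k = Zero C K G" using g' kh Obj by (auto simp: hom_def add_simps)
    then obtain t where t: "t \<in> hom C K J" "(k \<cdot> j) \<cdot> t = k"
      using is_kernel_lift[OF g, of k K] kh Dg hs by (auto simp: cat_simps)
    have "k \<cdot> (j \<cdot> t) = k \<cdot> Idn C K" using t hs by (simp add: hom_def cat_simps)
    then have jt: "j \<cdot> t = Idn C K"
      using mono_cancel[OF kernel_mono[OF k] kh(1) Comp_hom[OF t(1) jh(1)] Idn_hom[OF Obj(4)]] by simp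
    have "s = s \<cdot> (j \<cdot> t)" using jt s by (simp add: hom_def cat_simps)
    also have "\<dots> = (s \<cdot> j) \<cdot> t" using s hs t by (simp add: hom_def cat_simps)
    also have "\<dots> = Zero C K Y" using jh t Y J by (simp add: hom_def add_simps)
    finally show "s = Zero C K Y" .
  qed
  then obtain T' e w where e: "is_epi C e" "e \<in> hom C T' T" "w \<in> hom C T' X" "m \<cdot> w = x' \<cdot> e"
    using epi_pullback[OF _ m(1) x'(1)] by blast
  have "x \<cdot> e = k \<cdot> (x' \<cdot> e)" using x' kh e by (auto simp: hom_def cat_simps)
  also have "\<dots> = u \<cdot> w" using m kh e by (auto simp: hom_def cat_simps)
  finally show ?thesis using that e by blast
qed

lemma mono_epi_iso:
  assumes f: "f \<in> hom C X Y" and "is_mono C f" and epi: "is_epi C f"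
  shows "is_iso C f"
proof -
  obtain g where g: "is_kernel C g f" using mono_normal assms by blast
  have gh: "g \<in> hom C Y (Cod C g)" "g \<cdot> f = Zero C X (Cod C g)"
    using g f by (auto simp: is_kernel_def hom_def)
  have "g = Zero C Y (Cod C g)" using epi_Zero[OF epi f gh] .
  have Y: "Y \<in> Obj C" "X \<in> Obj C" using hom_Obj[OF f] by auto
  have "g \<cdot> Idn C Y = Zero C Y (Cod C g)"
    using gh \<open>g = Zero C Y (Cod C g)\<close> by (simp add: hom_def cat_simps)
  then obtain u where u: "u \<in> hom C Y X" "f \<cdot> u = Idn C Y"
    using is_kernel_lift[OF g, of "Idn C Y" Y] gh Idn_hom[OF Y(1)] f by (auto simp: hom_def)
  have "f \<cdot> (u \<cdot> f) = f \<cdot> Idn C X"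
    using u f Comp_assoc[OF f u(1) f] by (simp add: hom_def cat_simps)
  then have "u \<cdot> f = Idn C X" using mono_cancel[OF assms(2) f Comp_hom[OF f u(1)] Idn_hom[OF Y(2)]] by simp
  then show ?thesis using is_isoI[OF f u(1)] u(2) by simp
qed

end

text \<open>Acyclicity of the mapping cone of \<^term>\<open>f\<close>, expressed with generalized elements: a cone cocycle
  is a coboundary after passing to an epimorphic refinement of its stage.\<close>

definition qis :: "('o, 'a, 'z) addcat_scheme \<Rightarrow> ('o, 'a) cpx \<Rightarrow> ('o, 'a) cpx \<Rightarrow> (int \<Rightarrow> 'a) \<Rightarrow> bool" where
  "qis C X Y f \<longleftrightarrow> (\<forall>T n x y. x \<in> hom C T (fst X (n + 1)) \<and> y \<in> hom C T (fst Y n) \<and>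
     Comp C (snd X (n + 1)) x = Zero C T (fst X (n + 2)) \<and> Comp C (f (n + 1)) x = Comp C (snd Y n) y \<longrightarrow>
     (\<exists>T' e x' y'. is_epi C e \<and> e \<in> hom C T' T \<and> x' \<in> hom C T' (fst X n) \<and> y' \<in> hom C T' (fst Y (n - 1)) \<and>
        Comp C (snd X n) x' = Comp C x e \<and>
        Comp C y e = Add C (Comp C (f n) x') (Comp C (snd Y (n - 1)) y')))"

lemma qisD:
  assumes "qis C X Y f" "x \<in> hom C T (fst X (n + 1))" "y \<in> hom C T (fst Y n)"
    "Comp C (snd X (n + 1)) x = Zero C T (fst X (n + 2))" "Comp C (f (n + 1)) x = Comp C (snd Y n) y"
  obtains T' e x' y' where "is_epi C e" "e \<in> hom C T' T" "x' \<in> hom C T' (fst X n)"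
    "y' \<in> hom C T' (fst Y (n - 1))" "Comp C (snd X n) x' = Comp C x e"
    "Comp C y e = Add C (Comp C (f n) x') (Comp C (snd Y (n - 1)) y')"
  using assms unfolding qis_def by blast

lemma is_cohomologyE:
  assumes "is_cohomology C X n i p" "snd X n \<in> hom C (fst X n) (fst X (n + 1))"
    "preadditive_category C"
  obtains Z H u where "i \<in> hom C Z (fst X n)" "p \<in> hom C Z H" "u \<in> hom C (fst X (n - 1)) Z"
    "Comp C i u = snd X (n - 1)" "is_cokernel C u p" "is_kernel C (snd X n) i" "is_mono C i" "is_epi C p"
    "Comp C p u = Zero C (fst X (n - 1)) H" "Comp C (snd X n) i = Zero C Z (fst X (n + 1))"
proof -
  interpret preadditive_category C by (rule assms)
  obtain u where u: "u \<in> hom C (fst X (n - 1)) (Dom C i)" "Comp C i u = snd X (n - 1)" "is_cokernel C u p"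
    and k: "is_kernel C (snd X n) i"
    using assms by (auto simp: is_cohomology_def)
  show ?thesis
    by (rule that[of "Dom C i" "Cod C p" u])
      (use u k kernel_mono[OF k] cokernel_epi[OF u(3)] assms(2) in
        \<open>simp_all add: hom_def is_kernel_def is_cokernel_def\<close>)
qed

context abelian_category
begin

text \<open>The two directions of the comparison: the induced maps on cohomology are isomorphisms exactly
  when the cone is acyclic. Cocycles with the same class, and representatives of a given class, exist
  only after refinement.\<close>

lemma qis_cohomology_iso:
  assumes X: "X \<in> Obj (complexes C)" and Y: "Y \<in> Obj (complexes C)" and f: "(X, Y, f) \<in> Arr (complexes C)"
    and qis: "qis C X Y f" and HX: "is_cohomology C X n i p" and HY: "is_cohomology C Y n i' p'"
    and z: "z \<in> hom C (Dom C i) (Dom C i')" "i' \<cdot> z = f n \<cdot> i"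
    and h: "h \<in> hom C (Cod C p) (Cod C p')" "h \<cdot> p = p' \<cdot> z"
  shows "is_iso C h"
proof -
  have dX: "snd X m \<in> hom C (fst X m) (fst X (m + 1))" and dY: "snd Y m \<in> hom C (fst Y m) (fst Y (m + 1))"
    and f_hom: "f m \<in> hom C (fst X m) (fst Y m)" and f_comm: "snd Y m \<cdot> f m = f (m + 1) \<cdot> snd X m"
    and OX: "fst X m \<in> Obj C" and OY: "fst Y m \<in> Obj C" for m
    using X Y f by (auto simp: complexes_Obj complexes_Arr)
  obtain Z H u where i: "i \<in> hom C Z (fst X n)" and p: "p \<in> hom C Z H" and u: "u \<in> hom C (fst X (n - 1)) Z"
    "i \<cdot> u = snd X (n - 1)" "is_cokernel C u p" and ik: "is_kernel C (snd X n) i" "is_mono C i" "is_epi C p"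
    "p \<cdot> u = Zero C (fst X (n - 1)) H" "snd X n \<cdot> i = Zero C Z (fst X (n + 1))"
    by (rule is_cohomologyE[OF HX dX preadditive_category_axioms])
  obtain Z' H' u' where i': "i' \<in> hom C Z' (fst Y n)" and p': "p' \<in> hom C Z' H'" and u': "u' \<in> hom C (fst Y (n - 1)) Z'"
    "i' \<cdot> u' = snd Y (n - 1)" "is_cokernel C u' p'" and ik': "is_kernel C (snd Y n) i'" "is_mono C i'" "is_epi C p'"
    "p' \<cdot> u' = Zero C (fst Y (n - 1)) H'" "snd Y n \<cdot> i' = Zero C Z' (fst Y (n + 1))"
    by (rule is_cohomologyE[OF HY dY preadditive_category_axioms])
  have z': "z \<in> hom C Z Z'" and h': "h \<in> hom C H H'" using z h i i' p p' by (auto simp: hom_def)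
  have Obj: "Z \<in> Obj C" "H \<in> Obj C" "Z' \<in> Obj C" "H' \<in> Obj C"
    using hom_Obj[OF z'] hom_Obj[OF h'] by auto
  note hs = i[unfolded hom_def, simplified] p[unfolded hom_def, simplified] u(1)[unfolded hom_def, simplified]
    i'[unfolded hom_def, simplified] p'[unfolded hom_def, simplified] u'(1)[unfolded hom_def, simplified]
    z'[unfolded hom_def, simplified] h'[unfolded hom_def, simplified] f_hom[of n, unfolded hom_def, simplified]
    dX[of n, unfolded hom_def, simplified] dY[of n, unfolded hom_def, simplified]
    f_hom[of "n - 1", unfolded hom_def, simplified]
    dX[of "n - 1", unfolded hom_def, simplified] dY[of "n - 1", unfolded hom_def, simplified]
  \<comment> \<open>A class t killed by h is represented by a cocycle x such that f x is the boundary of some w;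
    so (x, w) is a cone cocycle, and by acyclicity x is a coboundary.\<close>
  have "is_mono C h"
  proof (rule monoI[OF h'])
    fix T t assume t: "t \<in> hom C T H" "h \<cdot> t = Zero C T H'"
    have T: "T \<in> Obj C" using hom_Obj[OF t(1)] by simp
    obtain T1 e1 x where e1: "is_epi C e1" "e1 \<in> hom C T1 T" "x \<in> hom C T1 Z" "p \<cdot> x = t \<cdot> e1"
      using epi_pullback[OF ik(3) p t(1)] by blast
    have T1: "T1 \<in> Obj C" using hom_Obj[OF e1(2)] by simp
    have zx: "z \<cdot> x \<in> hom C T1 Z'" using Comp_hom[OF e1(3) z'] .
    have "p' \<cdot> (z \<cdot> x) = (h \<cdot> p) \<cdot> x" using hs e1(3) h(2) by (simp add: hom_def cat_simps)
    also have "\<dots> = h \<cdot> (t \<cdot> e1)" using hs e1 by (simp add: hom_def cat_simps)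
    also have "\<dots> = (h \<cdot> t) \<cdot> e1" using hs e1(2) t(1) by (simp add: hom_def cat_simps)
    also have "\<dots> = Zero C T1 H'" using t e1 Obj by (simp add: hom_def add_simps)
    finally have "p' \<cdot> (z \<cdot> x) = Zero C T1 (Cod C p')" using hs by simp
    then obtain T2 e2 w where e2: "is_epi C e2" "e2 \<in> hom C T2 T1" "w \<in> hom C T2 (fst Y (n - 1))"
      "(z \<cdot> x) \<cdot> e2 = u' \<cdot> w"
      using exact_lift[OF u'(1,3) zx] by blast
    have xe: "i \<cdot> (x \<cdot> e2) \<in> hom C T2 (fst X (n - 1 + 1))" using hs e1 e2 by (simp add: hom_def cat_simps)
    have "snd X (n - 1 + 1) \<cdot> (i \<cdot> (x \<cdot> e2)) = (snd X n \<cdot> i) \<cdot> (x \<cdot> e2)"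
      using hs e1 e2 by (simp add: hom_def cat_simps)
    also have "\<dots> = Zero C T2 (fst X (n - 1 + 2))" using ik(5) e1 e2 Obj OX by (simp add: hom_def add_simps algebra_simps)
    finally have 1: "snd X (n - 1 + 1) \<cdot> (i \<cdot> (x \<cdot> e2)) = Zero C T2 (fst X (n - 1 + 2))" .
    have "f (n - 1 + 1) \<cdot> (i \<cdot> (x \<cdot> e2)) = (f n \<cdot> i) \<cdot> (x \<cdot> e2)" using hs e1 e2 by (simp add: hom_def cat_simps)
    also have "\<dots> = i' \<cdot> ((z \<cdot> x) \<cdot> e2)" unfolding z(2)[symmetric] using hs e1 e2 by (simp add: hom_def cat_simps)
    also have "\<dots> = snd Y (n - 1) \<cdot> w"
      unfolding e2(4) u'(2)[symmetric] using hs e2 by (simp add: hom_def cat_simps)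
    finally have 2: "f (n - 1 + 1) \<cdot> (i \<cdot> (x \<cdot> e2)) = snd Y (n - 1) \<cdot> w" .
    obtain T3 e3 v where e3: "is_epi C e3" "e3 \<in> hom C T3 T2" "v \<in> hom C T3 (fst X (n - 1))"
      "snd X (n - 1) \<cdot> v = (i \<cdot> (x \<cdot> e2)) \<cdot> e3"
      by (rule qisD[OF qis xe e2(3) 1 2])
    have "i \<cdot> (u \<cdot> v) = i \<cdot> (x \<cdot> (e2 \<cdot> e3))"
      using e3(4) u(2)[symmetric] hs e1 e2 e3 by (simp add: hom_def cat_simps)
    then have "u \<cdot> v = x \<cdot> (e2 \<cdot> e3)"
      using mono_cancel[OF ik(2) i Comp_hom[OF e3(3) u(1)] Comp_hom[OF Comp_hom[OF e3(2) e2(2)] e1(3)]] by simp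
    then have "p \<cdot> (u \<cdot> v) = p \<cdot> (x \<cdot> (e2 \<cdot> e3))" by simp
    then have "(p \<cdot> u) \<cdot> v = (p \<cdot> x) \<cdot> (e2 \<cdot> e3)"
      using hs e1(2,3) e2(2) e3(2,3) by (simp add: hom_def cat_simps)
    then have "t \<cdot> (e1 \<cdot> (e2 \<cdot> e3)) = Zero C T3 H"
      unfolding ik(4) e1(4) using e1 e2 e3 t Obj OX by (simp add: hom_def add_simps)
    moreover have "is_epi C (e1 \<cdot> (e2 \<cdot> e3))"
      by (rule epi_Comp[OF epi_Comp[OF e3(1,2) e2(1,2)] Comp_hom[OF e3(2) e2(2)] e1(1,2)])
    ultimately show "t = Zero C T H"
      using epi_Zero[OF _ Comp_hom[OF Comp_hom[OF e3(2) e2(2)] e1(2)] t(1)] by blast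
  qed
  \<comment> \<open>The generic cocycle i' of Y, paired with 0, is a cone cocycle. Acyclicity makes it
    cohomologous to the image of a cocycle of X.\<close>
  moreover have "is_epi C h"
  proof (rule epiI[OF h'])
    fix T t assume t: "t \<in> hom C H' T" "t \<cdot> h = Zero C H T"
    have T: "T \<in> Obj C" using hom_Obj[OF t(1)] by simp
    have zero: "Zero C Z' (fst X (n + 1)) \<in> hom C Z' (fst X (n + 1))" using Zero_hom Obj OX by blast
    have 1: "snd X (n + 1) \<cdot> Zero C Z' (fst X (n + 1)) = Zero C Z' (fst X (n + 2))"
      using dX[of "n + 1"] Obj OX by (simp add: hom_def add_simps add.commute)
    have 2: "f (n + 1) \<cdot> Zero C Z' (fst X (n + 1)) = snd Y n \<cdot> i'"
      using f_hom[of "n + 1"] Obj OX ik'(5) by (simp add: hom_def add_simps)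
    obtain T' e x y where e: "is_epi C e" "e \<in> hom C T' Z'" "x \<in> hom C T' (fst X n)"
      "y \<in> hom C T' (fst Y (n - 1))" "snd X n \<cdot> x = Zero C Z' (fst X (n + 1)) \<cdot> e"
      "i' \<cdot> e = f n \<cdot> x \<oplus> snd Y (n - 1) \<cdot> y"
      by (rule qisD[OF qis zero i' 1 2])
    have "snd X n \<cdot> x = Zero C T' (Cod C (snd X n))" using e(2,5) Obj OX hs by (simp add: hom_def add_simps)
    then obtain x' where x': "x' \<in> hom C T' Z" "i \<cdot> x' = x"
      using is_kernel_lift[OF ik(1), of x T'] e(3) hs by (auto simp: hom_def)
    have ix: "f n \<cdot> x = i' \<cdot> (z \<cdot> x')"
      unfolding x'(2)[symmetric] using z(2) hs x'(1) Comp_reassoc[of x' i "f n"] Comp_reassoc[of x' z i']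
      by (simp add: hom_def)
    have "i' \<cdot> e = i' \<cdot> (z \<cdot> x' \<oplus> u' \<cdot> y)"
      unfolding e(6) u'(2)[symmetric] ix using hs x'(1) e(4) by (simp add: hom_def add_simps)
    moreover have zu: "z \<cdot> x' \<oplus> u' \<cdot> y \<in> hom C T' Z'" using hs x'(1) e(4) by (simp add: hom_def add_simps)
    ultimately have "e = z \<cdot> x' \<oplus> u' \<cdot> y" using mono_cancel[OF ik'(2) i' e(2)] by blast
    then have "p' \<cdot> e = (p' \<cdot> z) \<cdot> x' \<oplus> (p' \<cdot> u') \<cdot> y" using hs x'(1) e(4) by (simp add: hom_def add_simps)
    also have "\<dots> = h \<cdot> (p \<cdot> x')"
      unfolding h(2)[symmetric] ik'(4) using hs x'(1) e(4) Obj OY by (simp add: hom_def add_simps)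
    finally have "(t \<cdot> p') \<cdot> e = (t \<cdot> h) \<cdot> (p \<cdot> x')" using hs x'(1) t(1) e(2) by (simp add: hom_def cat_simps)
    also have "\<dots> = Zero C T' T" unfolding t(2) using hs x'(1) T Obj by (simp add: hom_def add_simps)
    finally have "t \<cdot> p' = Zero C Z' T" using epi_Zero[OF e(1,2) Comp_hom[OF p' t(1)]] by simp
    then show "t = Zero C H' T" using epi_Zero[OF ik'(3) p' t(1)] by simp
  qed
  ultimately show ?thesis using mono_epi_iso[OF h'] by simp
qed

lemma cohomology_iso_qis:
  assumes X: "X \<in> Obj (complexes C)" and Y: "Y \<in> Obj (complexes C)" and f: "(X, Y, f) \<in> Arr (complexes C)"
    and H: "\<And>n. \<exists>i p i' p' z h. is_cohomology C X n i p \<and> is_cohomology C Y n i' p' \<and>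
      z \<in> hom C (Dom C i) (Dom C i') \<and> i' \<cdot> z = f n \<cdot> i \<and>
      h \<in> hom C (Cod C p) (Cod C p') \<and> h \<cdot> p = p' \<cdot> z \<and> is_iso C h"
  shows "qis C X Y f"
  unfolding qis_def
proof (intro allI impI, elim conjE)
  fix T n x y
  assume x: "x \<in> hom C T (fst X (n + 1))" "snd X (n + 1) \<cdot> x = Zero C T (fst X (n + 2))"
    and y: "y \<in> hom C T (fst Y n)" and xy: "f (n + 1) \<cdot> x = snd Y n \<cdot> y"
  have dX: "snd X m \<in> hom C (fst X m) (fst X (m + 1))" and dY: "snd Y m \<in> hom C (fst Y m) (fst Y (m + 1))"
    and f_hom: "f m \<in> hom C (fst X m) (fst Y m)" and f_comm: "snd Y m \<cdot> f m = f (m + 1) \<cdot> snd X m"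
    and OX: "fst X m \<in> Obj C" and OY: "fst Y m \<in> Obj C" for m
    using X Y f by (auto simp: complexes_Obj complexes_Arr)
  have d: "Dom C (snd X m) = fst X m" "Cod C (snd X m) = fst X (m + 1)" "snd X m \<in> Arr C"
    "Dom C (snd Y m) = fst Y m" "Cod C (snd Y m) = fst Y (m + 1)" "snd Y m \<in> Arr C"
    "Dom C (f m) = fst X m" "Cod C (f m) = fst Y m" "f m \<in> Arr C" for m
    using dX[of m] dY[of m] f_hom[of m] by (auto simp: hom_def)
  note hx = x(1)[unfolded hom_def, simplified] y[unfolded hom_def, simplified]
  \<comment> \<open>As f x is the boundary of y, the class of x is killed by the injective map on cohomology, so x is
    a coboundary after refinement.\<close>
  have refine: "\<exists>T1 e v. is_epi C e \<and> e \<in> hom C T1 T \<and> v \<in> hom C T1 (fst X n) \<and> snd X n \<cdot> v = x \<cdot> e"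
  proof -
    obtain i p i' p' z h where HX: "is_cohomology C X (n + 1) i p" and HY: "is_cohomology C Y (n + 1) i' p'"
      and z: "z \<in> hom C (Dom C i) (Dom C i')" "i' \<cdot> z = f (n + 1) \<cdot> i"
      and h: "h \<in> hom C (Cod C p) (Cod C p')" "h \<cdot> p = p' \<cdot> z" "is_iso C h" using H by blast
    obtain Z H u where i: "i \<in> hom C Z (fst X (n + 1))" and p: "p \<in> hom C Z H" and u: "u \<in> hom C (fst X n) Z"
      "i \<cdot> u = snd X n" "is_cokernel C u p" and ik: "is_kernel C (snd X (n + 1)) i"
      by (rule is_cohomologyE[OF HX dX preadditive_category_axioms]) simp
    obtain Z' H' u' where i': "i' \<in> hom C Z' (fst Y (n + 1))" and p': "p' \<in> hom C Z' H'" and u': "u' \<in> hom C (fst Y n) Z'"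
      "i' \<cdot> u' = snd Y n" and ik': "is_mono C i'" "p' \<cdot> u' = Zero C (fst Y n) H'"
      by (rule is_cohomologyE[OF HY dY preadditive_category_axioms]) simp
    have z': "z \<in> hom C Z Z'" and h': "h \<in> hom C H H'" using z h i i' p p' by (auto simp: hom_def)
    have Obj: "Z \<in> Obj C" "H \<in> Obj C" "Z' \<in> Obj C" "H' \<in> Obj C" "T \<in> Obj C"
      using hom_Obj[OF z'] hom_Obj[OF h'] hom_Obj[OF y] by auto
    note hs = i[unfolded hom_def, simplified] p[unfolded hom_def, simplified] u(1)[unfolded hom_def, simplified]
      i'[unfolded hom_def, simplified] p'[unfolded hom_def, simplified] u'(1)[unfolded hom_def, simplified]
      z'[unfolded hom_def, simplified] h'[unfolded hom_def, simplified]
    obtain x' where x': "x' \<in> hom C T Z" "i \<cdot> x' = x"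
      using is_kernel_lift[OF ik, of x T] x hs d by (auto simp: add.assoc)
    have "i' \<cdot> (z \<cdot> x') = f (n + 1) \<cdot> x"
      unfolding x'(2)[symmetric] using z(2) hs x'(1) d Comp_reassoc[of x' i "f (n + 1)"] Comp_reassoc[of x' z i']
      by (simp add: hom_def)
    also have "\<dots> = i' \<cdot> (u' \<cdot> y)" unfolding xy u'(2)[symmetric] using hs hx by (simp add: cat_simps)
    finally have zx: "z \<cdot> x' = u' \<cdot> y"
      using mono_cancel[OF ik'(1) i' Comp_hom[OF x'(1) z'] Comp_hom[OF y u'(1)]] by simp
    have "h \<cdot> (p \<cdot> x') = p' \<cdot> (z \<cdot> x')"
      using h(2) hs x'(1) Comp_reassoc[of x' p h] Comp_reassoc[of x' z p'] by (simp add: hom_def)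
    also have "\<dots> = (p' \<cdot> u') \<cdot> y" unfolding zx using hs hx by (simp add: cat_simps)
    also have "\<dots> = h \<cdot> Zero C T H" unfolding ik'(2) using hs hx Obj by (simp add: add_simps)
    finally have "p \<cdot> x' = Zero C T (Cod C p)"
      using iso_cancel_left[OF h(3) h' Comp_hom[OF x'(1) p] Zero_hom[OF Obj(5,2)]] hs by simp
    then obtain T1 e v where e: "is_epi C e" "e \<in> hom C T1 T" "v \<in> hom C T1 (fst X n)" "x' \<cdot> e = u \<cdot> v"
      using exact_lift[OF u(1,3) x'(1)] by blast
    have "snd X n \<cdot> v = i \<cdot> (x' \<cdot> e)" unfolding e(4) u(2)[symmetric] using hs e(3) by (simp add: hom_def cat_simps)
    also have "\<dots> = x \<cdot> e" unfolding x'(2)[symmetric] using hs e(2) x'(1) by (simp add: hom_def cat_simps)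
    finally show ?thesis using e by blast
  qed
  then obtain T1 e1 v where e1: "is_epi C e1" "e1 \<in> hom C T1 T" "v \<in> hom C T1 (fst X n)" "snd X n \<cdot> v = x \<cdot> e1"
    by blast
  note h1 = e1(2,3)[unfolded hom_def, simplified]
  \<comment> \<open>After subtracting the image of v, only a cocycle y1 of Y remains; its class comes from a class of X,
    which x2 represents.\<close>
  define y1 where "y1 = y \<cdot> e1 \<oplus> Neg C (f n \<cdot> v)"
  have y1: "y1 \<in> hom C T1 (fst Y n)" using hx h1 d by (simp add: y1_def hom_def add_simps)
  have T1: "T1 \<in> Obj C" using hom_Obj[OF e1(2)] by simp
  have "(snd Y n \<cdot> f n) \<cdot> v = f (n + 1) \<cdot> (snd X n \<cdot> v)"
    unfolding f_comm using d h1 by (simp add: cat_simps)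
  also have "\<dots> = (f (n + 1) \<cdot> x) \<cdot> e1" unfolding e1(4) using d hx h1 by (simp add: cat_simps)
  also have "\<dots> = snd Y n \<cdot> (y \<cdot> e1)" unfolding xy using d hx h1 by (simp add: cat_simps)
  finally have "snd Y n \<cdot> y1 = snd Y n \<cdot> (y \<cdot> e1) \<oplus> Neg C (snd Y n \<cdot> (y \<cdot> e1))"
    using d hx h1 by (simp add: y1_def add_simps)
  then have y1_cocycle: "snd Y n \<cdot> y1 = Zero C T1 (fst Y (n + 1))"
    using d hx h1 by (simp add: add_simps Add_inverse)

  obtain i p i' p' z h where HX: "is_cohomology C X n i p" and HY: "is_cohomology C Y n i' p'"
    and z: "z \<in> hom C (Dom C i) (Dom C i')" "i' \<cdot> z = f n \<cdot> i"
    and h: "h \<in> hom C (Cod C p) (Cod C p')" "h \<cdot> p = p' \<cdot> z" "is_iso C h" using H by blast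
  obtain Z H where i: "i \<in> hom C Z (fst X n)" and p: "p \<in> hom C Z H"
    and ik: "is_epi C p" "snd X n \<cdot> i = Zero C Z (fst X (n + 1))"
    by (rule is_cohomologyE[OF HX dX preadditive_category_axioms])
  obtain Z' H' u' where i': "i' \<in> hom C Z' (fst Y n)" and p': "p' \<in> hom C Z' H'" and u': "u' \<in> hom C (fst Y (n - 1)) Z'"
    "i' \<cdot> u' = snd Y (n - 1)" "is_cokernel C u' p'" and ik': "is_kernel C (snd Y n) i'"
    by (rule is_cohomologyE[OF HY dY preadditive_category_axioms])
  have z': "z \<in> hom C Z Z'" and h': "h \<in> hom C H H'" using z h i i' p p' by (auto simp: hom_def)
  have Obj: "Z \<in> Obj C" "H \<in> Obj C" "Z' \<in> Obj C" "H' \<in> Obj C"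
    using hom_Obj[OF z'] hom_Obj[OF h'] by auto
  note hs = i[unfolded hom_def, simplified] p[unfolded hom_def, simplified]
    i'[unfolded hom_def, simplified] p'[unfolded hom_def, simplified] u'(1)[unfolded hom_def, simplified]
    z'[unfolded hom_def, simplified] h'[unfolded hom_def, simplified]
  obtain k where k: "k \<in> hom C H' H" "h \<cdot> k = Idn C H'" using is_isoE[OF h(3) h'] by blast
  note hk = k(1)[unfolded hom_def, simplified]
  obtain y' where y': "y' \<in> hom C T1 Z'" "i' \<cdot> y' = y1"
    using is_kernel_lift[OF ik', of y1 T1] y1 y1_cocycle d hs by auto
  have ky: "k \<cdot> (p' \<cdot> y') \<in> hom C T1 H" using hs hk y'(1) by (simp add: hom_def cat_simps)
  obtain T2 e2 x2 where e2: "is_epi C e2" "e2 \<in> hom C T2 T1" "x2 \<in> hom C T2 Z" "p \<cdot> x2 = (k \<cdot> (p' \<cdot> y')) \<cdot> e2"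
    using epi_pullback[OF ik(1) p ky] by blast
  note h2 = e2(2,3)[unfolded hom_def, simplified] y'(1)[unfolded hom_def, simplified]
  define y2 where "y2 = y' \<cdot> e2 \<oplus> Neg C (z \<cdot> x2)"
  have y2: "y2 \<in> hom C T2 Z'" using hs h2 by (simp add: y2_def hom_def add_simps)
  have "(p' \<cdot> z) \<cdot> x2 = h \<cdot> (p \<cdot> x2)" unfolding h(2)[symmetric] using hs h2 by (simp add: cat_simps)
  also have "\<dots> = (h \<cdot> k) \<cdot> (p' \<cdot> (y' \<cdot> e2))" unfolding e2(4) using hs hk h2 by (simp add: cat_simps)
  also have "\<dots> = p' \<cdot> (y' \<cdot> e2)" unfolding k(2) using hs h2 by (simp add: cat_simps)
  finally have "p' \<cdot> y2 = p' \<cdot> (y' \<cdot> e2) \<oplus> Neg C (p' \<cdot> (y' \<cdot> e2))" using hs h2 by (simp add: y2_def add_simps)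
  then have "p' \<cdot> y2 = Zero C T2 (Cod C p')" using hs h2 by (simp add: cat_simps Add_inverse)
  then obtain T3 e3 w where e3: "is_epi C e3" "e3 \<in> hom C T3 T2" "w \<in> hom C T3 (fst Y (n - 1))" "y2 \<cdot> e3 = u' \<cdot> w"
    using exact_lift[OF u'(1,3) y2] by blast
  note h3 = e3(2,3)[unfolded hom_def, simplified]
  let ?e = "e1 \<cdot> (e2 \<cdot> e3)"
  let ?x = "v \<cdot> (e2 \<cdot> e3) \<oplus> i \<cdot> (x2 \<cdot> e3)"
  have e: "is_epi C ?e" "?e \<in> hom C T3 T"
    by (rule epi_Comp[OF epi_Comp[OF e3(1,2) e2(1,2)] Comp_hom[OF e3(2) e2(2)] e1(1,2)])
      (rule Comp_hom[OF Comp_hom[OF e3(2) e2(2)] e1(2)])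
  have x'_hom: "?x \<in> hom C T3 (fst X n)" using hs h1 h2 h3 by (simp add: hom_def add_simps)
  have "snd X n \<cdot> ?x = (snd X n \<cdot> v) \<cdot> (e2 \<cdot> e3) \<oplus> (snd X n \<cdot> i) \<cdot> (x2 \<cdot> e3)"
    using hs h1 h2 h3 d by (simp add: add_simps)
  also have "\<dots> = x \<cdot> ?e" unfolding e1(4) ik(2) using hx h1 h2 h3 Obj OX d by (simp add: add_simps)
  finally have dx': "snd X n \<cdot> ?x = x \<cdot> ?e" .
  have "i' \<cdot> (y2 \<cdot> e3) = (i' \<cdot> y') \<cdot> (e2 \<cdot> e3) \<oplus> Neg C ((i' \<cdot> z) \<cdot> (x2 \<cdot> e3))"
    using hs h2 h3 by (simp add: y2_def add_simps)
  then have "snd Y (n - 1) \<cdot> w = y1 \<cdot> (e2 \<cdot> e3) \<oplus> Neg C (f n \<cdot> (i \<cdot> (x2 \<cdot> e3)))"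
    unfolding y'(2) z(2) e3(4) u'(2)[symmetric] using hs h2 h3 d by (simp add: cat_simps)
  then have "f n \<cdot> ?x \<oplus> snd Y (n - 1) \<cdot> w = y \<cdot> ?e"
    using hs hx h1 h2 h3 d by (simp add: y1_def add_simps add_ac)
  then show "\<exists>T' e x' y'. is_epi C e \<and> e \<in> hom C T' T \<and> x' \<in> hom C T' (fst X n) \<and>
      y' \<in> hom C T' (fst Y (n - 1)) \<and> snd X n \<cdot> x' = x \<cdot> e \<and>
      y \<cdot> e = f n \<cdot> x' \<oplus> snd Y (n - 1) \<cdot> y'"
    using e x'_hom e3(3) dx' by metis
qed

end

section \<open>Functor categories\<close>

lemma is_kernel_liftE:
  assumes "is_kernel C f k" "f \<in> hom C X Y" "k \<in> hom C K X" "g \<in> hom C T X" "Comp C f g = Zero C T Y"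
  obtains u where "u \<in> hom C T K" "Comp C k u = g"
  using is_kernel_lift[OF assms(1), of g T] assms(2-5) homD(2,3)[OF assms(2)] homD(2)[OF assms(3)] by auto

lemma is_cokernel_descE:
  assumes "is_cokernel C f k" "f \<in> hom C X Y" "k \<in> hom C Y K" "g \<in> hom C Y T" "Comp C g f = Zero C X T"
  obtains u where "u \<in> hom C K T" "Comp C u k = g"
  using is_cokernel_desc[OF assms(1), of g T] assms(2-5) homD(2,3)[OF assms(2)] homD(3)[OF assms(3)] by auto

lemma quasi_isosD:
  assumes "(X, Y, f) \<in> quasi_isos C" "is_cohomology C X n i p" "is_cohomology C Y n i' p'"
    "z \<in> hom C (Dom C i) (Dom C i')" "Comp C i' z = Comp C (f n) i"
    "h \<in> hom C (Cod C p) (Cod C p')" "Comp C h p = Comp C p' z"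
  shows "is_iso C h"
  using assms unfolding quasi_isos_def by (simp add: complexes_sel)

lemma functor_category_Obj:
  "F \<in> Obj (functor_category I C) \<longleftrightarrow>
    is_functor I C F \<and> fst F \<in> extensional (Obj I) \<and> snd F \<in> extensional (Arr I)"
  by (simp add: functor_category_def Let_def)

lemma functor_category_hom:
  "f \<in> hom (functor_category I C) F G \<longleftrightarrow> F \<in> Obj (functor_category I C) \<and>
    G \<in> Obj (functor_category I C) \<and> f = (F, G, snd (snd f)) \<and>
    is_nat_trans I C F G (snd (snd f)) \<and> snd (snd f) \<in> extensional (Obj I)"
  by (cases f) (auto simp: functor_category_def Let_def hom_def)

lemma functor_category_sel:
  "Dom (functor_category I C) f = fst f" "Cod (functor_category I C) f = fst (snd f)"
  "Idn (functor_category I C) F = (F, F, \<lambda>i\<in>Obj I. Idn C (fst F i))"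
  "Comp (functor_category I C) g f =
    (fst f, fst (snd g), \<lambda>i\<in>Obj I. Comp C (snd (snd g) i) (snd (snd f) i))"
  "Add (functor_category I C) f g =
    (fst f, fst (snd f), \<lambda>i\<in>Obj I. Add C (snd (snd f) i) (snd (snd g) i))"
  "Zero (functor_category I C) F G = (F, G, \<lambda>i\<in>Obj I. Zero C (fst F i) (fst G i))"
  "Neg (functor_category I C) f = (fst f, fst (snd f), \<lambda>i\<in>Obj I. Neg C (snd (snd f) i))"
  by (cases f; cases g; simp add: functor_category_def Let_def)+

locale functor_cat = I: category I + C: preadditive_category C
  for I :: "('i, 'j, 'y) cat_scheme" and C :: "('o, 'a, 'z) addcat_scheme"
begin

abbreviation FC where "FC \<equiv> functor_category I C"

lemma F_Obj: "F \<in> Obj FC \<Longrightarrow> i \<in> Obj I \<Longrightarrow> fst F i \<in> Obj C"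
  by (auto simp: functor_category_Obj is_functor_def)

lemma F_hom: "F \<in> Obj FC \<Longrightarrow> \<phi> \<in> hom I i j \<Longrightarrow> snd F \<phi> \<in> hom C (fst F i) (fst F j)"
  by (auto simp: functor_category_Obj is_functor_def hom_def)

lemma F_Idn: "F \<in> Obj FC \<Longrightarrow> i \<in> Obj I \<Longrightarrow> snd F (Idn I i) = Idn C (fst F i)"
  by (auto simp: functor_category_Obj is_functor_def)

lemma F_Comp: "F \<in> Obj FC \<Longrightarrow> \<phi> \<in> hom I i j \<Longrightarrow> \<psi> \<in> hom I j k \<Longrightarrow>
    snd F (Comp I \<psi> \<phi>) = Comp C (snd F \<psi>) (snd F \<phi>)"
  by (auto simp: functor_category_Obj is_functor_def hom_def)

lemma at_hom: "f \<in> hom FC F G \<Longrightarrow> i \<in> Obj I \<Longrightarrow> snd (snd f) i \<in> hom C (fst F i) (fst G i)"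
  by (simp add: functor_category_hom is_nat_trans_def)

lemma at_nat: "f \<in> hom FC F G \<Longrightarrow> \<phi> \<in> hom I i j \<Longrightarrow>
    Comp C (snd (snd f) j) (snd F \<phi>) = Comp C (snd G \<phi>) (snd (snd f) i)"
  unfolding functor_category_hom is_nat_trans_def using homD[of \<phi> I i j] by blast

lemma hom_FC_Obj: "f \<in> hom FC F G \<Longrightarrow> F \<in> Obj FC \<and> G \<in> Obj FC"
  by (simp add: functor_category_hom)

lemma hom_FC_fst: "f \<in> hom FC F G \<Longrightarrow> fst f = F \<and> fst (snd f) = G"
  by (subst (asm) functor_category_hom) (metis fst_conv snd_conv)

lemma FC_ObjI:
  assumes "\<And>i. i \<in> Obj I \<Longrightarrow> K i \<in> Obj C"
    "\<And>\<phi> i j. \<phi> \<in> hom I i j \<Longrightarrow> L \<phi> \<in> hom C (K i) (K j)"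
    "\<And>i. i \<in> Obj I \<Longrightarrow> L (Idn I i) = Idn C (K i)"
    "\<And>\<phi> \<psi> i j k. \<phi> \<in> hom I i j \<Longrightarrow> \<psi> \<in> hom I j k \<Longrightarrow> L (Comp I \<psi> \<phi>) = Comp C (L \<psi>) (L \<phi>)"
  shows "(restrict K (Obj I), restrict L (Arr I)) \<in> Obj FC"
  unfolding functor_category_Obj is_functor_def
  using assms I.Dom_Obj I.Cod_Obj I.Idn_Arr I.Comp_Arr Arr_hom[of _ I]
  by (auto simp: hom_def)

lemma FC_homI:
  assumes "F \<in> Obj FC" "G \<in> Obj FC"
    "\<And>i. i \<in> Obj I \<Longrightarrow> \<eta> i \<in> hom C (fst F i) (fst G i)"
    "\<And>\<phi> i j. \<phi> \<in> hom I i j \<Longrightarrow> Comp C (\<eta> j) (snd F \<phi>) = Comp C (snd G \<phi>) (\<eta> i)"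
  shows "(F, G, restrict \<eta> (Obj I)) \<in> hom FC F G"
  unfolding functor_category_hom is_nat_trans_def
  using assms I.Dom_Obj I.Cod_Obj Arr_hom[of _ I] by auto

lemma FC_eqI:
  assumes "f \<in> hom FC F G" "g \<in> hom FC F G" "\<And>i. i \<in> Obj I \<Longrightarrow> snd (snd f) i = snd (snd g) i"
  shows "f = g"
proof -
  have "snd (snd f) = snd (snd g)"
    using assms by (intro extensionalityI[of _ "Obj I"]) (auto simp: functor_category_hom)
  moreover have "f = (F, G, snd (snd f))" "g = (F, G, snd (snd g))"
    using assms by (simp_all add: functor_category_hom)
  ultimately show ?thesis by metis
qed

lemma FC_Comp_hom: "\<lbrakk>f \<in> hom FC F G; g \<in> hom FC G H\<rbrakk> \<Longrightarrow> Comp FC g f \<in> hom FC F H"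
proof -
  assume f: "f \<in> hom FC F G" and g: "g \<in> hom FC G H"
  have "(F, H, \<lambda>i\<in>Obj I. Comp C (snd (snd g) i) (snd (snd f) i)) \<in> hom FC F H"
  proof (rule FC_homI)
    fix \<phi> i j assume \<phi>: "\<phi> \<in> hom I i j"
    note ij = I.hom_Obj[OF \<phi>]
    note hs = at_hom[OF f, of i, unfolded hom_def] at_hom[OF f, of j, unfolded hom_def]
      at_hom[OF g, of i, unfolded hom_def] at_hom[OF g, of j, unfolded hom_def]
      F_hom[OF _ \<phi>, of F, unfolded hom_def] F_hom[OF _ \<phi>, of G, unfolded hom_def]
      F_hom[OF _ \<phi>, of H, unfolded hom_def] hom_FC_Obj[OF f] hom_FC_Obj[OF g] ij
    have "Comp C (Comp C (snd (snd g) j) (snd (snd f) j)) (snd F \<phi>) =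
        Comp C (Comp C (snd (snd g) j) (snd G \<phi>)) (snd (snd f) i)"
      using hs at_nat[OF f \<phi>] by (simp add: C.cat_simps)
    also have "\<dots> = Comp C (snd H \<phi>) (Comp C (snd (snd g) i) (snd (snd f) i))"
      unfolding at_nat[OF g \<phi>] using hs by (simp add: C.cat_simps)
    finally show "Comp C (Comp C (snd (snd g) j) (snd (snd f) j)) (snd F \<phi>) =
        Comp C (snd H \<phi>) (Comp C (snd (snd g) i) (snd (snd f) i))" .
  qed (use hom_FC_Obj[OF f] hom_FC_Obj[OF g] C.Comp_hom[OF at_hom[OF f] at_hom[OF g]] in auto)
  then show ?thesis by (simp add: functor_category_sel hom_FC_fst[OF f] hom_FC_fst[OF g])
qed

lemma FC_Idn_hom:
  assumes F: "F \<in> Obj FC" shows "Idn FC F \<in> hom FC F F"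
  unfolding functor_category_sel
  by (rule FC_homI[OF F F C.Idn_hom[OF F_Obj[OF F]]])
    (use C.Comp_Idn_left[OF F_hom[OF F]] C.Comp_Idn_right[OF F_hom[OF F]] in auto)

lemma category_FC: "category FC"
proof
  fix f assume f: "f \<in> Arr FC"
  then show "Dom FC f \<in> Obj FC" "Cod FC f \<in> Obj FC"
    by (auto simp: functor_category_def Let_def)
next
  fix F assume "F \<in> Obj FC"
  then show "Idn FC F \<in> hom FC F F" by (rule FC_Idn_hom)
next
  fix f g F G H assume "f \<in> hom FC F G" "g \<in> hom FC G H"
  then show "Comp FC g f \<in> hom FC F H" by (rule FC_Comp_hom)
next
  fix f F G assume f: "f \<in> hom FC F G"
  note Obj = hom_FC_Obj[OF f]
  show "Comp FC f (Idn FC F) = f" "Comp FC (Idn FC G) f = f"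
    by (rule FC_eqI[OF FC_Comp_hom[OF FC_Idn_hom f] f] FC_eqI[OF FC_Comp_hom[OF f FC_Idn_hom] f];
        use Obj C.Comp_Idn_left[OF at_hom[OF f]] C.Comp_Idn_right[OF at_hom[OF f]] in
          \<open>simp add: functor_category_sel\<close>)+
next
  fix f g h E F G H assume h: "f \<in> hom FC E F" "g \<in> hom FC F G" "h \<in> hom FC G H"
  show "Comp FC h (Comp FC g f) = Comp FC (Comp FC h g) f"
    using C.Comp_assoc[OF at_hom[OF h(1)] at_hom[OF h(2)] at_hom[OF h(3)]]
    by (intro FC_eqI[OF FC_Comp_hom[OF FC_Comp_hom[OF h(1,2)] h(3)] FC_Comp_hom[OF h(1) FC_Comp_hom[OF h(2,3)]]])
      (simp add: functor_category_sel)
qed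

lemma FC_Add_hom:
  assumes f: "f \<in> hom FC F G" and g: "g \<in> hom FC F G"
  shows "Add FC f g \<in> hom FC F G"
proof -
  have "(F, G, \<lambda>i\<in>Obj I. Add C (snd (snd f) i) (snd (snd g) i)) \<in> hom FC F G"
  proof (rule FC_homI)
    fix \<phi> i j assume \<phi>: "\<phi> \<in> hom I i j"
    show "Comp C (Add C (snd (snd f) j) (snd (snd g) j)) (snd F \<phi>) =
        Comp C (snd G \<phi>) (Add C (snd (snd f) i) (snd (snd g) i))"
      using at_hom[OF f, of i, unfolded hom_def] at_hom[OF f, of j, unfolded hom_def]
        at_hom[OF g, of i, unfolded hom_def] at_hom[OF g, of j, unfolded hom_def]
        F_hom[OF _ \<phi>, of F, unfolded hom_def] F_hom[OF _ \<phi>, of G, unfolded hom_def]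
        hom_FC_Obj[OF f] I.hom_Obj[OF \<phi>] at_nat[OF f \<phi>] at_nat[OF g \<phi>]
      by (simp add: C.add_simps)
  qed (use hom_FC_Obj[OF f] C.Add_hom[OF at_hom[OF f] at_hom[OF g]] in auto)
  then show ?thesis by (simp add: functor_category_sel hom_FC_fst[OF f])
qed

lemma FC_Neg_hom:
  assumes f: "f \<in> hom FC F G"
  shows "Neg FC f \<in> hom FC F G"
proof -
  have "(F, G, \<lambda>i\<in>Obj I. Neg C (snd (snd f) i)) \<in> hom FC F G"
  proof (rule FC_homI)
    fix \<phi> i j assume \<phi>: "\<phi> \<in> hom I i j"
    show "Comp C (Neg C (snd (snd f) j)) (snd F \<phi>) = Comp C (snd G \<phi>) (Neg C (snd (snd f) i))"
      using at_hom[OF f, of i, unfolded hom_def] at_hom[OF f, of j, unfolded hom_def]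
        F_hom[OF _ \<phi>, of F, unfolded hom_def] F_hom[OF _ \<phi>, of G, unfolded hom_def]
        hom_FC_Obj[OF f] I.hom_Obj[OF \<phi>] at_nat[OF f \<phi>]
      by (simp add: C.add_simps)
  qed (use hom_FC_Obj[OF f] C.Neg_hom[OF at_hom[OF f]] in auto)
  then show ?thesis by (simp add: functor_category_sel hom_FC_fst[OF f])
qed

lemma FC_Zero_hom:
  assumes F: "F \<in> Obj FC" and G: "G \<in> Obj FC"
  shows "Zero FC F G \<in> hom FC F G"
  unfolding functor_category_sel
proof (rule FC_homI[OF F G])
  fix \<phi> i j assume \<phi>: "\<phi> \<in> hom I i j"
  show "Comp C (Zero C (fst F j) (fst G j)) (snd F \<phi>) = Comp C (snd G \<phi>) (Zero C (fst F i) (fst G i))"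
    using F_hom[OF F \<phi>, unfolded hom_def] F_hom[OF G \<phi>, unfolded hom_def]
      F_Obj[OF F] F_Obj[OF G] I.hom_Obj[OF \<phi>] by (simp add: C.add_simps)
qed (use F_Obj[OF F] F_Obj[OF G] C.Zero_hom in auto)

lemma preadditive_FC: "preadditive_category FC"
proof -
  interpret category FC by (rule category_FC)
  show ?thesis
  proof
    fix f g F G assume "f \<in> hom FC F G" "g \<in> hom FC F G"
    then show "Add FC f g \<in> hom FC F G" by (rule FC_Add_hom)
  next
    fix F G assume "F \<in> Obj FC" "G \<in> Obj FC"
    then show "Zero FC F G \<in> hom FC F G" by (rule FC_Zero_hom)
  next
    fix f F G assume "f \<in> hom FC F G"
    then show "Neg FC f \<in> hom FC F G" by (rule FC_Neg_hom)
  next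
    fix f g h F G assume h: "f \<in> hom FC F G" "g \<in> hom FC F G" "h \<in> hom FC F G"
    show "Add FC (Add FC f g) h = Add FC f (Add FC g h)"
      by (rule FC_eqI[OF FC_Add_hom[OF FC_Add_hom[OF h(1,2)] h(3)] FC_Add_hom[OF h(1) FC_Add_hom[OF h(2,3)]]])
        (simp add: functor_category_sel C.Add_assoc[OF at_hom[OF h(1)] at_hom[OF h(2)] at_hom[OF h(3)]])
  next
    fix f g F G assume h: "f \<in> hom FC F G" "g \<in> hom FC F G"
    show "Add FC f g = Add FC g f"
      by (rule FC_eqI[OF FC_Add_hom[OF h] FC_Add_hom[OF h(2,1)]])
        (simp add: functor_category_sel C.Add_commute[OF at_hom[OF h(1)] at_hom[OF h(2)]])
  next
    fix f F G assume h: "f \<in> hom FC F G"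
    note Obj = hom_FC_Obj[OF h]
    show "Add FC f (Zero FC F G) = f"
      by (rule FC_eqI[OF FC_Add_hom[OF h FC_Zero_hom] h])
        (simp_all add: Obj functor_category_sel C.Add_Zero[OF at_hom[OF h]])
    show "Add FC f (Neg FC f) = Zero FC F G"
      by (rule FC_eqI[OF FC_Add_hom[OF h FC_Neg_hom[OF h]] FC_Zero_hom])
        (simp_all add: Obj functor_category_sel C.Add_Neg[OF at_hom[OF h]])
  next
    fix f g h F G H assume h: "f \<in> hom FC F G" "g \<in> hom FC F G" "h \<in> hom FC G H"
    show "Comp FC h (Add FC f g) = Add FC (Comp FC h f) (Comp FC h g)"
      by (rule FC_eqI[OF FC_Comp_hom[OF FC_Add_hom[OF h(1,2)] h(3)]
            FC_Add_hom[OF FC_Comp_hom[OF h(1,3)] FC_Comp_hom[OF h(2,3)]]])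
        (simp add: functor_category_sel C.Comp_Add_left[OF at_hom[OF h(1)] at_hom[OF h(2)] at_hom[OF h(3)]])
  next
    fix f g h F G H assume h: "f \<in> hom FC F G" "g \<in> hom FC F G" "h \<in> hom FC H F"
    show "Comp FC (Add FC f g) h = Add FC (Comp FC f h) (Comp FC g h)"
      by (rule FC_eqI[OF FC_Comp_hom[OF h(3) FC_Add_hom[OF h(1,2)]]
            FC_Add_hom[OF FC_Comp_hom[OF h(3,1)] FC_Comp_hom[OF h(3,2)]]])
        (simp add: functor_category_sel C.Comp_Add_right[OF at_hom[OF h(1)] at_hom[OF h(2)] at_hom[OF h(3)]])
  qed
qed

lemma FC_iso_at:
  assumes f: "f \<in> hom FC F G" and "is_iso FC f" "i \<in> Obj I"
  shows "is_iso C (snd (snd f) i)"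
proof -
  interpret category FC by (rule category_FC)
  obtain g where g: "g \<in> hom FC G F" "Comp FC g f = Idn FC F" "Comp FC f g = Idn FC G"
    using is_isoE[OF assms(2) f] by blast
  have "snd (snd (Comp FC g f)) i = Idn C (fst F i)" "snd (snd (Comp FC f g)) i = Idn C (fst G i)"
    unfolding g(2,3) using assms(3) by (simp_all add: functor_category_sel)
  then show ?thesis
    using is_isoI[OF at_hom[OF f assms(3)] at_hom[OF g(1) assms(3)]] assms(3)
    by (simp add: functor_category_sel)
qed

lemma FC_isoI:
  assumes f: "f \<in> hom FC F G" and iso: "\<And>i. i \<in> Obj I \<Longrightarrow> is_iso C (snd (snd f) i)"
  shows "is_iso FC f"
proof -
  interpret category FC by (rule category_FC)
  note Obj = hom_FC_Obj[OF f]
  have "\<exists>g. g \<in> hom C (fst G i) (fst F i) \<and> Comp C g (snd (snd f) i) = Idn C (fst F i) \<and>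
      Comp C (snd (snd f) i) g = Idn C (fst G i)" if "i \<in> Obj I" for i
    using C.is_isoE[OF iso at_hom[OF f]] that by metis
  then obtain g where g: "\<And>i. i \<in> Obj I \<Longrightarrow> g i \<in> hom C (fst G i) (fst F i)"
    "\<And>i. i \<in> Obj I \<Longrightarrow> Comp C (g i) (snd (snd f) i) = Idn C (fst F i)"
    "\<And>i. i \<in> Obj I \<Longrightarrow> Comp C (snd (snd f) i) (g i) = Idn C (fst G i)" by metis
  have gh: "(G, F, restrict g (Obj I)) \<in> hom FC G F"
  proof (rule FC_homI)
    fix \<phi> i j assume \<phi>: "\<phi> \<in> hom I i j"
    have ij: "i \<in> Obj I" "j \<in> Obj I" using I.hom_Obj[OF \<phi>] by auto
    note F\<phi> = F_hom[OF conjunct1[OF Obj] \<phi>] and G\<phi> = F_hom[OF conjunct2[OF Obj] \<phi>]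
    show "Comp C (g j) (snd G \<phi>) = Comp C (snd F \<phi>) (g i)"
    proof (rule C.iso_cancel_left[OF iso[OF ij(2)] at_hom[OF f ij(2)]])
      have "Comp C (snd (snd f) j) (Comp C (g j) (snd G \<phi>)) = snd G \<phi>"
        using C.Comp_assoc[OF G\<phi> g(1)[OF ij(2)] at_hom[OF f ij(2)]] g(3)[OF ij(2)] C.Comp_Idn_left[OF G\<phi>]
        by simp
      moreover have "Comp C (snd (snd f) j) (Comp C (snd F \<phi>) (g i)) = snd G \<phi>"
        using C.Comp_assoc[OF g(1)[OF ij(1)] F\<phi> at_hom[OF f ij(2)]] at_nat[OF f \<phi>]
          C.Comp_assoc[OF g(1)[OF ij(1)] at_hom[OF f ij(1)] G\<phi>] g(3)[OF ij(1)] C.Comp_Idn_right[OF G\<phi>]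
        by simp
      ultimately show "Comp C (snd (snd f) j) (Comp C (g j) (snd G \<phi>)) =
          Comp C (snd (snd f) j) (Comp C (snd F \<phi>) (g i))" by simp
    qed (use C.Comp_hom[OF G\<phi> g(1)[OF ij(2)]] C.Comp_hom[OF g(1)[OF ij(1)] F\<phi>] in auto)
  qed (use Obj g in auto)
  show ?thesis
    by (rule is_isoI[OF f gh]; rule FC_eqI[OF FC_Comp_hom[OF f gh] FC_Idn_hom]
        FC_eqI[OF FC_Comp_hom[OF gh f] FC_Idn_hom])
      (use Obj g in \<open>auto simp: functor_category_sel\<close>)
qed

end

subsection \<open>Kernels and cokernels are computed pointwise\<close>

context preadditive_category
begin

lemma kernel_compare:
  assumes k: "is_kernel C f k" and k': "k' \<in> Arr C" "Cod C k' = Dom C f"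
    and v: "v \<in> hom C (Dom C k') (Dom C k)" "k \<cdot> v = k'" and w: "w \<in> hom C (Dom C k) (Dom C k')" "k' \<cdot> w = k"
    and wv: "w \<cdot> v = Idn C (Dom C k')"
  shows "is_kernel C f k'"
proof -
  have k1: "f \<in> Arr C" "k \<in> Arr C" "Cod C k = Dom C f" "f \<cdot> k = Zero C (Dom C k) (Cod C f)"
    using k by (auto simp: is_kernel_def)
  have "f \<cdot> k' = (f \<cdot> k) \<cdot> v" unfolding v(2)[symmetric] using k1(1-3) v(1) by (simp add: hom_def cat_simps)
  also have "\<dots> = Zero C (Dom C k') (Cod C f)" unfolding k1(4) using k1 v(1) by (auto simp: hom_def add_simps)
  finally have fk': "f \<cdot> k' = Zero C (Dom C k') (Cod C f)" .
  have "\<exists>!u. u \<in> hom C X (Dom C k') \<and> k' \<cdot> u = g"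
    if g: "g \<in> hom C X (Dom C f)" "f \<cdot> g = Zero C X (Cod C f)" for X g
  proof -
    obtain u where u: "u \<in> hom C X (Dom C k)" "k \<cdot> u = g" using is_kernel_lift[OF k g] by blast
    have "k' \<cdot> (w \<cdot> u) = (k' \<cdot> w) \<cdot> u" using k' w(1) u(1) by (simp add: hom_def cat_simps)
    then have 1: "w \<cdot> u \<in> hom C X (Dom C k')" "k' \<cdot> (w \<cdot> u) = g"
      using Comp_hom[OF u(1) w(1)] w(2) u(2) by auto
    have "u' = w \<cdot> u" if u': "u' \<in> hom C X (Dom C k')" "k' \<cdot> u' = g" for u'
    proof -
      have "k \<cdot> (v \<cdot> u') = (k \<cdot> v) \<cdot> u'" using k1(2) v(1) u'(1) by (simp add: hom_def cat_simps)
      then have "k \<cdot> (v \<cdot> u') = k \<cdot> u" using v(2) u' u by simp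
      then have "v \<cdot> u' = u"
        using mono_cancel[OF kernel_mono[OF k] Arr_hom[OF k1(2)] Comp_hom[OF u'(1) v(1)] u(1)] by simp
      then have "w \<cdot> u = (w \<cdot> v) \<cdot> u'" using Comp_assoc[OF u'(1) v(1) w(1)] by simp
      then show ?thesis using wv Comp_Idn_left[OF u'(1)] by simp
    qed
    with 1 show ?thesis by blast
  qed
  then show ?thesis using k1 k' fk' by (auto simp: is_kernel_def)
qed

lemma cokernel_compare:
  assumes k: "is_cokernel C f k" and k': "k' \<in> Arr C" "Dom C k' = Cod C f"
    and v: "v \<in> hom C (Cod C k) (Cod C k')" "v \<cdot> k = k'" and w: "w \<in> hom C (Cod C k') (Cod C k)" "w \<cdot> k' = k"
    and wv: "v \<cdot> w = Idn C (Cod C k')"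
  shows "is_cokernel C f k'"
proof -
  have k1: "f \<in> Arr C" "k \<in> Arr C" "Dom C k = Cod C f" "k \<cdot> f = Zero C (Dom C f) (Cod C k)"
    using k by (auto simp: is_cokernel_def)
  have "k' \<cdot> f = v \<cdot> (k \<cdot> f)" unfolding v(2)[symmetric] using k1(1-3) v(1) by (simp add: hom_def cat_simps)
  also have "\<dots> = Zero C (Dom C f) (Cod C k')" unfolding k1(4) using k1 v(1) by (auto simp: hom_def add_simps)
  finally have fk': "k' \<cdot> f = Zero C (Dom C f) (Cod C k')" .
  have "\<exists>!u. u \<in> hom C (Cod C k') X \<and> u \<cdot> k' = g"
    if g: "g \<in> hom C (Cod C f) X" "g \<cdot> f = Zero C (Dom C f) X" for X g
  proof -
    obtain u where u: "u \<in> hom C (Cod C k) X" "u \<cdot> k = g" using is_cokernel_desc[OF k g] by blast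
    have "(u \<cdot> w) \<cdot> k' = u \<cdot> (w \<cdot> k')" using k' w(1) u(1) by (simp add: hom_def cat_simps)
    then have 1: "u \<cdot> w \<in> hom C (Cod C k') X" "(u \<cdot> w) \<cdot> k' = g"
      using Comp_hom[OF w(1) u(1)] w(2) u(2) by auto
    have "u' = u \<cdot> w" if u': "u' \<in> hom C (Cod C k') X" "u' \<cdot> k' = g" for u'
    proof -
      have "(u' \<cdot> v) \<cdot> k = u' \<cdot> (v \<cdot> k)" using k1(2) v(1) u'(1) by (simp add: hom_def cat_simps)
      then have "(u' \<cdot> v) \<cdot> k = u \<cdot> k" using v(2) u' u by simp
      then have "u' \<cdot> v = u"
        using epi_cancel[OF cokernel_epi[OF k] Arr_hom[OF k1(2)] Comp_hom[OF v(1) u'(1)] u(1)] by simp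
      then have "u \<cdot> w = u' \<cdot> (v \<cdot> w)" using Comp_assoc[OF w(1) v(1) u'(1)] by simp
      then show ?thesis using wv Comp_Idn_right[OF u'(1)] by simp
    qed
    with 1 show ?thesis by blast
  qed
  then show ?thesis using k1 k' fk' by (auto simp: is_cokernel_def)
qed

end

locale abelian_functor_cat = functor_cat I C + C: abelian_category C
  for I :: "('i, 'j, 'y) cat_scheme" and C :: "('o, 'a, 'z) addcat_scheme"
begin

text \<open>The kernels of the components form a diagram: the universal property supplies the structure
  maps, and they are functorial because kernels are monic.\<close>

lemma FC_kernel_exists:
  assumes \<alpha>: "\<alpha> \<in> hom FC F G"
  obtains K \<kappa> where "\<kappa> \<in> hom FC K F" "is_kernel FC \<alpha> \<kappa>"
    "\<And>i. i \<in> Obj I \<Longrightarrow> is_kernel C (snd (snd \<alpha>) i) (snd (snd \<kappa>) i)"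
proof -
  interpret FC: preadditive_category FC by (rule preadditive_FC)
  have F: "F \<in> Obj FC" and G: "G \<in> Obj FC" using hom_FC_Obj[OF \<alpha>] by auto
  let ?\<alpha> = "\<lambda>i. snd (snd \<alpha>) i"
  have "\<exists>k. is_kernel C (?\<alpha> i) k" if "i \<in> Obj I" for i
    using C.ex_kernel homD(1)[OF at_hom[OF \<alpha> that]] by blast
  then obtain k where k: "\<And>i. i \<in> Obj I \<Longrightarrow> is_kernel C (?\<alpha> i) (k i)" by metis
  define K where "K i = Dom C (k i)" for i
  have k_hom: "k i \<in> hom C (K i) (fst F i)" and \<alpha>k: "Comp C (?\<alpha> i) (k i) = Zero C (K i) (fst G i)"
    and D: "Dom C (?\<alpha> i) = fst F i" "Cod C (?\<alpha> i) = fst G i" if "i \<in> Obj I" for i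
    using k[OF that] at_hom[OF \<alpha> that] by (auto simp: is_kernel_def hom_def K_def)
  note k_mono = C.mono_cancel[OF C.kernel_mono[OF k] k_hom]
  have "\<exists>u. u \<in> hom C (K (Dom I \<phi>)) (K (Cod I \<phi>)) \<and> Comp C (k (Cod I \<phi>)) u = Comp C (snd F \<phi>) (k (Dom I \<phi>))"
    if "\<phi> \<in> Arr I" for \<phi>
  proof -
    define i j where "i = Dom I \<phi>" and "j = Cod I \<phi>"
    have \<phi>: "\<phi> \<in> hom I i j" using that by (simp add: hom_def i_def j_def)
    then have ij: "i \<in> Obj I" "j \<in> Obj I" using I.hom_Obj by auto
    have "Comp C (?\<alpha> j) (Comp C (snd F \<phi>) (k i)) = Comp C (Comp C (?\<alpha> j) (snd F \<phi>)) (k i)"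
      using C.Comp_assoc[OF k_hom[OF ij(1)] F_hom[OF F \<phi>] at_hom[OF \<alpha> ij(2)]] .
    also have "\<dots> = Comp C (snd G \<phi>) (Comp C (?\<alpha> i) (k i))"
      using C.Comp_assoc[OF k_hom[OF ij(1)] at_hom[OF \<alpha> ij(1)] F_hom[OF G \<phi>]] at_nat[OF \<alpha> \<phi>] by simp
    also have "\<dots> = Zero C (K i) (fst G j)" unfolding \<alpha>k[OF ij(1)]
      using F_hom[OF G \<phi>] C.hom_Obj[OF k_hom[OF ij(1)]] by (simp add: hom_def C.add_simps)
    finally show ?thesis
      using is_kernel_lift[OF k[OF ij(2)], of "Comp C (snd F \<phi>) (k i)" "K i"]
        C.Comp_hom[OF k_hom[OF ij(1)] F_hom[OF F \<phi>]] D[OF ij(2)]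
      unfolding i_def[symmetric] j_def[symmetric] by (auto simp: K_def)
  qed
  then obtain L where L: "\<And>\<phi>. \<phi> \<in> Arr I \<Longrightarrow> L \<phi> \<in> hom C (K (Dom I \<phi>)) (K (Cod I \<phi>))"
    "\<And>\<phi>. \<phi> \<in> Arr I \<Longrightarrow> Comp C (k (Cod I \<phi>)) (L \<phi>) = Comp C (snd F \<phi>) (k (Dom I \<phi>))" by metis
  have L_hom: "L \<phi> \<in> hom C (K i) (K j)" and L_eq: "Comp C (k j) (L \<phi>) = Comp C (snd F \<phi>) (k i)"
    if "\<phi> \<in> hom I i j" for \<phi> i j
    using L[of \<phi>] that by (auto simp: hom_def)
  have KO: "K i \<in> Obj C" if "i \<in> Obj I" for i using C.hom_Obj[OF k_hom[OF that]] by simp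
  let ?K = "(restrict K (Obj I), restrict L (Arr I))"
  have K: "?K \<in> Obj FC"
  proof (rule FC_ObjI[OF KO L_hom])
    fix i assume i: "i \<in> Obj I"
    show "L (Idn I i) = Idn C (K i)"
      using L_eq[OF I.Idn_hom[OF i]] F_Idn[OF F i] C.Comp_Idn_left[OF k_hom[OF i]]
        C.Comp_Idn_right[OF k_hom[OF i]]
      by (intro k_mono[OF i i L_hom[OF I.Idn_hom[OF i]] C.Idn_hom[OF KO[OF i]]]) simp
  next
    fix \<phi> \<psi> i j l assume \<phi>: "\<phi> \<in> hom I i j" and \<psi>: "\<psi> \<in> hom I j l"
    have ij: "i \<in> Obj I" "j \<in> Obj I" "l \<in> Obj I" using I.hom_Obj \<phi> \<psi> by auto
    have "Comp C (k l) (Comp C (L \<psi>) (L \<phi>)) = Comp C (snd F \<psi>) (Comp C (k j) (L \<phi>))"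
      using C.Comp_assoc[OF L_hom[OF \<phi>] L_hom[OF \<psi>] k_hom[OF ij(3)]] L_eq[OF \<psi>]
        C.Comp_assoc[OF L_hom[OF \<phi>] k_hom[OF ij(2)] F_hom[OF F \<psi>]] by simp
    also have "\<dots> = Comp C (k l) (L (Comp I \<psi> \<phi>))"
      using C.Comp_assoc[OF k_hom[OF ij(1)] F_hom[OF F \<phi>] F_hom[OF F \<psi>]] L_eq[OF \<phi>]
        L_eq[OF I.Comp_hom[OF \<phi> \<psi>]] F_Comp[OF F \<phi> \<psi>] by simp
    finally show "L (Comp I \<psi> \<phi>) = Comp C (L \<psi>) (L \<phi>)"
      using k_mono[OF ij(3,3) L_hom[OF I.Comp_hom[OF \<phi> \<psi>]] C.Comp_hom[OF L_hom[OF \<phi>] L_hom[OF \<psi>]]] by simp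
  qed
  define \<kappa> where "\<kappa> = (?K, F, restrict k (Obj I))"
  have \<kappa>: "\<kappa> \<in> hom FC ?K F"
    unfolding \<kappa>_def by (rule FC_homI[OF K F]) (use k_hom L_eq I.hom_Obj in \<open>auto simp: hom_def\<close>)
  have at\<kappa>: "snd (snd \<kappa>) i = k i" if "i \<in> Obj I" for i using that by (simp add: \<kappa>_def)
  have "is_kernel FC \<alpha> \<kappa>"
    unfolding is_kernel_def
  proof (intro conjI allI ballI impI)
    show "\<alpha> \<in> Arr FC" "\<kappa> \<in> Arr FC" "Cod FC \<kappa> = Dom FC \<alpha>" using \<alpha> \<kappa> by (auto simp: hom_def)
    show "Comp FC \<alpha> \<kappa> = Zero FC (Dom FC \<kappa>) (Cod FC \<alpha>)"
      unfolding homD(2)[OF \<kappa>] homD(3)[OF \<alpha>]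
      by (rule FC_eqI[OF FC.Comp_hom[OF \<kappa> \<alpha>] FC.Zero_hom[OF K G]])
        (simp add: functor_category_sel at\<kappa> \<alpha>k)
  next
    fix X g assume g: "g \<in> hom FC X (Dom FC \<alpha>)" and zero: "Comp FC \<alpha> g = Zero FC X (Cod FC \<alpha>)"
    then have g: "g \<in> hom FC X F" and zero: "Comp FC \<alpha> g = Zero FC X G" using \<alpha> by (auto simp: hom_def)
    have X: "X \<in> Obj FC" using hom_FC_Obj[OF g] by simp
    have "\<exists>u. u \<in> hom C (fst X i) (K i) \<and> Comp C (k i) u = snd (snd g) i" if i: "i \<in> Obj I" for i
    proof -
      have "snd (snd (Comp FC \<alpha> g)) i = Zero C (fst X i) (fst G i)"
        unfolding zero using i by (simp add: functor_category_sel)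
      then show ?thesis
        using is_kernel_lift[OF k[OF i], of "snd (snd g) i" "fst X i"] at_hom[OF g i] i D[OF i]
        by (auto simp: functor_category_sel K_def)
    qed
    then obtain u where u: "\<And>i. i \<in> Obj I \<Longrightarrow> u i \<in> hom C (fst X i) (K i)"
      "\<And>i. i \<in> Obj I \<Longrightarrow> Comp C (k i) (u i) = snd (snd g) i" by metis
    let ?u = "(X, ?K, restrict u (Obj I))"
    have uh: "?u \<in> hom FC X ?K"
    proof (rule FC_homI[OF X K])
      fix \<phi> i j assume \<phi>: "\<phi> \<in> hom I i j"
      have ij: "i \<in> Obj I" "j \<in> Obj I" using I.hom_Obj \<phi> by auto
      have "Comp C (k j) (Comp C (u j) (snd X \<phi>)) = Comp C (snd (snd g) j) (snd X \<phi>)"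
        using C.Comp_assoc[OF F_hom[OF X \<phi>] u(1)[OF ij(2)] k_hom[OF ij(2)]] u(2)[OF ij(2)] by simp
      also have "\<dots> = Comp C (k j) (Comp C (L \<phi>) (u i))"
        using at_nat[OF g \<phi>] C.Comp_assoc[OF u(1)[OF ij(1)] k_hom[OF ij(1)] F_hom[OF F \<phi>]]
          C.Comp_assoc[OF u(1)[OF ij(1)] L_hom[OF \<phi>] k_hom[OF ij(2)]] u(2)[OF ij(1)] L_eq[OF \<phi>] by simp
      finally show "Comp C (u j) (snd X \<phi>) = Comp C (snd ?K \<phi>) (u i)"
        using k_mono[OF ij(2,2) C.Comp_hom[OF F_hom[OF X \<phi>] u(1)[OF ij(2)]] C.Comp_hom[OF u(1)[OF ij(1)] L_hom[OF \<phi>]]]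
          homD(1)[OF \<phi>] by simp
    qed (use u in auto)
    have "Comp FC \<kappa> ?u = g"
      by (rule FC_eqI[OF FC.Comp_hom[OF uh \<kappa>] g]) (simp add: functor_category_sel at\<kappa> u(2))
    moreover have "u' = ?u" if u': "u' \<in> hom FC X ?K" "Comp FC \<kappa> u' = g" for u'
    proof (rule FC_eqI[OF u'(1) uh])
      fix i assume i: "i \<in> Obj I"
      have "Comp C (k i) (snd (snd u') i) = snd (snd g) i"
        unfolding u'(2)[symmetric] using i by (simp add: functor_category_sel at\<kappa>)
      moreover have "snd (snd u') i \<in> hom C (fst X i) (K i)" using at_hom[OF u'(1) i] i by simp
      ultimately show "snd (snd u') i = snd (snd ?u) i" using u i k_mono[OF i i] by simp
    qed
    ultimately show "\<exists>!u. u \<in> hom FC X (Dom FC \<kappa>) \<and> Comp FC \<kappa> u = g"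
      unfolding homD(2)[OF \<kappa>] using uh by blast
  qed
  then show ?thesis using that[OF \<kappa>] k at\<kappa> by simp
qed

text \<open>All kernels of an arrow are isomorphic, in particular to the pointwise one.\<close>

lemma FC_kernel_at:
  assumes k': "is_kernel FC \<alpha> \<kappa>'" and i: "i \<in> Obj I"
  shows "is_kernel C (snd (snd \<alpha>) i) (snd (snd \<kappa>') i)"
proof -
  interpret FC: preadditive_category FC by (rule preadditive_FC)
  define F G K' where "F = Dom FC \<alpha>" and "G = Cod FC \<alpha>" and "K' = Dom FC \<kappa>'"
  have \<alpha>: "\<alpha> \<in> hom FC F G" and \<kappa>': "\<kappa>' \<in> hom FC K' F" "Comp FC \<alpha> \<kappa>' = Zero FC K' G"
    using k' by (auto simp: is_kernel_def hom_def F_def G_def K'_def)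
  obtain K \<kappa> where \<kappa>: "\<kappa> \<in> hom FC K F" and k: "is_kernel FC \<alpha> \<kappa>"
    "\<And>i. i \<in> Obj I \<Longrightarrow> is_kernel C (snd (snd \<alpha>) i) (snd (snd \<kappa>) i)"
    by (rule FC_kernel_exists[OF \<alpha>]) (rule that)
  have zero: "Comp FC \<alpha> \<kappa> = Zero FC K G" using k(1) \<alpha> \<kappa> by (simp add: is_kernel_def hom_def)
  obtain w where w: "w \<in> hom FC K K'" "Comp FC \<kappa>' w = \<kappa>"
    by (rule is_kernel_liftE[OF k' \<alpha> \<kappa>'(1) \<kappa> zero])
  obtain v where v: "v \<in> hom FC K' K" "Comp FC \<kappa> v = \<kappa>'"
    by (rule is_kernel_liftE[OF k(1) \<alpha> \<kappa> \<kappa>'])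
  have K': "K' \<in> Obj FC" using hom_FC_Obj[OF \<kappa>'(1)] by simp
  have "Comp FC \<kappa>' (Comp FC w v) = Comp FC \<kappa>' (Idn FC K')"
    using FC.Comp_assoc[OF v(1) w(1) \<kappa>'(1)] w(2) v(2) FC.Comp_Idn_right[OF \<kappa>'(1)] by simp
  then have wv: "Comp FC w v = Idn FC K'"
    using FC.mono_cancel[OF FC.kernel_mono[OF k'] \<kappa>'(1) FC.Comp_hom[OF v(1) w(1)] FC.Idn_hom[OF K']] by simp
  note hs = at_hom[OF \<kappa> i] at_hom[OF \<kappa>'(1) i] at_hom[OF v(1) i] at_hom[OF w(1) i] at_hom[OF \<alpha> i]
  have e: "snd (snd (Comp FC \<kappa> v)) i = snd (snd \<kappa>') i" "snd (snd (Comp FC \<kappa>' w)) i = snd (snd \<kappa>) i"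
    "snd (snd (Comp FC w v)) i = snd (snd (Idn FC K')) i" unfolding v(2) w(2) wv by simp_all
  show ?thesis
    by (rule C.kernel_compare[OF k(2)[OF i], of _ "snd (snd v) i" "snd (snd w) i"])
      (use hs e i in \<open>auto simp: hom_def functor_category_sel\<close>)
qed

lemma FC_cokernel_exists:
  assumes \<alpha>: "\<alpha> \<in> hom FC F G"
  obtains K \<kappa> where "\<kappa> \<in> hom FC G K" "is_cokernel FC \<alpha> \<kappa>"
    "\<And>i. i \<in> Obj I \<Longrightarrow> is_cokernel C (snd (snd \<alpha>) i) (snd (snd \<kappa>) i)"
proof -
  interpret FC: preadditive_category FC by (rule preadditive_FC)
  have F: "F \<in> Obj FC" and G: "G \<in> Obj FC" using hom_FC_Obj[OF \<alpha>] by auto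
  let ?\<alpha> = "\<lambda>i. snd (snd \<alpha>) i"
  have "\<exists>k. is_cokernel C (?\<alpha> i) k" if "i \<in> Obj I" for i
    using C.ex_cokernel homD(1)[OF at_hom[OF \<alpha> that]] by blast
  then obtain k where k: "\<And>i. i \<in> Obj I \<Longrightarrow> is_cokernel C (?\<alpha> i) (k i)" by metis
  define K where "K i = Cod C (k i)" for i
  have k_hom: "k i \<in> hom C (fst G i) (K i)" and \<alpha>k: "Comp C (k i) (?\<alpha> i) = Zero C (fst F i) (K i)"
    and D: "Dom C (?\<alpha> i) = fst F i" "Cod C (?\<alpha> i) = fst G i" if "i \<in> Obj I" for i
    using k[OF that] at_hom[OF \<alpha> that] by (auto simp: is_cokernel_def hom_def K_def)
  note k_epi = C.epi_cancel[OF C.cokernel_epi[OF k] k_hom]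
  have "\<exists>u. u \<in> hom C (K (Dom I \<phi>)) (K (Cod I \<phi>)) \<and> Comp C u (k (Dom I \<phi>)) = Comp C (k (Cod I \<phi>)) (snd G \<phi>)"
    if "\<phi> \<in> Arr I" for \<phi>
  proof -
    define i j where "i = Dom I \<phi>" and "j = Cod I \<phi>"
    have \<phi>: "\<phi> \<in> hom I i j" using that by (simp add: hom_def i_def j_def)
    then have ij: "i \<in> Obj I" "j \<in> Obj I" using I.hom_Obj by auto
    have "Comp C (Comp C (k j) (snd G \<phi>)) (?\<alpha> i) = Comp C (k j) (Comp C (snd G \<phi>) (?\<alpha> i))"
      using C.Comp_assoc[OF at_hom[OF \<alpha> ij(1)] F_hom[OF G \<phi>] k_hom[OF ij(2)]] by simp
    also have "\<dots> = Comp C (Comp C (k j) (?\<alpha> j)) (snd F \<phi>)"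
      using C.Comp_assoc[OF F_hom[OF F \<phi>] at_hom[OF \<alpha> ij(2)] k_hom[OF ij(2)]] at_nat[OF \<alpha> \<phi>] by simp
    also have "\<dots> = Zero C (fst F i) (K j)" unfolding \<alpha>k[OF ij(2)]
      using F_hom[OF F \<phi>] C.hom_Obj[OF k_hom[OF ij(2)]] by (simp add: hom_def C.add_simps)
    finally show ?thesis
      using is_cokernel_desc[OF k[OF ij(1)], of "Comp C (k j) (snd G \<phi>)" "K j"]
        C.Comp_hom[OF F_hom[OF G \<phi>] k_hom[OF ij(2)]] D[OF ij(1)]
      unfolding i_def[symmetric] j_def[symmetric] by (auto simp: K_def)
  qed
  then obtain L where L: "\<And>\<phi>. \<phi> \<in> Arr I \<Longrightarrow> L \<phi> \<in> hom C (K (Dom I \<phi>)) (K (Cod I \<phi>))"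
    "\<And>\<phi>. \<phi> \<in> Arr I \<Longrightarrow> Comp C (L \<phi>) (k (Dom I \<phi>)) = Comp C (k (Cod I \<phi>)) (snd G \<phi>)" by metis
  have L_hom: "L \<phi> \<in> hom C (K i) (K j)" and L_eq: "Comp C (L \<phi>) (k i) = Comp C (k j) (snd G \<phi>)"
    if "\<phi> \<in> hom I i j" for \<phi> i j
    using L[of \<phi>] that by (auto simp: hom_def)
  have KO: "K i \<in> Obj C" if "i \<in> Obj I" for i using C.hom_Obj[OF k_hom[OF that]] by simp
  let ?K = "(restrict K (Obj I), restrict L (Arr I))"
  have K: "?K \<in> Obj FC"
  proof (rule FC_ObjI[OF KO L_hom])
    fix i assume i: "i \<in> Obj I"
    show "L (Idn I i) = Idn C (K i)"
      using L_eq[OF I.Idn_hom[OF i]] F_Idn[OF G i] C.Comp_Idn_left[OF k_hom[OF i]]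
        C.Comp_Idn_right[OF k_hom[OF i]]
      by (intro k_epi[OF i i L_hom[OF I.Idn_hom[OF i]] C.Idn_hom[OF KO[OF i]]]) simp
  next
    fix \<phi> \<psi> i j l assume \<phi>: "\<phi> \<in> hom I i j" and \<psi>: "\<psi> \<in> hom I j l"
    have ij: "i \<in> Obj I" "j \<in> Obj I" "l \<in> Obj I" using I.hom_Obj \<phi> \<psi> by auto
    have "Comp C (Comp C (L \<psi>) (L \<phi>)) (k i) = Comp C (Comp C (L \<psi>) (k j)) (snd G \<phi>)"
      using C.Comp_assoc[OF k_hom[OF ij(1)] L_hom[OF \<phi>] L_hom[OF \<psi>]] L_eq[OF \<phi>]
        C.Comp_assoc[OF F_hom[OF G \<phi>] k_hom[OF ij(2)] L_hom[OF \<psi>]] by simp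
    also have "\<dots> = Comp C (L (Comp I \<psi> \<phi>)) (k i)"
      using C.Comp_assoc[OF F_hom[OF G \<phi>] F_hom[OF G \<psi>] k_hom[OF ij(3)]] L_eq[OF \<psi>]
        L_eq[OF I.Comp_hom[OF \<phi> \<psi>]] F_Comp[OF G \<phi> \<psi>] by simp
    finally show "L (Comp I \<psi> \<phi>) = Comp C (L \<psi>) (L \<phi>)"
      using k_epi[OF ij(1,1) L_hom[OF I.Comp_hom[OF \<phi> \<psi>]] C.Comp_hom[OF L_hom[OF \<phi>] L_hom[OF \<psi>]]] by simp
  qed
  define \<kappa> where "\<kappa> = (G, ?K, restrict k (Obj I))"
  have \<kappa>: "\<kappa> \<in> hom FC G ?K"
    unfolding \<kappa>_def by (rule FC_homI[OF G K]) (use k_hom L_eq I.hom_Obj in \<open>auto simp: hom_def\<close>)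
  have at\<kappa>: "snd (snd \<kappa>) i = k i" if "i \<in> Obj I" for i using that by (simp add: \<kappa>_def)
  have "is_cokernel FC \<alpha> \<kappa>"
    unfolding is_cokernel_def
  proof (intro conjI allI ballI impI)
    show "\<alpha> \<in> Arr FC" "\<kappa> \<in> Arr FC" "Dom FC \<kappa> = Cod FC \<alpha>" using \<alpha> \<kappa> by (auto simp: hom_def)
    show "Comp FC \<kappa> \<alpha> = Zero FC (Dom FC \<alpha>) (Cod FC \<kappa>)"
      unfolding homD(3)[OF \<kappa>] homD(2)[OF \<alpha>]
      by (rule FC_eqI[OF FC.Comp_hom[OF \<alpha> \<kappa>] FC.Zero_hom[OF F K]])
        (simp add: functor_category_sel at\<kappa> \<alpha>k)
  next
    fix X g assume g: "g \<in> hom FC (Cod FC \<alpha>) X" and zero: "Comp FC g \<alpha> = Zero FC (Dom FC \<alpha>) X"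
    then have g: "g \<in> hom FC G X" and zero: "Comp FC g \<alpha> = Zero FC F X" using \<alpha> by (auto simp: hom_def)
    have X: "X \<in> Obj FC" using hom_FC_Obj[OF g] by simp
    have "\<exists>u. u \<in> hom C (K i) (fst X i) \<and> Comp C u (k i) = snd (snd g) i" if i: "i \<in> Obj I" for i
    proof -
      have "snd (snd (Comp FC g \<alpha>)) i = Zero C (fst F i) (fst X i)"
        unfolding zero using i by (simp add: functor_category_sel)
      then show ?thesis
        using is_cokernel_desc[OF k[OF i], of "snd (snd g) i" "fst X i"] at_hom[OF g i] i D[OF i]
        by (auto simp: functor_category_sel K_def)
    qed
    then obtain u where u: "\<And>i. i \<in> Obj I \<Longrightarrow> u i \<in> hom C (K i) (fst X i)"
      "\<And>i. i \<in> Obj I \<Longrightarrow> Comp C (u i) (k i) = snd (snd g) i" by metis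
    let ?u = "(?K, X, restrict u (Obj I))"
    have uh: "?u \<in> hom FC ?K X"
    proof (rule FC_homI[OF K X])
      fix \<phi> i j assume \<phi>: "\<phi> \<in> hom I i j"
      have ij: "i \<in> Obj I" "j \<in> Obj I" using I.hom_Obj \<phi> by auto
      have "Comp C (Comp C (snd X \<phi>) (u i)) (k i) = Comp C (snd X \<phi>) (snd (snd g) i)"
        using C.Comp_assoc[OF k_hom[OF ij(1)] u(1)[OF ij(1)] F_hom[OF X \<phi>]] u(2)[OF ij(1)] by simp
      also have "\<dots> = Comp C (Comp C (u j) (L \<phi>)) (k i)"
        using at_nat[OF g \<phi>] C.Comp_assoc[OF F_hom[OF G \<phi>] k_hom[OF ij(2)] u(1)[OF ij(2)]]
          C.Comp_assoc[OF k_hom[OF ij(1)] L_hom[OF \<phi>] u(1)[OF ij(2)]] u(2)[OF ij(2)] L_eq[OF \<phi>] by simp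
      finally show "Comp C (u j) (snd ?K \<phi>) = Comp C (snd X \<phi>) (u i)"
        using k_epi[OF ij(1,1) C.Comp_hom[OF u(1)[OF ij(1)] F_hom[OF X \<phi>]] C.Comp_hom[OF L_hom[OF \<phi>] u(1)[OF ij(2)]]]
          homD(1)[OF \<phi>] by simp
    qed (use u in auto)
    have "Comp FC ?u \<kappa> = g"
      by (rule FC_eqI[OF FC.Comp_hom[OF \<kappa> uh] g]) (simp add: functor_category_sel at\<kappa> u(2))
    moreover have "u' = ?u" if u': "u' \<in> hom FC ?K X" "Comp FC u' \<kappa> = g" for u'
    proof (rule FC_eqI[OF u'(1) uh])
      fix i assume i: "i \<in> Obj I"
      have "Comp C (snd (snd u') i) (k i) = snd (snd g) i"
        unfolding u'(2)[symmetric] using i by (simp add: functor_category_sel at\<kappa>)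
      moreover have "snd (snd u') i \<in> hom C (K i) (fst X i)" using at_hom[OF u'(1) i] i by simp
      ultimately show "snd (snd u') i = snd (snd ?u) i" using u i k_epi[OF i i] by simp
    qed
    ultimately show "\<exists>!u. u \<in> hom FC (Cod FC \<kappa>) X \<and> Comp FC u \<kappa> = g"
      unfolding homD(3)[OF \<kappa>] using uh by blast
  qed
  then show ?thesis using that[OF \<kappa>] k at\<kappa> by simp
qed

lemma FC_cokernel_at:
  assumes k': "is_cokernel FC \<alpha> \<kappa>'" and i: "i \<in> Obj I"
  shows "is_cokernel C (snd (snd \<alpha>) i) (snd (snd \<kappa>') i)"
proof -
  interpret FC: preadditive_category FC by (rule preadditive_FC)
  define F G K' where "F = Dom FC \<alpha>" and "G = Cod FC \<alpha>" and "K' = Cod FC \<kappa>'"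
  have \<alpha>: "\<alpha> \<in> hom FC F G" and \<kappa>': "\<kappa>' \<in> hom FC G K'" "Comp FC \<kappa>' \<alpha> = Zero FC F K'"
    using k' by (auto simp: is_cokernel_def hom_def F_def G_def K'_def)
  obtain K \<kappa> where \<kappa>: "\<kappa> \<in> hom FC G K" and k: "is_cokernel FC \<alpha> \<kappa>"
    "\<And>i. i \<in> Obj I \<Longrightarrow> is_cokernel C (snd (snd \<alpha>) i) (snd (snd \<kappa>) i)"
    by (rule FC_cokernel_exists[OF \<alpha>]) (rule that)
  have zero: "Comp FC \<kappa> \<alpha> = Zero FC F K" using k(1) \<alpha> \<kappa> by (simp add: is_cokernel_def hom_def)
  obtain w where w: "w \<in> hom FC K' K" "Comp FC w \<kappa>' = \<kappa>"
    by (rule is_cokernel_descE[OF k' \<alpha> \<kappa>'(1) \<kappa> zero])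
  obtain v where v: "v \<in> hom FC K K'" "Comp FC v \<kappa> = \<kappa>'"
    by (rule is_cokernel_descE[OF k(1) \<alpha> \<kappa> \<kappa>'])
  have K': "K' \<in> Obj FC" using hom_FC_Obj[OF \<kappa>'(1)] by simp
  have "Comp FC (Comp FC v w) \<kappa>' = Comp FC (Idn FC K') \<kappa>'"
    using FC.Comp_assoc[OF \<kappa>'(1) w(1) v(1)] w(2) v(2) FC.Comp_Idn_left[OF \<kappa>'(1)] by simp
  then have wv: "Comp FC v w = Idn FC K'"
    using FC.epi_cancel[OF FC.cokernel_epi[OF k'] \<kappa>'(1) FC.Comp_hom[OF w(1) v(1)] FC.Idn_hom[OF K']] by simp
  note hs = at_hom[OF \<kappa> i] at_hom[OF \<kappa>'(1) i] at_hom[OF v(1) i] at_hom[OF w(1) i] at_hom[OF \<alpha> i]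
  have e: "snd (snd (Comp FC v \<kappa>)) i = snd (snd \<kappa>') i" "snd (snd (Comp FC w \<kappa>')) i = snd (snd \<kappa>) i"
    "snd (snd (Comp FC v w)) i = snd (snd (Idn FC K')) i" unfolding v(2) w(2) wv by simp_all
  show ?thesis
    by (rule C.cokernel_compare[OF k(2)[OF i], of _ "snd (snd v) i" "snd (snd w) i"])
      (use hs e i in \<open>auto simp: hom_def functor_category_sel\<close>)
qed

end

subsection \<open>Quasi-isomorphisms of complexes of diagrams\<close>

definition at_cpx :: "'i \<Rightarrow> (('i, 'j, 'o, 'a) ftr, ('i, 'j, 'o, 'a) ftr \<times> ('i, 'j, 'o, 'a) ftr \<times> ('i \<Rightarrow> 'a)) cpx
    \<Rightarrow> ('o, 'a) cpx" where
  "at_cpx i X = (\<lambda>n. fst (fst X n) i, \<lambda>n. snd (snd (snd X n)) i)"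

context preadditive_category
begin

lemma cohomology_map:
  assumes X: "X \<in> Obj (complexes C)" and Y: "Y \<in> Obj (complexes C)" and f: "(X, Y, f) \<in> Arr (complexes C)"
    and HX: "is_cohomology C X n i p" and HY: "is_cohomology C Y n i' p'"
  obtains z h where "z \<in> hom C (Dom C i) (Dom C i')" "i' \<cdot> z = f n \<cdot> i"
    "h \<in> hom C (Cod C p) (Cod C p')" "h \<cdot> p = p' \<cdot> z"
proof -
  have dX: "snd X m \<in> hom C (fst X m) (fst X (m + 1))" and dY: "snd Y m \<in> hom C (fst Y m) (fst Y (m + 1))"
    and f_hom: "f m \<in> hom C (fst X m) (fst Y m)" and f_comm: "snd Y m \<cdot> f m = f (m + 1) \<cdot> snd X m"
    and OX: "fst X m \<in> Obj C" and OY: "fst Y m \<in> Obj C" for m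
    using X Y f by (auto simp: complexes_Obj complexes_Arr)
  obtain Z H u where i: "i \<in> hom C Z (fst X n)" and p: "p \<in> hom C Z H" and u: "u \<in> hom C (fst X (n - 1)) Z"
    "i \<cdot> u = snd X (n - 1)" "is_cokernel C u p" and ik: "snd X n \<cdot> i = Zero C Z (fst X (n + 1))"
    by (rule is_cohomologyE[OF HX dX preadditive_category_axioms])
  obtain Z' H' u' where i': "i' \<in> hom C Z' (fst Y n)" and p': "p' \<in> hom C Z' H'" and u': "u' \<in> hom C (fst Y (n - 1)) Z'"
    "i' \<cdot> u' = snd Y (n - 1)" and ik': "is_kernel C (snd Y n) i'" "is_mono C i'"
    "p' \<cdot> u' = Zero C (fst Y (n - 1)) H'"
    by (rule is_cohomologyE[OF HY dY preadditive_category_axioms]) (rule that)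
  have Obj: "Z \<in> Obj C" "H \<in> Obj C" "Z' \<in> Obj C" "H' \<in> Obj C"
    using hom_Obj[OF p] hom_Obj[OF p'] by auto
  note hs = i[unfolded hom_def, simplified] p[unfolded hom_def, simplified] u(1)[unfolded hom_def, simplified]
    i'[unfolded hom_def, simplified] p'[unfolded hom_def, simplified] u'(1)[unfolded hom_def, simplified]
    f_hom[of n, unfolded hom_def, simplified]
    dX[of n, unfolded hom_def, simplified] dY[of n, unfolded hom_def, simplified]
    f_hom[of "n - 1", unfolded hom_def, simplified] f_hom[of "n + 1", unfolded hom_def, simplified]
    dX[of "n - 1", unfolded hom_def, simplified] dY[of "n - 1", unfolded hom_def, simplified]
  have "snd Y n \<cdot> (f n \<cdot> i) = (snd Y n \<cdot> f n) \<cdot> i" using hs by (simp add: cat_simps)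
  also have "\<dots> = f (n + 1) \<cdot> (snd X n \<cdot> i)" unfolding f_comm using hs by (simp add: cat_simps)
  also have "\<dots> = Zero C Z (fst Y (n + 1))" unfolding ik using hs Obj OX by (simp add: add_simps)
  finally obtain z where z: "z \<in> hom C Z Z'" "i' \<cdot> z = f n \<cdot> i"
    using is_kernel_lift[OF ik'(1), of "f n \<cdot> i" Z] Comp_hom[OF i f_hom] hs by auto
  note hz = z(1)[unfolded hom_def, simplified]
  have "i' \<cdot> (z \<cdot> u) = (i' \<cdot> z) \<cdot> u" using hs hz by (simp add: cat_simps)
  also have "\<dots> = f (n - 1 + 1) \<cdot> (i \<cdot> u)" unfolding z(2) using hs by (simp add: cat_simps)
  also have "\<dots> = (i' \<cdot> u') \<cdot> f (n - 1)" unfolding u(2) u'(2) f_comm ..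
  also have "\<dots> = i' \<cdot> (u' \<cdot> f (n - 1))" using hs by (simp add: cat_simps)
  finally have "z \<cdot> u = u' \<cdot> f (n - 1)"
    using mono_cancel[OF ik'(2) i' Comp_hom[OF u(1) z(1)] Comp_hom[OF f_hom u'(1)]] by simp
  then have "(p' \<cdot> z) \<cdot> u = (p' \<cdot> u') \<cdot> f (n - 1)" using hs hz by (simp add: cat_simps)
  then have "(p' \<cdot> z) \<cdot> u = Zero C (fst X (n - 1)) H'" unfolding ik'(3) using hs Obj by (simp add: add_simps)
  then obtain h where "h \<in> hom C H H'" "h \<cdot> p = p' \<cdot> z"
    using is_cokernel_desc[OF u(3), of "p' \<cdot> z" H'] Comp_hom[OF z(1) p'] hs by auto
  then show ?thesis using that z hs by auto
qed

end

context abelian_functor_cat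
begin

lemma at_cpx_Obj:
  assumes X: "X \<in> Obj (complexes FC)" and i: "i \<in> Obj I"
  shows "at_cpx i X \<in> Obj (complexes C)"
proof -
  have d: "fst X n \<in> Obj FC" "snd X n \<in> hom FC (fst X n) (fst X (n + 1))"
    "Comp FC (snd X (n + 1)) (snd X n) = Zero FC (fst X n) (fst X (n + 2))" for n
    using X by (simp_all add: complexes_Obj)
  have "snd (snd (Comp FC (snd X (n + 1)) (snd X n))) i =
      snd (snd (Zero FC (fst X n) (fst X (n + 2)))) i" for n unfolding d(3) ..
  then show ?thesis
    using F_Obj[OF d(1) i] at_hom[OF d(2) i] i by (simp add: complexes_Obj at_cpx_def functor_category_sel)
qed

lemma at_cpx_Arr:
  assumes f: "(X, Y, f) \<in> Arr (complexes FC)" and i: "i \<in> Obj I"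
  shows "(at_cpx i X, at_cpx i Y, \<lambda>n. snd (snd (f n)) i) \<in> Arr (complexes C)"
proof -
  have d: "X \<in> Obj (complexes FC)" "Y \<in> Obj (complexes FC)" "f n \<in> hom FC (fst X n) (fst Y n)"
    "Comp FC (snd Y n) (f n) = Comp FC (f (n + 1)) (snd X n)" for n
    using f by (simp_all add: complexes_Arr)
  have "snd (snd (Comp FC (snd Y n) (f n))) i = snd (snd (Comp FC (f (n + 1)) (snd X n))) i" for n
    unfolding d(4) ..
  then show ?thesis
    using at_cpx_Obj[OF d(1) i] at_cpx_Obj[OF d(2) i] at_hom[OF d(3) i] i
    by (simp add: complexes_Arr at_cpx_def functor_category_sel)
qed

lemma is_cohomology_at:
  assumes H: "is_cohomology FC X n \<iota> \<pi>" and i: "i \<in> Obj I"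
  shows "is_cohomology C (at_cpx i X) n (snd (snd \<iota>) i) (snd (snd \<pi>) i)"
proof -
  obtain u where k: "is_kernel FC (snd X n) \<iota>" and u: "u \<in> hom FC (fst X (n - 1)) (Dom FC \<iota>)"
    "Comp FC \<iota> u = snd X (n - 1)" "is_cokernel FC u \<pi>"
    using H by (auto simp: is_cohomology_def)
  have "\<iota> \<in> hom FC (Dom FC \<iota>) (Cod FC \<iota>)" using k by (simp add: is_kernel_def hom_def)
  then have "Dom C (snd (snd \<iota>) i) = fst (Dom FC \<iota>) i" using at_hom i by (auto simp: hom_def)
  moreover have "Comp C (snd (snd \<iota>) i) (snd (snd u) i) = snd (snd (snd X (n - 1))) i"
    unfolding u(2)[symmetric] using i by (simp add: functor_category_sel)
  ultimately show ?thesis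
    using FC_kernel_at[OF k i] FC_cokernel_at[OF u(3) i] at_hom[OF u(1) i]
    unfolding is_cohomology_def at_cpx_def by auto
qed

text \<open>The definition of \<^term>\<open>quasi_isos FC\<close> quantifies over all cohomology objects; their existence
  makes it imply that the induced maps at each point are isomorphisms.\<close>

lemma is_cohomology_exists:
  assumes X: "X \<in> Obj (complexes FC)"
  shows "\<exists>\<iota> \<pi>. is_cohomology FC X n \<iota> \<pi>"
proof -
  interpret FC: preadditive_category FC by (rule preadditive_FC)
  have d: "snd X m \<in> hom FC (fst X m) (fst X (m + 1))"
    "Comp FC (snd X (m + 1)) (snd X m) = Zero FC (fst X m) (fst X (m + 2))" for m
    using X by (simp_all add: complexes_Obj)
  obtain K \<kappa> where k: "\<kappa> \<in> hom FC K (fst X n)" "is_kernel FC (snd X n) \<kappa>"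
    by (rule FC_kernel_exists[OF d(1)]) (rule that)
  have d': "snd X (n - 1) \<in> hom FC (fst X (n - 1)) (fst X n)"
    "Comp FC (snd X n) (snd X (n - 1)) = Zero FC (fst X (n - 1)) (fst X (n + 1))"
    using d[of "n - 1"] by (simp_all add: algebra_simps)
  obtain u where u: "u \<in> hom FC (fst X (n - 1)) K" "Comp FC \<kappa> u = snd X (n - 1)"
    by (rule is_kernel_liftE[OF k(2) d(1) k(1) d'])
  obtain L \<pi> where "\<pi> \<in> hom FC K L" "is_cokernel FC u \<pi>"
    by (rule FC_cokernel_exists[OF u(1)]) (rule that)
  then have "is_cohomology FC X n \<kappa> \<pi>"
    unfolding is_cohomology_def homD(2)[OF k(1)] using k(2) u by blast
  then show ?thesis by (intro exI)
qed

text \<open>Cohomology, being built from kernels and cokernels, is computed pointwise, and so is the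
  invertibility of the induced maps.\<close>

theorem quasi_isos_FC:
  assumes f: "(X, Y, f) \<in> Arr (complexes FC)"
  shows "(X, Y, f) \<in> quasi_isos FC \<longleftrightarrow>
    (\<forall>i\<in>Obj I. qis C (at_cpx i X) (at_cpx i Y) (\<lambda>n. snd (snd (f n)) i))"
proof
  interpret FC: preadditive_category FC by (rule preadditive_FC)
  have XY: "X \<in> Obj (complexes FC)" "Y \<in> Obj (complexes FC)" and f_hom: "f n \<in> hom FC (fst X n) (fst Y n)" for n
    using f by (simp_all add: complexes_Arr)
  show "\<forall>i\<in>Obj I. qis C (at_cpx i X) (at_cpx i Y) (\<lambda>n. snd (snd (f n)) i)"
    if q: "(X, Y, f) \<in> quasi_isos FC"
  proof
    fix i assume i: "i \<in> Obj I"
    show "qis C (at_cpx i X) (at_cpx i Y) (\<lambda>n. snd (snd (f n)) i)"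
    proof (rule C.cohomology_iso_qis[OF at_cpx_Obj[OF XY(1) i] at_cpx_Obj[OF XY(2) i] at_cpx_Arr[OF f i]])
      fix n
      obtain \<iota> \<pi> where H: "is_cohomology FC X n \<iota> \<pi>" using is_cohomology_exists[OF XY(1)] by blast
      obtain \<iota>' \<pi>' where H': "is_cohomology FC Y n \<iota>' \<pi>'" using is_cohomology_exists[OF XY(2)] by blast
      obtain z h where z: "z \<in> hom FC (Dom FC \<iota>) (Dom FC \<iota>')" "Comp FC \<iota>' z = Comp FC (f n) \<iota>"
        and h: "h \<in> hom FC (Cod FC \<pi>) (Cod FC \<pi>')" "Comp FC h \<pi> = Comp FC \<pi>' z"
        by (rule FC.cohomology_map[OF XY f H H'])
      have iso: "is_iso FC h" by (rule quasi_isosD[OF q H H' z h])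
      have "\<iota> \<in> hom FC (Dom FC \<iota>) (Cod FC \<iota>)" "\<iota>' \<in> hom FC (Dom FC \<iota>') (Cod FC \<iota>')"
        "\<pi> \<in> hom FC (Dom FC \<pi>) (Cod FC \<pi>)" "\<pi>' \<in> hom FC (Dom FC \<pi>') (Cod FC \<pi>')"
        using H H' by (auto simp: is_cohomology_def is_kernel_def is_cokernel_def hom_def)
      note hs = this[THEN at_hom, OF i, unfolded hom_def, simplified]
      have "snd (snd (Comp FC \<iota>' z)) i = snd (snd (Comp FC (f n) \<iota>)) i"
        "snd (snd (Comp FC h \<pi>)) i = snd (snd (Comp FC \<pi>' z)) i" unfolding z(2) h(2) by simp_all
      then have e: "Comp C (snd (snd \<iota>') i) (snd (snd z) i) = Comp C (snd (snd (f n)) i) (snd (snd \<iota>) i)"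
        "Comp C (snd (snd h) i) (snd (snd \<pi>) i) = Comp C (snd (snd \<pi>') i) (snd (snd z) i)"
        using i by (simp_all add: functor_category_sel)
      have m: "snd (snd z) i \<in> hom C (Dom C (snd (snd \<iota>) i)) (Dom C (snd (snd \<iota>') i))"
        "snd (snd h) i \<in> hom C (Cod C (snd (snd \<pi>) i)) (Cod C (snd (snd \<pi>') i))"
        using at_hom[OF z(1) i] at_hom[OF h(1) i] hs by simp_all
      show "\<exists>j p j' p' z h. is_cohomology C (at_cpx i X) n j p \<and> is_cohomology C (at_cpx i Y) n j' p' \<and>
          z \<in> hom C (Dom C j) (Dom C j') \<and> Comp C j' z = Comp C (snd (snd (f n)) i) j \<and>
          h \<in> hom C (Cod C p) (Cod C p') \<and> Comp C h p = Comp C p' z \<and> is_iso C h"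
        using is_cohomology_at[OF H i] is_cohomology_at[OF H' i] m e FC_iso_at[OF h(1) iso i]
        by (intro exI conjI)
    qed
  qed
  show "(X, Y, f) \<in> quasi_isos FC"
    if q: "\<forall>i\<in>Obj I. qis C (at_cpx i X) (at_cpx i Y) (\<lambda>n. snd (snd (f n)) i)"
    unfolding quasi_isos_def
  proof (intro CollectI conjI f allI impI)
    fix n \<iota> \<pi> \<iota>' \<pi>' z h
    assume "is_cohomology FC (Dom (complexes FC) (X, Y, f)) n \<iota> \<pi>"
      "is_cohomology FC (Cod (complexes FC) (X, Y, f)) n \<iota>' \<pi>'"
      and z: "z \<in> hom FC (Dom FC \<iota>) (Dom FC \<iota>')" "Comp FC \<iota>' z = Comp FC (components (X, Y, f) n) \<iota>"
      and h: "h \<in> hom FC (Cod FC \<pi>) (Cod FC \<pi>')" "Comp FC h \<pi> = Comp FC \<pi>' z"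
    then have H: "is_cohomology FC X n \<iota> \<pi>" and H': "is_cohomology FC Y n \<iota>' \<pi>'"
      by (simp_all add: complexes_sel)
    show "is_iso FC h"
    proof (rule FC_isoI[OF h(1)])
      fix i assume i: "i \<in> Obj I"
      have "\<iota> \<in> hom FC (Dom FC \<iota>) (Cod FC \<iota>)" "\<iota>' \<in> hom FC (Dom FC \<iota>') (Cod FC \<iota>')"
        "\<pi> \<in> hom FC (Dom FC \<pi>) (Cod FC \<pi>)" "\<pi>' \<in> hom FC (Dom FC \<pi>') (Cod FC \<pi>')"
        using H H' by (auto simp: is_cohomology_def is_kernel_def is_cokernel_def hom_def)
      note hs = this[THEN at_hom, OF i, unfolded hom_def, simplified]
      have "snd (snd (Comp FC \<iota>' z)) i = snd (snd (Comp FC (f n) \<iota>)) i"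
        "snd (snd (Comp FC h \<pi>)) i = snd (snd (Comp FC \<pi>' z)) i" using z(2) h(2) by simp_all
      then have e: "Comp C (snd (snd \<iota>') i) (snd (snd z) i) = Comp C (snd (snd (f n)) i) (snd (snd \<iota>) i)"
        "Comp C (snd (snd h) i) (snd (snd \<pi>) i) = Comp C (snd (snd \<pi>') i) (snd (snd z) i)"
        using i by (simp_all add: functor_category_sel)
      have m: "snd (snd z) i \<in> hom C (Dom C (snd (snd \<iota>) i)) (Dom C (snd (snd \<iota>') i))"
        "snd (snd h) i \<in> hom C (Cod C (snd (snd \<pi>) i)) (Cod C (snd (snd \<pi>') i))"
        using at_hom[OF z(1) i] at_hom[OF h(1) i] hs by simp_all
      show "is_iso C (snd (snd h) i)"
        by (rule C.qis_cohomology_iso[OF at_cpx_Obj[OF XY(1) i] at_cpx_Obj[OF XY(2) i] at_cpx_Arr[OF f i]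
              bspec[OF q i] is_cohomology_at[OF H i] is_cohomology_at[OF H' i] m(1) e(1) m(2) e(2)])
    qed
  qed
qed

end

section \<open>Finite products, finite sums and signs\<close>

definition is_prod :: "('o, 'a, 'z) cat_scheme \<Rightarrow> 'p set \<Rightarrow> ('p \<Rightarrow> 'o) \<Rightarrow> 'o \<Rightarrow> ('p \<Rightarrow> 'a) \<Rightarrow> bool" where
  "is_prod C I V S \<pi> \<longleftrightarrow> S \<in> Obj C \<and> (\<forall>i\<in>I. \<pi> i \<in> hom C S (V i)) \<and>
    (\<forall>T t. T \<in> Obj C \<longrightarrow> (\<forall>i\<in>I. t i \<in> hom C T (V i)) \<longrightarrow>
      (\<exists>!u. u \<in> hom C T S \<and> (\<forall>i\<in>I. Comp C (\<pi> i) u = t i)))"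

text \<open>The choice depends only on the family of objects: equal families have equal products. The strict
  compatibility of twisted products with the shift relies on this.\<close>

definition pobj :: "('o, 'a, 'z) cat_scheme \<Rightarrow> 'p set \<Rightarrow> ('p \<Rightarrow> 'o) \<Rightarrow> 'o" where
  "pobj C I V = fst (SOME (S, \<pi>). is_prod C I V S \<pi>)"

definition pproj :: "('o, 'a, 'z) cat_scheme \<Rightarrow> 'p set \<Rightarrow> ('p \<Rightarrow> 'o) \<Rightarrow> 'p \<Rightarrow> 'a" where
  "pproj C I V = snd (SOME (S, \<pi>). is_prod C I V S \<pi>)"

definition tuple :: "('o, 'a, 'z) cat_scheme \<Rightarrow> 'p set \<Rightarrow> ('p \<Rightarrow> 'o) \<Rightarrow> 'o \<Rightarrow> ('p \<Rightarrow> 'a) \<Rightarrow> 'a" where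
  "tuple C I V T t = (THE u. u \<in> hom C T (pobj C I V) \<and> (\<forall>i\<in>I. Comp C (pproj C I V i) u = t i))"

fun list_sum :: "('o, 'a, 'z) addcat_scheme \<Rightarrow> 'o \<Rightarrow> 'o \<Rightarrow> ('p \<Rightarrow> 'a) \<Rightarrow> 'p list \<Rightarrow> 'a" where
  "list_sum C X Y f [] = Zero C X Y"
| "list_sum C X Y f (i # l) = Add C (f i) (list_sum C X Y f l)"

text \<open>Arrows with varying ends do not form a commutative monoid, so the sum is taken along a fixed
  enumeration of the finite index set. Sums are compared only over the same set, hence with the same
  enumeration.\<close>

definition arrow_sum :: "('o, 'a, 'z) addcat_scheme \<Rightarrow> 'o \<Rightarrow> 'o \<Rightarrow> ('p \<Rightarrow> 'a) \<Rightarrow> 'p set \<Rightarrow> 'a" where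
  "arrow_sum C X Y f I = list_sum C X Y f (SOME l. set l = I \<and> distinct l)"

definition sign :: "('o, 'a, 'z) addcat_scheme \<Rightarrow> int \<Rightarrow> 'a \<Rightarrow> 'a" where
  "sign C n f = (if even n then f else Neg C f)"

context preadditive_category
begin

lemma sign_Arr:
  assumes "f \<in> Arr C"
  shows "sign C n f \<in> Arr C" "Dom C (sign C n f) = Dom C f" "Cod C (sign C n f) = Cod C f"
  using assms by (simp_all add: sign_def Neg_Arr)

lemma sign_Comp:
  "\<lbrakk>f \<in> Arr C; h \<in> Arr C; Cod C f = Dom C h\<rbrakk> \<Longrightarrow> h \<cdot> sign C n f = sign C n (h \<cdot> f)"
  "\<lbrakk>f \<in> Arr C; h \<in> Arr C; Cod C h = Dom C f\<rbrakk> \<Longrightarrow> sign C n f \<cdot> h = sign C n (f \<cdot> h)"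
  by (simp_all add: sign_def Comp_Neg)

lemma sign_Zero: "\<lbrakk>X \<in> Obj C; Y \<in> Obj C\<rbrakk> \<Longrightarrow> sign C n (Zero C X Y) = Zero C X Y"
  by (simp add: sign_def Neg_Zero)

lemma sign_Add:
  "\<lbrakk>f \<in> Arr C; g \<in> Arr C; Dom C f = Dom C g; Cod C f = Cod C g\<rbrakk>
    \<Longrightarrow> sign C n (f \<oplus> g) = sign C n f \<oplus> sign C n g"
  by (simp add: sign_def Neg_Add)

lemma sign_Neg: "f \<in> Arr C \<Longrightarrow> sign C n (Neg C f) = Neg C (sign C n f)"
  by (simp add: sign_def)

lemma sign_sign: "f \<in> Arr C \<Longrightarrow> sign C n (sign C n f) = f"
  by (simp add: sign_def Neg_Neg)

lemma sign_Suc: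
  assumes "f \<in> Arr C"
  shows "sign C (n + 1) f = Neg C (sign C n f)" "sign C (1 + n) f = Neg C (sign C n f)"
    "sign C (n - 1) f = Neg C (sign C n f)"
  using assms by (simp_all add: sign_def Neg_Neg)

lemmas sign_simps = sign_Arr sign_Comp sign_Zero sign_Add sign_Neg sign_sign sign_Suc

lemma list_sum_hom:
  "\<lbrakk>X \<in> Obj C; Y \<in> Obj C; \<And>i. i \<in> set l \<Longrightarrow> f i \<in> hom C X Y\<rbrakk> \<Longrightarrow> list_sum C X Y f l \<in> hom C X Y"
  by (induction l) (auto intro: Zero_hom Add_hom)

lemma list_sum_Comp_left:
  assumes "X \<in> Obj C" "h \<in> hom C Y Z" "\<And>i. i \<in> set l \<Longrightarrow> f i \<in> hom C X Y"
  shows "h \<cdot> list_sum C X Y f l = list_sum C X Z (\<lambda>i. h \<cdot> f i) l"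
  using assms(3)
proof (induction l)
  case Nil
  then show ?case using assms hom_Obj[OF assms(2)] by (auto simp: hom_def add_simps)
next
  case (Cons i l)
  then show ?case
    using Comp_Add_left[OF _ list_sum_hom assms(2), of "f i" X l f] assms(1) hom_Obj[OF assms(2)] by simp
qed

lemma list_sum_Comp_right:
  assumes "Z \<in> Obj C" "h \<in> hom C X Y" "\<And>i. i \<in> set l \<Longrightarrow> f i \<in> hom C Y Z"
  shows "list_sum C Y Z f l \<cdot> h = list_sum C X Z (\<lambda>i. f i \<cdot> h) l"
  using assms(3)
proof (induction l)
  case Nil
  then show ?case using assms hom_Obj[OF assms(2)] by (auto simp: hom_def add_simps)
next
  case (Cons i l)
  then show ?case
    using Comp_Add_right[OF _ list_sum_hom assms(2), of "f i" Z l f] assms(1) hom_Obj[OF assms(2)] by simp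
qed

lemma list_sum_cong: "(\<And>i. i \<in> set l \<Longrightarrow> f i = g i) \<Longrightarrow> list_sum C X Y f l = list_sum C X Y g l"
  by (induction l) auto

lemma list_sum_Zero:
  "\<lbrakk>X \<in> Obj C; Y \<in> Obj C; \<And>i. i \<in> set l \<Longrightarrow> f i = Zero C X Y\<rbrakk> \<Longrightarrow> list_sum C X Y f l = Zero C X Y"
  by (induction l) (auto simp: add_simps)

lemma list_sum_single:
  assumes "X \<in> Obj C" "Y \<in> Obj C" "distinct l" "j \<in> set l" "f j \<in> hom C X Y"
    "\<And>i. i \<in> set l \<Longrightarrow> i \<noteq> j \<Longrightarrow> f i = Zero C X Y"
  shows "list_sum C X Y f l = f j"
  using assms(3-6)
proof (induction l)
  case (Cons i l)
  show ?case
  proof (cases "i = j")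
    case True
    then have "list_sum C X Y f l = Zero C X Y" using Cons assms by (intro list_sum_Zero) auto
    then show ?thesis using True Cons.prems by (auto simp: hom_def add_simps)
  next
    case False
    then show ?thesis using Cons assms(1,2) by (auto simp: hom_def add_simps)
  qed
qed simp

lemma list_sum_Add:
  assumes "X \<in> Obj C" "Y \<in> Obj C" "\<And>i. i \<in> set l \<Longrightarrow> f i \<in> hom C X Y" "\<And>i. i \<in> set l \<Longrightarrow> g i \<in> hom C X Y"
  shows "list_sum C X Y (\<lambda>i. f i \<oplus> g i) l = list_sum C X Y f l \<oplus> list_sum C X Y g l"
  using assms(3-)
proof (induction l)
  case Nil
  then show ?case using assms by (simp add: add_simps)
next
  case (Cons i l)
  then show ?case
    using list_sum_hom[of X Y l f] list_sum_hom[of X Y l g] assms(1,2)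
    by (auto simp: hom_def add_simps add_ac)
qed

lemma list_sum_Neg:
  assumes "X \<in> Obj C" "Y \<in> Obj C" "\<And>i. i \<in> set l \<Longrightarrow> f i \<in> hom C X Y"
  shows "Neg C (list_sum C X Y f l) = list_sum C X Y (\<lambda>i. Neg C (f i)) l"
  using assms(3-)
proof (induction l)
  case Nil
  then show ?case using assms by (simp add: add_simps)
next
  case (Cons i l)
  then show ?case using list_sum_hom[of X Y l f] assms(1,2) by (auto simp: hom_def add_simps)
qed

lemma enum: "finite I \<Longrightarrow> set (SOME l. set l = I \<and> distinct l) = I \<and> distinct (SOME l. set l = I \<and> distinct l)"
  using finite_distinct_list[of I] by (rule someI_ex)

lemma arrow_sum_hom:
  "\<lbrakk>finite I; X \<in> Obj C; Y \<in> Obj C; \<And>i. i \<in> I \<Longrightarrow> f i \<in> hom C X Y\<rbrakk> \<Longrightarrow> arrow_sum C X Y f I \<in> hom C X Y"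
  unfolding arrow_sum_def using enum[of I] by (intro list_sum_hom) auto

lemma arrow_sum_Comp_left:
  "\<lbrakk>finite I; X \<in> Obj C; h \<in> hom C Y Z; \<And>i. i \<in> I \<Longrightarrow> f i \<in> hom C X Y\<rbrakk>
    \<Longrightarrow> h \<cdot> arrow_sum C X Y f I = arrow_sum C X Z (\<lambda>i. h \<cdot> f i) I"
  unfolding arrow_sum_def using enum[of I] by (intro list_sum_Comp_left) auto

lemma arrow_sum_Comp_right:
  "\<lbrakk>finite I; Z \<in> Obj C; h \<in> hom C X Y; \<And>i. i \<in> I \<Longrightarrow> f i \<in> hom C Y Z\<rbrakk>
    \<Longrightarrow> arrow_sum C Y Z f I \<cdot> h = arrow_sum C X Z (\<lambda>i. f i \<cdot> h) I"
  unfolding arrow_sum_def using enum[of I] by (intro list_sum_Comp_right) auto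

lemma arrow_sum_cong:
  "\<lbrakk>finite I; \<And>i. i \<in> I \<Longrightarrow> f i = g i\<rbrakk> \<Longrightarrow> arrow_sum C X Y f I = arrow_sum C X Y g I"
  unfolding arrow_sum_def using enum[of I] by (intro list_sum_cong) auto

lemma arrow_sum_Zero:
  "\<lbrakk>finite I; X \<in> Obj C; Y \<in> Obj C; \<And>i. i \<in> I \<Longrightarrow> f i = Zero C X Y\<rbrakk> \<Longrightarrow> arrow_sum C X Y f I = Zero C X Y"
  unfolding arrow_sum_def using enum[of I] by (intro list_sum_Zero) auto

lemma arrow_sum_single:
  "\<lbrakk>finite I; X \<in> Obj C; Y \<in> Obj C; j \<in> I; f j \<in> hom C X Y; \<And>i. i \<in> I \<Longrightarrow> i \<noteq> j \<Longrightarrow> f i = Zero C X Y\<rbrakk>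
    \<Longrightarrow> arrow_sum C X Y f I = f j"
  unfolding arrow_sum_def using enum[of I] by (intro list_sum_single) auto

lemma arrow_sum_Add:
  "\<lbrakk>finite I; X \<in> Obj C; Y \<in> Obj C; \<And>i. i \<in> I \<Longrightarrow> f i \<in> hom C X Y; \<And>i. i \<in> I \<Longrightarrow> g i \<in> hom C X Y\<rbrakk>
    \<Longrightarrow> arrow_sum C X Y (\<lambda>i. f i \<oplus> g i) I = arrow_sum C X Y f I \<oplus> arrow_sum C X Y g I"
  unfolding arrow_sum_def using enum[of I] by (intro list_sum_Add) auto

lemma arrow_sum_Neg:
  "\<lbrakk>finite I; X \<in> Obj C; Y \<in> Obj C; \<And>i. i \<in> I \<Longrightarrow> f i \<in> hom C X Y\<rbrakk>
    \<Longrightarrow> Neg C (arrow_sum C X Y f I) = arrow_sum C X Y (\<lambda>i. Neg C (f i)) I"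
  unfolding arrow_sum_def using enum[of I] by (intro list_sum_Neg) auto

lemma arrow_sum_sign:
  "\<lbrakk>finite I; X \<in> Obj C; Y \<in> Obj C; \<And>i. i \<in> I \<Longrightarrow> f i \<in> hom C X Y\<rbrakk>
    \<Longrightarrow> sign C n (arrow_sum C X Y f I) = arrow_sum C X Y (\<lambda>i. sign C n (f i)) I"
  by (simp add: sign_def arrow_sum_Neg)

end

context abelian_category
begin

lemma prod_exists:
  assumes "finite I" "\<And>i. i \<in> I \<Longrightarrow> V i \<in> Obj C"
  shows "\<exists>S \<pi>. is_prod C I V S \<pi>"
  using assms
proof (induction I rule: finite_induct)
  case empty
  obtain Z where Z: "is_zero_object C Z" using ex_zero_object by blast
  have "is_prod C {} V Z \<pi>" for \<pi>
    unfolding is_prod_def using Z by (auto simp: is_zero_object_def)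
  then show ?case by blast
next
  case (insert x I)
  then obtain S \<pi> where S: "is_prod C I V S \<pi>" by auto
  then have SO: "S \<in> Obj C" and \<pi>: "\<And>i. i \<in> I \<Longrightarrow> \<pi> i \<in> hom C S (V i)"
    and univ: "\<And>T t. T \<in> Obj C \<Longrightarrow> (\<forall>i\<in>I. t i \<in> hom C T (V i)) \<Longrightarrow>
      (\<exists>!u. u \<in> hom C T S \<and> (\<forall>i\<in>I. \<pi> i \<cdot> u = t i))"
    by (auto simp: is_prod_def)
  obtain B i j p q where B: "is_biproduct C (V x) S B i j p q" using ex_biproduct[of "V x" S] insert SO by auto
  have h: "i \<in> hom C (V x) B" "j \<in> hom C S B" "p \<in> hom C B (V x)" "q \<in> hom C B S"
    and eq: "p \<cdot> i = Idn C (V x)" "q \<cdot> j = Idn C S" "q \<cdot> i = Zero C (V x) S" "p \<cdot> j = Zero C S (V x)"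
      "i \<cdot> p \<oplus> j \<cdot> q = Idn C B"
    using B by (auto simp: is_biproduct_def)
  note hs = h[unfolded hom_def, simplified]
  have BO: "B \<in> Obj C" "V x \<in> Obj C" using hom_Obj[OF h(1)] by auto
  let ?\<pi> = "\<lambda>y. if y = x then p else \<pi> y \<cdot> q"
  have "is_prod C (insert x I) V B ?\<pi>"
    unfolding is_prod_def
  proof (intro conjI allI impI)
    show "B \<in> Obj C" by (rule BO)
    show "\<forall>y\<in>insert x I. ?\<pi> y \<in> hom C B (V y)" using h Comp_hom[OF h(4) \<pi>] by auto
    fix T t assume T: "T \<in> Obj C" and t: "\<forall>y\<in>insert x I. t y \<in> hom C T (V y)"
    obtain u where u: "u \<in> hom C T S" "\<forall>y\<in>I. \<pi> y \<cdot> u = t y"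
        "\<And>u'. u' \<in> hom C T S \<Longrightarrow> \<forall>y\<in>I. \<pi> y \<cdot> u' = t y \<Longrightarrow> u' = u"
      using univ[OF T, of t] t by (auto elim!: ex1E)
    define v where "v = i \<cdot> t x \<oplus> j \<cdot> u"
    have tx: "t x \<in> hom C T (V x)" using t by simp
    note hs' = hs tx[unfolded hom_def, simplified] u(1)[unfolded hom_def, simplified]
    have v: "v \<in> hom C T B" using hs' by (simp add: v_def hom_def add_simps)
    have "p \<cdot> v = (p \<cdot> i) \<cdot> t x \<oplus> (p \<cdot> j) \<cdot> u" "q \<cdot> v = (q \<cdot> i) \<cdot> t x \<oplus> (q \<cdot> j) \<cdot> u"
      using hs' by (simp_all add: v_def add_simps)
    then have pv: "p \<cdot> v = t x" "q \<cdot> v = u" unfolding eq using hs' BO SO T by (simp_all add: add_simps)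
    have "\<forall>y\<in>insert x I. ?\<pi> y \<cdot> v = t y"
    proof
      fix y assume "y \<in> insert x I"
      then show "?\<pi> y \<cdot> v = t y"
        using pv u(2) Comp_assoc[OF v h(4) \<pi>, of y] by (cases "y = x") simp_all
    qed
    moreover have "v' = v" if v': "v' \<in> hom C T B" "\<forall>y\<in>insert x I. ?\<pi> y \<cdot> v' = t y" for v'
    proof -
      have "\<forall>y\<in>I. \<pi> y \<cdot> (q \<cdot> v') = t y"
      proof
        fix y assume y: "y \<in> I"
        then have "y \<noteq> x" using insert(2) by blast
        then show "\<pi> y \<cdot> (q \<cdot> v') = t y"
          using bspec[OF v'(2), of y] y Comp_assoc[OF v'(1) h(4) \<pi>[OF y]] by simp
      qed
      then have 1: "q \<cdot> v' = u" using u(3) Comp_hom[OF v'(1) h(4)] by simp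
      have 2: "p \<cdot> v' = t x" using v' by auto
      have "v' = Idn C B \<cdot> v'" using v'(1) by (simp add: hom_def cat_simps)
      also have "\<dots> = i \<cdot> (p \<cdot> v') \<oplus> j \<cdot> (q \<cdot> v')"
        unfolding eq(5)[symmetric] using hs v'(1) by (simp add: hom_def add_simps)
      finally show ?thesis unfolding 1 2 v_def .
    qed
    ultimately show "\<exists>!u. u \<in> hom C T B \<and> (\<forall>y\<in>insert x I. ?\<pi> y \<cdot> u = t y)" using v by blast
  qed
  then show ?case by blast
qed

definition family where "family I V \<longleftrightarrow> finite I \<and> (\<forall>i\<in>I. V i \<in> Obj C)"

lemma is_prod_pobj: "family I V \<Longrightarrow> is_prod C I V (pobj C I V) (pproj C I V)"
  using prod_exists[of I V] someI_ex[of "\<lambda>(S, \<pi>). is_prod C I V S \<pi>"]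
  by (auto simp: family_def pobj_def pproj_def split: prod.splits)

lemma pobj_Obj: "family I V \<Longrightarrow> pobj C I V \<in> Obj C"
  using is_prod_pobj by (auto simp: is_prod_def)

lemma pproj_hom: "family I V \<Longrightarrow> i \<in> I \<Longrightarrow> pproj C I V i \<in> hom C (pobj C I V) (V i)"
  using is_prod_pobj[of I V] unfolding is_prod_def by blast

lemma tuple_ex1:
  assumes "family I V" "T \<in> Obj C" "\<And>i. i \<in> I \<Longrightarrow> t i \<in> hom C T (V i)"
  shows "\<exists>!u. u \<in> hom C T (pobj C I V) \<and> (\<forall>i\<in>I. pproj C I V i \<cdot> u = t i)"
  using is_prod_pobj[OF assms(1)] assms(2,3) unfolding is_prod_def by blast

lemma tuple_hom:
  assumes "family I V" "T \<in> Obj C" "\<And>i. i \<in> I \<Longrightarrow> t i \<in> hom C T (V i)"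
  shows "tuple C I V T t \<in> hom C T (pobj C I V)"
  using theI'[OF tuple_ex1[OF assms]] unfolding tuple_def by simp

lemma pproj_tuple:
  assumes "family I V" "T \<in> Obj C" "\<And>i. i \<in> I \<Longrightarrow> t i \<in> hom C T (V i)" "i \<in> I"
  shows "pproj C I V i \<cdot> tuple C I V T t = t i"
  using theI'[OF tuple_ex1[OF assms(1-3)]] assms(4) unfolding tuple_def by simp

lemma prod_eqI:
  assumes "family I V" "u \<in> hom C T (pobj C I V)" "v \<in> hom C T (pobj C I V)"
    "\<And>i. i \<in> I \<Longrightarrow> pproj C I V i \<cdot> u = pproj C I V i \<cdot> v"
  shows "u = v"
proof -
  have "\<exists>!w. w \<in> hom C T (pobj C I V) \<and> (\<forall>i\<in>I. pproj C I V i \<cdot> w = pproj C I V i \<cdot> v)"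
    using assms by (intro tuple_ex1) (use hom_Obj[OF assms(2)] Comp_hom[OF _ pproj_hom] in auto)
  then show ?thesis using assms by blast
qed

end

section \<open>Complexes of diagrams on a poset\<close>

lemma poset_category_sel:
  "Obj (poset_category P r) = P" "Arr (poset_category P r) = r"
  "Dom (poset_category P r) = fst" "Cod (poset_category P r) = snd"
  "Idn (poset_category P r) x = (x, x)" "Comp (poset_category P r) g f = (fst f, snd g)"
  by (simp_all add: poset_category_def)

lemma poset_category_hom: "f \<in> hom (poset_category P r) x y \<longleftrightarrow> f = (x, y) \<and> (x, y) \<in> r"
  by (cases f) (auto simp: hom_def poset_category_def)

lemma category_poset:
  assumes "partial_order_on P r"
  shows "category (poset_category P r)"
proof -
  have r: "r \<subseteq> P \<times> P" "\<And>x. x \<in> P \<Longrightarrow> (x, x) \<in> r" "trans r"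
    using assms by (auto simp: partial_order_on_def preorder_on_def refl_on_def)
  show ?thesis
    by standard (use r in \<open>auto simp: poset_category_sel poset_category_hom dest: transD\<close>)
qed

type_synonym ('p, 'o, 'a) dcpx =
  "(('p, 'p \<times> 'p, 'o, 'a) ftr, ('p, 'p \<times> 'p, 'o, 'a) ftr \<times> ('p, 'p \<times> 'p, 'o, 'a) ftr \<times> ('p \<Rightarrow> 'a)) cpx"

type_synonym ('p, 'o, 'a) dcpx_map =
  "(('p, 'p \<times> 'p, 'o, 'a) ftr, ('p, 'p \<times> 'p, 'o, 'a) ftr \<times> ('p, 'p \<times> 'p, 'o, 'a) ftr \<times> ('p \<Rightarrow> 'a)) cpx_map"

text \<open>Coordinates of a complex of diagrams in degree \<open>n\<close>: the object at a point, the structure map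
  between two points, the differential at a point, and the component of a chain map at a point.\<close>

definition ob :: "('p, 'o, 'a) dcpx \<Rightarrow> int \<Rightarrow> 'p \<Rightarrow> 'o" where
  "ob X n x = fst (fst X n) x"

definition mp :: "('p, 'o, 'a) dcpx \<Rightarrow> int \<Rightarrow> 'p \<Rightarrow> 'p \<Rightarrow> 'a" where
  "mp X n x y = snd (fst X n) (x, y)"

definition df :: "('p, 'o, 'a) dcpx \<Rightarrow> int \<Rightarrow> 'p \<Rightarrow> 'a" where
  "df X n x = snd (snd (snd X n)) x"

definition cm :: "('p, 'o, 'a) dcpx_map \<Rightarrow> int \<Rightarrow> 'p \<Rightarrow> 'a" where
  "cm f n x = snd (snd (components f n)) x"

text \<open>Diagrams and their maps are extensional functions, hence the restrictions.\<close>

definition mk_diagram :: "'p set \<Rightarrow> 'p rel \<Rightarrow> ('p \<Rightarrow> 'o) \<Rightarrow> ('p \<Rightarrow> 'p \<Rightarrow> 'a) \<Rightarrow> ('p, 'p \<times> 'p, 'o, 'a) ftr" where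
  "mk_diagram P r V m = (restrict V P, restrict (\<lambda>(x, y). m x y) r)"

definition mk_cpx :: "'p set \<Rightarrow> 'p rel \<Rightarrow> (int \<Rightarrow> 'p \<Rightarrow> 'o) \<Rightarrow> (int \<Rightarrow> 'p \<Rightarrow> 'p \<Rightarrow> 'a) \<Rightarrow> (int \<Rightarrow> 'p \<Rightarrow> 'a)
    \<Rightarrow> ('p, 'o, 'a) dcpx" where
  "mk_cpx P r V m d = (\<lambda>n. mk_diagram P r (V n) (m n),
     \<lambda>n. (mk_diagram P r (V n) (m n), mk_diagram P r (V (n + 1)) (m (n + 1)), restrict (d n) P))"

definition mk_map :: "'p set \<Rightarrow> ('p, 'o, 'a) dcpx \<Rightarrow> ('p, 'o, 'a) dcpx \<Rightarrow> (int \<Rightarrow> 'p \<Rightarrow> 'a) \<Rightarrow> ('p, 'o, 'a) dcpx_map" where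
  "mk_map P X Y f = (X, Y, \<lambda>n. (fst X n, fst Y n, restrict (f n) P))"

lemma mk_cpx_sel:
  "x \<in> P \<Longrightarrow> ob (mk_cpx P r V m d) n x = V n x"
  "(x, y) \<in> r \<Longrightarrow> mp (mk_cpx P r V m d) n x y = m n x y"
  "x \<in> P \<Longrightarrow> df (mk_cpx P r V m d) n x = d n x"
  by (simp_all add: ob_def mp_def df_def mk_cpx_def mk_diagram_def)

lemma mk_map_sel: "x \<in> P \<Longrightarrow> cm (mk_map P X Y f) n x = f n x"
  by (simp add: cm_def mk_map_def)

locale poset_diagrams = C: abelian_category C
  for C :: "('o, 'a, 'z) addcat_scheme" +
  fixes P :: "'p set" and R :: "'p rel"
  assumes partial_order: "partial_order_on P R"
begin

sublocale abelian_functor_cat "poset_category P R" C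
  using category_poset[OF partial_order]
  by (simp add: abelian_functor_cat_def functor_cat_def C.abelian_category_axioms C.preadditive_category_axioms)

sublocale FC: preadditive_category FC by (rule preadditive_FC)

abbreviation K where "K \<equiv> complexes FC"

lemma R_P: "(x, y) \<in> R \<Longrightarrow> x \<in> P \<and> y \<in> P"
  using partial_order by (auto simp: partial_order_on_def preorder_on_def refl_on_def)

context
  fixes X assumes X: "X \<in> Obj K"
begin

lemma fst_X: "fst X n \<in> Obj FC" and snd_X: "snd X n \<in> hom FC (fst X n) (fst X (n + 1))"
  and X_dd: "Comp FC (snd X (n + 1)) (snd X n) = Zero FC (fst X n) (fst X (n + 2))"
  using X by (simp_all add: complexes_Obj)

lemma ob_Obj: "x \<in> P \<Longrightarrow> ob X n x \<in> Obj C"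
  using F_Obj[OF fst_X] by (simp add: ob_def poset_category_sel)

lemma df_hom: "x \<in> P \<Longrightarrow> df X n x \<in> hom C (ob X n x) (ob X (n + 1) x)"
  using at_hom[OF snd_X] by (simp add: ob_def df_def poset_category_sel)

lemma df_df: "x \<in> P \<Longrightarrow> Comp C (df X (n + 1) x) (df X n x) = Zero C (ob X n x) (ob X (n + 2) x)"
  using arg_cong[OF X_dd, of "\<lambda>f. snd (snd f) x"]
  by (simp add: ob_def df_def poset_category_sel functor_category_sel)

lemma df_df': "\<lbrakk>x \<in> P; t \<in> hom C T (ob X n x)\<rbrakk> \<Longrightarrow>
    Comp C (df X (n + 1) x) (Comp C (df X n x) t) = Zero C T (ob X (n + 2) x)"
  using C.Comp_assoc[OF _ df_hom df_hom, of t T n x] df_df[of x n] ob_Obj[of x] C.hom_Obj[of t T "ob X n x"]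
  by (auto simp: hom_def C.add_simps)

lemma mp_hom: "(x, y) \<in> R \<Longrightarrow> mp X n x y \<in> hom C (ob X n x) (ob X n y)"
  using F_hom[OF fst_X, of "(x, y)" x y] by (simp add: ob_def mp_def poset_category_hom)

lemma mp_refl: "x \<in> P \<Longrightarrow> mp X n x x = Idn C (ob X n x)"
  using F_Idn[OF fst_X, of x] by (simp add: ob_def mp_def poset_category_sel)

lemma mp_trans: "\<lbrakk>(x, y) \<in> R; (y, z) \<in> R\<rbrakk> \<Longrightarrow> Comp C (mp X n y z) (mp X n x y) = mp X n x z"
  using F_Comp[OF fst_X, of "(x, y)" x y "(y, z)" z] by (simp add: mp_def poset_category_sel poset_category_hom)

lemma mp_df: "(x, y) \<in> R \<Longrightarrow> Comp C (df X n y) (mp X n x y) = Comp C (mp X (n + 1) x y) (df X n x)"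
  using at_nat[OF snd_X, of "(x, y)" x y] by (simp add: mp_def df_def poset_category_hom)

end

lemma diagram_ObjI:
  assumes V: "\<And>n x. x \<in> P \<Longrightarrow> V n x \<in> Obj C"
    and m: "\<And>n x y. (x, y) \<in> R \<Longrightarrow> m n x y \<in> hom C (V n x) (V n y)"
    and m_refl: "\<And>n x. x \<in> P \<Longrightarrow> m n x x = Idn C (V n x)"
    and m_trans: "\<And>n x y z. (x, y) \<in> R \<Longrightarrow> (y, z) \<in> R \<Longrightarrow> m n x z = Comp C (m n y z) (m n x y)"
  shows "mk_diagram P R (V n) (m n) \<in> Obj FC"
  unfolding mk_diagram_def
  using FC_ObjI[of "V n" "\<lambda>(x, y). m n x y"] assms
  by (simp add: poset_category_sel poset_category_hom split: prod.splits)

lemma mk_cpx_Obj: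
  assumes V: "\<And>n x. x \<in> P \<Longrightarrow> V n x \<in> Obj C"
    and m: "\<And>n x y. (x, y) \<in> R \<Longrightarrow> m n x y \<in> hom C (V n x) (V n y)"
    and m_refl: "\<And>n x. x \<in> P \<Longrightarrow> m n x x = Idn C (V n x)"
    and m_trans: "\<And>n x y z. (x, y) \<in> R \<Longrightarrow> (y, z) \<in> R \<Longrightarrow> m n x z = Comp C (m n y z) (m n x y)"
    and d: "\<And>n x. x \<in> P \<Longrightarrow> d n x \<in> hom C (V n x) (V (n + 1) x)"
    and dm: "\<And>n x y. (x, y) \<in> R \<Longrightarrow> Comp C (d n y) (m n x y) = Comp C (m (n + 1) x y) (d n x)"
    and dd: "\<And>n x. x \<in> P \<Longrightarrow> Comp C (d (n + 1) x) (d n x) = Zero C (V n x) (V (n + 2) x)"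
  shows "mk_cpx P R V m d \<in> Obj K"
proof -
  note Obj = diagram_ObjI[of V m, OF V m m_refl m_trans]
  have d_hom: "(mk_diagram P R (V n) (m n), mk_diagram P R (V (n + 1)) (m (n + 1)), restrict (d n) P)
      \<in> hom FC (mk_diagram P R (V n) (m n)) (mk_diagram P R (V (n + 1)) (m (n + 1)))" for n
    using FC_homI[OF Obj Obj, of "d n" n "n + 1"] d dm R_P
    by (simp add: mk_diagram_def poset_category_sel poset_category_hom)
  moreover have "Comp FC (snd (mk_cpx P R V m d) (n + 1)) (snd (mk_cpx P R V m d) n) =
      Zero FC (fst (mk_cpx P R V m d) n) (fst (mk_cpx P R V m d) (n + 2))" for n
    using dd[of _ n]
    by (auto simp: functor_category_sel mk_cpx_def poset_category_sel mk_diagram_def restrict_def fun_eq_iff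
        add.commute)
  ultimately show ?thesis using Obj unfolding complexes_Obj by (simp add: mk_cpx_def)
qed

context
  fixes f X Y assumes f: "f \<in> hom K X Y"
begin

lemma f_Obj: "X \<in> Obj K" "Y \<in> Obj K" and f_components: "components f n \<in> hom FC (fst X n) (fst Y n)"
  and f_df: "Comp FC (snd Y n) (components f n) = Comp FC (components f (n + 1)) (snd X n)"
  using f by (simp_all add: complexes_hom)

lemma cm_hom: "x \<in> P \<Longrightarrow> cm f n x \<in> hom C (ob X n x) (ob Y n x)"
  using at_hom[OF f_components] by (simp add: ob_def cm_def poset_category_sel)

lemma cm_mp: "(x, y) \<in> R \<Longrightarrow> Comp C (cm f n y) (mp X n x y) = Comp C (mp Y n x y) (cm f n x)"
  using at_nat[OF f_components, of "(x, y)" x y] by (simp add: mp_def cm_def poset_category_hom)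

lemma cm_df: "x \<in> P \<Longrightarrow> Comp C (df Y n x) (cm f n x) = Comp C (cm f (n + 1) x) (df X n x)"
  using arg_cong[OF f_df[of n], of "\<lambda>f. snd (snd f) x"]
  by (simp add: cm_def df_def poset_category_sel functor_category_sel)

end

lemma mk_map_hom:
  assumes X: "X \<in> Obj K" and Y: "Y \<in> Obj K"
    and f: "\<And>n x. x \<in> P \<Longrightarrow> f n x \<in> hom C (ob X n x) (ob Y n x)"
    and fm: "\<And>n x y. (x, y) \<in> R \<Longrightarrow> Comp C (f n y) (mp X n x y) = Comp C (mp Y n x y) (f n x)"
    and fd: "\<And>n x. x \<in> P \<Longrightarrow> Comp C (df Y n x) (f n x) = Comp C (f (n + 1) x) (df X n x)"
  shows "mk_map P X Y f \<in> hom K X Y"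
proof -
  have "(fst X n, fst Y n, restrict (f n) P) \<in> hom FC (fst X n) (fst Y n)" for n
    using FC_homI[OF fst_X[OF X] fst_X[OF Y], of "f n"] f fm
    by (simp add: poset_category_sel poset_category_hom ob_def mp_def)
  moreover have "Comp FC (snd Y n) (fst X n, fst Y n, restrict (f n) P) =
      Comp FC (fst X (n + 1), fst Y (n + 1), restrict (f (n + 1)) P) (snd X n)" for n
    using fd[of _ n] hom_FC_fst[OF snd_X[OF X, of n]] hom_FC_fst[OF snd_X[OF Y, of n]]
    by (auto simp: functor_category_sel poset_category_sel df_def restrict_def fun_eq_iff)
  ultimately show ?thesis using X Y unfolding complexes_hom mk_map_def by simp
qed

lemma diagram_map_eqI:
  assumes f: "f \<in> hom K X Y" and g: "g \<in> hom K X Y"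
    and eq: "\<And>n x. x \<in> P \<Longrightarrow> cm f n x = cm g n x"
  shows "f = g"
proof -
  have "components f n = components g n" for n
    using eq by (intro FC_eqI[OF f_components[OF f] f_components[OF g]]) (simp add: cm_def poset_category_sel)
  then have "components f = components g" by auto
  moreover have "f = (X, Y, components f)" "g = (X, Y, components g)"
    using f g by (simp_all add: complexes_hom)
  ultimately show ?thesis by metis
qed

lemma quasi_iso_iff:
  assumes f: "f \<in> hom K X Y"
  shows "f \<in> quasi_isos FC \<longleftrightarrow>
    (\<forall>x\<in>P. qis C (\<lambda>n. ob X n x, \<lambda>n. df X n x) (\<lambda>n. ob Y n x, \<lambda>n. df Y n x) (\<lambda>n. cm f n x))"
proof -
  have e: "f = (X, Y, components f)" using f by (simp add: complexes_hom)
  then have "(X, Y, components f) \<in> Arr K" using homD(1)[OF f] by simp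
  from quasi_isos_FC[OF this] e show ?thesis
    by (simp add: poset_category_sel at_cpx_def ob_def df_def cm_def)
qed

end

section \<open>Twisted products\<close>

text \<open>The data for a functor from complexes of diagrams on \<open>(P, R)\<close> to complexes of diagrams on
  \<open>(P, R')\<close>. In degree \<open>n\<close> the value at \<open>x\<close> is the product of the objects \<open>X\<^sub>c\<close> in degree \<open>n + e c\<close>, for
  \<open>c \<in> U x\<close>. Its differential consists of the differentials of \<open>X\<close> and of \<open>(-1)\<^sup>n\<close> times the structure
  map \<open>X\<^sub>b \<rightarrow> X\<^sub>c\<close> for each pair \<open>b \<noteq> c\<close> related by \<open>R\<close>; \<open>e_step\<close> is what makes the degrees match, and
  \<open>height\<close> excludes the composition of two structure maps in the square of the differential.
  A transition map keeps the components common to source and target and is zero in the others;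
  \<open>U_between\<close> makes this functorial, and \<open>U_nat\<close> makes it commute with the differentials.\<close>

locale twisted_product = S: poset_diagrams C P R + T: poset_diagrams C P R'
  for C :: "('o, 'a, 'z) addcat_scheme" and P :: "'p set" and R R' :: "'p rel" +
  fixes U :: "'p \<Rightarrow> 'p set" and e :: "'p \<Rightarrow> int"
  assumes finite_P: "finite P"
    and U_P: "x \<in> P \<Longrightarrow> U x \<subseteq> P"
    and height: "\<lbrakk>(a, b) \<in> R; (b, c) \<in> R\<rbrakk> \<Longrightarrow> a = b \<or> b = c"
    and e_step: "\<lbrakk>(b, c) \<in> R; b \<noteq> c\<rbrakk> \<Longrightarrow> e b = e c + 1"
    and U_between: "\<lbrakk>(x, y) \<in> R'; (y, z) \<in> R'; c \<in> U x; c \<in> U z\<rbrakk> \<Longrightarrow> c \<in> U y"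
    and U_nat: "\<lbrakk>(x, y) \<in> R'; b \<in> U x; c \<in> U y; (b, c) \<in> R\<rbrakk> \<Longrightarrow> b \<in> U y \<and> c \<in> U x"
begin

text \<open>For the degree \<open>n\<close> of the twisted product: \<open>dg n c\<close> is the degree of the factor from \<open>X\<^sub>c\<close>, \<open>V\<close>
  the family of factors, \<open>so\<close> their product, \<open>pr\<close> its projections, \<open>D\<close> the differential, \<open>tm\<close> the
  transition maps, and \<open>diag\<close> the map induced by a graded family \<open>\<phi>\<close> of maps of diagrams.\<close>

definition dg :: "int \<Rightarrow> 'p \<Rightarrow> int" where "dg n c = n + e c"

lemma dg_Suc: "dg (n + 1) c = dg n c + 1" "dg (1 + n) c = dg n c + 1" "dg (n + 2) c = dg n c + 2"
  "dg (2 + n) c = dg n c + 2" "dg (n - 1) c = dg n c - 1"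
  by (simp_all add: dg_def)

lemma dg_step: "\<lbrakk>(b, c) \<in> R; b \<noteq> c\<rbrakk> \<Longrightarrow> dg n c + 1 = dg n b"
  using e_step by (simp add: dg_def)

definition V where "V X n = (\<lambda>c. ob X (dg n c) c)"

definition so where "so X n x = pobj C (U x) (V X n)"

definition pr where "pr X n x = pproj C (U x) (V X n)"

text \<open>The off-diagonal part of the differential, on an element whose components are \<open>p b\<close>. The sum
  runs over all of \<open>P\<close>, with zero terms where nothing contributes, so that sums arising at different
  points have the same index set.\<close>

definition off where
  "off X n x c A p = arrow_sum C A (ob X (dg n c + 1) c)
    (\<lambda>b. if b \<in> U x \<and> (b, c) \<in> R \<and> b \<noteq> c then Comp C (mp X (dg n c + 1) b c) (p b)
      else Zero C A (ob X (dg n c + 1) c)) P"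

definition D where
  "D X n x = tuple C (U x) (V X (n + 1)) (so X n x) (\<lambda>c.
    Add C (Comp C (df X (dg n c) c) (pr X n x c)) (sign C n (off X n x c (so X n x) (pr X n x))))"

definition tm where
  "tm X n x y = tuple C (U y) (V X n) (so X n x)
    (\<lambda>c. if c \<in> U x then pr X n x c else Zero C (so X n x) (ob X (dg n c) c))"

definition diag where
  "diag X Y \<phi> n x = tuple C (U x) (V Y n) (so X n x) (\<lambda>c. Comp C (\<phi> (dg n c) c) (pr X n x c))"

definition Tot where "Tot X = mk_cpx P R' (so X) (tm X) (D X)"

definition Totm where
  "Totm f = mk_map P (Tot (fst f)) (Tot (fst (snd f))) (diag (fst f) (fst (snd f)) (cm f))"

context
  fixes X assumes X: "X \<in> Obj S.K"
begin

lemma family_V: "x \<in> P \<Longrightarrow> S.C.family (U x) (V X n)"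
  using finite_subset[OF U_P finite_P] S.ob_Obj[OF X] U_P unfolding S.C.family_def V_def by blast

lemma so_Obj: "x \<in> P \<Longrightarrow> so X n x \<in> Obj C"
  unfolding so_def by (rule S.C.pobj_Obj[OF family_V])

lemma pr_hom: "\<lbrakk>x \<in> P; c \<in> U x\<rbrakk> \<Longrightarrow> pr X n x c \<in> hom C (so X n x) (ob X (dg n c) c)"
  using S.C.pproj_hom[OF family_V, of x c n] by (simp add: pr_def so_def V_def)

lemma pr_comp_hom: "\<lbrakk>x \<in> P; c \<in> U x; t \<in> hom C A (so X n x)\<rbrakk> \<Longrightarrow> Comp C (pr X n x c) t \<in> hom C A (ob X (dg n c) c)"
  using S.C.Comp_hom pr_hom by blast

lemma elem_eqI:
  assumes "x \<in> P" "u \<in> hom C A (so X n x)" "v \<in> hom C A (so X n x)"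
    "\<And>c. c \<in> U x \<Longrightarrow> Comp C (pr X n x c) u = Comp C (pr X n x c) v"
  shows "u = v"
  using S.C.prod_eqI[OF family_V] assms unfolding pr_def so_def by blast

lemma tuple_so:
  assumes "x \<in> P" "A \<in> Obj C" "\<And>c. c \<in> U x \<Longrightarrow> p c \<in> hom C A (ob X (dg n c) c)"
  shows "tuple C (U x) (V X n) A p \<in> hom C A (so X n x)"
    "c \<in> U x \<Longrightarrow> Comp C (pr X n x c) (tuple C (U x) (V X n) A p) = p c"
  using S.C.tuple_hom[OF family_V, of x A p n] S.C.pproj_tuple[OF family_V, of x A p n c] assms
  by (simp_all add: so_def pr_def V_def)

lemma mp_step_hom: "\<lbrakk>(b, c) \<in> R; b \<noteq> c\<rbrakk> \<Longrightarrow> mp X (dg n c + 1) b c \<in> hom C (ob X (dg n b) b) (ob X (dg n c + 1) c)"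
  using S.mp_hom[OF X, of b c "dg n c + 1"] dg_step by simp

lemma off_hom:
  assumes "c \<in> P" "A \<in> Obj C" "\<And>b. b \<in> U x \<Longrightarrow> p b \<in> hom C A (ob X (dg n b) b)"
  shows "off X n x c A p \<in> hom C A (ob X (dg n c + 1) c)"
  unfolding off_def
  by (rule S.C.arrow_sum_hom[OF finite_P assms(2) S.ob_Obj[OF X assms(1)]])
    (use assms S.ob_Obj[OF X assms(1)] S.C.Zero_hom S.C.Comp_hom[OF _ mp_step_hom] in auto)

lemma off_cong:
  assumes "\<And>b. \<lbrakk>b \<in> U x; (b, c) \<in> R; b \<noteq> c\<rbrakk> \<Longrightarrow> p b = q b"
  shows "off X n x c A p = off X n x c A q"
  unfolding off_def by (rule S.C.arrow_sum_cong[OF finite_P]) (use assms in auto)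

lemma off_Zero:
  assumes "c \<in> P" "A \<in> Obj C"
    "\<And>b. \<lbrakk>b \<in> U x; (b, c) \<in> R; b \<noteq> c\<rbrakk> \<Longrightarrow> p b = Zero C A (ob X (dg n b) b)"
  shows "off X n x c A p = Zero C A (ob X (dg n c + 1) c)"
  unfolding off_def
  by (rule S.C.arrow_sum_Zero[OF finite_P assms(2) S.ob_Obj[OF X assms(1)]])
    (use assms S.ob_Obj[OF X] mp_step_hom[of _ c n] S.R_P in \<open>auto simp: hom_def S.C.add_simps\<close>)

lemma off_comp:
  assumes "c \<in> P" "A \<in> Obj C" "\<And>b. b \<in> U x \<Longrightarrow> p b \<in> hom C A (ob X (dg n b) b)" "h \<in> hom C B A"
  shows "Comp C (off X n x c A p) h = off X n x c B (\<lambda>b. Comp C (p b) h)"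
proof -
  have "Comp C (off X n x c A p) h = arrow_sum C B (ob X (dg n c + 1) c)
    (\<lambda>b. Comp C (if b \<in> U x \<and> (b, c) \<in> R \<and> b \<noteq> c then Comp C (mp X (dg n c + 1) b c) (p b)
      else Zero C A (ob X (dg n c + 1) c)) h) P"
    unfolding off_def
    by (rule S.C.arrow_sum_Comp_right[OF finite_P S.ob_Obj[OF X assms(1)] assms(4)])
      (use assms S.ob_Obj[OF X assms(1)] S.C.Zero_hom S.C.Comp_hom[OF _ mp_step_hom] in auto)
  also have "\<dots> = off X n x c B (\<lambda>b. Comp C (p b) h)"
    unfolding off_def
  proof (rule S.C.arrow_sum_cong[OF finite_P])
    fix b
    show "Comp C (if b \<in> U x \<and> (b, c) \<in> R \<and> b \<noteq> c then Comp C (mp X (dg n c + 1) b c) (p b)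
          else Zero C A (ob X (dg n c + 1) c)) h =
        (if b \<in> U x \<and> (b, c) \<in> R \<and> b \<noteq> c then Comp C (mp X (dg n c + 1) b c) (Comp C (p b) h)
          else Zero C B (ob X (dg n c + 1) c))"
      using S.C.Comp_assoc[OF assms(4) assms(3) mp_step_hom, of b c] assms(2,4) S.ob_Obj[OF X assms(1)]
      by (auto simp: hom_def S.C.add_simps)
  qed
  finally show ?thesis .
qed

lemma off_df:
  assumes "x \<in> P" "c \<in> P" "A \<in> Obj C" "\<And>b. b \<in> U x \<Longrightarrow> p b \<in> hom C A (ob X (dg n b) b)"
  shows "off X (n + 1) x c A (\<lambda>b. Comp C (df X (dg n b) b) (p b)) = Comp C (df X (dg n c + 1) c) (off X n x c A p)"
proof -
  let ?d = "df X (dg n c + 1) c"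
  have d: "?d \<in> hom C (ob X (dg n c + 1) c) (ob X (dg n c + 2) c)" using S.df_hom[OF X assms(2), of "dg n c + 1"] by (simp add: add.commute)
  have "Comp C ?d (off X n x c A p) = arrow_sum C A (ob X (dg n c + 2) c)
    (\<lambda>b. Comp C ?d (if b \<in> U x \<and> (b, c) \<in> R \<and> b \<noteq> c then Comp C (mp X (dg n c + 1) b c) (p b)
      else Zero C A (ob X (dg n c + 1) c))) P"
    unfolding off_def
    by (rule S.C.arrow_sum_Comp_left[OF finite_P assms(3) d])
      (use assms S.ob_Obj[OF X assms(2)] S.C.Zero_hom S.C.Comp_hom[OF _ mp_step_hom] in auto)
  also have "\<dots> = off X (n + 1) x c A (\<lambda>b. Comp C (df X (dg n b) b) (p b))"
    unfolding off_def dg_Suc add.assoc one_add_one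
  proof (rule S.C.arrow_sum_cong[OF finite_P])
    fix b
    have "Comp C ?d (Comp C (mp X (dg n c + 1) b c) (p b)) =
        Comp C (mp X (dg n c + 2) b c) (Comp C (df X (dg n b) b) (p b))"
      if b: "b \<in> U x" "(b, c) \<in> R" "b \<noteq> c"
    proof -
      have m: "mp X (dg n b + 1) b c \<in> hom C (ob X (dg n b + 1) b) (ob X (dg n b + 1) c)"
        using S.mp_hom[OF X b(2)] by simp
      have "Comp C ?d (Comp C (mp X (dg n c + 1) b c) (p b)) = Comp C (Comp C ?d (mp X (dg n c + 1) b c)) (p b)"
        using S.C.Comp_assoc[OF assms(4)[OF b(1)] mp_step_hom[OF b(2,3)] d] .
      also have "\<dots> = Comp C (Comp C (mp X (dg n b + 1) b c) (df X (dg n b) b)) (p b)"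
        using S.mp_df[OF X b(2), of "dg n b"] dg_step[OF b(2,3), of n] by simp
      also have "\<dots> = Comp C (mp X (dg n b + 1) b c) (Comp C (df X (dg n b) b) (p b))"
        using S.C.Comp_assoc[OF assms(4)[OF b(1)] S.df_hom[OF X] m] S.R_P[OF b(2)] by simp
      also have "dg n b + 1 = dg n c + 2" using dg_step[OF b(2,3), of n] by simp
      finally show ?thesis .
    qed
    then show "Comp C ?d (if b \<in> U x \<and> (b, c) \<in> R \<and> b \<noteq> c then Comp C (mp X (dg n c + 1) b c) (p b)
          else Zero C A (ob X (dg n c + 1) c)) =
        (if b \<in> U x \<and> (b, c) \<in> R \<and> b \<noteq> c then Comp C (mp X (dg n c + 2) b c) (Comp C (df X (dg n b) b) (p b))
          else Zero C A (ob X (dg n c + 2) c))"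
      using d assms(3) by (auto simp: hom_def S.C.add_simps)
  qed
  finally show ?thesis ..
qed

lemma off_Add:
  assumes "c \<in> P" "A \<in> Obj C" "\<And>b. b \<in> U x \<Longrightarrow> p b \<in> hom C A (ob X (dg n b) b)"
    "\<And>b. b \<in> U x \<Longrightarrow> q b \<in> hom C A (ob X (dg n b) b)"
  shows "off X n x c A (\<lambda>b. Add C (p b) (q b)) = Add C (off X n x c A p) (off X n x c A q)"
proof -
  have "Add C (off X n x c A p) (off X n x c A q) = arrow_sum C A (ob X (dg n c + 1) c)
    (\<lambda>b. Add C (if b \<in> U x \<and> (b, c) \<in> R \<and> b \<noteq> c then Comp C (mp X (dg n c + 1) b c) (p b)
      else Zero C A (ob X (dg n c + 1) c)) (if b \<in> U x \<and> (b, c) \<in> R \<and> b \<noteq> c then Comp C (mp X (dg n c + 1) b c) (q b)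
      else Zero C A (ob X (dg n c + 1) c))) P"
    unfolding off_def
    by (rule S.C.arrow_sum_Add[OF finite_P assms(2) S.ob_Obj[OF X assms(1)], symmetric])
      (use assms S.ob_Obj[OF X assms(1)] S.C.Zero_hom S.C.Comp_hom[OF _ mp_step_hom] in auto)
  also have "\<dots> = off X n x c A (\<lambda>b. Add C (p b) (q b))"
    unfolding off_def
    by (rule S.C.arrow_sum_cong[OF finite_P])
      (use assms S.ob_Obj[OF X assms(1)] S.C.Comp_Add_left[OF assms(3,4) mp_step_hom] S.C.Zero_Arr S.C.Add_0 in auto)
  finally show ?thesis ..
qed

text \<open>The off-diagonal part at \<open>c\<close> is not affected by a change of the point as long as the components that
  map to \<open>c\<close> stay the same.\<close>

lemma off_change:
  assumes "c \<in> P" "A \<in> Obj C"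
    and "\<And>b. \<lbrakk>(b, c) \<in> R; b \<in> U x\<rbrakk> \<Longrightarrow> b \<in> U y \<and> p b = q b"
    and "\<And>b. \<lbrakk>(b, c) \<in> R; b \<in> U y; b \<notin> U x\<rbrakk> \<Longrightarrow> p b = Zero C A (ob X (dg n b) b)"
  shows "off X n y c A p = off X n x c A q"
  unfolding off_def
proof (rule S.C.arrow_sum_cong[OF finite_P])
  fix b
  show "(if b \<in> U y \<and> (b, c) \<in> R \<and> b \<noteq> c then Comp C (mp X (dg n c + 1) b c) (p b) else Zero C A (ob X (dg n c + 1) c)) =
      (if b \<in> U x \<and> (b, c) \<in> R \<and> b \<noteq> c then Comp C (mp X (dg n c + 1) b c) (q b) else Zero C A (ob X (dg n c + 1) c))"
    using assms(2) assms(3,4)[of b] mp_step_hom[of b c n] by (auto simp: hom_def S.C.add_simps)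
qed

lemma pr_D:
  assumes x: "x \<in> P" and t: "t \<in> hom C A (so X n x)"
  shows "D X n x \<in> hom C (so X n x) (so X (n + 1) x)"
    "c \<in> U x \<Longrightarrow> Comp C (pr X (n + 1) x c) (Comp C (D X n x) t) =
      Add C (Comp C (df X (dg n c) c) (Comp C (pr X n x c) t))
        (sign C n (off X n x c A (\<lambda>b. Comp C (pr X n x b) t)))"
proof -
  have row: "Add C (Comp C (df X (dg n c) c) (pr X n x c)) (sign C n (off X n x c (so X n x) (pr X n x)))
      \<in> hom C (so X n x) (ob X (dg (n + 1) c) c)" if c: "c \<in> U x" for c
  proof -
    have cP: "c \<in> P" using c U_P[OF x] by blast
    show ?thesis
      using S.df_hom[OF X cP, of "dg n c"] pr_hom[OF x c, of n] off_hom[OF cP so_Obj[OF x] pr_hom[OF x], where n = n]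
      by (simp add: hom_def S.C.add_simps S.C.sign_simps dg_Suc)
  qed
  have D: "D X n x \<in> hom C (so X n x) (so X (n + 1) x)"
    "c \<in> U x \<Longrightarrow> Comp C (pr X (n + 1) x c) (D X n x) =
      Add C (Comp C (df X (dg n c) c) (pr X n x c)) (sign C n (off X n x c (so X n x) (pr X n x)))" for c
    unfolding D_def by (rule tuple_so[OF x so_Obj[OF x] row]; assumption)+
  show "D X n x \<in> hom C (so X n x) (so X (n + 1) x)" by (rule D)
  show "Comp C (pr X (n + 1) x c) (Comp C (D X n x) t) =
      Add C (Comp C (df X (dg n c) c) (Comp C (pr X n x c) t))
        (sign C n (off X n x c A (\<lambda>b. Comp C (pr X n x b) t)))" if c: "c \<in> U x"
  proof -
    have cP: "c \<in> P" using c U_P[OF x] by blast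
    note o = off_hom[OF cP so_Obj[OF x] pr_hom[OF x], where n = n]
    have "Comp C (pr X (n + 1) x c) (Comp C (D X n x) t) = Comp C (Comp C (pr X (n + 1) x c) (D X n x)) t"
      using S.C.Comp_assoc[OF t D(1) pr_hom[OF x c]] .
    also have "\<dots> = Add C (Comp C (df X (dg n c) c) (Comp C (pr X n x c) t))
        (sign C n (Comp C (off X n x c (so X n x) (pr X n x)) t))"
      unfolding D(2)[OF c]
      using t S.df_hom[OF X cP, of "dg n c"] pr_hom[OF x c, of n] o
      by (simp add: hom_def S.C.add_simps S.C.sign_simps dg_Suc)
    also have "Comp C (off X n x c (so X n x) (pr X n x)) t = off X n x c A (\<lambda>b. Comp C (pr X n x b) t)"
      by (rule off_comp[OF cP so_Obj[OF x] pr_hom[OF x] t])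
    finally show ?thesis .
  qed
qed

lemma D_hom: "x \<in> P \<Longrightarrow> D X n x \<in> hom C (so X n x) (so X (n + 1) x)"
  by (rule pr_D(1)[OF _ S.C.Idn_hom[OF so_Obj]])

lemma pr_tm:
  assumes x: "x \<in> P" and y: "y \<in> P" and t: "t \<in> hom C A (so X n x)"
  shows "tm X n x y \<in> hom C (so X n x) (so X n y)"
    "c \<in> U y \<Longrightarrow> Comp C (pr X n y c) (Comp C (tm X n x y) t) =
      (if c \<in> U x then Comp C (pr X n x c) t else Zero C A (ob X (dg n c) c))"
proof -
  have row: "(if c \<in> U x then pr X n x c else Zero C (so X n x) (ob X (dg n c) c))
      \<in> hom C (so X n x) (ob X (dg n c) c)" if "c \<in> U y" for c
    using that U_P[OF y] pr_hom[OF x] S.C.Zero_hom[OF so_Obj[OF x] S.ob_Obj[OF X]] by auto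
  have tm: "tm X n x y \<in> hom C (so X n x) (so X n y)"
    "c \<in> U y \<Longrightarrow> Comp C (pr X n y c) (tm X n x y) =
      (if c \<in> U x then pr X n x c else Zero C (so X n x) (ob X (dg n c) c))" for c
    unfolding tm_def by (rule tuple_so[OF y so_Obj[OF x] row]; assumption)+
  show "tm X n x y \<in> hom C (so X n x) (so X n y)" by (rule tm)
  show "Comp C (pr X n y c) (Comp C (tm X n x y) t) =
      (if c \<in> U x then Comp C (pr X n x c) t else Zero C A (ob X (dg n c) c))" if c: "c \<in> U y"
    using S.C.Comp_assoc[OF t tm(1) pr_hom[OF y c]] tm(2)[OF c] t so_Obj[OF x] S.ob_Obj[OF X, of c] U_P[OF y] c
    by (auto simp: hom_def S.C.add_simps)
qed

end

end

subsection \<open>Construction and functoriality\<close>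

lemma (in category) eq_by_elements:
  assumes "f \<in> hom C X Y" "g \<in> hom C X Y" "\<And>t. t \<in> hom C X X \<Longrightarrow> f \<cdot> t = g \<cdot> t"
  shows "f = g"
  using assms(3)[OF Idn_hom] Comp_Idn_right[OF assms(1)] Comp_Idn_right[OF assms(2)] hom_Obj[OF assms(1)] by simp

lemma complexes_fst: "f \<in> hom (complexes C) X Y \<Longrightarrow> fst f = X \<and> fst (snd f) = Y"
  by (auto simp: hom_def complexes_Dom)

context twisted_product
begin

text \<open>By \<open>U_nat\<close> the off-diagonal entries of the differential connect the common components of both
  points only among each other, and the omitted components of the source only among each other.\<close>

lemma tm_D:
  assumes X: "X \<in> Obj S.K" and xy: "(x, y) \<in> R'" and t: "t \<in> hom C A (so X n x)"
  shows "Comp C (D X n y) (Comp C (tm X n x y) t) = Comp C (tm X (n + 1) x y) (Comp C (D X n x) t)"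
proof -
  have x: "x \<in> P" and y: "y \<in> P" using T.R_P[OF xy] by auto
  have A: "A \<in> Obj C" using S.C.hom_Obj[OF t] by simp
  note tt = S.C.Comp_hom[OF t pr_tm(1)[OF X x y t]]
  note Dt = S.C.Comp_hom[OF t D_hom[OF X x]]
  show ?thesis
  proof (rule elem_eqI[OF X y S.C.Comp_hom[OF tt D_hom[OF X y]] S.C.Comp_hom[OF Dt pr_tm(1)[OF X x y Dt]]])
    fix c assume c: "c \<in> U y"
    then have cP: "c \<in> P" using U_P[OF y] by blast
    let ?p = "\<lambda>b. Comp C (pr X n y b) (Comp C (tm X n x y) t)"
    have p: "?p b = (if b \<in> U x then Comp C (pr X n x b) t else Zero C A (ob X (dg n b) b))" if "b \<in> U y" for b
      using pr_tm(2)[OF X x y t that] .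
    note df = S.df_hom[OF X cP, of "dg n c"]
    show "Comp C (pr X (n + 1) y c) (Comp C (D X n y) (Comp C (tm X n x y) t)) =
        Comp C (pr X (n + 1) y c) (Comp C (tm X (n + 1) x y) (Comp C (D X n x) t))"
    proof (cases "c \<in> U x")
      case True
      have "off X n y c A ?p = off X n x c A (\<lambda>b. Comp C (pr X n x b) t)"
        by (rule off_change[OF X cP A]) (use p U_nat[OF xy _ c] in auto)
      then show ?thesis
        using True pr_D(2)[OF X y tt c] pr_D(2)[OF X x t True] pr_tm(2)[OF X x y Dt c] p[OF c] by simp
    next
      case False
      have "off X n y c A ?p = Zero C A (ob X (dg n c + 1) c)"
        by (rule off_Zero[OF X cP A]) (use p U_nat[OF xy _ c] False in auto)
      then show ?thesis
        using False pr_D(2)[OF X y tt c] pr_tm(2)[OF X x y Dt c] p[OF c] df A S.ob_Obj[OF X cP]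
        by (simp add: hom_def S.C.add_simps S.C.sign_simps dg_Suc)
    qed
  qed
qed

text \<open>The square of the diagonal part vanishes, that of the off-diagonal part by \<open>height\<close>, and the
  mixed terms cancel because the sign changes from degree \<open>n\<close> to \<open>n + 1\<close>.\<close>

lemma D_D:
  assumes X: "X \<in> Obj S.K" and x: "x \<in> P" and t: "t \<in> hom C A (so X n x)"
  shows "Comp C (D X (n + 1) x) (Comp C (D X n x) t) = Zero C A (so X (n + 2) x)"
proof -
  have A: "A \<in> Obj C" using S.C.hom_Obj[OF t] by simp
  note Dt = S.C.Comp_hom[OF t D_hom[OF X x]]
  have DDt: "Comp C (D X (n + 1) x) (Comp C (D X n x) t) \<in> hom C A (so X (n + 2) x)"
    using S.C.Comp_hom[OF Dt D_hom[OF X x]] by (simp add: add.commute)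
  show ?thesis
  proof (rule elem_eqI[OF X x DDt S.C.Zero_hom[OF A so_Obj[OF X x]]])
    fix c assume c: "c \<in> U x"
    then have cP: "c \<in> P" using U_P[OF x] by blast
    let ?p = "\<lambda>b. Comp C (pr X n x b) t"
    have p: "?p b \<in> hom C A (ob X (dg n b) b)" if "b \<in> U x" for b using pr_comp_hom[OF X x that t] .
    have "off X (n + 1) x c A (\<lambda>b. Comp C (pr X (n + 1) x b) (Comp C (D X n x) t)) =
        off X (n + 1) x c A (\<lambda>b. Comp C (df X (dg n b) b) (?p b))"
    proof (rule off_cong[OF X])
      fix b assume b: "b \<in> U x" "(b, c) \<in> R" "b \<noteq> c"
      then have bP: "b \<in> P" using U_P[OF x] by blast
      have "off X n x b A ?p = Zero C A (ob X (dg n b + 1) b)"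
        by (rule off_Zero[OF X bP A]) (use height b in blast)
      then show "Comp C (pr X (n + 1) x b) (Comp C (D X n x) t) = Comp C (df X (dg n b) b) (?p b)"
        using pr_D(2)[OF X x t b(1)] S.df_hom[OF X bP, of "dg n b"] p[OF b(1)] A S.ob_Obj[OF X bP]
        by (simp add: hom_def S.C.add_simps S.C.sign_simps)
    qed
    also have "\<dots> = Comp C (df X (dg n c + 1) c) (off X n x c A ?p)"
      by (rule off_df[OF X x cP A p])
    finally have o: "off X (n + 1) x c A (\<lambda>b. Comp C (pr X (n + 1) x b) (Comp C (D X n x) t)) =
      Comp C (df X (dg n c + 1) c) (off X n x c A ?p)" .
    have "Comp C (pr X (n + 2) x c) (Comp C (D X (n + 1) x) (Comp C (D X n x) t)) =
       Add C (Comp C (df X (dg n c + 1) c) (Comp C (pr X (n + 1) x c) (Comp C (D X n x) t)))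
         (sign C (n + 1) (Comp C (df X (dg n c + 1) c) (off X n x c A ?p)))"
      using pr_D(2)[OF X x Dt c] o by (simp add: dg_Suc add.commute)
    also have "Comp C (pr X (n + 1) x c) (Comp C (D X n x) t) =
        Add C (Comp C (df X (dg n c) c) (?p c)) (sign C n (off X n x c A ?p))"
      by (rule pr_D(2)[OF X x t c])
    finally show "Comp C (pr X (n + 2) x c) (Comp C (D X (n + 1) x) (Comp C (D X n x) t)) =
        Comp C (pr X (n + 2) x c) (Zero C A (so X (n + 2) x))"
      using S.df_df'[OF X cP p[OF c]] S.df_hom[OF X cP, of "dg n c"] S.df_hom[OF X cP, of "dg n c + 1"] p[OF c]
        off_hom[OF X cP A p] pr_hom[OF X x c, of "n + 2"] A S.ob_Obj[OF X cP] so_Obj[OF X x]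
      by (simp add: hom_def S.C.add_simps S.C.sign_simps S.C.Add_inverse dg_Suc add.commute)
  qed
qed

lemma Tot_Obj:
  assumes X: "X \<in> Obj S.K"
  shows "Tot X \<in> Obj T.K"
  unfolding Tot_def
proof (rule T.mk_cpx_Obj)
  fix n x assume x: "x \<in> P"
  show "so X n x \<in> Obj C" by (rule so_Obj[OF X x])
  show "D X n x \<in> hom C (so X n x) (so X (n + 1) x)" by (rule D_hom[OF X x])
  show "tm X n x x = Idn C (so X n x)"
  proof (rule S.C.eq_by_elements[OF pr_tm(1)[OF X x x S.C.Idn_hom] S.C.Idn_hom]; (rule so_Obj[OF X x])?)
    fix t assume t: "t \<in> hom C (so X n x) (so X n x)"
    show "Comp C (tm X n x x) t = Comp C (Idn C (so X n x)) t"
      by (rule elem_eqI[OF X x S.C.Comp_hom[OF t pr_tm(1)[OF X x x t]] S.C.Comp_hom[OF t S.C.Idn_hom[OF so_Obj[OF X x]]]])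
        (use pr_tm(2)[OF X x x t] S.C.Comp_Idn_left[OF t] in simp)
  qed
  show "Comp C (D X (n + 1) x) (D X n x) = Zero C (so X n x) (so X (n + 2) x)"
    using D_D[OF X x S.C.Idn_hom[OF so_Obj[OF X x]], of n] S.C.Comp_Idn_right[OF D_hom[OF X x]] by simp
next
  fix n x y assume xy: "(x, y) \<in> R'"
  then have x: "x \<in> P" and y: "y \<in> P" using T.R_P by auto
  note i = S.C.Idn_hom[OF so_Obj[OF X x]]
  show tm: "tm X n x y \<in> hom C (so X n x) (so X n y)" for n by (rule pr_tm(1)[OF X x y i])
  show "Comp C (D X n y) (tm X n x y) = Comp C (tm X (n + 1) x y) (D X n x)"
    using tm_D[OF X xy i, of n] S.C.Comp_Idn_right[OF D_hom[OF X x]] S.C.Comp_Idn_right[OF tm] by simp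
next
  fix n x y z assume xy: "(x, y) \<in> R'" and yz: "(y, z) \<in> R'"
  then have x: "x \<in> P" and y: "y \<in> P" and z: "z \<in> P" using T.R_P by auto
  note i = S.C.Idn_hom[OF so_Obj[OF X x]]
  note m = pr_tm(1)[OF X x y i] and m' = pr_tm(1)[OF X y z S.C.Idn_hom[OF so_Obj[OF X y]]]
    and m'' = pr_tm(1)[OF X x z i]
  show "tm X n x z = Comp C (tm X n y z) (tm X n x y)"
  proof (rule S.C.eq_by_elements[OF m'' S.C.Comp_hom[OF m m']])
    fix t assume t: "t \<in> hom C (so X n x) (so X n x)"
    note mt = S.C.Comp_hom[OF t m]
    have "Comp C (tm X n x z) t = Comp C (tm X n y z) (Comp C (tm X n x y) t)"
      by (rule elem_eqI[OF X z S.C.Comp_hom[OF t m''] S.C.Comp_hom[OF mt m']])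
        (use pr_tm(2)[OF X x z t] pr_tm(2)[OF X y z mt] pr_tm(2)[OF X x y t] U_between[OF xy yz] in auto)
    then show "Comp C (tm X n x z) t = Comp C (Comp C (tm X n y z) (tm X n x y)) t"
      using S.C.Comp_assoc[OF t m m'] by simp
  qed
qed

lemma Tot_sel:
  "x \<in> P \<Longrightarrow> ob (Tot X) n x = so X n x"
  "(x, y) \<in> R' \<Longrightarrow> mp (Tot X) n x y = tm X n x y"
  "x \<in> P \<Longrightarrow> df (Tot X) n x = D X n x"
  by (simp_all add: Tot_def mk_cpx_sel)

text \<open>The construction applies to every graded family of maps of diagrams, whether or not it
  commutes with the differentials; for mapping cones, the splittings are such families.\<close>

definition graded_map where
  "graded_map X Y \<phi> \<longleftrightarrow> X \<in> Obj S.K \<and> Y \<in> Obj S.K \<and>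
    (\<forall>m. \<forall>c\<in>P. \<phi> m c \<in> hom C (ob X m c) (ob Y m c)) \<and>
    (\<forall>m. \<forall>(b, c)\<in>R. Comp C (\<phi> m c) (mp X m b c) = Comp C (mp Y m b c) (\<phi> m b))"

lemma graded_map_cm: "f \<in> hom S.K X Y \<Longrightarrow> graded_map X Y (cm f)"
  unfolding graded_map_def using S.cm_hom[of f X Y] S.cm_mp[of f X Y] S.f_Obj[of f X Y] by auto

context
  fixes X Y \<phi> assumes \<phi>: "graded_map X Y \<phi>"
begin

lemma gX: "X \<in> Obj S.K" and gY: "Y \<in> Obj S.K"
  and g_hom: "c \<in> P \<Longrightarrow> \<phi> m c \<in> hom C (ob X m c) (ob Y m c)"
  and g_mp: "(b, c) \<in> R \<Longrightarrow> Comp C (\<phi> m c) (mp X m b c) = Comp C (mp Y m b c) (\<phi> m b)"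
  using \<phi> by (auto simp: graded_map_def)

lemma diag_hom: "x \<in> P \<Longrightarrow> diag X Y \<phi> n x \<in> hom C (so X n x) (so Y n x)"
  unfolding diag_def
  by (rule tuple_so[OF gY _ so_Obj[OF gX] S.C.Comp_hom[OF pr_hom[OF gX] g_hom]]) (use U_P in auto)

lemma pr_diag:
  assumes x: "x \<in> P" and t: "t \<in> hom C A (so X n x)" and c: "c \<in> U x"
  shows "Comp C (pr Y n x c) (Comp C (diag X Y \<phi> n x) t) = Comp C (\<phi> (dg n c) c) (Comp C (pr X n x c) t)"
proof -
  have cP: "c \<in> P" using c U_P[OF x] by blast
  have "Comp C (pr Y n x c) (diag X Y \<phi> n x) = Comp C (\<phi> (dg n c) c) (pr X n x c)"
    unfolding diag_def
    by (rule tuple_so(2)[OF gY x so_Obj[OF gX x] S.C.Comp_hom[OF pr_hom[OF gX x] g_hom] c]) (use U_P[OF x] in auto)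
  then show ?thesis
    using S.C.Comp_assoc[OF t diag_hom[OF x] pr_hom[OF gY x c]] S.C.Comp_assoc[OF t pr_hom[OF gX x c] g_hom[OF cP]]
    by simp
qed

lemma diag_tm:
  assumes xy: "(x, y) \<in> R'"
  shows "Comp C (diag X Y \<phi> n y) (tm X n x y) = Comp C (tm Y n x y) (diag X Y \<phi> n x)"
proof -
  have x: "x \<in> P" and y: "y \<in> P" using T.R_P[OF xy] by auto
  note m = pr_tm(1)[OF gX x y S.C.Idn_hom[OF so_Obj[OF gX x]]]
    and m' = pr_tm(1)[OF gY x y S.C.Idn_hom[OF so_Obj[OF gY x]]]
  show ?thesis
  proof (rule S.C.eq_by_elements[OF S.C.Comp_hom[OF m diag_hom[OF y]] S.C.Comp_hom[OF diag_hom[OF x] m']])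
    fix t assume t: "t \<in> hom C (so X n x) (so X n x)"
    note mt = S.C.Comp_hom[OF t m] and dt = S.C.Comp_hom[OF t diag_hom[OF x]]
    have "Comp C (diag X Y \<phi> n y) (Comp C (tm X n x y) t) = Comp C (tm Y n x y) (Comp C (diag X Y \<phi> n x) t)"
    proof (rule elem_eqI[OF gY y S.C.Comp_hom[OF mt diag_hom[OF y]] S.C.Comp_hom[OF dt m']])
      fix c assume c: "c \<in> U y"
      then have cP: "c \<in> P" using U_P[OF y] by blast
      show "Comp C (pr Y n y c) (Comp C (diag X Y \<phi> n y) (Comp C (tm X n x y) t)) =
          Comp C (pr Y n y c) (Comp C (tm Y n x y) (Comp C (diag X Y \<phi> n x) t))"
        using pr_diag[OF y mt c] pr_tm(2)[OF gX x y t c] pr_tm(2)[OF gY x y dt c] pr_diag[OF x t, of c]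
          g_hom[OF cP, of "dg n c"] so_Obj[OF gX x, of n]
        by (simp add: hom_def S.C.add_simps)
    qed
    then show "Comp C (Comp C (diag X Y \<phi> n y) (tm X n x y)) t = Comp C (Comp C (tm Y n x y) (diag X Y \<phi> n x)) t"
      using S.C.Comp_assoc[OF t m diag_hom[OF y]] S.C.Comp_assoc[OF t diag_hom[OF x] m'] by simp
  qed
qed

lemma off_map:
  assumes "x \<in> P" "c \<in> P" "A \<in> Obj C" "\<And>b. b \<in> U x \<Longrightarrow> p b \<in> hom C A (ob X (dg n b) b)"
  shows "Comp C (\<phi> (dg n c + 1) c) (off X n x c A p) = off Y n x c A (\<lambda>b. Comp C (\<phi> (dg n b) b) (p b))"
proof -
  let ?d = "\<phi> (dg n c + 1) c"
  have d: "?d \<in> hom C (ob X (dg n c + 1) c) (ob Y (dg n c + 1) c)" using g_hom[OF assms(2)] .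
  have "Comp C ?d (off X n x c A p) = arrow_sum C A (ob Y (dg n c + 1) c)
    (\<lambda>b. Comp C ?d (if b \<in> U x \<and> (b, c) \<in> R \<and> b \<noteq> c then Comp C (mp X (dg n c + 1) b c) (p b)
      else Zero C A (ob X (dg n c + 1) c))) P"
    unfolding off_def
    by (rule S.C.arrow_sum_Comp_left[OF finite_P assms(3) d])
      (use assms S.ob_Obj[OF gX assms(2)] S.C.Zero_hom S.C.Comp_hom[OF _ mp_step_hom[OF gX]] in auto)
  also have "\<dots> = off Y n x c A (\<lambda>b. Comp C (\<phi> (dg n b) b) (p b))"
    unfolding off_def
  proof (rule S.C.arrow_sum_cong[OF finite_P])
    fix b
    have "Comp C ?d (Comp C (mp X (dg n c + 1) b c) (p b)) =
        Comp C (mp Y (dg n c + 1) b c) (Comp C (\<phi> (dg n b) b) (p b))"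
      if b: "b \<in> U x" "(b, c) \<in> R" "b \<noteq> c"
    proof -
      have f: "\<phi> (dg n c + 1) b \<in> hom C (ob X (dg n b) b) (ob Y (dg n b) b)"
        using g_hom[of b "dg n b"] S.R_P[OF b(2)] dg_step[OF b(2,3), of n] by simp
      have "Comp C ?d (Comp C (mp X (dg n c + 1) b c) (p b)) = Comp C (Comp C ?d (mp X (dg n c + 1) b c)) (p b)"
        using S.C.Comp_assoc[OF assms(4)[OF b(1)] mp_step_hom[OF gX b(2,3)] d] .
      also have "\<dots> = Comp C (Comp C (mp Y (dg n c + 1) b c) (\<phi> (dg n c + 1) b)) (p b)"
        using g_mp[OF b(2), of "dg n c + 1"] by simp
      also have "\<dots> = Comp C (mp Y (dg n c + 1) b c) (Comp C (\<phi> (dg n c + 1) b) (p b))"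
        using S.C.Comp_assoc[OF assms(4)[OF b(1)] f mp_step_hom[OF gY b(2,3)]] by simp
      finally show ?thesis using dg_step[OF b(2,3), of n] by simp
    qed
    then show "Comp C ?d (if b \<in> U x \<and> (b, c) \<in> R \<and> b \<noteq> c then Comp C (mp X (dg n c + 1) b c) (p b)
          else Zero C A (ob X (dg n c + 1) c)) =
        (if b \<in> U x \<and> (b, c) \<in> R \<and> b \<noteq> c then Comp C (mp Y (dg n c + 1) b c) (Comp C (\<phi> (dg n b) b) (p b))
          else Zero C A (ob Y (dg n c + 1) c))"
      using d assms(3) by (auto simp: hom_def S.C.add_simps)
  qed
  finally show ?thesis .
qed

end

lemma diag_D:
  assumes f: "f \<in> hom S.K X Y" and x: "x \<in> P"
  shows "Comp C (D Y n x) (diag X Y (cm f) n x) = Comp C (diag X Y (cm f) (n + 1) x) (D X n x)"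
proof -
  note \<phi> = graded_map_cm[OF f]
  note X = gX[OF \<phi>] and Y = gY[OF \<phi>]
  note d = diag_hom[OF \<phi> x] and DX = D_hom[OF X x] and DY = D_hom[OF Y x]
  show ?thesis
  proof (rule S.C.eq_by_elements[OF S.C.Comp_hom[OF d DY] S.C.Comp_hom[OF DX d]])
    fix t assume t: "t \<in> hom C (so X n x) (so X n x)"
    note dt = S.C.Comp_hom[OF t d] and Dt = S.C.Comp_hom[OF t DX]
    have "Comp C (D Y n x) (Comp C (diag X Y (cm f) n x) t) = Comp C (diag X Y (cm f) (n + 1) x) (Comp C (D X n x) t)"
    proof (rule elem_eqI[OF Y x S.C.Comp_hom[OF dt DY] S.C.Comp_hom[OF Dt d]])
      fix c assume c: "c \<in> U x"
      then have cP: "c \<in> P" using U_P[OF x] by blast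
      let ?A = "so X n x"
      let ?p = "\<lambda>b. Comp C (pr X n x b) t"
      have p: "?p b \<in> hom C ?A (ob X (dg n b) b)" if "b \<in> U x" for b using pr_comp_hom[OF X x that t] .
      have o: "off Y n x c ?A (\<lambda>b. Comp C (pr Y n x b) (Comp C (diag X Y (cm f) n x) t)) =
          Comp C (cm f (dg n c + 1) c) (off X n x c ?A ?p)"
        using off_map[OF \<phi> x cP so_Obj[OF X x] p]
          off_cong[OF Y, of x c "\<lambda>b. Comp C (pr Y n x b) (Comp C (diag X Y (cm f) n x) t)"
            "\<lambda>b. Comp C (cm f (dg n b) b) (?p b)" n ?A] pr_diag[OF \<phi> x t] by simp
      have 1: "Comp C (pr Y (n + 1) x c) (Comp C (D Y n x) (Comp C (diag X Y (cm f) n x) t)) =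
          Add C (Comp C (df Y (dg n c) c) (Comp C (cm f (dg n c) c) (?p c)))
            (sign C n (Comp C (cm f (dg n c + 1) c) (off X n x c ?A ?p)))"
        using pr_D(2)[OF Y x dt c] o pr_diag[OF \<phi> x t c] by simp
      have 2: "Comp C (pr Y (n + 1) x c) (Comp C (diag X Y (cm f) (n + 1) x) (Comp C (D X n x) t)) =
          Comp C (cm f (dg n c + 1) c) (Add C (Comp C (df X (dg n c) c) (?p c)) (sign C n (off X n x c ?A ?p)))"
        using pr_diag[OF \<phi> x Dt c] pr_D(2)[OF X x t c] by (simp add: dg_Suc)
      have "Comp C (df Y (dg n c) c) (Comp C (cm f (dg n c) c) (?p c)) =
          Comp C (cm f (dg n c + 1) c) (Comp C (df X (dg n c) c) (?p c))"
        using S.C.Comp_assoc[OF p[OF c] S.cm_hom[OF f cP] S.df_hom[OF Y cP]] S.cm_df[OF f cP, of "dg n c"]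
          S.C.Comp_assoc[OF p[OF c] S.df_hom[OF X cP] S.cm_hom[OF f cP]] by simp
      with 1 2 show "Comp C (pr Y (n + 1) x c) (Comp C (D Y n x) (Comp C (diag X Y (cm f) n x) t)) =
          Comp C (pr Y (n + 1) x c) (Comp C (diag X Y (cm f) (n + 1) x) (Comp C (D X n x) t))"
        using p[OF c] S.df_hom[OF X cP, of "dg n c"] S.cm_hom[OF f cP, of "dg n c + 1"]
          off_hom[OF X cP so_Obj[OF X x] p]
        by (simp add: hom_def S.C.add_simps S.C.sign_simps)
    qed
    then show "Comp C (Comp C (D Y n x) (diag X Y (cm f) n x)) t = Comp C (Comp C (diag X Y (cm f) (n + 1) x) (D X n x)) t"
      using S.C.Comp_assoc[OF t d DY] S.C.Comp_assoc[OF t DX d] by simp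
  qed
qed

lemma Totm_hom:
  assumes f: "f \<in> hom S.K X Y"
  shows "Totm f \<in> hom T.K (Tot X) (Tot Y)"
proof -
  have e: "fst f = X" "fst (snd f) = Y" using complexes_fst[OF f] by auto
  note \<phi> = graded_map_cm[OF f]
  show ?thesis
    unfolding Totm_def e
    by (rule T.mk_map_hom[OF Tot_Obj[OF gX[OF \<phi>]] Tot_Obj[OF gY[OF \<phi>]]])
      (use diag_hom[OF \<phi>] diag_tm[OF \<phi>] diag_D[OF f] T.R_P in \<open>simp_all add: Tot_sel\<close>)
qed

lemma cm_Totm: "x \<in> P \<Longrightarrow> f \<in> hom S.K X Y \<Longrightarrow> cm (Totm f) n x = diag X Y (cm f) n x"
  using complexes_fst[of f S.FC X Y] by (simp add: Totm_def mk_map_sel)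

lemma pr_cm_Totm:
  assumes f: "f \<in> hom S.K X Y" and x: "x \<in> P" and t: "t \<in> hom C A (so X n x)" and c: "c \<in> U x"
  shows "Comp C (pr Y n x c) (Comp C (cm (Totm f) n x) t) = Comp C (cm f (dg n c) c) (Comp C (pr X n x c) t)"
  using pr_diag[OF graded_map_cm[OF f] x t c] cm_Totm[OF x f] by simp

end

lemma (in poset_diagrams) cm_Comp:
  "x \<in> P \<Longrightarrow> cm (Comp K g f) n x = Comp C (cm g n x) (cm f n x)"
  by (cases f; cases g) (simp add: cm_def complexes_sel functor_category_sel poset_category_sel)

lemma (in poset_diagrams) cm_Idn: "x \<in> P \<Longrightarrow> cm (Idn K X) n x = Idn C (ob X n x)"
  by (simp add: cm_def ob_def complexes_sel functor_category_sel poset_category_sel)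

context twisted_product
begin

lemma is_functor_Tot: "is_functor S.K T.K (Tot, Totm)"
proof -
  interpret SK: category S.K by (rule S.FC.category_complexes)
  interpret TK: category T.K by (rule T.FC.category_complexes)
  have "Totm (Idn S.K X) = Idn T.K (Tot X)" if X: "X \<in> Obj S.K" for X
  proof (rule T.diagram_map_eqI[OF Totm_hom[OF SK.Idn_hom[OF X]] TK.Idn_hom[OF Tot_Obj[OF X]]])
    fix n x assume x: "x \<in> P"
    note i = SK.Idn_hom[OF X]
    note d = diag_hom[OF graded_map_cm[OF i] x, of n, folded cm_Totm[OF x i]]
    show "cm (Totm (Idn S.K X)) n x = cm (Idn T.K (Tot X)) n x"
      unfolding T.cm_Idn[OF x] Tot_sel(1)[OF x]
    proof (rule S.C.eq_by_elements[OF d S.C.Idn_hom[OF so_Obj[OF X x]]])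
      fix t assume t: "t \<in> hom C (so X n x) (so X n x)"
      show "Comp C (cm (Totm (Idn S.K X)) n x) t = Comp C (Idn C (so X n x)) t"
        by (rule elem_eqI[OF X x S.C.Comp_hom[OF t d] S.C.Comp_hom[OF t S.C.Idn_hom[OF so_Obj[OF X x]]]])
          (use pr_cm_Totm[OF i x t] S.C.Comp_Idn_left[OF t] S.C.Comp_Idn_left[OF pr_comp_hom[OF X x _ t]] U_P[OF x]
            in \<open>auto simp: S.cm_Idn\<close>)
    qed
  qed
  moreover have "Totm (Comp S.K g f) = Comp T.K (Totm g) (Totm f)"
    if f: "f \<in> hom S.K X Y" and g: "g \<in> hom S.K Y Z" for f g X Y Z
  proof (rule T.diagram_map_eqI[OF Totm_hom[OF SK.Comp_hom[OF f g]] TK.Comp_hom[OF Totm_hom[OF f] Totm_hom[OF g]]])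
    fix n x assume x: "x \<in> P"
    note X = S.f_Obj(1)[OF f] and Z = S.f_Obj(2)[OF g] and gf = SK.Comp_hom[OF f g]
    note df = diag_hom[OF graded_map_cm[OF f] x, of n, folded cm_Totm[OF x f]]
    note dg = diag_hom[OF graded_map_cm[OF g] x, of n, folded cm_Totm[OF x g]]
    note dgf = diag_hom[OF graded_map_cm[OF gf] x, of n, folded cm_Totm[OF x gf]]
    show "cm (Totm (Comp S.K g f)) n x = cm (Comp T.K (Totm g) (Totm f)) n x"
      unfolding T.cm_Comp[OF x]
    proof (rule S.C.eq_by_elements[OF dgf S.C.Comp_hom[OF df dg]])
      fix t assume t: "t \<in> hom C (so X n x) (so X n x)"
      note ft = S.C.Comp_hom[OF t df]
      have "Comp C (cm (Totm (Comp S.K g f)) n x) t = Comp C (cm (Totm g) n x) (Comp C (cm (Totm f) n x) t)"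
      proof (rule elem_eqI[OF Z x S.C.Comp_hom[OF t dgf] S.C.Comp_hom[OF ft dg]])
        fix c assume c: "c \<in> U x"
        then have cP: "c \<in> P" using U_P[OF x] by blast
        show "Comp C (pr Z n x c) (Comp C (cm (Totm (Comp S.K g f)) n x) t) =
            Comp C (pr Z n x c) (Comp C (cm (Totm g) n x) (Comp C (cm (Totm f) n x) t))"
          using pr_cm_Totm[OF gf x t c] pr_cm_Totm[OF g x ft c] pr_cm_Totm[OF f x t c] S.cm_Comp[OF cP, of g f]
            S.C.Comp_assoc[OF pr_comp_hom[OF X x c t] S.cm_hom[OF f cP] S.cm_hom[OF g cP]] by simp
      qed
      then show "Comp C (cm (Totm (Comp S.K g f)) n x) t = Comp C (Comp C (cm (Totm g) n x) (cm (Totm f) n x)) t"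
        using S.C.Comp_assoc[OF t df dg] by simp
    qed
  qed
  ultimately show ?thesis
    using Tot_Obj Totm_hom Arr_hom[of _ S.K] unfolding is_functor_def
    by (metis (no_types, lifting) fst_conv snd_conv)
qed

subsection \<open>Shift\<close>

lemma shift_sel:
  "ob (shift_cpx S.FC X) n x = ob X (n + 1) x"
  "mp (shift_cpx S.FC X) n x y = mp X (n + 1) x y"
  "x \<in> P \<Longrightarrow> df (shift_cpx S.FC X) n x = Neg C (df X (n + 1) x)"
  by (simp_all add: ob_def mp_def df_def shift_cpx_def functor_category_sel poset_category_sel)

lemma cm_shift: "cm (shift_map S.FC f) n x = cm f (n + 1) x"
  by (cases f) (simp add: cm_def shift_map_def)

lemma shift_V: "V (shift_cpx S.FC X) n = V X (n + 1)"
  by (simp add: V_def shift_sel dg_Suc)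

lemma shift_so: "so (shift_cpx S.FC X) n = so X (n + 1)"
  by (simp add: so_def shift_V fun_eq_iff)

lemma shift_pr: "pr (shift_cpx S.FC X) n = pr X (n + 1)"
  by (simp add: pr_def shift_V fun_eq_iff)

lemma shift_tm: "tm (shift_cpx S.FC X) n = tm X (n + 1)"
  by (simp add: tm_def shift_V shift_so shift_pr shift_sel dg_Suc fun_eq_iff cong: if_cong)

lemma shift_off: "off (shift_cpx S.FC X) n x c A p = off X (n + 1) x c A p"
  by (simp add: off_def shift_sel dg_Suc add.commute cong: if_cong)

lemma shift_diag:
  "diag (shift_cpx S.FC X) (shift_cpx S.FC Y) (cm (shift_map S.FC f)) n x = diag X Y (cm f) (n + 1) x"
  by (simp add: diag_def shift_V shift_so shift_pr cm_shift dg_Suc)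

text \<open>The sign \<open>(-1)\<^sup>n\<close> on the off-diagonal entries of the differential makes the construction
  commute with the shift on the nose.\<close>

lemma shift_D:
  assumes X: "X \<in> Obj S.K" and x: "x \<in> P"
  shows "D (shift_cpx S.FC X) n x = Neg C (D X (n + 1) x)"
proof -
  let ?X = "shift_cpx S.FC X"
  note sX = S.FC.shift_cpx_Obj[OF X]
  have D: "D X (n + 1) x \<in> hom C (so X (n + 1) x) (so X (n + 2) x)"
    using D_hom[OF X x, of "n + 1"] by (simp add: add.commute)
  have D': "D ?X n x \<in> hom C (so X (n + 1) x) (so X (n + 2) x)"
    using D_hom[OF sX x, of n] by (simp add: shift_so add.commute)
  show ?thesis
  proof (rule S.C.eq_by_elements[OF D' S.C.Neg_hom[OF D]])
    fix t assume t: "t \<in> hom C (so X (n + 1) x) (so X (n + 1) x)"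
    have t': "t \<in> hom C (so X (n + 1) x) (so ?X n x)" using t by (simp add: shift_so)
    show "Comp C (D ?X n x) t = Comp C (Neg C (D X (n + 1) x)) t"
    proof (rule elem_eqI[OF X x S.C.Comp_hom[OF t D'] S.C.Comp_hom[OF t S.C.Neg_hom[OF D]]])
      fix c assume c: "c \<in> U x"
      then have cP: "c \<in> P" using U_P[OF x] by blast
      let ?p = "\<lambda>b. Comp C (pr X (n + 1) x b) t"
      have p: "?p b \<in> hom C (so X (n + 1) x) (ob X (dg (n + 1) b) b)" if "b \<in> U x" for b
        using pr_comp_hom[OF X x that t] .
      have 1: "Comp C (pr X (n + 2) x c) (Comp C (D ?X n x) t) =
         Add C (Comp C (Neg C (df X (dg n c + 1) c)) (?p c)) (sign C n (off X (n + 1) x c (so X (n + 1) x) ?p))"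
        using pr_D(2)[OF sX x t' c] by (simp add: shift_pr shift_off shift_sel cP add.commute)
      have 2: "Comp C (pr X (n + 2) x c) (Comp C (D X (n + 1) x) t) =
         Add C (Comp C (df X (dg n c + 1) c) (?p c)) (Neg C (sign C n (off X (n + 1) x c (so X (n + 1) x) ?p)))"
        using pr_D(2)[OF X x t c] off_hom[OF X cP so_Obj[OF X x] p]
        by (simp add: hom_def S.C.sign_simps dg_Suc add.commute)
      have "Comp C (pr X (n + 2) x c) (Comp C (Neg C (D X (n + 1) x)) t) =
          Neg C (Comp C (pr X (n + 2) x c) (Comp C (D X (n + 1) x) t))"
        using D t pr_hom[OF X x c, of "n + 2"] by (simp add: hom_def S.C.add_simps)
      then show "Comp C (pr X (n + 2) x c) (Comp C (D ?X n x) t) =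
          Comp C (pr X (n + 2) x c) (Comp C (Neg C (D X (n + 1) x)) t)"
        unfolding 1 2 using p[OF c] S.df_hom[OF X cP, of "dg n c + 1"] off_hom[OF X cP so_Obj[OF X x] p]
        by (simp add: hom_def S.C.add_simps S.C.sign_simps dg_Suc add.commute)
    qed
  qed
qed

lemma Tot_shift:
  assumes X: "X \<in> Obj S.K"
  shows "Tot (shift_cpx S.FC X) = shift_cpx T.FC (Tot X)"
proof -
  have "restrict (D (shift_cpx S.FC X) n) P = (\<lambda>i\<in>P. Neg C (restrict (D X (n + 1)) P i))" for n
    using shift_D[OF X] by (auto simp: restrict_def)
  then show ?thesis
    by (simp add: Tot_def mk_cpx_def shift_cpx_def[of T.FC] functor_category_sel poset_category_sel
        shift_so shift_tm)
qed

lemma Totm_shift: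
  assumes f: "f \<in> hom S.K X Y"
  shows "Totm (shift_map S.FC f) = shift_map T.FC (Totm f)"
proof -
  obtain \<phi> where e: "f = (X, Y, \<phi>)" using f by (auto simp: complexes_hom)
  note X = S.f_Obj(1)[OF f] and Y = S.f_Obj(2)[OF f]
  have s: "shift_map S.FC f = (shift_cpx S.FC X, shift_cpx S.FC Y, components (shift_map S.FC f))"
    by (simp add: e shift_map_def)
  have "restrict (diag (shift_cpx S.FC X) (shift_cpx S.FC Y) (cm (shift_map S.FC f)) n) P =
      restrict (diag X Y (cm f) (n + 1)) P" for n
    using shift_diag[of X Y f n] by (auto simp: restrict_def)
  moreover have "fst (shift_map S.FC f) = shift_cpx S.FC X" "fst (snd (shift_map S.FC f)) = shift_cpx S.FC Y"
    by (simp_all add: e shift_map_def)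
  ultimately have "Totm (shift_map S.FC f) = (shift_cpx T.FC (Tot X), shift_cpx T.FC (Tot Y),
      \<lambda>n. (fst (shift_cpx T.FC (Tot X)) n, fst (shift_cpx T.FC (Tot Y)) n, restrict (diag X Y (cm f) (n + 1)) P))"
    by (simp add: Totm_def mk_map_def Tot_shift[OF X] Tot_shift[OF Y])
  also have "\<dots> = shift_map T.FC (Totm f)"
    by (simp add: e Totm_def mk_map_def shift_map_def shift_cpx_def[of T.FC])
  finally show ?thesis .
qed

subsection \<open>Cones\<close>

lemma diag_eqI:
  assumes X: "X \<in> Obj S.K" and \<phi>: "graded_map X Y \<phi>" and x: "x \<in> P"
    and u: "u \<in> hom C (so X n x) (so Y n x)"
    and eq: "\<And>t c. t \<in> hom C (so X n x) (so X n x) \<Longrightarrow> c \<in> U x \<Longrightarrow>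
      Comp C (pr Y n x c) (Comp C u t) = Comp C (\<phi> (dg n c) c) (Comp C (pr X n x c) t)"
  shows "u = diag X Y \<phi> n x"
proof (rule S.C.eq_by_elements[OF u diag_hom[OF \<phi> x]])
  fix t assume t: "t \<in> hom C (so X n x) (so X n x)"
  show "Comp C u t = Comp C (diag X Y \<phi> n x) t"
    by (rule elem_eqI[OF gY[OF \<phi>] x S.C.Comp_hom[OF t u] S.C.Comp_hom[OF t diag_hom[OF \<phi> x]]])
      (use eq[OF t] pr_diag[OF \<phi> x t] in simp)
qed

lemma diag_Comp:
  assumes \<phi>: "graded_map X Y \<phi>" and \<psi>: "graded_map Y Z \<psi>" and \<chi>: "graded_map X Z \<chi>" and x: "x \<in> P"
    and eq: "\<And>m c. c \<in> P \<Longrightarrow> Comp C (\<psi> m c) (\<phi> m c) = \<chi> m c"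
  shows "Comp C (diag Y Z \<psi> n x) (diag X Y \<phi> n x) = diag X Z \<chi> n x"
proof (rule diag_eqI[OF gX[OF \<phi>] \<chi> x S.C.Comp_hom[OF diag_hom[OF \<phi> x] diag_hom[OF \<psi> x]]])
  fix t c assume t: "t \<in> hom C (so X n x) (so X n x)" and c: "c \<in> U x"
  have cP: "c \<in> P" using c U_P[OF x] by blast
  note dt = S.C.Comp_hom[OF t diag_hom[OF \<phi> x]]
  show "Comp C (pr Z n x c) (Comp C (Comp C (diag Y Z \<psi> n x) (diag X Y \<phi> n x)) t) =
      Comp C (\<chi> (dg n c) c) (Comp C (pr X n x c) t)"
    using S.C.Comp_assoc[OF t diag_hom[OF \<phi> x] diag_hom[OF \<psi> x]] pr_diag[OF \<psi> x dt c] pr_diag[OF \<phi> x t c]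
      S.C.Comp_assoc[OF pr_comp_hom[OF gX[OF \<phi>] x c t] g_hom[OF \<phi> cP] g_hom[OF \<psi> cP]] eq[OF cP] by simp
qed

lemma diag_Idn:
  assumes X: "X \<in> Obj S.K" and x: "x \<in> P" and eq: "\<And>m c. c \<in> P \<Longrightarrow> \<phi> m c = Idn C (ob X m c)"
    and \<phi>: "graded_map X X \<phi>"
  shows "diag X X \<phi> n x = Idn C (so X n x)"
proof (rule diag_eqI[OF X \<phi> x S.C.Idn_hom[OF so_Obj[OF X x]], symmetric])
  fix t c assume t: "t \<in> hom C (so X n x) (so X n x)" and c: "c \<in> U x"
  have cP: "c \<in> P" using c U_P[OF x] by blast
  show "Comp C (pr X n x c) (Comp C (Idn C (so X n x)) t) = Comp C (\<phi> (dg n c) c) (Comp C (pr X n x c) t)"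
    using S.C.Comp_Idn_left[OF t] S.C.Comp_Idn_left[OF pr_comp_hom[OF X x c t]] eq[OF cP] by simp
qed

lemma diag_Zero:
  assumes \<phi>: "graded_map X Y \<phi>" and x: "x \<in> P"
    and eq: "\<And>m c. c \<in> P \<Longrightarrow> \<phi> m c = Zero C (ob X m c) (ob Y m c)"
  shows "diag X Y \<phi> n x = Zero C (so X n x) (so Y n x)"
proof (rule diag_eqI[OF gX[OF \<phi>] \<phi> x S.C.Zero_hom[OF so_Obj[OF gX[OF \<phi>] x] so_Obj[OF gY[OF \<phi>] x]], symmetric])
  fix t c assume t: "t \<in> hom C (so X n x) (so X n x)" and c: "c \<in> U x"
  have cP: "c \<in> P" using c U_P[OF x] by blast
  show "Comp C (pr Y n x c) (Comp C (Zero C (so X n x) (so Y n x)) t) = Comp C (\<phi> (dg n c) c) (Comp C (pr X n x c) t)"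
    using eq[OF cP] t pr_hom[OF gX[OF \<phi>] x c, of n] pr_hom[OF gY[OF \<phi>] x c, of n]
      so_Obj[OF gX[OF \<phi>] x] so_Obj[OF gY[OF \<phi>] x] S.ob_Obj[OF gX[OF \<phi>] cP] S.ob_Obj[OF gY[OF \<phi>] cP]
    by (simp add: hom_def S.C.add_simps)
qed

lemma diag_Add:
  assumes \<phi>: "graded_map X Y \<phi>" and \<psi>: "graded_map X Y \<psi>" and \<chi>: "graded_map X Y \<chi>" and x: "x \<in> P"
    and eq: "\<And>m c. c \<in> P \<Longrightarrow> Add C (\<phi> m c) (\<psi> m c) = \<chi> m c"
  shows "Add C (diag X Y \<phi> n x) (diag X Y \<psi> n x) = diag X Y \<chi> n x"
proof (rule diag_eqI[OF gX[OF \<phi>] \<chi> x S.C.Add_hom[OF diag_hom[OF \<phi> x] diag_hom[OF \<psi> x]]])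
  fix t c assume t: "t \<in> hom C (so X n x) (so X n x)" and c: "c \<in> U x"
  have cP: "c \<in> P" using c U_P[OF x] by blast
  note d = diag_hom[OF \<phi> x, of n] diag_hom[OF \<psi> x, of n] g_hom[OF \<phi> cP, of "dg n c"] g_hom[OF \<psi> cP, of "dg n c"]
    pr_comp_hom[OF gX[OF \<phi>] x c t] pr_hom[OF gY[OF \<phi>] x c, of n]
  have "Comp C (pr Y n x c) (Comp C (Add C (diag X Y \<phi> n x) (diag X Y \<psi> n x)) t) =
      Add C (Comp C (pr Y n x c) (Comp C (diag X Y \<phi> n x) t)) (Comp C (pr Y n x c) (Comp C (diag X Y \<psi> n x) t))"
    using d t by (simp add: hom_def S.C.add_simps)
  also have "\<dots> = Comp C (Add C (\<phi> (dg n c) c) (\<psi> (dg n c) c)) (Comp C (pr X n x c) t)"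
    unfolding pr_diag[OF \<phi> x t c] pr_diag[OF \<psi> x t c]
    using S.C.Comp_Add_right[OF d(3,4) d(5)] by simp
  finally show "Comp C (pr Y n x c) (Comp C (Add C (diag X Y \<phi> n x) (diag X Y \<psi> n x)) t) =
      Comp C (\<chi> (dg n c) c) (Comp C (pr X n x c) t)" unfolding eq[OF cP] .
qed

definition diag_arrow where
  "diag_arrow X Y \<phi> n = (fst (Tot X) n, fst (Tot Y) n, restrict (diag X Y \<phi> n) P)"

lemma diag_arrow_hom:
  assumes \<phi>: "graded_map X Y \<phi>"
  shows "diag_arrow X Y \<phi> n \<in> hom T.FC (fst (Tot X) n) (fst (Tot Y) n)"
  unfolding diag_arrow_def
  using T.FC_homI[OF T.fst_X[OF Tot_Obj[OF gX[OF \<phi>]], of n] T.fst_X[OF Tot_Obj[OF gY[OF \<phi>]], of n], of "diag X Y \<phi> n"]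
    diag_hom[OF \<phi>] diag_tm[OF \<phi>] Tot_sel(1,2)[where X = X and n = n] Tot_sel(1,2)[where X = Y and n = n]
  by (auto simp: poset_category_sel poset_category_hom ob_def mp_def)

lemma Totm_components:
  "f \<in> hom S.K X Y \<Longrightarrow> components (Totm f) n = diag_arrow X Y (cm f) n"
  using complexes_fst[of f S.FC X Y] by (simp add: Totm_def mk_map_def diag_arrow_def)

lemma diag_arrow_Comp:
  assumes "graded_map X Y \<phi>" "graded_map Y Z \<psi>" "graded_map X Z \<chi>"
    "\<And>m c. c \<in> P \<Longrightarrow> Comp C (\<psi> m c) (\<phi> m c) = \<chi> m c"
  shows "Comp T.FC (diag_arrow Y Z \<psi> n) (diag_arrow X Y \<phi> n) = diag_arrow X Z \<chi> n"
  using diag_Comp[OF assms(1-3) _ assms(4)]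
  by (auto simp: diag_arrow_def functor_category_sel poset_category_sel restrict_def)

lemma diag_arrow_Idn:
  assumes "graded_map X X \<phi>" "\<And>m c. c \<in> P \<Longrightarrow> \<phi> m c = Idn C (ob X m c)"
  shows "diag_arrow X X \<phi> n = Idn T.FC (fst (Tot X) n)"
  using diag_Idn[OF gX[OF assms(1)] _ assms(2) assms(1)] Tot_sel(1)[where X = X]
  by (auto simp: diag_arrow_def functor_category_sel poset_category_sel restrict_def ob_def)

lemma diag_arrow_Zero:
  assumes "graded_map X Y \<phi>" "\<And>m c. c \<in> P \<Longrightarrow> \<phi> m c = Zero C (ob X m c) (ob Y m c)"
  shows "diag_arrow X Y \<phi> n = Zero T.FC (fst (Tot X) n) (fst (Tot Y) n)"
  using diag_Zero[OF assms(1) _ assms(2)] Tot_sel(1)[where X = X] Tot_sel(1)[where X = Y]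
  by (auto simp: diag_arrow_def functor_category_sel poset_category_sel restrict_def ob_def)

lemma diag_arrow_Add:
  assumes "graded_map X Y \<phi>" "graded_map X Y \<psi>" "graded_map X Y \<chi>"
    "\<And>m c. c \<in> P \<Longrightarrow> Add C (\<phi> m c) (\<psi> m c) = \<chi> m c"
  shows "Add T.FC (diag_arrow X Y \<phi> n) (diag_arrow X Y \<psi> n) = diag_arrow X Y \<chi> n"
  using diag_Add[OF assms(1-3) _ assms(4)]
  by (auto simp: diag_arrow_def functor_category_sel poset_category_sel restrict_def)

lemma graded_map_Idn:
  assumes X: "X \<in> Obj S.K"
  shows "graded_map X X (\<lambda>m c. Idn C (ob X m c))"
  unfolding graded_map_def
  using S.C.Idn_hom S.ob_Obj[OF X] S.C.Comp_Idn_left[OF S.mp_hom[OF X]]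
    S.C.Comp_Idn_right[OF S.mp_hom[OF X]] X by auto

lemma graded_map_Zero:
  assumes X: "X \<in> Obj S.K" and Y: "Y \<in> Obj S.K"
  shows "graded_map X Y (\<lambda>m c. Zero C (ob X m c) (ob Y m c))"
  unfolding graded_map_def
proof (intro conjI X Y allI ballI)
  fix m c assume "c \<in> P"
  then show "Zero C (ob X m c) (ob Y m c) \<in> hom C (ob X m c) (ob Y m c)"
    using S.ob_Obj[OF X] S.ob_Obj[OF Y] S.C.Zero_hom by blast
next
  fix m bc assume "bc \<in> R"
  then show "case bc of (b, c) \<Rightarrow> Comp C (Zero C (ob X m c) (ob Y m c)) (mp X m b c) =
      Comp C (mp Y m b c) (Zero C (ob X m b) (ob Y m b))"
    using S.mp_hom[OF X, of "fst bc" "snd bc" m] S.mp_hom[OF Y, of "fst bc" "snd bc" m]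
      S.R_P[of "fst bc" "snd bc"] S.ob_Obj[OF X] S.ob_Obj[OF Y]
    by (auto simp: hom_def S.C.add_simps)
qed

lemma graded_map_Comp:
  assumes \<phi>: "graded_map X Y \<phi>" and \<psi>: "graded_map Y Z \<psi>"
  shows "graded_map X Z (\<lambda>m c. Comp C (\<psi> m c) (\<phi> m c))"
  unfolding graded_map_def
proof (intro conjI gX[OF \<phi>] gY[OF \<psi>] allI ballI)
  fix m c assume "c \<in> P"
  then show "Comp C (\<psi> m c) (\<phi> m c) \<in> hom C (ob X m c) (ob Z m c)"
    using S.C.Comp_hom[OF g_hom[OF \<phi>] g_hom[OF \<psi>]] by blast
next
  fix m bc assume "bc \<in> R"
  then obtain b c where bc: "bc = (b, c)" "(b, c) \<in> R" by (cases bc) auto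
  then have P: "b \<in> P" "c \<in> P" using S.R_P by auto
  note m = S.mp_hom[OF gX[OF \<phi>] bc(2), of m] S.mp_hom[OF gY[OF \<phi>] bc(2), of m] S.mp_hom[OF gY[OF \<psi>] bc(2), of m]
  show "case bc of (b, c) \<Rightarrow> Comp C (Comp C (\<psi> m c) (\<phi> m c)) (mp X m b c) =
      Comp C (mp Z m b c) (Comp C (\<psi> m b) (\<phi> m b))"
    using S.C.Comp_assoc[OF m(1) g_hom[OF \<phi> P(2)] g_hom[OF \<psi> P(2)]] g_mp[OF \<phi> bc(2), of m]
      S.C.Comp_assoc[OF g_hom[OF \<phi> P(1)] m(2) g_hom[OF \<psi> P(2)]] g_mp[OF \<psi> bc(2), of m]
      S.C.Comp_assoc[OF g_hom[OF \<phi> P(1)] g_hom[OF \<psi> P(1)] m(3)]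
    by (simp add: bc(1))
qed

lemma graded_map_at:
  assumes "X \<in> Obj S.K" "Y \<in> Obj S.K" "\<And>n. s n \<in> hom S.FC (fst X n) (fst Y n)"
  shows "graded_map X Y (\<lambda>n c. snd (snd (s n)) c)"
  unfolding graded_map_def
  using assms S.at_hom[OF assms(3)] S.at_nat[OF assms(3)]
  by (auto simp: ob_def mp_def poset_category_sel poset_category_hom)

text \<open>The maps \<open>i\<close> and \<open>q\<close> that split a cone are compatible with the structure maps though not with
  the differentials, so \<open>diag\<close> applies to them and carries the biproduct to a biproduct. It remains
  to compare the differentials of the twisted product of the cone and of the cone of the twisted
  products.\<close>

theorem Tot_cone:
  assumes "is_cone_triangle S.FC f g h"
  shows "is_cone_triangle T.FC (Totm f) (Totm g) (Totm h)"
proof -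
  obtain X Y Z i q where f: "f \<in> hom S.K X Y" and g: "g \<in> hom S.K Y Z"
    and h: "h \<in> hom S.K Z (shift_cpx S.FC X)"
    and bi: "\<And>n. is_biproduct S.FC (fst X (n + 1)) (fst Y n) (fst Z n) (i n) (components g n) (components h n) (q n)"
    and d: "\<And>n. snd Z n = Add S.FC
              (Add S.FC (Comp S.FC (i (n + 1)) (Comp S.FC (Neg S.FC (snd X (n + 1))) (components h n)))
                     (Comp S.FC (components g (n + 1)) (Comp S.FC (components f (n + 1)) (components h n))))
              (Comp S.FC (components g (n + 1)) (Comp S.FC (snd Y n) (q n)))"
    using assms unfolding is_cone_triangle_def by blast
  let ?X = "shift_cpx S.FC X"
  note X = S.f_Obj(1)[OF f] and Y = S.f_Obj(2)[OF f] and Z = S.f_Obj(2)[OF g]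
  note sX = S.FC.shift_cpx_Obj[OF X]
  define \<iota> where "\<iota> = (\<lambda>n c. snd (snd (i n)) c)"
  define \<kappa> where "\<kappa> = (\<lambda>n c. snd (snd (q n)) c)"
  have "i n \<in> hom S.FC (fst ?X n) (fst Z n)" "q n \<in> hom S.FC (fst Z n) (fst Y n)" for n
    using bi[of n] by (simp_all add: is_biproduct_def shift_cpx_def)
  then have \<iota>: "graded_map ?X Z \<iota>" and \<kappa>: "graded_map Z Y \<kappa>"
    unfolding \<iota>_def \<kappa>_def using graded_map_at X Y Z sX by blast+
  note G = graded_map_cm[OF g] and H = graded_map_cm[OF h] and F = graded_map_cm[OF f]
  have eqs: "Comp S.FC (components h n) (i n) = Idn S.FC (fst X (n + 1))"
    "Comp S.FC (q n) (components g n) = Idn S.FC (fst Y n)"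
    "Comp S.FC (q n) (i n) = Zero S.FC (fst X (n + 1)) (fst Y n)"
    "Comp S.FC (components h n) (components g n) = Zero S.FC (fst Y n) (fst X (n + 1))"
    "Add S.FC (Comp S.FC (i n) (components h n)) (Comp S.FC (components g n) (q n)) = Idn S.FC (fst Z n)" for n
    using bi[of n] by (simp_all add: is_biproduct_def)
  have e: "Comp C (cm h n c) (\<iota> n c) = Idn C (ob ?X n c)" "Comp C (\<kappa> n c) (cm g n c) = Idn C (ob Y n c)"
    "Comp C (\<kappa> n c) (\<iota> n c) = Zero C (ob ?X n c) (ob Y n c)"
    "Comp C (cm h n c) (cm g n c) = Zero C (ob Y n c) (ob ?X n c)"
    "Add C (Comp C (\<iota> n c) (cm h n c)) (Comp C (cm g n c) (\<kappa> n c)) = Idn C (ob Z n c)"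
    if "c \<in> P" for n c
    using eqs[of n, THEN arg_cong, of "\<lambda>f. snd (snd f) c"] that
    by (simp_all add: functor_category_sel poset_category_sel \<iota>_def \<kappa>_def cm_def ob_def shift_cpx_def)
  have dZ: "df Z n c = Add C (Add C (Comp C (\<iota> (n + 1) c) (Comp C (df ?X n c) (cm h n c)))
      (Comp C (cm g (n + 1) c) (Comp C (cm f (n + 1) c) (cm h n c))))
      (Comp C (cm g (n + 1) c) (Comp C (df Y n c) (\<kappa> n c)))" if "c \<in> P" for n c
    unfolding df_def[of Z] using that
    by (subst d) (simp add: functor_category_sel poset_category_sel \<iota>_def \<kappa>_def cm_def df_def shift_cpx_def)
  have D: "D Z n x = Add C (Add C (Comp C (diag ?X Z \<iota> (n + 1) x) (Comp C (Neg C (D X (n + 1) x)) (diag Z ?X (cm h) n x)))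
        (Comp C (diag Y Z (cm g) (n + 1) x) (Comp C (diag X Y (cm f) (n + 1) x) (diag Z ?X (cm h) n x))))
        (Comp C (diag Y Z (cm g) (n + 1) x) (Comp C (D Y n x) (diag Z Y \<kappa> n x)))"
    (is "_ = Add C (Add C (Comp C ?I (Comp C _ ?H)) (Comp C ?G (Comp C ?F ?H))) (Comp C ?G (Comp C ?D ?Q))")
    if x: "x \<in> P" for n x
  proof -
    note hI = diag_hom[OF \<iota> x, of "n + 1"] and hH = diag_hom[OF H x, of n] and hG = diag_hom[OF G x, of "n + 1"]
      and hQ = diag_hom[OF \<kappa> x, of n] and hDY = D_hom[OF Y x, of n] and hDX = D_hom[OF sX x, of n]
    have hF: "?F \<in> hom C (so ?X n x) (so Y (n + 1) x)" using diag_hom[OF F x, of "n + 1"] by (simp add: shift_so)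
    note hs = hI hH hG hQ hDY hDX hF
    have rhs: "Add C (Add C (Comp C ?I (Comp C (D ?X n x) ?H)) (Comp C ?G (Comp C ?F ?H))) (Comp C ?G (Comp C ?D ?Q))
      \<in> hom C (so Z n x) (so Z (n + 1) x)"
      by (intro S.C.Add_hom S.C.Comp_hom[OF S.C.Comp_hom[OF hH hDX] hI] S.C.Comp_hom[OF S.C.Comp_hom[OF hH hF] hG]
          S.C.Comp_hom[OF S.C.Comp_hom[OF hQ hDY] hG])
    show ?thesis
      unfolding shift_D[OF X x, symmetric]
    proof (rule S.C.eq_by_elements[OF D_hom[OF Z x] rhs])
      fix t assume t: "t \<in> hom C (so Z n x) (so Z n x)"
      let ?A = "so Z n x"
      have A: "?A \<in> Obj C" by (rule so_Obj[OF Z x])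
      note tH = S.C.Comp_hom[OF t hH] and tQ = S.C.Comp_hom[OF t hQ]
      note tF = S.C.Comp_hom[OF tH hF] and tDX = S.C.Comp_hom[OF tH hDX] and tDY = S.C.Comp_hom[OF tQ hDY]
      have rhs_t: "Comp C (Add C (Add C (Comp C ?I (Comp C (D ?X n x) ?H)) (Comp C ?G (Comp C ?F ?H)))
          (Comp C ?G (Comp C ?D ?Q))) t =
        Add C (Add C (Comp C ?I (Comp C (D ?X n x) (Comp C ?H t))) (Comp C ?G (Comp C ?F (Comp C ?H t))))
          (Comp C ?G (Comp C ?D (Comp C ?Q t)))"
        using hs t by (simp add: hom_def S.C.add_simps)
      show "Comp C (D Z n x) t = Comp C (Add C (Add C (Comp C ?I (Comp C (D ?X n x) ?H)) (Comp C ?G (Comp C ?F ?H)))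
          (Comp C ?G (Comp C ?D ?Q))) t"
      proof (rule elem_eqI[OF Z x S.C.Comp_hom[OF t D_hom[OF Z x]] S.C.Comp_hom[OF t rhs]])
        fix c assume c: "c \<in> U x"
        then have cP: "c \<in> P" using U_P[OF x] by blast
        let ?p = "\<lambda>b. Comp C (pr Z n x b) t"
        have p: "?p b \<in> hom C ?A (ob Z (dg n b) b)" if "b \<in> U x" for b using pr_comp_hom[OF Z x that t] .
        let ?m = "dg n c"
        let ?H1 = "\<lambda>b. Comp C (cm h (dg n b) b) (?p b)" and ?Q1 = "\<lambda>b. Comp C (\<kappa> (dg n b) b) (?p b)"
        have bP: "b \<in> P" if "b \<in> U x" for b using that U_P[OF x] by blast
        have H1: "?H1 b \<in> hom C ?A (ob ?X (dg n b) b)" and Q1: "?Q1 b \<in> hom C ?A (ob Y (dg n b) b)"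
          if "b \<in> U x" for b
          using S.C.Comp_hom[OF p[OF that] g_hom[OF H bP[OF that]]] S.C.Comp_hom[OF p[OF that] g_hom[OF \<kappa> bP[OF that]]] by auto
        have offX: "off ?X n x c ?A (\<lambda>b. Comp C (pr ?X n x b) (Comp C ?H t)) = off ?X n x c ?A ?H1"
          by (rule off_cong[OF sX]) (use pr_diag[OF H x t] in simp)
        have offY: "off Y n x c ?A (\<lambda>b. Comp C (pr Y n x b) (Comp C ?Q t)) = off Y n x c ?A ?Q1"
          by (rule off_cong[OF Y]) (use pr_diag[OF \<kappa> x t] in simp)
        have 1: "Comp C (pr Z (n + 1) x c) (Comp C ?I (Comp C (D ?X n x) (Comp C ?H t))) =
            Comp C (\<iota> (?m + 1) c) (Add C (Comp C (df ?X ?m c) (?H1 c)) (sign C n (off ?X n x c ?A ?H1)))"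
          using pr_diag[OF \<iota> x tDX c] pr_D(2)[OF sX x tH c] pr_diag[OF H x t c] offX by (simp add: dg_Suc)
        have 2: "Comp C (pr Z (n + 1) x c) (Comp C ?G (Comp C ?D (Comp C ?Q t))) =
            Comp C (cm g (?m + 1) c) (Add C (Comp C (df Y ?m c) (?Q1 c)) (sign C n (off Y n x c ?A ?Q1)))"
          using pr_diag[OF G x tDY c] pr_D(2)[OF Y x tQ c] pr_diag[OF \<kappa> x t c] offY by (simp add: dg_Suc)
        have "Comp C (pr Y (n + 1) x c) (Comp C ?F (Comp C ?H t)) = Comp C (cm f (dg (n + 1) c) c) (?H1 c)"
          using pr_diag[OF F x tH[unfolded shift_so] c] pr_diag[OF H x t c] by (simp add: shift_pr)
        then have 3: "Comp C (pr Z (n + 1) x c) (Comp C ?G (Comp C ?F (Comp C ?H t))) =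
            Comp C (cm g (?m + 1) c) (Comp C (cm f (?m + 1) c) (?H1 c))"
          using pr_diag[OF G x tF c] by (simp add: dg_Suc)
        have o1: "Comp C (\<iota> (?m + 1) c) (off ?X n x c ?A ?H1) = off Z n x c ?A (\<lambda>b. Comp C (\<iota> (dg n b) b) (?H1 b))"
          by (rule off_map[OF \<iota> x cP A H1])
        have o2: "Comp C (cm g (?m + 1) c) (off Y n x c ?A ?Q1) = off Z n x c ?A (\<lambda>b. Comp C (cm g (dg n b) b) (?Q1 b))"
          by (rule off_map[OF G x cP A Q1])
        \<comment> \<open>The splitting of the identity of Z distributes the off-diagonal part of its differential over
          the two summands.\<close>
        have o3: "Add C (Comp C (\<iota> (?m + 1) c) (off ?X n x c ?A ?H1)) (Comp C (cm g (?m + 1) c) (off Y n x c ?A ?Q1)) =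
            off Z n x c ?A ?p"
        proof -
          have "off Z n x c ?A (\<lambda>b. Add C (Comp C (\<iota> (dg n b) b) (?H1 b)) (Comp C (cm g (dg n b) b) (?Q1 b))) =
              off Z n x c ?A ?p"
          proof (rule off_cong[OF Z])
            fix b assume b: "b \<in> U x"
            note hb = g_hom[OF \<iota> bP[OF b], of "dg n b"] g_hom[OF G bP[OF b], of "dg n b"] g_hom[OF H bP[OF b], of "dg n b"]
              g_hom[OF \<kappa> bP[OF b], of "dg n b"] p[OF b]
            have "Add C (Comp C (\<iota> (dg n b) b) (?H1 b)) (Comp C (cm g (dg n b) b) (?Q1 b)) =
              Comp C (Add C (Comp C (\<iota> (dg n b) b) (cm h (dg n b) b)) (Comp C (cm g (dg n b) b) (\<kappa> (dg n b) b))) (?p b)"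
              using hb by (simp add: hom_def S.C.add_simps)
            also have "\<dots> = ?p b" unfolding e(5)[OF bP[OF b]] using S.C.Comp_Idn_left[OF p[OF b]] .
            finally show "Add C (Comp C (\<iota> (dg n b) b) (?H1 b)) (Comp C (cm g (dg n b) b) (?Q1 b)) = ?p b" .
          qed
          moreover have "off Z n x c ?A (\<lambda>b. Add C (Comp C (\<iota> (dg n b) b) (?H1 b)) (Comp C (cm g (dg n b) b) (?Q1 b))) =
              Add C (off Z n x c ?A (\<lambda>b. Comp C (\<iota> (dg n b) b) (?H1 b))) (off Z n x c ?A (\<lambda>b. Comp C (cm g (dg n b) b) (?Q1 b)))"
            by (rule off_Add[OF Z cP A S.C.Comp_hom[OF H1 g_hom[OF \<iota> bP]] S.C.Comp_hom[OF Q1 g_hom[OF G bP]]]; assumption)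
          ultimately show ?thesis using o1 o2 by simp
        qed
        note hc = g_hom[OF \<iota> cP, of "?m + 1"] g_hom[OF G cP, of "?m + 1"] g_hom[OF H cP, of ?m]
          g_hom[OF \<kappa> cP, of ?m] g_hom[OF F cP, of "?m + 1"] p[OF c] S.df_hom[OF Y cP, of ?m]
          S.df_hom[OF sX cP, of ?m] off_hom[OF sX cP A H1] off_hom[OF Y cP A Q1] pr_hom[OF Z x c, of "n + 1"]
          S.C.Comp_hom[OF tDX hI] S.C.Comp_hom[OF tF hG] S.C.Comp_hom[OF tDY hG]
        note hc' = hc[unfolded hom_def shift_sel(1) mem_Collect_eq]
        have "Comp C (pr Z (n + 1) x c) (Comp C (D Z n x) t) = Add C (Comp C (df Z ?m c) (?p c))
            (Add C (sign C n (Comp C (\<iota> (?m + 1) c) (off ?X n x c ?A ?H1)))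
              (sign C n (Comp C (cm g (?m + 1) c) (off Y n x c ?A ?Q1))))"
          using pr_D(2)[OF Z x t c] o3[symmetric] hc' by (simp add: S.C.add_simps S.C.sign_simps)
        also have "\<dots> = Comp C (pr Z (n + 1) x c)
            (Add C (Add C (Comp C ?I (Comp C (D ?X n x) (Comp C ?H t))) (Comp C ?G (Comp C ?F (Comp C ?H t))))
              (Comp C ?G (Comp C ?D (Comp C ?Q t))))"
        proof -
          have "Comp C (pr Z (n + 1) x c)
            (Add C (Add C (Comp C ?I (Comp C (D ?X n x) (Comp C ?H t))) (Comp C ?G (Comp C ?F (Comp C ?H t))))
              (Comp C ?G (Comp C ?D (Comp C ?Q t)))) =
            Add C (Add C (Comp C (pr Z (n + 1) x c) (Comp C ?I (Comp C (D ?X n x) (Comp C ?H t))))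
               (Comp C (pr Z (n + 1) x c) (Comp C ?G (Comp C ?F (Comp C ?H t)))))
              (Comp C (pr Z (n + 1) x c) (Comp C ?G (Comp C ?D (Comp C ?Q t))))"
            using hc' by (simp add: S.C.Comp_distrib S.C.Add_Arr)
          then show ?thesis
            unfolding 1 2 3 dZ[OF cP] using hc' by (simp add: S.C.add_simps S.C.sign_simps S.C.add_ac)
        qed
        finally show "Comp C (pr Z (n + 1) x c) (Comp C (D Z n x) t) =
            Comp C (pr Z (n + 1) x c) (Comp C (Add C (Add C (Comp C ?I (Comp C (D ?X n x) ?H)) (Comp C ?G (Comp C ?F ?H)))
          (Comp C ?G (Comp C ?D ?Q))) t)"
          unfolding rhs_t .
      qed
    qed
  qed
  have fst_sX: "fst (Tot ?X) n = fst (Tot X) (n + 1)" for n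
    unfolding Tot_shift[OF X] by (simp add: shift_cpx_def)
  show ?thesis
    unfolding is_cone_triangle_def
  proof (intro exI conjI allI)
    show "Totm f \<in> hom T.K (Tot X) (Tot Y)" "Totm g \<in> hom T.K (Tot Y) (Tot Z)"
      by (rule Totm_hom[OF f] Totm_hom[OF g])+
    show "Totm h \<in> hom T.K (Tot Z) (shift_cpx T.FC (Tot X))"
      using Totm_hom[OF h] by (simp add: Tot_shift[OF X])
    fix n
    note c = Totm_components[OF f] Totm_components[OF g] Totm_components[OF h]
    show "is_biproduct T.FC (fst (Tot X) (n + 1)) (fst (Tot Y) n) (fst (Tot Z) n)
        (diag_arrow ?X Z \<iota> n) (components (Totm g) n) (components (Totm h) n) (diag_arrow Z Y \<kappa> n)"
      unfolding is_biproduct_def c fst_sX[symmetric]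
    proof (intro conjI diag_arrow_hom \<iota> \<kappa> G H)
      show "Comp T.FC (diag_arrow Z ?X (cm h) n) (diag_arrow ?X Z \<iota> n) = Idn T.FC (fst (Tot ?X) n)"
        using diag_arrow_Comp[OF \<iota> H graded_map_Idn[OF sX] e(1)] diag_arrow_Idn[OF graded_map_Idn[OF sX] HOL.refl] by simp
      show "Comp T.FC (diag_arrow Z Y \<kappa> n) (diag_arrow Y Z (cm g) n) = Idn T.FC (fst (Tot Y) n)"
        using diag_arrow_Comp[OF G \<kappa> graded_map_Idn[OF Y] e(2)] diag_arrow_Idn[OF graded_map_Idn[OF Y] HOL.refl] by simp
      show "Comp T.FC (diag_arrow Z Y \<kappa> n) (diag_arrow ?X Z \<iota> n) = Zero T.FC (fst (Tot ?X) n) (fst (Tot Y) n)"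
        using diag_arrow_Comp[OF \<iota> \<kappa> graded_map_Zero[OF sX Y] e(3)] diag_arrow_Zero[OF graded_map_Zero[OF sX Y] HOL.refl] by simp
      show "Comp T.FC (diag_arrow Z ?X (cm h) n) (diag_arrow Y Z (cm g) n) = Zero T.FC (fst (Tot Y) n) (fst (Tot ?X) n)"
        using diag_arrow_Comp[OF G H graded_map_Zero[OF Y sX] e(4)] diag_arrow_Zero[OF graded_map_Zero[OF Y sX] HOL.refl] by simp
      show "Add T.FC (Comp T.FC (diag_arrow ?X Z \<iota> n) (diag_arrow Z ?X (cm h) n))
          (Comp T.FC (diag_arrow Y Z (cm g) n) (diag_arrow Z Y \<kappa> n)) = Idn T.FC (fst (Tot Z) n)"
        using diag_arrow_Comp[OF H \<iota> graded_map_Comp[OF H \<iota>] HOL.refl] diag_arrow_Comp[OF \<kappa> G graded_map_Comp[OF \<kappa> G] HOL.refl]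
          diag_arrow_Add[OF graded_map_Comp[OF H \<iota>] graded_map_Comp[OF \<kappa> G] graded_map_Idn[OF Z] e(5)]
          diag_arrow_Idn[OF graded_map_Idn[OF Z] HOL.refl] by simp
    qed
    show "snd (Tot Z) n = Add T.FC
        (Add T.FC (Comp T.FC (diag_arrow ?X Z \<iota> (n + 1)) (Comp T.FC (Neg T.FC (snd (Tot X) (n + 1))) (components (Totm h) n)))
          (Comp T.FC (components (Totm g) (n + 1)) (Comp T.FC (components (Totm f) (n + 1)) (components (Totm h) n))))
        (Comp T.FC (components (Totm g) (n + 1)) (Comp T.FC (snd (Tot Y) n) (diag_arrow Z Y \<kappa> n)))"
      unfolding c using D[of _ n] Tot_sel(3)[where X = X and n = "n + 1"] Tot_sel(3)[where X = Y and n = n]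
      by (auto simp: functor_category_sel poset_category_sel diag_arrow_def df_def restrict_def fun_eq_iff
          Tot_def[of Z] mk_cpx_def)
  qed
qed

subsection \<open>Quasi-isomorphisms\<close>

lemma inj_component:
  assumes X: "X \<in> Obj S.K" and x: "x \<in> P" and c: "c \<in> U x" and a: "a \<in> hom C A (ob X (dg n c) c)"
  obtains \<alpha> where "\<alpha> \<in> hom C A (so X n x)" "Comp C (pr X n x c) \<alpha> = a"
    "\<And>b. b \<in> U x \<Longrightarrow> b \<noteq> c \<Longrightarrow> Comp C (pr X n x b) \<alpha> = Zero C A (ob X (dg n b) b)"
proof -
  have A: "A \<in> Obj C" using S.C.hom_Obj[OF a] by simp
  let ?t = "\<lambda>b. if b = c then a else Zero C A (ob X (dg n b) b)"
  have t: "?t b \<in> hom C A (ob X (dg n b) b)" if "b \<in> U x" for b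
    using that a S.C.Zero_hom[OF A S.ob_Obj[OF X]] U_P[OF x] by auto
  let ?\<alpha> = "tuple C (U x) (V X n) A ?t"
  have "?\<alpha> \<in> hom C A (so X n x)" "\<And>b. b \<in> U x \<Longrightarrow> Comp C (pr X n x b) ?\<alpha> = ?t b"
    by (rule tuple_so[OF X x A t]; assumption)+
  then show ?thesis using that[of ?\<alpha>] c by simp
qed

text \<open>Cone cocycles whose components in \<^term>\<open>J\<close> vanish are coboundaries after refinement. The
  components are killed one after another, each only after those of which the differential of the
  twisted product maps into it; then the component of the cocycle is itself a cocycle.\<close>

lemma diag_qis_aux:
  assumes f: "f \<in> hom S.K X Y" and x: "x \<in> P"
    and q: "\<And>c. c \<in> P \<Longrightarrow> qis C (\<lambda>n. ob X n c, \<lambda>n. df X n c) (\<lambda>n. ob Y n c, \<lambda>n. df Y n c) (\<lambda>n. cm f n c)"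
  shows "\<lbrakk>J \<subseteq> U x; \<forall>c\<in>J. \<forall>b\<in>U x. (b, c) \<in> R \<longrightarrow> b \<in> J; card (U x - J) = k;
      u \<in> hom C A (so X (n + 1) x); v \<in> hom C A (so Y n x);
      Comp C (D X (n + 1) x) u = Zero C A (so X (n + 2) x);
      Comp C (diag X Y (cm f) (n + 1) x) u = Comp C (D Y n x) v;
      \<forall>c\<in>J. Comp C (pr X (n + 1) x c) u = Zero C A (ob X (dg n c + 1) c);
      \<forall>c\<in>J. Comp C (pr Y n x c) v = Zero C A (ob Y (dg n c) c)\<rbrakk> \<Longrightarrow>
    \<exists>A' e u' v'. is_epi C e \<and> e \<in> hom C A' A \<and> u' \<in> hom C A' (so X n x) \<and> v' \<in> hom C A' (so Y (n - 1) x) \<and>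
      Comp C (D X n x) u' = Comp C u e \<and>
      Comp C v e = Add C (Comp C (diag X Y (cm f) n x) u') (Comp C (D Y (n - 1) x) v')"
proof (induction k arbitrary: J A u v)
  note X = S.f_Obj(1)[OF f] and Y = S.f_Obj(2)[OF f] and \<phi> = graded_map_cm[OF f]
  note fin = finite_subset[OF U_P[OF x] finite_P]
  case 0
  then have J: "J = U x" using fin by auto
  have A: "A \<in> Obj C" using S.C.hom_Obj[OF 0(4)] by simp
  note Z = S.C.Zero_hom[OF A so_Obj[OF X x]] S.C.Zero_hom[OF A so_Obj[OF Y x]]
  have u: "u = Zero C A (so X (n + 1) x)"
    by (rule elem_eqI[OF X x 0(4) Z(1)])
      (use 0(8) pr_hom[OF X x, of _ "n + 1"] A in \<open>auto simp: J hom_def S.C.add_simps so_Obj[OF X x] dg_Suc\<close>)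
  have v: "v = Zero C A (so Y n x)"
    by (rule elem_eqI[OF Y x 0(5) Z(2)])
      (use 0(9) pr_hom[OF Y x, of _ n] A in \<open>auto simp: J hom_def S.C.add_simps so_Obj[OF Y x]\<close>)
  show ?case
    by (rule exI[of _ A], rule exI[of _ "Idn C A"], rule exI[of _ "Zero C A (so X n x)"],
        rule exI[of _ "Zero C A (so Y (n - 1) x)"])
      (use Z A S.C.Idn_hom[OF A] S.C.epi_Idn[OF A] D_hom[OF X x, of n] D_hom[OF Y x, of "n - 1"]
        diag_hom[OF \<phi> x, of n] so_Obj[OF X x] so_Obj[OF Y x] in \<open>simp add: u v hom_def S.C.add_simps\<close>)
next
  note X = S.f_Obj(1)[OF f] and Y = S.f_Obj(2)[OF f] and \<phi> = graded_map_cm[OF f]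
  note fin = finite_subset[OF U_P[OF x] finite_P]
  case (Suc k)
  note J = Suc.prems(1) and closed = Suc.prems(2) and u = Suc.prems(4) and v = Suc.prems(5)
    and Du = Suc.prems(6) and fu = Suc.prems(7) and uJ = Suc.prems(8) and vJ = Suc.prems(9)
  have A: "A \<in> Obj C" using S.C.hom_Obj[OF u] by simp
  \<comment> \<open>Among the components outside J there is one, c, into which no other one is mapped.\<close>
  have "U x - J \<noteq> {}" using Suc.prems(3) by (metis card.empty nat.distinct(1))
  then obtain c0 where c0: "c0 \<in> U x - J" by blast
  obtain c where c: "c \<in> U x" "c \<notin> J" "\<And>b. b \<in> U x \<Longrightarrow> (b, c) \<in> R \<Longrightarrow> b \<noteq> c \<Longrightarrow> b \<in> J"
  proof (cases "\<exists>b\<in>U x - J. (b, c0) \<in> R \<and> b \<noteq> c0")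
    case True
    then obtain b where "b \<in> U x - J" "(b, c0) \<in> R" "b \<noteq> c0" by blast
    then show ?thesis using that[of b] height by blast
  next
    case False
    then show ?thesis using that[of c0] c0 by blast
  qed
  have cP: "c \<in> P" using c U_P[OF x] by blast
  have PU: "b \<in> P" if "b \<in> U x" for b using that U_P[OF x] by blast

  let ?a = "Comp C (pr X (n + 1) x c) u" and ?b = "Comp C (pr Y n x c) v"
  have a: "?a \<in> hom C A (ob X (dg n c + 1) c)" and b: "?b \<in> hom C A (ob Y (dg n c) c)"
    using pr_comp_hom[OF X x c(1) u] pr_comp_hom[OF Y x c(1) v] by (simp_all add: dg_Suc)
  have offu: "off X (n + 1) x c A (\<lambda>b. Comp C (pr X (n + 1) x b) u) = Zero C A (ob X (dg (n + 1) c + 1) c)"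
    by (rule off_Zero[OF X cP A]) (use c(3) uJ in \<open>simp add: dg_Suc\<close>)
  have offv: "off Y n x c A (\<lambda>b. Comp C (pr Y n x b) v) = Zero C A (ob Y (dg n c + 1) c)"
    by (rule off_Zero[OF Y cP A]) (use c(3) vJ in simp)
  have "Comp C (pr X (n + 2) x c) (Comp C (D X (n + 1) x) u) = Comp C (df X (dg n c + 1) c) ?a"
    using pr_D(2)[OF X x u c(1)] offu a S.df_hom[OF X cP, of "dg n c + 1"] A S.ob_Obj[OF X cP]
    by (simp add: hom_def S.C.add_simps S.C.sign_simps dg_Suc add.commute)
  then have da: "Comp C (df X (dg n c + 1) c) ?a = Zero C A (ob X (dg n c + 2) c)"
    unfolding Du using pr_hom[OF X x c(1), of "n + 2"] A so_Obj[OF X x]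
    by (simp add: hom_def S.C.add_simps dg_Suc)
  have "Comp C (pr Y (n + 1) x c) (Comp C (D Y n x) v) = Comp C (df Y (dg n c) c) ?b"
    using pr_D(2)[OF Y x v c(1)] offv b S.df_hom[OF Y cP, of "dg n c"] A S.ob_Obj[OF Y cP]
    by (simp add: hom_def S.C.add_simps S.C.sign_simps)
  then have fa: "Comp C (cm f (dg n c + 1) c) ?a = Comp C (df Y (dg n c) c) ?b"
    using pr_diag[OF \<phi> x u c(1)] unfolding fu by (simp add: dg_Suc)
  obtain A1 e1 a' b' where e1: "is_epi C e1" "e1 \<in> hom C A1 A" and a': "a' \<in> hom C A1 (ob X (dg n c) c)"
    and b': "b' \<in> hom C A1 (ob Y (dg n c - 1) c)"
    and a'eq: "Comp C (df X (dg n c) c) a' = Comp C ?a e1"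
    and b'eq: "Comp C ?b e1 = Add C (Comp C (cm f (dg n c) c) a') (Comp C (df Y (dg n c - 1) c) b')"
    by (rule qisD[OF q[OF cP], unfolded fst_conv snd_conv, OF a b da fa])
  have A1: "A1 \<in> Obj C" using S.C.hom_Obj[OF e1(2)] by simp
  obtain \<alpha> where \<alpha>: "\<alpha> \<in> hom C A1 (so X n x)" "Comp C (pr X n x c) \<alpha> = a'"
    "\<And>b. b \<in> U x \<Longrightarrow> b \<noteq> c \<Longrightarrow> Comp C (pr X n x b) \<alpha> = Zero C A1 (ob X (dg n b) b)"
    using inj_component[OF X x c(1) a'] by blast
  obtain \<beta> where \<beta>: "\<beta> \<in> hom C A1 (so Y (n - 1) x)" "Comp C (pr Y (n - 1) x c) \<beta> = b'"
    "\<And>b. b \<in> U x \<Longrightarrow> b \<noteq> c \<Longrightarrow> Comp C (pr Y (n - 1) x b) \<beta> = Zero C A1 (ob Y (dg n b - 1) b)"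
    using inj_component[OF Y x c(1), of b' A1 "n - 1"] b' by (auto simp: dg_Suc)
  have prD\<alpha>: "Comp C (pr X (n + 1) x j) (Comp C (D X n x) \<alpha>) =
      (if j = c then Comp C ?a e1 else Zero C A1 (ob X (dg n j + 1) j))" if j: "j \<in> insert c J" for j
  proof -
    have jU: "j \<in> U x" and jP: "j \<in> P" using j J c(1) PU by auto
    have "off X n x j A1 (\<lambda>b. Comp C (pr X n x b) \<alpha>) = Zero C A1 (ob X (dg n j + 1) j)"
      by (rule off_Zero[OF X jP A1]) (use \<alpha>(3) closed j c(2) in blast)
    then show ?thesis
      using pr_D(2)[OF X x \<alpha>(1) jU] \<alpha>(2,3) jU a' a'eq S.df_hom[OF X jP, of "dg n j"] A1 S.ob_Obj[OF X jP] a e1(2)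
      by (auto simp: hom_def S.C.add_simps S.C.sign_simps)
  qed
  have prD\<beta>: "Comp C (pr Y n x j) (Comp C (D Y (n - 1) x) \<beta>) =
      (if j = c then Comp C (df Y (dg n c - 1) c) b' else Zero C A1 (ob Y (dg n j) j))" if j: "j \<in> insert c J" for j
  proof -
    have jU: "j \<in> U x" and jP: "j \<in> P" using j J c(1) PU by auto
    have "off Y (n - 1) x j A1 (\<lambda>b. Comp C (pr Y (n - 1) x b) \<beta>) = Zero C A1 (ob Y (dg (n - 1) j + 1) j)"
      by (rule off_Zero[OF Y jP A1]) (use \<beta>(3) closed j c(2) in \<open>auto simp: dg_Suc\<close>)
    then show ?thesis
      using pr_D(2)[OF Y x \<beta>(1) jU] \<beta>(2,3) jU b' S.df_hom[OF Y jP, of "dg n j - 1"] A1 S.ob_Obj[OF Y jP]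
      by (auto simp: hom_def S.C.add_simps S.C.sign_simps dg_Suc)
  qed
  note hDX = D_hom[OF X x, of n] and hDX1 = D_hom[OF X x, of "n + 1"] and hDY = D_hom[OF Y x, of n]
    and hDY1 = D_hom[OF Y x, of "n - 1"] and hf = diag_hom[OF \<phi> x, of n] and hf1 = diag_hom[OF \<phi> x, of "n + 1"]
  note hs = hDX hDX1 hDY hDY1 hf hf1 \<alpha>(1) \<beta>(1) u v e1(2)
  note hs' = hs[unfolded hom_def mem_Collect_eq]
  \<comment> \<open>The elements \<open>\<alpha>\<close> and \<open>\<beta>\<close> are concentrated at c. Subtracting their cone boundary kills the component
    of the cocycle at c, and leaves those in J zero because no component outside J is mapped into J.\<close>
  let ?u = "Add C (Comp C u e1) (Neg C (Comp C (D X n x) \<alpha>))"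
  let ?v = "Add C (Comp C v e1) (Neg C (Add C (Comp C (diag X Y (cm f) n x) \<alpha>) (Comp C (D Y (n - 1) x) \<beta>)))"
  have u1: "?u \<in> hom C A1 (so X (n + 1) x)" and v1: "?v \<in> hom C A1 (so Y n x)"
    using hs' by (simp_all add: hom_def S.C.add_simps)
  have DD: "Comp C (D X (n + 1) x) (Comp C (D X n x) \<alpha>) = Zero C A1 (so X (n + 2) x)"
    "Comp C (D Y n x) (Comp C (D Y (n - 1) x) \<beta>) = Zero C A1 (so Y (n + 1) x)"
    using D_D[OF X x \<alpha>(1)] D_D[OF Y x \<beta>(1)] by (simp_all add: add.commute)
  have Due: "Comp C (D X (n + 1) x) (Comp C u e1) = Zero C A1 (so X (n + 2) x)"
    using S.C.Comp_assoc[OF e1(2) u hDX1] Du e1(2) so_Obj[OF X x] A by (simp add: hom_def S.C.add_simps)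
  have "Comp C (D X (n + 1) x) ?u = Add C (Comp C (D X (n + 1) x) (Comp C u e1))
      (Neg C (Comp C (D X (n + 1) x) (Comp C (D X n x) \<alpha>)))"
    using hs' by (simp add: S.C.add_simps)
  then have Du1: "Comp C (D X (n + 1) x) ?u = Zero C A1 (so X (n + 2) x)"
    unfolding Due DD using A1 so_Obj[OF X x] by (simp add: S.C.add_simps)
  have fue: "Comp C (diag X Y (cm f) (n + 1) x) (Comp C u e1) = Comp C (D Y n x) (Comp C v e1)"
    using S.C.Comp_assoc[OF e1(2) u hf1] S.C.Comp_assoc[OF e1(2) v hDY] fu by simp
  have fD: "Comp C (diag X Y (cm f) (n + 1) x) (Comp C (D X n x) \<alpha>) = Comp C (D Y n x) (Comp C (diag X Y (cm f) n x) \<alpha>)"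
    using S.C.Comp_assoc[OF \<alpha>(1) hDX hf1] S.C.Comp_assoc[OF \<alpha>(1) hf hDY] diag_D[OF f x, of n] by simp
  have "Comp C (diag X Y (cm f) (n + 1) x) ?u = Add C (Comp C (diag X Y (cm f) (n + 1) x) (Comp C u e1))
      (Neg C (Comp C (diag X Y (cm f) (n + 1) x) (Comp C (D X n x) \<alpha>)))"
    using hs' by (simp add: S.C.add_simps)
  also have "\<dots> = Add C (Comp C (D Y n x) (Comp C v e1))
      (Neg C (Add C (Comp C (D Y n x) (Comp C (diag X Y (cm f) n x) \<alpha>)) (Comp C (D Y n x) (Comp C (D Y (n - 1) x) \<beta>))))"
    unfolding fue fD DD(2) using hs' A1 so_Obj[OF Y x] by (simp add: S.C.add_simps)
  also have "\<dots> = Comp C (D Y n x) ?v" using hs' by (simp add: S.C.add_simps)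
  finally have fu1: "Comp C (diag X Y (cm f) (n + 1) x) ?u = Comp C (D Y n x) ?v" .
  have u1J: "\<forall>j\<in>insert c J. Comp C (pr X (n + 1) x j) ?u = Zero C A1 (ob X (dg n j + 1) j)"
  proof
    fix j assume j: "j \<in> insert c J"
    then have jU: "j \<in> U x" and jP: "j \<in> P" using J c(1) PU by auto
    note hp = pr_hom[OF X x jU, of "n + 1", unfolded hom_def mem_Collect_eq dg_Suc]
    have "Comp C (pr X (n + 1) x j) ?u = Add C (Comp C (Comp C (pr X (n + 1) x j) u) e1)
        (Neg C (Comp C (pr X (n + 1) x j) (Comp C (D X n x) \<alpha>)))"
      using hs' hp by (simp add: S.C.add_simps)
    also have "\<dots> = Zero C A1 (ob X (dg n j + 1) j)"
    proof (cases "j = c")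
      case True
      then show ?thesis
        unfolding prD\<alpha>[OF j] using S.C.Comp_hom[OF e1(2) a] by (simp add: S.C.Add_inverse hom_def)
    next
      case False
      then have "j \<in> J" using j by simp
      from False show ?thesis
        unfolding prD\<alpha>[OF j] bspec[OF uJ \<open>j \<in> J\<close>] using e1(2) A A1 S.ob_Obj[OF X jP]
        by (simp add: hom_def S.C.add_simps)
    qed
    finally show "Comp C (pr X (n + 1) x j) ?u = Zero C A1 (ob X (dg n j + 1) j)" .
  qed
  have v1J: "\<forall>j\<in>insert c J. Comp C (pr Y n x j) ?v = Zero C A1 (ob Y (dg n j) j)"
  proof
    fix j assume j: "j \<in> insert c J"
    then have jU: "j \<in> U x" and jP: "j \<in> P" using J c(1) PU by auto
    note hp = pr_hom[OF Y x jU, of n, unfolded hom_def mem_Collect_eq]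
    have fj: "Comp C (cm f (dg n j) j) (Comp C (pr X n x j) \<alpha>) =
        (if j = c then Comp C (cm f (dg n c) c) a' else Zero C A1 (ob Y (dg n j) j))"
      using \<alpha>(2,3) jU S.cm_hom[OF f jP, of "dg n j"] A1 by (auto simp: hom_def S.C.add_simps)
    have "Comp C (pr Y n x j) ?v = Add C (Comp C (Comp C (pr Y n x j) v) e1)
        (Neg C (Add C (Comp C (pr Y n x j) (Comp C (diag X Y (cm f) n x) \<alpha>)) (Comp C (pr Y n x j) (Comp C (D Y (n - 1) x) \<beta>))))"
      using hs' hp by (simp add: S.C.add_simps)
    also have "\<dots> = Zero C A1 (ob Y (dg n j) j)"
    proof (cases "j = c")
      case True
      have "Add C (Comp C (cm f (dg n c) c) a') (Comp C (df Y (dg n c - 1) c) b') \<in> hom C A1 (ob Y (dg n c) c)"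
        using S.C.Comp_hom[OF e1(2) b] unfolding b'eq .
      then show ?thesis
        unfolding prD\<beta>[OF j] pr_diag[OF \<phi> x \<alpha>(1) jU] fj using True b'eq
        by (simp add: S.C.Add_inverse hom_def)
    next
      case False
      then have "j \<in> J" using j by simp
      from False show ?thesis
        unfolding prD\<beta>[OF j] pr_diag[OF \<phi> x \<alpha>(1) jU] fj bspec[OF vJ \<open>j \<in> J\<close>]
        using e1(2) A A1 S.ob_Obj[OF Y jP] by (simp add: hom_def S.C.add_simps)
    qed
    finally show "Comp C (pr Y n x j) ?v = Zero C A1 (ob Y (dg n j) j)" .
  qed
  have card: "card (U x - insert c J) = k"
    using Suc.prems(3) c(1,2) fin by (metis Diff_insert card_Diff_singleton DiffI diff_Suc_1)
  have J': "insert c J \<subseteq> U x" "\<forall>c'\<in>insert c J. \<forall>b\<in>U x. (b, c') \<in> R \<longrightarrow> b \<in> insert c J"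
    using J c closed by blast+
  obtain A2 e2 u2 v2 where e2: "is_epi C e2" "e2 \<in> hom C A2 A1" "u2 \<in> hom C A2 (so X n x)"
    "v2 \<in> hom C A2 (so Y (n - 1) x)" "Comp C (D X n x) u2 = Comp C ?u e2"
    "Comp C ?v e2 = Add C (Comp C (diag X Y (cm f) n x) u2) (Comp C (D Y (n - 1) x) v2)"
    using Suc.IH[OF J' card u1 v1 Du1 fu1 u1J v1J] by blast
  note h2 = e2(2-4)[unfolded hom_def mem_Collect_eq]
  let ?e = "Comp C e1 e2" and ?u' = "Add C u2 (Comp C \<alpha> e2)" and ?v' = "Add C v2 (Comp C \<beta> e2)"
  have "Comp C (D X n x) ?u' = Add C (Comp C ?u e2) (Comp C (Comp C (D X n x) \<alpha>) e2)"
    unfolding e2(5)[symmetric] using hs' h2 by (simp add: S.C.add_simps)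
  also have "\<dots> = Comp C u ?e" using hs' h2 by (simp add: S.C.add_simps S.C.add_ac)
  finally have 1: "Comp C (D X n x) ?u' = Comp C u ?e" .
  have "Add C (Comp C (diag X Y (cm f) n x) ?u') (Comp C (D Y (n - 1) x) ?v') =
      Add C (Comp C ?v e2) (Comp C (Add C (Comp C (diag X Y (cm f) n x) \<alpha>) (Comp C (D Y (n - 1) x) \<beta>)) e2)"
    unfolding e2(6) using hs' h2 by (simp add: S.C.add_simps S.C.add_ac)
  also have "\<dots> = Comp C v ?e" using hs' h2 by (simp add: S.C.add_simps S.C.add_ac)
  finally have 2: "Comp C v ?e = Add C (Comp C (diag X Y (cm f) n x) ?u') (Comp C (D Y (n - 1) x) ?v')" ..
  have "?u' \<in> hom C A2 (so X n x)" "?v' \<in> hom C A2 (so Y (n - 1) x)" "?e \<in> hom C A2 A"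
    using hs' h2 by (simp_all add: hom_def S.C.add_simps)
  with 1 2 S.C.epi_Comp[OF e2(1,2) e1(1,2)] show ?case by blast
qed

theorem Totm_quasi_iso:
  assumes f: "f \<in> hom S.K X Y" and q: "f \<in> quasi_isos S.FC"
  shows "Totm f \<in> quasi_isos T.FC"
proof -
  have q': "qis C (\<lambda>n. ob X n c, \<lambda>n. df X n c) (\<lambda>n. ob Y n c, \<lambda>n. df Y n c) (\<lambda>n. cm f n c)" if "c \<in> P" for c
    using q S.quasi_iso_iff[OF f] that by blast
  have "qis C (\<lambda>n. so X n x, \<lambda>n. D X n x) (\<lambda>n. so Y n x, \<lambda>n. D Y n x) (\<lambda>n. diag X Y (cm f) n x)"
    if x: "x \<in> P" for x
    unfolding qis_def
    using diag_qis_aux[OF f x q', of "{}" "card (U x)"] by simp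
  moreover have "(\<lambda>n. cm (Totm f) n x) = (\<lambda>n. diag X Y (cm f) n x)" if "x \<in> P" for x
    using cm_Totm[OF that f] by auto
  ultimately show ?thesis
    unfolding T.quasi_iso_iff[OF Totm_hom[OF f]] by (simp add: Tot_sel)
qed

end

section \<open>Posets of height at most one\<close>

locale height_one_poset = C: abelian_category C
  for C :: "('o, 'a, 'z) addcat_scheme" +
  fixes P :: "'p set" and r :: "'p rel"
  assumes finite_P: "finite P" and po: "partial_order_on P r" and height_r: "height_at_most_one r"
begin

definition up :: "'p \<Rightarrow> 'p set" where "up x = {c. (x, c) \<in> r}"

definition eps :: "'p \<Rightarrow> int" where "eps x = (if x \<in> minimal_elements r P then 1 else 0)"

lemma r_P: "(x, y) \<in> r \<Longrightarrow> x \<in> P \<and> y \<in> P" and r_refl: "x \<in> P \<Longrightarrow> (x, x) \<in> r"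
  and r_trans: "(x, y) \<in> r \<Longrightarrow> (y, z) \<in> r \<Longrightarrow> (x, z) \<in> r"
  and r_antisym: "(x, y) \<in> r \<Longrightarrow> (y, x) \<in> r \<Longrightarrow> x = y"
  using po by (auto simp: partial_order_on_def preorder_on_def refl_on_def dest: transD antisymD)

lemma r_height: "(x, y) \<in> r \<Longrightarrow> (y, z) \<in> r \<Longrightarrow> x = y \<or> y = z"
  using height_r r_antisym unfolding height_at_most_one_def by blast

lemma eps_less:
  assumes "(x, y) \<in> r" "x \<noteq> y"
  shows "eps x = 1" "eps y = 0"
  using assms r_P[of x y] r_height[of _ x y] unfolding eps_def minimal_elements_def by auto

text \<open>\<open>F\<close> produces at a minimal element \<open>a\<close> the product of \<open>X\<^sub>a\<close> in degree \<open>n + 1\<close> and of the \<open>X\<^sub>b\<close>, \<open>b > a\<close>,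
  in degree \<open>n\<close>, which is the cone of \<open>X\<^sub>a \<rightarrow> \<Oplus>\<^sub>b X\<^sub>b\<close> up to signs. \<open>G\<close>, with the opposite degrees and the
  opposite structure maps, produces the cone of \<open>\<Oplus>\<^sub>b Y\<^sub>b \<rightarrow> Y\<^sub>a\<close> shifted by \<open>-1\<close>. In both cases
  the product has a single factor at the other elements, and at minimal elements that are also
  maximal the complex is just shifted.\<close>

sublocale F: twisted_product C P r "r\<inverse>" up eps
proof
  show "partial_order_on P r" "partial_order_on P (r\<inverse>)" using po by simp_all
  show "finite P" by (rule finite_P)
  show "up x \<subseteq> P" if "x \<in> P" for x using r_P by (auto simp: up_def)
  show "a = b \<or> b = c" if "(a, b) \<in> r" "(b, c) \<in> r" for a b c
    using that r_height[of a b c] by auto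
  show "eps b = eps c + 1" if "(b, c) \<in> r" "b \<noteq> c" for b c
    using that eps_less[of b c] by auto
  show "c \<in> up y" if "(x, y) \<in> r\<inverse>" "(y, z) \<in> r\<inverse>" "c \<in> up x" "c \<in> up z" for x y z c
    using that r_trans[of y x c] by (auto simp: up_def)
  show "b \<in> up y \<and> c \<in> up x" if "(x, y) \<in> r\<inverse>" "b \<in> up x" "c \<in> up y" "(b, c) \<in> r" for x y b c
    using that r_trans[of x b c] r_trans[of y x b] by (auto simp: up_def)
qed

sublocale G: twisted_product C P "r\<inverse>" r up "\<lambda>x. - eps x"
proof
  show "up x \<subseteq> P" if "x \<in> P" for x using r_P by (auto simp: up_def)
  show "a = b \<or> b = c" if "(a, b) \<in> r\<inverse>" "(b, c) \<in> r\<inverse>" for a b c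
    using that r_height[of c b a] by auto
  show "- eps b = - eps c + 1" if "(b, c) \<in> r\<inverse>" "b \<noteq> c" for b c
    using that eps_less[of c b] by auto
  show "c \<in> up y" if "(x, y) \<in> r" "(y, z) \<in> r" "c \<in> up x" "c \<in> up z" for x y z c
    using that r_trans[of y z c] by (auto simp: up_def)
  show "b \<in> up y \<and> c \<in> up x" if "(x, y) \<in> r" "b \<in> up x" "c \<in> up y" "(b, c) \<in> r\<inverse>" for x y b c
    using that r_trans[of y c b] r_trans[of x y c] by (auto simp: up_def)
qed (rule finite_P)

lemma dg: "F.dg n c = n + eps c" "G.dg n c = n - eps c"
  by (simp_all add: F.dg_def G.dg_def)

lemma up_self: "x \<in> P \<Longrightarrow> x \<in> up x" and up_P: "c \<in> up x \<Longrightarrow> c \<in> P \<and> x \<in> P"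
  and up_r: "c \<in> up x \<longleftrightarrow> (x, c) \<in> r"
  using r_refl r_P by (auto simp: up_def)

lemma up_top: "\<lbrakk>c \<in> up x; c \<noteq> x\<rbrakk> \<Longrightarrow> up c = {c}"
  using r_height[of x c] r_P[of x c] r_refl[of c] by (auto simp: up_def)

subsection \<open>The unit\<close>

text \<open>The value of \<open>G (F X)\<close> at \<open>x\<close> is a product over the pairs \<open>x \<le> c \<le> e\<close>. As the height is at most
  one, either \<open>e = c\<close>, with factor \<open>X\<^sub>c\<close> in degree \<open>n\<close>, or \<open>x = c < e\<close>, with factor \<open>X\<^sub>e\<close> in degree
  \<open>n - 1\<close>. The components of an element at these factors are \<open>cc\<close> and \<open>co\<close>.\<close>

definition cc where
  "cc X n x c u = Comp C (F.pr X (n - eps c) c c) (Comp C (G.pr (F.Tot X) n x c) u)"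

definition co where
  "co X n x e u = Comp C (F.pr X (n - 1) x e) (Comp C (G.pr (F.Tot X) n x x) u)"

context
  fixes X assumes X: "X \<in> Obj F.S.K"
begin

lemma FX: "F.Tot X \<in> Obj F.T.K" by (rule F.Tot_Obj[OF X])

lemma G_pr_hom:
  assumes "x \<in> P" "c \<in> up x" "u \<in> hom C A (G.so (F.Tot X) n x)"
  shows "Comp C (G.pr (F.Tot X) n x c) u \<in> hom C A (F.so X (n - eps c) c)"
  using G.pr_comp_hom[OF FX assms] up_P[OF assms(2)] by (simp add: F.Tot_sel dg)

lemma cc_hom:
  assumes "x \<in> P" "c \<in> up x" "u \<in> hom C A (G.so (F.Tot X) n x)"
  shows "cc X n x c u \<in> hom C A (ob X n c)"
  using F.pr_comp_hom[OF X _ up_self G_pr_hom[OF assms]] up_P[OF assms(2)] by (simp add: cc_def dg)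

lemma co_hom:
  assumes "(x, e) \<in> r" "x \<noteq> e" "u \<in> hom C A (G.so (F.Tot X) n x)"
  shows "co X n x e u \<in> hom C A (ob X (n - 1) e)"
  using F.pr_comp_hom[OF X _ _ G_pr_hom[OF _ up_self assms(3)], of e] r_P[OF assms(1)] assms(1,2)
    eps_less[OF assms(1,2)] by (simp add: co_def dg up_def)

lemma unit_eqI:
  assumes x: "x \<in> P" and u: "u \<in> hom C A (G.so (F.Tot X) n x)" and v: "v \<in> hom C A (G.so (F.Tot X) n x)"
    and cc: "\<And>c. c \<in> up x \<Longrightarrow> cc X n x c u = cc X n x c v"
    and co: "\<And>e. (x, e) \<in> r \<Longrightarrow> x \<noteq> e \<Longrightarrow> co X n x e u = co X n x e v"
  shows "u = v"
proof (rule G.elem_eqI[OF FX x u v])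
  fix c assume c: "c \<in> up x"
  then have cP: "c \<in> P" using up_P by blast
  show "Comp C (G.pr (F.Tot X) n x c) u = Comp C (G.pr (F.Tot X) n x c) v"
  proof (rule F.elem_eqI[OF X cP G_pr_hom[OF x c u] G_pr_hom[OF x c v]])
    fix e assume e: "e \<in> up c"
    show "Comp C (F.pr X (n - eps c) c e) (Comp C (G.pr (F.Tot X) n x c) u) =
        Comp C (F.pr X (n - eps c) c e) (Comp C (G.pr (F.Tot X) n x c) v)"
    proof (cases "e = c")
      case True
      then show ?thesis using cc[OF c] by (simp add: cc_def)
    next
      case False
      then have "c = x" using up_top[OF c] e by auto
      then show ?thesis using co[of e] e False eps_less[of x e] by (auto simp: co_def up_def)
    qed
  qed
qed

text \<open>Besides the diagonal entries, the differential of \<open>G (F X)\<close> maps into the factor of \<open>(c, e)\<close>, with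
  \<open>c < e\<close>, from the factor of \<open>(e, e)\<close>, by a transition map of \<open>F X\<close> (\<open>G_off_row\<close>), and from that of
  \<open>(c, c)\<close>, by a structure map of \<open>X\<close> (\<open>F_off_row\<close>). Nothing maps into the factors of \<open>(c, c)\<close>.\<close>

lemma G_off_row:
  assumes x: "x \<in> P" and c: "c \<in> up x" and e: "e \<in> up c" and A: "A \<in> Obj C"
    and p: "\<And>b. b \<in> up x \<Longrightarrow> p b \<in> hom C A (F.so X (n - eps b) b)"
  shows "Comp C (F.pr X (n + 1 - eps c) c e) (G.off (F.Tot X) n x c A p) =
    (if e = c then Zero C A (ob X (n + 1) c) else Comp C (F.pr X n e e) (p e))"
proof -
  have cP: "c \<in> P" and eP: "e \<in> P" using up_P c e by auto
  let ?m = "n + 1 - eps c"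
  let ?t = "\<lambda>b. if b \<in> up x \<and> (b, c) \<in> r\<inverse> \<and> b \<noteq> c then Comp C (F.tm X ?m b c) (p b) else Zero C A (F.so X ?m c)"
  have deg: "eps b = 0 \<and> eps c = 1" if "(b, c) \<in> r\<inverse>" "b \<noteq> c" for b using that eps_less[of c b] by auto
  have off: "G.off (F.Tot X) n x c A p = arrow_sum C A (F.so X ?m c) ?t P"
  proof -
    have m: "G.dg n c + 1 = ?m" by (simp add: dg)
    show ?thesis
      unfolding G.off_def m F.Tot_sel(1)[OF cP]
      by (rule C.arrow_sum_cong[OF finite_P]) (auto simp: F.Tot_sel)
  qed
  have t: "?t b \<in> hom C A (F.so X ?m c)" for b
  proof (cases "b \<in> up x \<and> (b, c) \<in> r\<inverse> \<and> b \<noteq> c")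
    case True
    then have b: "b \<in> P" "p b \<in> hom C A (F.so X ?m b)" using p[of b] deg[of b] up_P[of b x] by auto
    then show ?thesis using True C.Comp_hom[OF b(2) F.pr_tm(1)[OF X b(1) cP b(2)]] by simp
  next
    case False
    then show ?thesis using C.Zero_hom[OF A F.so_Obj[OF X cP]] by auto
  qed
  have pr: "F.pr X ?m c e \<in> hom C (F.so X ?m c) (ob X (?m + eps e) e)"
    using F.pr_hom[OF X cP e, of ?m] by (simp add: dg)
  have sum: "Comp C (F.pr X ?m c e) (G.off (F.Tot X) n x c A p) =
      arrow_sum C A (ob X (?m + eps e) e) (\<lambda>b. Comp C (F.pr X ?m c e) (?t b)) P"
    unfolding off by (rule C.arrow_sum_Comp_left[OF finite_P A pr t])
  have row: "Comp C (F.pr X ?m c e) (?t b) = (if b \<in> up x \<and> (b, c) \<in> r\<inverse> \<and> b \<noteq> c \<and> e = b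
      then Comp C (F.pr X n e e) (p e) else Zero C A (ob X (?m + eps e) e))" for b
  proof (cases "b \<in> up x \<and> (b, c) \<in> r\<inverse> \<and> b \<noteq> c")
    case True
    then have b: "b \<in> P" "p b \<in> hom C A (F.so X ?m b)" using p[of b] deg[of b] up_P[of b x] by auto
    have "up b = {b}" using True up_top[of b c] by (auto simp: up_def)
    then show ?thesis using True F.pr_tm(2)[OF X b(1) cP b(2) e] deg[of b] by (auto simp: dg)
  next
    case False
    then show ?thesis using pr A F.so_Obj[OF X cP] by (auto simp: hom_def C.add_simps)
  qed
  show ?thesis
  proof (cases "e = c")
    case True
    then have m: "?m + eps e = n + 1" by simp
    show ?thesis unfolding sum row m
      by (subst C.arrow_sum_Zero[OF finite_P A F.S.ob_Obj[OF X eP]]) (use True in auto)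
  next
    case False
    have ce: "(c, e) \<in> r" using e by (simp add: up_def)
    have ex: "e \<in> up x" using r_trans c e by (auto simp: up_def)
    have m: "?m + eps e = n" "eps e = 0" using eps_less[OF ce] False by auto
    have "Comp C (F.pr X n e e) (p e) \<in> hom C A (ob X n e)"
      using F.pr_comp_hom[OF X eP up_self[OF eP], of "p e" A n] p[OF ex] m(2) by (simp add: dg)
    then show ?thesis unfolding sum row m(1)
      by (subst C.arrow_sum_single[OF finite_P A F.S.ob_Obj[OF X eP] eP]) (use ex ce False in auto)
  qed
qed

lemma F_off_row:
  assumes c: "c \<in> P" and e: "e \<in> up c" and A: "A \<in> Obj C"
    and p: "\<And>b. b \<in> up c \<Longrightarrow> p b \<in> hom C A (ob X (m + eps b) b)"
  shows "F.off X m c e A p = (if e = c then Zero C A (ob X (m + eps c + 1) c) else Comp C (mp X (m + 1) c e) (p c))"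
proof -
  have eP: "e \<in> P" using up_P e by auto
  show ?thesis
  proof (cases "e = c")
    case True
    then show ?thesis using F.off_Zero[OF X eP A, of c p m] r_antisym by (auto simp: dg up_def)
  next
    case False
    have ce: "(c, e) \<in> r" using e by (simp add: up_def)
    note d = eps_less[OF ce False[symmetric]]
    have "Comp C (mp X (m + 1) c e) (p c) \<in> hom C A (ob X (m + 1) e)"
      using C.Comp_hom[OF p[OF up_self[OF c]] F.S.mp_hom[OF X ce, of "m + eps c"]] d by simp
    moreover have "b = c" if "b \<in> up c" "(b, e) \<in> r" "b \<noteq> e" for b
      using that r_height[of c b e] by (auto simp: up_def)
    ultimately show ?thesis using False d ce up_self[OF c]
      unfolding F.off_def dg
      by (subst C.arrow_sum_single[OF finite_P A F.S.ob_Obj[OF X eP] c]) auto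
  qed
qed

lemma cc_D:
  assumes x: "x \<in> P" and c: "c \<in> up x" and u: "u \<in> hom C A (G.so (F.Tot X) n x)"
  shows "cc X (n + 1) x c (Comp C (G.D (F.Tot X) n x) u) = Comp C (df X n c) (cc X n x c u)"
proof -
  have cP: "c \<in> P" using c up_P by blast
  have A: "A \<in> Obj C" using C.hom_Obj[OF u] by simp
  let ?p = "\<lambda>b. Comp C (G.pr (F.Tot X) n x b) u"
  note p = G_pr_hom[OF x _ u]
  let ?m = "n - eps c" and ?o = "G.off (F.Tot X) n x c A ?p"
  have m: "?m + 1 = n + 1 - eps c" by simp
  have o: "?o \<in> hom C A (F.so X (?m + 1) c)"
    using G.off_hom[OF FX cP A G.pr_comp_hom[OF FX x _ u]] by (simp add: F.Tot_sel cP dg)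
  have Dp: "Comp C (F.D X ?m c) (?p c) \<in> hom C A (F.so X (?m + 1) c)"
    using C.Comp_hom[OF p[OF c] F.D_hom[OF X cP]] .
  have "Comp C (G.pr (F.Tot X) (n + 1) x c) (Comp C (G.D (F.Tot X) n x) u) =
      Add C (Comp C (F.D X ?m c) (?p c)) (sign C n ?o)"
    using G.pr_D(2)[OF FX x u c] by (simp add: F.Tot_sel cP dg)
  then have "cc X (n + 1) x c (Comp C (G.D (F.Tot X) n x) u) =
      Add C (Comp C (F.pr X (?m + 1) c c) (Comp C (F.D X ?m c) (?p c))) (sign C n (Comp C (F.pr X (?m + 1) c c) ?o))"
    using F.pr_hom[OF X cP up_self[OF cP], of "?m + 1"] Dp o
    unfolding cc_def m[symmetric] by (simp add: hom_def C.add_simps C.sign_simps)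
  also have "Comp C (F.pr X (?m + 1) c c) ?o = Zero C A (ob X (n + 1) c)"
    using G_off_row[OF x c up_self[OF cP] A p] by (simp add: m)
  also have "Comp C (F.pr X (?m + 1) c c) (Comp C (F.D X ?m c) (?p c)) = Add C (Comp C (df X n c) (cc X n x c u))
      (sign C ?m (Zero C A (ob X (n + 1) c)))"
    using F.pr_D(2)[OF X cP p[OF c] up_self[OF cP]]
      F_off_row[OF cP up_self[OF cP] A, of "\<lambda>b. Comp C (F.pr X ?m c b) (?p c)" ?m]
      F.pr_comp_hom[OF X cP _ p[OF c]] by (simp add: dg cc_def)
  finally show ?thesis
    using C.Comp_hom[OF cc_hom[OF x c u] F.S.df_hom[OF X cP]] A F.S.ob_Obj[OF X cP]
    by (simp add: hom_def C.add_simps C.sign_simps)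
qed

lemma co_D:
  assumes xe: "(x, e) \<in> r" "x \<noteq> e" and u: "u \<in> hom C A (G.so (F.Tot X) n x)"
  shows "co X (n + 1) x e (Comp C (G.D (F.Tot X) n x) u) = Add C (Comp C (df X (n - 1) e) (co X n x e u))
    (Add C (Neg C (sign C n (Comp C (mp X n x e) (cc X n x x u)))) (sign C n (cc X n x e u)))"
proof -
  have x: "x \<in> P" and eP: "e \<in> P" using r_P[OF xe(1)] by auto
  have A: "A \<in> Obj C" using C.hom_Obj[OF u] by simp
  note d = eps_less[OF xe]
  have e: "e \<in> up x" using xe by (simp add: up_def)
  let ?p = "\<lambda>b. Comp C (G.pr (F.Tot X) n x b) u"
  note p = G_pr_hom[OF x _ u]
  let ?o = "G.off (F.Tot X) n x x A ?p"
  have px: "?p x \<in> hom C A (F.so X (n - 1) x)" using p[OF up_self[OF x]] d by simp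
  have o: "?o \<in> hom C A (F.so X n x)"
    using G.off_hom[OF FX x A G.pr_comp_hom[OF FX x _ u]] d by (simp add: F.Tot_sel x dg)
  have Dp: "Comp C (F.D X (n - 1) x) (?p x) \<in> hom C A (F.so X n x)"
    using C.Comp_hom[OF px F.D_hom[OF X x]] by simp
  have "Comp C (G.pr (F.Tot X) (n + 1) x x) (Comp C (G.D (F.Tot X) n x) u) =
      Add C (Comp C (F.D X (n - 1) x) (?p x)) (sign C n ?o)"
    using G.pr_D(2)[OF FX x u up_self[OF x]] d by (simp add: F.Tot_sel x dg)
  then have "co X (n + 1) x e (Comp C (G.D (F.Tot X) n x) u) =
      Add C (Comp C (F.pr X n x e) (Comp C (F.D X (n - 1) x) (?p x))) (sign C n (Comp C (F.pr X n x e) ?o))"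
    using F.pr_hom[OF X x e, of n] Dp o
    unfolding co_def by (simp add: hom_def C.add_simps C.sign_simps)
  also have "Comp C (F.pr X n x e) ?o = cc X n x e u"
    using G_off_row[OF x up_self[OF x] e A p] d xe by (simp add: cc_def)
  also have "Comp C (F.pr X n x e) (Comp C (F.D X (n - 1) x) (?p x)) = Add C (Comp C (df X (n - 1) e) (co X n x e u))
      (sign C (n - 1) (Comp C (mp X n x e) (cc X n x x u)))"
    using F.pr_D(2)[OF X x px e] F_off_row[OF x e A, of "\<lambda>b. Comp C (F.pr X (n - 1) x b) (?p x)" "n - 1"]
      F.pr_comp_hom[OF X x _ px] d xe by (simp add: dg cc_def co_def)
  finally show ?thesis
    using C.Comp_hom[OF co_hom[OF xe u] F.S.df_hom[OF X eP]] cc_hom[OF x e u]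
      C.Comp_hom[OF cc_hom[OF x up_self[OF x] u] F.S.mp_hom[OF X xe(1)]]
    by (simp add: hom_def C.Add_reassoc C.sign_simps C.Neg_Arr)
qed

end

text \<open>An element of \<open>X\<^sub>x\<close> is sent to its images in all factors \<open>X\<^sub>c\<close>, and to zero in the factors of the
  pairs \<open>x < e\<close>. The composite of the inclusion into degree \<open>n\<close> with the differential vanishes at
  the latter because the two off-diagonal entries have opposite signs.\<close>

definition unit_at where
  "unit_at X n x = tuple C (up x) (G.V (F.Tot X) n) (ob X n x)
    (\<lambda>c. tuple C (up c) (F.V X (n - eps c)) (ob X n x)
      (\<lambda>e. if e = c then mp X n x c else Zero C (ob X n x) (ob X (F.dg (n - eps c) e) e)))"

definition unit_map where "unit_map X = mk_map P X (G.Tot (F.Tot X)) (unit_at X)"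

context
  fixes X assumes X: "X \<in> Obj F.S.K"
begin

lemma cc_co_Add:
  assumes x: "x \<in> P" and u: "u \<in> hom C A (G.so (F.Tot X) n x)" and v: "v \<in> hom C A (G.so (F.Tot X) n x)"
  shows "c \<in> up x \<Longrightarrow> cc X n x c (Add C u v) = Add C (cc X n x c u) (cc X n x c v)"
    "(x, e) \<in> r \<Longrightarrow> x \<noteq> e \<Longrightarrow> co X n x e (Add C u v) = Add C (co X n x e u) (co X n x e v)"
proof -
  have pG: "G.pr (F.Tot X) n x c \<in> hom C (G.so (F.Tot X) n x) (F.so X (n - eps c) c)" if "c \<in> up x" for c
    using G.pr_hom[OF FX[OF X] x that, of n] up_P[OF that] by (simp add: F.Tot_sel dg)
  show "cc X n x c (Add C u v) = Add C (cc X n x c u) (cc X n x c v)" if "c \<in> up x"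
    using pG[OF that] F.pr_hom[OF X _ up_self, of c "n - eps c"] up_P[OF that] u v
    by (simp add: cc_def hom_def C.Comp_distrib C.Comp_Arr)
  show "co X n x e (Add C u v) = Add C (co X n x e u) (co X n x e v)" if "(x, e) \<in> r" "x \<noteq> e"
    using pG[OF up_self[OF x]] F.pr_hom[OF X x, of e "n - 1"] that eps_less[OF that] u v
    by (simp add: co_def hom_def C.Comp_distrib C.Comp_Arr up_def)
qed

lemma unit_at_tuple:
  assumes x: "x \<in> P"
  shows "unit_at X n x \<in> hom C (ob X n x) (G.so (F.Tot X) n x)"
    "c \<in> up x \<Longrightarrow> e \<in> up c \<Longrightarrow> Comp C (F.pr X (n - eps c) c e) (Comp C (G.pr (F.Tot X) n x c) (unit_at X n x)) =
      (if e = c then mp X n x c else Zero C (ob X n x) (ob X (F.dg (n - eps c) e) e))"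
proof -
  let ?A = "ob X n x"
  let ?t = "\<lambda>c e. if e = c then mp X n x c else Zero C ?A (ob X (F.dg (n - eps c) e) e)"
  let ?s = "\<lambda>c. tuple C (up c) (F.V X (n - eps c)) ?A (?t c)"
  have A: "?A \<in> Obj C" by (rule F.S.ob_Obj[OF X x])
  have t: "?t c e \<in> hom C ?A (ob X (F.dg (n - eps c) e) e)" if "c \<in> up x" "e \<in> up c" for c e
    using F.S.mp_hom[OF X, of x c n] C.Zero_hom[OF A F.S.ob_Obj[OF X]] that up_P[OF that(2)]
    by (auto simp: dg up_r)
  have s: "?s c \<in> hom C ?A (F.so X (n - eps c) c)"
    "\<And>e. e \<in> up c \<Longrightarrow> Comp C (F.pr X (n - eps c) c e) (?s c) = ?t c e" if "c \<in> up x" for c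
    by (rule F.tuple_so[OF X _ A t[OF that]]; use up_P[OF that] in simp)+
  have s': "?s c \<in> hom C ?A (ob (F.Tot X) (G.dg n c) c)" if "c \<in> up x" for c
    using s(1)[OF that] up_P[OF that] by (simp add: F.Tot_sel dg)
  have u: "unit_at X n x \<in> hom C ?A (G.so (F.Tot X) n x)"
    "\<And>c. c \<in> up x \<Longrightarrow> Comp C (G.pr (F.Tot X) n x c) (unit_at X n x) = ?s c"
    unfolding unit_at_def by (rule G.tuple_so[OF FX[OF X] x A s']; assumption)+
  show "unit_at X n x \<in> hom C ?A (G.so (F.Tot X) n x)" by (rule u)
  show "Comp C (F.pr X (n - eps c) c e) (Comp C (G.pr (F.Tot X) n x c) (unit_at X n x)) = ?t c e"
    if "c \<in> up x" "e \<in> up c"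
    using u(2) s(2) that by simp
qed

lemma unit_at_row:
  assumes x: "x \<in> P" and t: "t \<in> hom C A (ob X n x)"
  shows "Comp C (unit_at X n x) t \<in> hom C A (G.so (F.Tot X) n x)"
    "c \<in> up x \<Longrightarrow> cc X n x c (Comp C (unit_at X n x) t) = Comp C (mp X n x c) t"
    "(x, e) \<in> r \<Longrightarrow> x \<noteq> e \<Longrightarrow> co X n x e (Comp C (unit_at X n x) t) = Zero C A (ob X (n - 1) e)"
proof -
  note u = unit_at_tuple(1)[OF x, of n]
  show "Comp C (unit_at X n x) t \<in> hom C A (G.so (F.Tot X) n x)" using C.Comp_hom[OF t u] .
  have row: "Comp C (F.pr X (n - eps c) c e) (Comp C (G.pr (F.Tot X) n x c) (Comp C (unit_at X n x) t)) =
      Comp C (if e = c then mp X n x c else Zero C (ob X n x) (ob X (F.dg (n - eps c) e) e)) t"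
    if c: "c \<in> up x" and e: "e \<in> up c" for c e
  proof -
    have cP: "c \<in> P" using up_P[OF c] by simp
    have pG: "G.pr (F.Tot X) n x c \<in> hom C (G.so (F.Tot X) n x) (F.so X (n - eps c) c)"
      using G.pr_hom[OF FX[OF X] x c, of n] by (simp add: F.Tot_sel cP dg)
    show ?thesis
      unfolding unit_at_tuple(2)[OF x c e, symmetric]
      using u t pG F.pr_hom[OF X cP e, of "n - eps c"] by (simp add: hom_def C.cat_simps)
  qed
  show "cc X n x c (Comp C (unit_at X n x) t) = Comp C (mp X n x c) t" if c: "c \<in> up x"
    unfolding cc_def using row[OF c up_self] up_P[OF c] by simp
  show "co X n x e (Comp C (unit_at X n x) t) = Zero C A (ob X (n - 1) e)" if "(x, e) \<in> r" "x \<noteq> e"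
    using row[OF up_self[OF x], of e] that eps_less[OF that] t F.S.ob_Obj[OF X] r_P[OF that(1)]
    by (auto simp: co_def up_def dg hom_def C.add_simps)
qed

lemma unit_at_D:
  assumes x: "x \<in> P" and t: "t \<in> hom C A (ob X n x)"
  shows "Comp C (G.D (F.Tot X) n x) (Comp C (unit_at X n x) t) = Comp C (unit_at X (n + 1) x) (Comp C (df X n x) t)"
proof -
  note dt = C.Comp_hom[OF t F.S.df_hom[OF X x]] and ut = unit_at_row(1)[OF x t]
  have A: "A \<in> Obj C" using C.hom_Obj[OF t] by simp
  show ?thesis
  proof (rule unit_eqI[OF X x C.Comp_hom[OF ut G.D_hom[OF FX[OF X] x]] unit_at_row(1)[OF x dt]])
    fix c assume c: "c \<in> up x"
    then have xc: "(x, c) \<in> r" by (simp add: up_def)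
    then have cP: "c \<in> P" using r_P by blast
    show "cc X (n + 1) x c (Comp C (G.D (F.Tot X) n x) (Comp C (unit_at X n x) t)) =
        cc X (n + 1) x c (Comp C (unit_at X (n + 1) x) (Comp C (df X n x) t))"
      using cc_D[OF X x c ut] unit_at_row(2)[OF x t c] unit_at_row(2)[OF x dt c]
        C.Comp_assoc[OF t F.S.mp_hom[OF X xc] F.S.df_hom[OF X cP]] F.S.mp_df[OF X xc, of n]
        C.Comp_assoc[OF t F.S.df_hom[OF X x] F.S.mp_hom[OF X xc]] by simp
  next
    fix e assume e: "(x, e) \<in> r" "x \<noteq> e"
    then have eP: "e \<in> P" and eU: "e \<in> up x" using r_P by (auto simp: up_def)
    have "Comp C (mp X n x x) t = t" using F.S.mp_refl[OF X x] C.Comp_Idn_left[OF t] by simp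
    then show "co X (n + 1) x e (Comp C (G.D (F.Tot X) n x) (Comp C (unit_at X n x) t)) =
        co X (n + 1) x e (Comp C (unit_at X (n + 1) x) (Comp C (df X n x) t))"
      using co_D[OF X e ut] unit_at_row(3)[OF x t e] unit_at_row(3)[OF x dt e] unit_at_row(2)[OF x t up_self[OF x]]
        unit_at_row(2)[OF x t eU] C.Comp_hom[OF t F.S.mp_hom[OF X e(1)]] F.S.df_hom[OF X eP, of "n - 1"] A F.S.ob_Obj[OF X eP]
      by (simp add: hom_def C.add_simps C.sign_simps C.Add_inverse)
  qed
qed

lemma unit_at_tm:
  assumes xy: "(x, y) \<in> r" and t: "t \<in> hom C A (ob X n x)"
  shows "Comp C (G.tm (F.Tot X) n x y) (Comp C (unit_at X n x) t) = Comp C (unit_at X n y) (Comp C (mp X n x y) t)"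
proof -
  have x: "x \<in> P" and y: "y \<in> P" using r_P[OF xy] by auto
  note mt = C.Comp_hom[OF t F.S.mp_hom[OF X xy]] and ut = unit_at_row(1)[OF x t]
  note tm = G.pr_tm[OF FX[OF X] x y ut]
  have sub: "c \<in> up x" if "c \<in> up y" for c using that xy r_trans by (auto simp: up_def)
  show ?thesis
  proof (rule unit_eqI[OF X y C.Comp_hom[OF ut tm(1)] unit_at_row(1)[OF y mt]])
    fix c assume c: "c \<in> up y"
    then have yc: "(y, c) \<in> r" by (simp add: up_def)
    have "cc X n y c (Comp C (G.tm (F.Tot X) n x y) (Comp C (unit_at X n x) t)) = cc X n x c (Comp C (unit_at X n x) t)"
      using tm(2)[OF c] sub[OF c] by (simp add: cc_def)
    then show "cc X n y c (Comp C (G.tm (F.Tot X) n x y) (Comp C (unit_at X n x) t)) =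
        cc X n y c (Comp C (unit_at X n y) (Comp C (mp X n x y) t))"
      using unit_at_row(2)[OF x t sub[OF c]] unit_at_row(2)[OF y mt c] F.S.mp_trans[OF X xy yc, of n]
        C.Comp_assoc[OF t F.S.mp_hom[OF X xy] F.S.mp_hom[OF X yc]] by simp
  next
    fix e assume e: "(y, e) \<in> r" "y \<noteq> e"
    then have "y = x" using r_height[OF xy] by auto
    then show "co X n y e (Comp C (G.tm (F.Tot X) n x y) (Comp C (unit_at X n x) t)) =
        co X n y e (Comp C (unit_at X n y) (Comp C (mp X n x y) t))"
      using tm(2)[OF up_self[OF y]] up_self[OF y] unit_at_row(3)[OF x t, of e] unit_at_row(3)[OF y mt e] e
      by (simp add: co_def)
  qed
qed

lemma unit_map_hom: "unit_map X \<in> hom F.S.K X (G.Tot (F.Tot X))"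
  unfolding unit_map_def
proof (rule F.S.mk_map_hom[OF X G.Tot_Obj[OF FX[OF X]]])
  fix n x assume x: "x \<in> P"
  show "unit_at X n x \<in> hom C (ob X n x) (ob (G.Tot (F.Tot X)) n x)"
    using unit_at_tuple(1)[OF x] by (simp add: G.Tot_sel x)
  show "Comp C (df (G.Tot (F.Tot X)) n x) (unit_at X n x) = Comp C (unit_at X (n + 1) x) (df X n x)"
    using unit_at_D[OF x C.Idn_hom[OF F.S.ob_Obj[OF X x]], of n] C.Comp_Idn_right[OF unit_at_tuple(1)[OF x]]
      C.Comp_Idn_right[OF F.S.df_hom[OF X x]] by (simp add: G.Tot_sel x)
next
  fix n x y assume xy: "(x, y) \<in> r"
  then have x: "x \<in> P" using r_P by blast
  show "Comp C (unit_at X n y) (mp X n x y) = Comp C (mp (G.Tot (F.Tot X)) n x y) (unit_at X n x)"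
    using unit_at_tm[OF xy C.Idn_hom[OF F.S.ob_Obj[OF X x]], of n] C.Comp_Idn_right[OF unit_at_tuple(1)[OF x]]
      C.Comp_Idn_right[OF F.S.mp_hom[OF X xy]] by (simp add: G.Tot_sel xy)
qed

lemma cm_unit_map: "x \<in> P \<Longrightarrow> cm (unit_map X) n x = unit_at X n x"
  by (simp add: unit_map_def mk_map_sel)

text \<open>The component at the pair \<open>(x, x)\<close> retracts the unit, and its kernel is contractible: there the
  differential maps the factor of \<open>(e, e)\<close> isomorphically to that of \<open>(x, e)\<close>. As the contraction is
  explicit, the stage does not have to be refined.\<close>

lemma unit_map_quasi_iso: "unit_map X \<in> quasi_isos F.S.FC"
  unfolding F.S.quasi_iso_iff[OF unit_map_hom]
proof
  fix x assume x: "x \<in> P"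
  have e: "(\<lambda>n. cm (unit_map X) n x) = (\<lambda>n. unit_at X n x)" "(\<lambda>n. ob (G.Tot (F.Tot X)) n x) = (\<lambda>n. G.so (F.Tot X) n x)"
    "(\<lambda>n. df (G.Tot (F.Tot X)) n x) = (\<lambda>n. G.D (F.Tot X) n x)"
    using cm_unit_map x by (simp_all add: G.Tot_sel)
  show "qis C (\<lambda>n. ob X n x, \<lambda>n. df X n x) (\<lambda>n. ob (G.Tot (F.Tot X)) n x, \<lambda>n. df (G.Tot (F.Tot X)) n x)
      (\<lambda>n. cm (unit_map X) n x)"
    unfolding qis_def e fst_conv snd_conv
  proof (intro allI impI, elim conjE)
    fix A n t y
    assume t: "t \<in> hom C A (ob X (n + 1) x)" and y: "y \<in> hom C A (G.so (F.Tot X) n x)"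
      and ty: "Comp C (unit_at X (n + 1) x) t = Comp C (G.D (F.Tot X) n x) y"
    have A: "A \<in> Obj C" using C.hom_Obj[OF t] by simp
    let ?x = "cc X n x x y"
    note xh = cc_hom[OF X x up_self[OF x] y]
    have tt: "Comp C (mp X (n + 1) x x) t = t" using F.S.mp_refl[OF X x] C.Comp_Idn_left[OF t] by simp
    have dx: "Comp C (df X n x) ?x = t"
      using cc_D[OF X x up_self[OF x] y] unit_at_row(2)[OF x t up_self[OF x]] tt unfolding ty by simp
    have xx: "Comp C (mp X n x x) ?x = ?x" using F.S.mp_refl[OF X x] C.Comp_Idn_left[OF xh] by simp

    \<comment> \<open>With \<open>?x\<close> the component of y at \<open>(x, x)\<close>, the difference of y and the image of \<open>?x\<close> is the boundary
      of z, whose component at \<open>(c, c)\<close> is up to sign that of y at \<open>(x, c)\<close>.\<close>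
    define w where "w c = sign C (n - 1) (co X n x c y)" for c
    have w: "w c \<in> hom C A (ob X (n - 1) c)" if "(x, c) \<in> r" "x \<noteq> c" for c
      using co_hom[OF X that y] by (simp add: w_def hom_def C.sign_simps C.Neg_Arr)
    have "\<exists>\<alpha>. \<alpha> \<in> hom C A (F.so X (n - 1 - eps c) c) \<and> (c \<noteq> x \<longrightarrow> Comp C (F.pr X (n - 1 - eps c) c c) \<alpha> = w c) \<and>
        (c = x \<longrightarrow> \<alpha> = Zero C A (F.so X (n - 1 - eps c) c))" if c: "c \<in> up x" for c
    proof (cases "c = x")
      case True
      then show ?thesis using C.Zero_hom[OF A F.so_Obj[OF X x]] by auto
    next
      case False
      have cP: "c \<in> P" using up_P[OF c] by simp
      have "w c \<in> hom C A (ob X (F.dg (n - 1 - eps c) c) c)" using w[of c] c False by (simp add: dg up_def)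
      then show ?thesis using F.inj_component[OF X cP up_self[OF cP]] False by metis
    qed
    then obtain \<alpha> where \<alpha>: "\<And>c. c \<in> up x \<Longrightarrow> \<alpha> c \<in> hom C A (F.so X (n - 1 - eps c) c)"
      "\<And>c. c \<in> up x \<Longrightarrow> c \<noteq> x \<Longrightarrow> Comp C (F.pr X (n - 1 - eps c) c c) (\<alpha> c) = w c"
      "\<alpha> x = Zero C A (F.so X (n - 1 - eps x) x)"
      using up_self[OF x] by metis
    have \<alpha>': "\<alpha> c \<in> hom C A (ob (F.Tot X) (G.dg (n - 1) c) c)" if "c \<in> up x" for c
      using \<alpha>(1)[OF that] up_P[OF that] by (simp add: F.Tot_sel dg)
    define z where "z = tuple C (up x) (G.V (F.Tot X) (n - 1)) A \<alpha>"
    have z: "z \<in> hom C A (G.so (F.Tot X) (n - 1) x)"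
      "\<And>c. c \<in> up x \<Longrightarrow> Comp C (G.pr (F.Tot X) (n - 1) x c) z = \<alpha> c"
      unfolding z_def by (rule G.tuple_so[OF FX[OF X] x A \<alpha>']; assumption)+
    have ccz: "cc X (n - 1) x c z = (if c = x then Zero C A (ob X (n - 1) x) else w c)" if c: "c \<in> up x" for c
      using z(2)[OF c] \<alpha>(2)[OF c] \<alpha>(3) F.pr_hom[OF X x up_self[OF x], of "n - 1 - eps x"] A F.so_Obj[OF X x]
      by (auto simp: cc_def hom_def C.add_simps dg)
    have coz: "co X (n - 1) x c z = Zero C A (ob X (n - 1 - 1) c)" if c: "(x, c) \<in> r" "x \<noteq> c" for c
      using z(2)[OF up_self[OF x]] \<alpha>(3) F.pr_hom[OF X x, of c "n - 1 - 1"] A F.so_Obj[OF X x] c eps_less[OF c]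
      by (auto simp: co_def hom_def C.add_simps dg up_def)
    note Dz = C.Comp_hom[OF z(1) G.D_hom[OF FX[OF X] x], simplified]
    note ux = unit_at_row(1)[OF x xh]
    have Dz_cc: "cc X n x c (Comp C (G.D (F.Tot X) (n - 1) x) z) =
        (if c = x then Zero C A (ob X n x) else Comp C (df X (n - 1) c) (w c))" if c: "c \<in> up x" for c
      using cc_D[OF X x c z(1)] ccz[OF c] F.S.df_hom[OF X x, of "n - 1"] A
      by (auto simp: hom_def C.add_simps)
    have Dz_co: "co X n x c (Comp C (G.D (F.Tot X) (n - 1) x) z) = co X n x c y" if c: "(x, c) \<in> r" "x \<noteq> c" for c
    proof -
      have cP: "c \<in> P" and cU: "c \<in> up x" using r_P[OF c(1)] c by (auto simp: up_def)
      show ?thesis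
        using co_D[OF X c z(1)] ccz[OF up_self[OF x]] ccz[OF cU] coz[OF c] c w[OF c] co_hom[OF X c y]
          F.S.mp_hom[OF X c(1), of "n - 1"] F.S.df_hom[OF X cP, of "n - 1 - 1"] A F.S.ob_Obj[OF X cP]
        by (simp add: hom_def C.add_simps C.sign_simps w_def)
    qed
    have "y = Add C (Comp C (unit_at X n x) ?x) (Comp C (G.D (F.Tot X) (n - 1) x) z)"
    proof (rule unit_eqI[OF X x y C.Add_hom[OF ux Dz]])
      fix c assume c: "c \<in> up x"
      then have xc: "(x, c) \<in> r" by (simp add: up_def)
      then have cP: "c \<in> P" using r_P by blast
      have "cc X n x c (Add C (Comp C (unit_at X n x) ?x) (Comp C (G.D (F.Tot X) (n - 1) x) z)) =
          Add C (Comp C (mp X n x c) ?x) (if c = x then Zero C A (ob X n x) else Comp C (df X (n - 1) c) (w c))"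
        unfolding cc_co_Add(1)[OF x ux Dz c] unit_at_row(2)[OF x xh c] Dz_cc[OF c] ..
      also have "\<dots> = cc X n x c y"
      proof (cases "c = x")
        case True
        then show ?thesis using xx xh by (simp add: hom_def C.Add_0)
      next
        case False
        then have xc': "x \<noteq> c" by simp
        note co = co_hom[OF X xc xc' y]
        note hs = cc_hom[OF X x c y, unfolded hom_def mem_Collect_eq] co[unfolded hom_def mem_Collect_eq]
          C.Comp_hom[OF xh F.S.mp_hom[OF X xc], unfolded hom_def mem_Collect_eq]
          C.Comp_hom[OF co F.S.df_hom[OF X cP], unfolded hom_def mem_Collect_eq]
        have "co X (n + 1) x c (Comp C (G.D (F.Tot X) n x) y) = Zero C A (ob X n c)"
          using unit_at_row(3)[OF x t xc xc'] unfolding ty by simp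
        then have 0: "Add C (Comp C (df X (n - 1) c) (co X n x c y))
            (Add C (Neg C (sign C n (Comp C (mp X n x c) ?x))) (sign C n (cc X n x c y))) = Zero C A (ob X n c)"
          using co_D[OF X xc xc' y] by simp
        have "Neg C (sign C n (Add C (Comp C (df X (n - 1) c) (co X n x c y))
            (Add C (Neg C (sign C n (Comp C (mp X n x c) ?x))) (sign C n (cc X n x c y))))) = Zero C A (ob X n c)"
          unfolding 0 using A F.S.ob_Obj[OF X cP] by (simp add: C.sign_simps C.Neg_Zero)
        then have "Add C (Add C (Comp C (mp X n x c) ?x) (Comp C (df X (n - 1) c) (w c))) (Neg C (cc X n x c y)) =
            Zero C A (ob X n c)"
          using hs co F.S.df_hom[OF X cP, of "n - 1"]
          by (simp add: w_def hom_def C.add_simps C.sign_simps C.add_ac)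
        moreover have "Add C (Comp C (mp X n x c) ?x) (Comp C (df X (n - 1) c) (w c)) \<in> hom C A (ob X n c)"
          using hs C.Comp_hom[OF w[OF xc xc'] F.S.df_hom[OF X cP]] by (simp add: hom_def C.Add_Arr)
        ultimately have "Add C (Comp C (mp X n x c) ?x) (Comp C (df X (n - 1) c) (w c)) = cc X n x c y"
          using C.Sub_Zero[of _ "cc X n x c y" A "ob X n c"] hs by (simp add: hom_def)
        then show ?thesis using False by simp
      qed
      finally show "cc X n x c y = cc X n x c (Add C (Comp C (unit_at X n x) ?x) (Comp C (G.D (F.Tot X) (n - 1) x) z))" ..
    next
      fix c assume c: "(x, c) \<in> r" "x \<noteq> c"
      show "co X n x c y = co X n x c (Add C (Comp C (unit_at X n x) ?x) (Comp C (G.D (F.Tot X) (n - 1) x) z))"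
        unfolding cc_co_Add(2)[OF x ux Dz c] unit_at_row(3)[OF x xh c] Dz_co[OF c]
        using co_hom[OF X c y] by (simp add: hom_def C.Add_0)
    qed
    then show "\<exists>A' e x' y'. is_epi C e \<and> e \<in> hom C A' A \<and> x' \<in> hom C A' (ob X n x) \<and>
        y' \<in> hom C A' (G.so (F.Tot X) (n - 1) x) \<and> Comp C (df X n x) x' = Comp C t e \<and>
        Comp C y e = Add C (Comp C (unit_at X n x) x') (Comp C (G.D (F.Tot X) (n - 1) x) y')"
      using C.epi_Idn[OF A] C.Idn_hom[OF A] xh z(1) dx C.Comp_Idn_right[OF t] C.Comp_Idn_right[OF y] by metis
  qed
qed

end

lemma unit_map_natural:
  "is_nat_trans F.S.K F.S.K id_functor (comp_functor (G.Tot, G.Totm) (F.Tot, F.Totm)) unit_map"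
  unfolding is_nat_trans_def
proof (intro conjI ballI)
  interpret SK: category F.S.K by (rule F.S.FC.category_complexes)
  fix X assume X: "X \<in> Obj F.S.K"
  show "unit_map X \<in> hom F.S.K (fst id_functor X) (fst (comp_functor (G.Tot, G.Totm) (F.Tot, F.Totm)) X)"
    using unit_map_hom[OF X] by (simp add: id_functor_def comp_functor_def)
next
  interpret SK: category F.S.K by (rule F.S.FC.category_complexes)
  fix f assume "f \<in> Arr F.S.K"
  define X Y where "X = Dom F.S.K f" and "Y = Cod F.S.K f"
  have f: "f \<in> hom F.S.K X Y" using \<open>f \<in> Arr F.S.K\<close> by (simp add: hom_def X_def Y_def)
  note X = F.S.f_Obj(1)[OF f] and Y = F.S.f_Obj(2)[OF f]
  note Ff = F.Totm_hom[OF f]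
  note GFf = G.Totm_hom[OF Ff]
  have "Comp F.S.K (unit_map Y) f = Comp F.S.K (G.Totm (F.Totm f)) (unit_map X)"
  proof (rule F.S.diagram_map_eqI[OF SK.Comp_hom[OF f unit_map_hom[OF Y]] SK.Comp_hom[OF unit_map_hom[OF X] GFf]])
    fix n x assume x: "x \<in> P"
    note hf = F.S.cm_hom[OF f x, of n] and hX = unit_at_tuple(1)[OF X x, of n] and hY = unit_at_tuple(1)[OF Y x, of n]
    have hG: "cm (G.Totm (F.Totm f)) n x \<in> hom C (G.so (F.Tot X) n x) (G.so (F.Tot Y) n x)"
      using F.S.cm_hom[OF GFf x, of n] by (simp add: G.Tot_sel x)
    show "cm (Comp F.S.K (unit_map Y) f) n x = cm (Comp F.S.K (G.Totm (F.Totm f)) (unit_map X)) n x"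
      unfolding F.S.cm_Comp[OF x] cm_unit_map[OF X x] cm_unit_map[OF Y x]
    proof (rule C.eq_by_elements[OF C.Comp_hom[OF hf hY] C.Comp_hom[OF hX hG]])
      fix t assume t: "t \<in> hom C (ob X n x) (ob X n x)"
      note ft = C.Comp_hom[OF t hf] and ut = unit_at_row(1)[OF X x t]
      have GF_row: "Comp C (F.pr Y (n - eps c) c e) (Comp C (G.pr (F.Tot Y) n x c) (Comp C (cm (G.Totm (F.Totm f)) n x) u)) =
          Comp C (cm f (n - eps c + eps e) e) (Comp C (F.pr X (n - eps c) c e) (Comp C (G.pr (F.Tot X) n x c) u))"
        if u: "u \<in> hom C A (G.so (F.Tot X) n x)" and c: "c \<in> up x" and e: "e \<in> up c" for u A c e
      proof -
        have cP: "c \<in> P" using up_P[OF c] by simp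
        show ?thesis
          using G.pr_cm_Totm[OF Ff x u c] F.pr_cm_Totm[OF f cP G_pr_hom[OF X x c u] e] by (simp add: dg)
      qed
      have "Comp C (unit_at Y n x) (Comp C (cm f n x) t) = Comp C (cm (G.Totm (F.Totm f)) n x) (Comp C (unit_at X n x) t)"
      proof (rule unit_eqI[OF Y x unit_at_row(1)[OF Y x ft] C.Comp_hom[OF ut hG]])
        fix c assume c: "c \<in> up x"
        then have xc: "(x, c) \<in> r" by (simp add: up_def)
        then have cP: "c \<in> P" using r_P by blast
        have "cc Y n x c (Comp C (cm (G.Totm (F.Totm f)) n x) (Comp C (unit_at X n x) t)) =
            Comp C (cm f n c) (Comp C (mp X n x c) t)"
          using GF_row[OF ut c up_self[OF cP]] unit_at_row(2)[OF X x t c] by (simp add: cc_def)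
        then show "cc Y n x c (Comp C (unit_at Y n x) (Comp C (cm f n x) t)) =
            cc Y n x c (Comp C (cm (G.Totm (F.Totm f)) n x) (Comp C (unit_at X n x) t))"
          using unit_at_row(2)[OF Y x ft c] C.Comp_assoc[OF t hf F.S.mp_hom[OF Y xc]] F.S.cm_mp[OF f xc, of n]
            C.Comp_assoc[OF t F.S.mp_hom[OF X xc] F.S.cm_hom[OF f cP]] by simp
      next
        fix e assume e: "(x, e) \<in> r" "x \<noteq> e"
        then have eP: "e \<in> P" and eU: "e \<in> up x" using r_P by (auto simp: up_def)
        have "co Y n x e (Comp C (cm (G.Totm (F.Totm f)) n x) (Comp C (unit_at X n x) t)) =
            Comp C (cm f (n - 1) e) (co X n x e (Comp C (unit_at X n x) t))"
          using GF_row[OF ut up_self[OF x] eU] eps_less[OF e] by (simp add: co_def)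
        then show "co Y n x e (Comp C (unit_at Y n x) (Comp C (cm f n x) t)) =
            co Y n x e (Comp C (cm (G.Totm (F.Totm f)) n x) (Comp C (unit_at X n x) t))"
          using unit_at_row(3)[OF X x t e] unit_at_row(3)[OF Y x ft e] F.S.cm_hom[OF f eP, of "n - 1"] F.S.ob_Obj[OF X x]
          by (simp add: hom_def C.add_simps)
      qed
      then show "Comp C (Comp C (unit_at Y n x) (cm f n x)) t = Comp C (Comp C (cm (G.Totm (F.Totm f)) n x) (unit_at X n x)) t"
        using C.Comp_assoc[OF t hf hY] C.Comp_assoc[OF t hX hG] by simp
    qed
  qed
  then show "Comp F.S.K (unit_map (Cod F.S.K f)) (snd id_functor f) =
      Comp F.S.K (snd (comp_functor (G.Tot, G.Totm) (F.Tot, F.Totm)) f) (unit_map (Dom F.S.K f))"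
    by (simp add: id_functor_def comp_functor_def X_def Y_def)
qed

subsection \<open>The counit\<close>

definition bsum where
  "bsum Y n x A p = arrow_sum C A (ob Y n x)
    (\<lambda>b. if (x, b) \<in> r \<and> x \<noteq> b then Comp C (mp Y n b x) (p b) else Zero C A (ob Y n x)) P"

text \<open>As for the unit, the value of \<open>F (G Y)\<close> at \<open>x\<close> is a product over the pairs \<open>x \<le> c \<le> e\<close>. The
  components of an element are \<open>dd\<close> for \<open>e = c\<close>, in \<open>Y\<^sub>c\<close> and degree \<open>n\<close>, and \<open>dv\<close> for \<open>x = c < e\<close>, in
  \<open>Y\<^sub>e\<close> and degree \<open>n + 1\<close>.\<close>

definition dd where
  "dd Y n x c w = Comp C (G.pr Y (n + eps c) c c) (Comp C (F.pr (G.Tot Y) n x c) w)"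

definition dv where
  "dv Y n x e w = Comp C (G.pr Y (n + 1) x e) (Comp C (F.pr (G.Tot Y) n x x) w)"

text \<open>The counit adds up the images in \<open>Y\<^sub>x\<close> of all components \<open>dd\<close> and forgets the components \<open>dv\<close>.
  It is obtained as an arrow by evaluating at the identity, the generic element.\<close>

definition counit_at where
  "counit_at Y n x = Add C (dd Y n x x (Idn C (F.so (G.Tot Y) n x)))
    (bsum Y n x (F.so (G.Tot Y) n x) (\<lambda>b. dd Y n x b (Idn C (F.so (G.Tot Y) n x))))"

definition counit_map where "counit_map Y = mk_map P (F.Tot (G.Tot Y)) Y (counit_at Y)"

context
  fixes Y assumes Y: "Y \<in> Obj F.T.K"
begin

lemma GY: "G.Tot Y \<in> Obj F.S.K" by (rule G.Tot_Obj[OF Y])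

lemma bmp_hom: "(x, b) \<in> r \<Longrightarrow> mp Y n b x \<in> hom C (ob Y n b) (ob Y n x)"
  using F.T.mp_hom[OF Y, of b x n] by simp

lemma bsum_hom:
  assumes "x \<in> P" "A \<in> Obj C" "\<And>b. (x, b) \<in> r \<Longrightarrow> x \<noteq> b \<Longrightarrow> p b \<in> hom C A (ob Y n b)"
  shows "bsum Y n x A p \<in> hom C A (ob Y n x)"
  unfolding bsum_def
  by (rule C.arrow_sum_hom[OF finite_P assms(2) F.T.ob_Obj[OF Y assms(1)]])
    (use assms F.T.ob_Obj[OF Y assms(1)] C.Zero_hom C.Comp_hom[OF _ bmp_hom] in auto)

lemma bsum_cong:
  assumes "\<And>b. (x, b) \<in> r \<Longrightarrow> x \<noteq> b \<Longrightarrow> p b = q b"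
  shows "bsum Y n x A p = bsum Y n x A q"
  unfolding bsum_def by (rule C.arrow_sum_cong[OF finite_P]) (use assms in auto)

lemma bsum_Zero:
  assumes "x \<in> P" "A \<in> Obj C" "\<And>b. (x, b) \<in> r \<Longrightarrow> x \<noteq> b \<Longrightarrow> p b = Zero C A (ob Y n b)"
  shows "bsum Y n x A p = Zero C A (ob Y n x)"
  unfolding bsum_def
  by (rule C.arrow_sum_Zero[OF finite_P assms(2) F.T.ob_Obj[OF Y assms(1)]])
    (use assms bmp_hom[of x _ n] in \<open>auto simp: hom_def C.add_simps\<close>)

lemma bsum_comp:
  assumes x: "x \<in> P" and p: "\<And>b. (x, b) \<in> r \<Longrightarrow> x \<noteq> b \<Longrightarrow> p b \<in> hom C A (ob Y n b)" and h: "h \<in> hom C B A"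
  shows "Comp C (bsum Y n x A p) h = bsum Y n x B (\<lambda>b. Comp C (p b) h)"
proof -
  have A: "A \<in> Obj C" using C.hom_Obj[OF h] by simp
  have "Comp C (bsum Y n x A p) h = arrow_sum C B (ob Y n x)
      (\<lambda>b. Comp C (if (x, b) \<in> r \<and> x \<noteq> b then Comp C (mp Y n b x) (p b) else Zero C A (ob Y n x)) h) P"
    unfolding bsum_def
    by (rule C.arrow_sum_Comp_right[OF finite_P F.T.ob_Obj[OF Y x] h])
      (use p F.T.ob_Obj[OF Y x] A C.Zero_hom C.Comp_hom[OF _ bmp_hom] in auto)
  also have "\<dots> = bsum Y n x B (\<lambda>b. Comp C (p b) h)"
    unfolding bsum_def
    by (rule C.arrow_sum_cong[OF finite_P])
      (use C.Comp_assoc[OF h p bmp_hom] h F.T.ob_Obj[OF Y x] in \<open>auto simp: hom_def C.add_simps\<close>)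
  finally show ?thesis .
qed

lemma bsum_Add:
  assumes "x \<in> P" "A \<in> Obj C" "\<And>b. (x, b) \<in> r \<Longrightarrow> x \<noteq> b \<Longrightarrow> p b \<in> hom C A (ob Y n b)"
    "\<And>b. (x, b) \<in> r \<Longrightarrow> x \<noteq> b \<Longrightarrow> q b \<in> hom C A (ob Y n b)"
  shows "bsum Y n x A (\<lambda>b. Add C (p b) (q b)) = Add C (bsum Y n x A p) (bsum Y n x A q)"
proof -
  have "Add C (bsum Y n x A p) (bsum Y n x A q) = arrow_sum C A (ob Y n x)
    (\<lambda>b. Add C (if (x, b) \<in> r \<and> x \<noteq> b then Comp C (mp Y n b x) (p b) else Zero C A (ob Y n x))
      (if (x, b) \<in> r \<and> x \<noteq> b then Comp C (mp Y n b x) (q b) else Zero C A (ob Y n x))) P"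
    unfolding bsum_def
    by (rule C.arrow_sum_Add[OF finite_P assms(2) F.T.ob_Obj[OF Y assms(1)], symmetric])
      (use assms F.T.ob_Obj[OF Y assms(1)] C.Zero_hom C.Comp_hom[OF _ bmp_hom] in auto)
  also have "\<dots> = bsum Y n x A (\<lambda>b. Add C (p b) (q b))"
    unfolding bsum_def
    by (rule C.arrow_sum_cong[OF finite_P])
      (use assms F.T.ob_Obj[OF Y assms(1)] C.Comp_Add_left[OF assms(3,4) bmp_hom] C.Zero_Arr C.Add_0 in auto)
  finally show ?thesis ..
qed

lemma bsum_sign:
  assumes "x \<in> P" "A \<in> Obj C" "\<And>b. (x, b) \<in> r \<Longrightarrow> x \<noteq> b \<Longrightarrow> p b \<in> hom C A (ob Y n b)"
  shows "bsum Y n x A (\<lambda>b. sign C k (p b)) = sign C k (bsum Y n x A p)"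
proof -
  have "sign C k (bsum Y n x A p) = arrow_sum C A (ob Y n x)
    (\<lambda>b. sign C k (if (x, b) \<in> r \<and> x \<noteq> b then Comp C (mp Y n b x) (p b) else Zero C A (ob Y n x))) P"
    unfolding bsum_def
    by (rule C.arrow_sum_sign[OF finite_P assms(2) F.T.ob_Obj[OF Y assms(1)]])
      (use assms F.T.ob_Obj[OF Y assms(1)] C.Zero_hom C.Comp_hom[OF _ bmp_hom] in auto)
  also have "\<dots> = bsum Y n x A (\<lambda>b. sign C k (p b))"
    unfolding bsum_def
    by (rule C.arrow_sum_cong[OF finite_P])
      (use assms(2) assms(3) bmp_hom F.T.ob_Obj[OF Y assms(1)] in \<open>auto simp: hom_def C.sign_simps\<close>)
  finally show ?thesis ..
qed

lemma bsum_map: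
  assumes x: "x \<in> P" and A: "A \<in> Obj C" and p: "\<And>b. (x, b) \<in> r \<Longrightarrow> x \<noteq> b \<Longrightarrow> p b \<in> hom C A (ob Y n b)"
    and h: "\<And>b. b \<in> P \<Longrightarrow> h b \<in> hom C (ob Y n b) (ob Z m b)" and Z: "Z \<in> Obj F.T.K"
    and nat: "\<And>b. (x, b) \<in> r \<Longrightarrow> Comp C (h x) (mp Y n b x) = Comp C (mp Z m b x) (h b)"
  shows "Comp C (h x) (bsum Y n x A p) = bsum Z m x A (\<lambda>b. Comp C (h b) (p b))"
proof -
  have "Comp C (h x) (bsum Y n x A p) = arrow_sum C A (ob Z m x)
    (\<lambda>b. Comp C (h x) (if (x, b) \<in> r \<and> x \<noteq> b then Comp C (mp Y n b x) (p b) else Zero C A (ob Y n x))) P"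
    unfolding bsum_def
    by (rule C.arrow_sum_Comp_left[OF finite_P A h[OF x]])
      (use p F.T.ob_Obj[OF Y x] A C.Zero_hom C.Comp_hom[OF _ bmp_hom] in auto)
  also have "\<dots> = bsum Z m x A (\<lambda>b. Comp C (h b) (p b))"
    unfolding bsum_def
  proof (rule C.arrow_sum_cong[OF finite_P])
    fix b
    have "Comp C (h x) (Comp C (mp Y n b x) (p b)) = Comp C (mp Z m b x) (Comp C (h b) (p b))"
      if b: "(x, b) \<in> r" "x \<noteq> b"
    proof -
      have m: "mp Z m b x \<in> hom C (ob Z m b) (ob Z m x)" using F.T.mp_hom[OF Z, of b x m] b by simp
      have bP: "b \<in> P" using r_P b by blast
      show ?thesis
        using C.Comp_assoc[OF p[OF b] bmp_hom[OF b(1)] h[OF x]] nat[OF b(1)] C.Comp_assoc[OF p[OF b] h[OF bP] m] by simp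
    qed
    then show "Comp C (h x) (if (x, b) \<in> r \<and> x \<noteq> b then Comp C (mp Y n b x) (p b) else Zero C A (ob Y n x)) =
        (if (x, b) \<in> r \<and> x \<noteq> b then Comp C (mp Z m b x) (Comp C (h b) (p b)) else Zero C A (ob Z m x))"
      using h[OF x] A by (auto simp: hom_def C.add_simps)
  qed
  finally show ?thesis .
qed

lemma F_pr_hom:
  assumes "x \<in> P" "c \<in> up x" "w \<in> hom C A (F.so (G.Tot Y) n x)"
  shows "Comp C (F.pr (G.Tot Y) n x c) w \<in> hom C A (G.so Y (n + eps c) c)"
  using F.pr_comp_hom[OF GY assms] up_P[OF assms(2)] by (simp add: G.Tot_sel dg)

lemma dd_hom:
  assumes "x \<in> P" "c \<in> up x" "w \<in> hom C A (F.so (G.Tot Y) n x)"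
  shows "dd Y n x c w \<in> hom C A (ob Y n c)"
  using G.pr_comp_hom[OF Y _ up_self F_pr_hom[OF assms]] up_P[OF assms(2)] by (simp add: dd_def dg)

lemma dv_hom:
  assumes "(x, e) \<in> r" "x \<noteq> e" "w \<in> hom C A (F.so (G.Tot Y) n x)"
  shows "dv Y n x e w \<in> hom C A (ob Y (n + 1) e)"
  using G.pr_comp_hom[OF Y _ _ F_pr_hom[OF _ up_self assms(3)], of e] r_P[OF assms(1)] assms(1,2)
    eps_less[OF assms(1,2)] by (simp add: dv_def dg up_def)

lemma counit_eqI:
  assumes x: "x \<in> P" and u: "u \<in> hom C A (F.so (G.Tot Y) n x)" and v: "v \<in> hom C A (F.so (G.Tot Y) n x)"
    and dd: "\<And>c. c \<in> up x \<Longrightarrow> dd Y n x c u = dd Y n x c v"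
    and dv: "\<And>e. (x, e) \<in> r \<Longrightarrow> x \<noteq> e \<Longrightarrow> dv Y n x e u = dv Y n x e v"
  shows "u = v"
proof (rule F.elem_eqI[OF GY x u v])
  fix c assume c: "c \<in> up x"
  then have cP: "c \<in> P" using up_P by blast
  show "Comp C (F.pr (G.Tot Y) n x c) u = Comp C (F.pr (G.Tot Y) n x c) v"
  proof (rule G.elem_eqI[OF Y cP F_pr_hom[OF x c u] F_pr_hom[OF x c v]])
    fix e assume e: "e \<in> up c"
    show "Comp C (G.pr Y (n + eps c) c e) (Comp C (F.pr (G.Tot Y) n x c) u) =
        Comp C (G.pr Y (n + eps c) c e) (Comp C (F.pr (G.Tot Y) n x c) v)"
    proof (cases "e = c")
      case True
      then show ?thesis using dd[OF c] by (simp add: dd_def)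
    next
      case False
      then have "c = x" using up_top[OF c] e by auto
      then show ?thesis using dv[of e] e False eps_less[of x e] by (auto simp: dv_def up_def)
    qed
  qed
qed

text \<open>Besides the diagonal entries, the differential of \<open>F (G Y)\<close> maps the factor of \<open>(x, e)\<close>, with
  \<open>x < e\<close>, to that of \<open>(x, x)\<close>, by a structure map of \<open>Y\<close> (\<open>G_off_row2\<close>), and identically up to sign to
  that of \<open>(e, e)\<close>, by a transition map of \<open>G Y\<close> (\<open>F_off_row2\<close>).\<close>

lemma G_off_row2:
  assumes c: "c \<in> P" and e: "e \<in> up c" and A: "A \<in> Obj C"
  shows "G.off Y m c e A p = (if e = c then bsum Y (m + 1 - eps c) c A p else Zero C A (ob Y (m + 1 - eps e) e))"
proof (cases "e = c")
  case True
  have m: "G.dg m c + 1 = m + 1 - eps c" by (simp add: dg)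
  show ?thesis
    unfolding G.off_def bsum_def True m
    by (simp, rule C.arrow_sum_cong[OF finite_P]) (auto simp: up_def)
next
  case False
  have eP: "e \<in> P" using up_P[OF e] by simp
  have "G.off Y m c e A p = Zero C A (ob Y (G.dg m e + 1) e)"
    by (rule G.off_Zero[OF Y eP A]) (use False e r_height[of c e] in \<open>auto simp: up_def\<close>)
  moreover have "G.dg m e + 1 = m + 1 - eps e" by (simp add: dg)
  ultimately show ?thesis using False by simp
qed

lemma F_off_row2:
  assumes x: "x \<in> P" and c: "c \<in> up x" and A: "A \<in> Obj C"
    and p: "\<And>b. b \<in> up x \<Longrightarrow> p b \<in> hom C A (G.so Y (n + eps b) b)"
  shows "F.off (G.Tot Y) n x c A p = (if c = x then Zero C A (G.so Y (n + eps c + 1) c)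
    else Comp C (G.tm Y (n + 1) x c) (p x))"
proof -
  have cP: "c \<in> P" using up_P[OF c] by simp
  have ob: "ob (G.Tot Y) (F.dg n c + 1) c = G.so Y (n + eps c + 1) c" by (simp add: G.Tot_sel cP dg)
  show ?thesis
  proof (cases "c = x")
    case True
    then show ?thesis
      using F.off_Zero[OF GY cP A, of x p n] ob r_antisym by (auto simp: up_def)
  next
    case False
    then have xc: "(x, c) \<in> r" "x \<noteq> c" using c by (auto simp: up_def)
    note d = eps_less[OF xc]
    have px: "p x \<in> hom C A (G.so Y (n + 1) x)" using p[OF up_self[OF x]] d by simp
    have h: "Comp C (G.tm Y (n + 1) x c) (p x) \<in> hom C A (G.so Y (n + 1) c)"
      using C.Comp_hom[OF px G.pr_tm(1)[OF Y x cP px]] .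
    have "b = x" if "b \<in> up x" "(b, c) \<in> r" "b \<noteq> c" for b
      using that r_height[of x b c] by (auto simp: up_def)
    then show ?thesis
      unfolding F.off_def ob using d False h xc up_self[OF x]
      by (subst C.arrow_sum_single[OF finite_P A G.so_Obj[OF Y cP] x]) (auto simp: G.Tot_sel dg)
  qed
qed

lemma dd_D:
  assumes x: "x \<in> P" and w: "w \<in> hom C A (F.so (G.Tot Y) n x)" and c: "c \<in> up x"
  shows "dd Y (n + 1) x c (Comp C (F.D (G.Tot Y) n x) w) = Add C (Comp C (df Y n c) (dd Y n x c w))
    (if c = x then Neg C (sign C n (bsum Y (n + 1) x A (\<lambda>b. dv Y n x b w))) else sign C n (dv Y n x c w))"
proof -
  have A: "A \<in> Obj C" using C.hom_Obj[OF w] by simp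
  have cP: "c \<in> P" using up_P[OF c] by simp
  let ?p = "\<lambda>b. Comp C (F.pr (G.Tot Y) n x b) w"
  note p = F_pr_hom[OF x _ w]
  let ?m = "n + eps c" and ?o = "F.off (G.Tot Y) n x c A ?p"
  have Dp: "Comp C (G.D Y ?m c) (?p c) \<in> hom C A (G.so Y (?m + 1) c)"
    using C.Comp_hom[OF p[OF c] G.D_hom[OF Y cP]] .
  have o: "?o \<in> hom C A (G.so Y (?m + 1) c)"
    using F.off_hom[OF GY cP A F.pr_comp_hom[OF GY x _ w]] by (simp add: G.Tot_sel cP dg)
  have "Comp C (F.pr (G.Tot Y) (n + 1) x c) (Comp C (F.D (G.Tot Y) n x) w) =
      Add C (Comp C (G.D Y ?m c) (?p c)) (sign C n ?o)"
    using F.pr_D(2)[OF GY x w c] by (simp add: G.Tot_sel cP dg)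
  moreover have m: "n + 1 + eps c = ?m + 1" by simp
  ultimately have "dd Y (n + 1) x c (Comp C (F.D (G.Tot Y) n x) w) =
      Add C (Comp C (G.pr Y (?m + 1) c c) (Comp C (G.D Y ?m c) (?p c))) (sign C n (Comp C (G.pr Y (?m + 1) c c) ?o))"
    unfolding dd_def m using G.pr_hom[OF Y cP up_self[OF cP], of "?m + 1"] Dp o
    by (simp add: hom_def C.add_simps C.sign_simps)
  also have "Comp C (G.pr Y (?m + 1) c c) (Comp C (G.D Y ?m c) (?p c)) = Add C (Comp C (df Y n c) (dd Y n x c w))
      (sign C ?m (bsum Y (n + 1) c A (\<lambda>b. Comp C (G.pr Y ?m c b) (?p c))))"
    using G.pr_D(2)[OF Y cP p[OF c] up_self[OF cP]] G_off_row2[OF cP up_self[OF cP] A, of ?m]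
    by (simp add: dg dd_def)
  finally have eq: "dd Y (n + 1) x c (Comp C (F.D (G.Tot Y) n x) w) =
      Add C (Add C (Comp C (df Y n c) (dd Y n x c w))
        (sign C ?m (bsum Y (n + 1) c A (\<lambda>b. Comp C (G.pr Y ?m c b) (?p c)))))
      (sign C n (Comp C (G.pr Y (?m + 1) c c) ?o))" .
  note h = C.Comp_hom[OF dd_hom[OF x c w] F.T.df_hom[OF Y cP]]
  show ?thesis
  proof (cases "c = x")
    case True
    have "sign C ?m (bsum Y (n + 1) c A (\<lambda>b. Comp C (G.pr Y ?m c b) (?p c))) =
        Neg C (sign C n (bsum Y (n + 1) x A (\<lambda>b. dv Y n x b w)))"
    proof (cases "\<exists>b. (x, b) \<in> r \<and> x \<noteq> b")
      case ex: True
      then have e1: "eps x = 1" using eps_less by blast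
      have "bsum Y (n + 1) x A (\<lambda>b. dv Y n x b w) \<in> hom C A (ob Y (n + 1) x)"
        by (rule bsum_hom[OF x A]) (use dv_hom[OF _ _ w] in auto)
      then show ?thesis using True e1 by (simp add: dv_def hom_def C.sign_simps)
    next
      case False
      have "bsum Y (n + 1) x A q = Zero C A (ob Y (n + 1) x)" for q
        by (rule bsum_Zero[OF x A]) (use False in auto)
      then show ?thesis using True A F.T.ob_Obj[OF Y x] by (simp add: C.sign_simps C.Neg_Zero)
    qed
    moreover have "Comp C (G.pr Y (?m + 1) c c) ?o = Zero C A (ob Y (n + 1) c)"
      using F_off_row2[OF x c A p] True G.pr_hom[OF Y cP up_self[OF cP], of "?m + 1"] A G.so_Obj[OF Y cP]
      by (simp add: hom_def C.add_simps dg)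
    moreover have "bsum Y (n + 1) x A (\<lambda>b. dv Y n x b w) \<in> hom C A (ob Y (n + 1) x)"
      by (rule bsum_hom[OF x A]) (use dv_hom[OF _ _ w] in auto)
    ultimately show ?thesis unfolding eq using True h A F.T.ob_Obj[OF Y cP]
      by (simp add: hom_def C.Add_0 C.Add_Arr C.Neg_Arr C.sign_simps)
  next
    case False
    then have xc: "(x, c) \<in> r" "x \<noteq> c" using c by (auto simp: up_def)
    note d = eps_less[OF xc]
    have "bsum Y (n + 1) c A q = Zero C A (ob Y (n + 1) c)" for q
      by (rule bsum_Zero[OF cP A]) (use xc r_height[OF xc(1)] in auto)
    moreover have "?p x \<in> hom C A (G.so Y (n + 1) x)" using p[OF up_self[OF x]] d by simp
    then have "Comp C (G.pr Y (?m + 1) c c) ?o = dv Y n x c w"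
      using F_off_row2[OF x c A p] False d G.pr_tm(2)[OF Y x cP _ up_self[OF cP]] c by (simp add: dv_def)
    ultimately show ?thesis unfolding eq using False h A F.T.ob_Obj[OF Y cP]
      by (simp add: hom_def C.Add_0 C.sign_simps)
  qed
qed

lemma dv_D:
  assumes xe: "(x, e) \<in> r" "x \<noteq> e" and w: "w \<in> hom C A (F.so (G.Tot Y) n x)"
  shows "dv Y (n + 1) x e (Comp C (F.D (G.Tot Y) n x) w) = Comp C (df Y (n + 1) e) (dv Y n x e w)"
proof -
  have A: "A \<in> Obj C" using C.hom_Obj[OF w] by simp
  have x: "x \<in> P" and eP: "e \<in> P" using r_P[OF xe(1)] by auto
  have e: "e \<in> up x" using xe by (simp add: up_def)
  note d = eps_less[OF xe]
  let ?p = "\<lambda>b. Comp C (F.pr (G.Tot Y) n x b) w"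
  note p = F_pr_hom[OF x _ w]
  have px: "?p x \<in> hom C A (G.so Y (n + 1) x)" using p[OF up_self[OF x]] d by simp
  have Dp: "Comp C (G.D Y (n + 1) x) (?p x) \<in> hom C A (G.so Y (n + 1 + 1) x)"
    using C.Comp_hom[OF px G.D_hom[OF Y x]] .
  have "Comp C (F.pr (G.Tot Y) (n + 1) x x) (Comp C (F.D (G.Tot Y) n x) w) =
      Add C (Comp C (G.D Y (n + 1) x) (?p x)) (sign C n (Zero C A (G.so Y (n + 1 + 1) x)))"
    using F.pr_D(2)[OF GY x w up_self[OF x]] F_off_row2[OF x up_self[OF x] A p] d by (simp add: G.Tot_sel x dg)
  also have "\<dots> = Comp C (G.D Y (n + 1) x) (?p x)"
    using Dp A G.so_Obj[OF Y x] by (simp add: hom_def C.Add_0 C.sign_simps)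
  finally have "dv Y (n + 1) x e (Comp C (F.D (G.Tot Y) n x) w) =
      Comp C (G.pr Y (n + 1 + 1) x e) (Comp C (G.D Y (n + 1) x) (?p x))" by (simp add: dv_def)
  also have "\<dots> = Add C (Comp C (df Y (n + 1) e) (dv Y n x e w)) (sign C (n + 1) (Zero C A (ob Y (n + 1 + 1) e)))"
    using G.pr_D(2)[OF Y x px e] G_off_row2[OF x e A, of "n + 1"] d xe by (simp add: dg dv_def)
  finally show ?thesis
    using C.Comp_hom[OF dv_hom[OF xe w] F.T.df_hom[OF Y eP]] A F.T.ob_Obj[OF Y eP]
    by (simp add: hom_def C.Add_0 C.sign_Zero)
qed

lemma dd_comp:
  assumes x: "x \<in> P" and c: "c \<in> up x" and w: "w \<in> hom C A (F.so (G.Tot Y) n x)" and t: "t \<in> hom C B A"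
  shows "Comp C (dd Y n x c w) t = dd Y n x c (Comp C w t)"
proof -
  have cP: "c \<in> P" using up_P[OF c] by simp
  have pF: "F.pr (G.Tot Y) n x c \<in> hom C (F.so (G.Tot Y) n x) (G.so Y (n + eps c) c)"
    using F.pr_hom[OF GY x c, of n] by (simp add: G.Tot_sel cP dg)
  show ?thesis unfolding dd_def
    using pF G.pr_hom[OF Y cP up_self[OF cP], of "n + eps c"] w t by (simp add: hom_def C.cat_simps)
qed

lemma counit_at_row:
  assumes x: "x \<in> P" and w: "w \<in> hom C A (F.so (G.Tot Y) n x)"
  shows "counit_at Y n x \<in> hom C (F.so (G.Tot Y) n x) (ob Y n x)"
    "Comp C (counit_at Y n x) w = Add C (dd Y n x x w) (bsum Y n x A (\<lambda>b. dd Y n x b w))"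
proof -
  let ?S = "F.so (G.Tot Y) n x"
  have S: "?S \<in> Obj C" by (rule F.so_Obj[OF GY x])
  have 1: "dd Y n x c (Idn C ?S) \<in> hom C ?S (ob Y n c)" if "c \<in> up x" for c
    by (rule dd_hom[OF x that C.Idn_hom[OF S]])
  have 2: "bsum Y n x ?S (\<lambda>b. dd Y n x b (Idn C ?S)) \<in> hom C ?S (ob Y n x)"
    by (rule bsum_hom[OF x S]) (use 1 in \<open>auto simp: up_def\<close>)
  show "counit_at Y n x \<in> hom C ?S (ob Y n x)"
    unfolding counit_at_def using C.Add_hom[OF 1[OF up_self[OF x]] 2] .
  have 3: "Comp C (dd Y n x c (Idn C ?S)) w = dd Y n x c w" if "c \<in> up x" for c
    using dd_comp[OF x that C.Idn_hom[OF S] w] C.Comp_Idn_left[OF w] by simp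
  have "Comp C (bsum Y n x ?S (\<lambda>b. dd Y n x b (Idn C ?S))) w =
      bsum Y n x A (\<lambda>b. Comp C (dd Y n x b (Idn C ?S)) w)"
    by (rule bsum_comp[OF x _ w]) (use 1 in \<open>auto simp: up_def\<close>)
  also have "\<dots> = bsum Y n x A (\<lambda>b. dd Y n x b w)"
    by (rule bsum_cong) (use 3 in \<open>auto simp: up_def\<close>)
  finally show "Comp C (counit_at Y n x) w = Add C (dd Y n x x w) (bsum Y n x A (\<lambda>b. dd Y n x b w))"
    unfolding counit_at_def using C.Comp_Add_right[OF 1[OF up_self[OF x]] 2 w] 3[OF up_self[OF x]] by simp
qed

text \<open>The contributions of the components \<open>dv\<close> cancel: each of them reaches \<open>Y\<^sub>x\<close> once through the
  factor of \<open>(x, x)\<close> and once, with the opposite sign, through the factor of \<open>(e, e)\<close>.\<close>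

lemma counit_at_D:
  assumes x: "x \<in> P" and w: "w \<in> hom C A (F.so (G.Tot Y) n x)"
  shows "Comp C (counit_at Y (n + 1) x) (Comp C (F.D (G.Tot Y) n x) w) = Comp C (df Y n x) (Comp C (counit_at Y n x) w)"
proof -
  have A: "A \<in> Obj C" using C.hom_Obj[OF w] by simp
  note Dw = C.Comp_hom[OF w F.D_hom[OF GY x]]
  let ?B = "bsum Y (n + 1) x A (\<lambda>b. dv Y n x b w)"
  have bU: "b \<in> up x" "b \<in> P" if "(x, b) \<in> r" for b using that r_P by (auto simp: up_def)
  have dd: "dd Y n x b w \<in> hom C A (ob Y n b)" and ddf: "Comp C (df Y n b) (dd Y n x b w) \<in> hom C A (ob Y (n + 1) b)"
    if "(x, b) \<in> r" for b
    using dd_hom[OF x bU(1)[OF that] w] C.Comp_hom[OF dd_hom[OF x bU(1)[OF that] w] F.T.df_hom[OF Y bU(2)[OF that]]] by auto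
  have B: "?B \<in> hom C A (ob Y (n + 1) x)" by (rule bsum_hom[OF x A]) (use dv_hom[OF _ _ w] in auto)
  have sB: "sign C n (dv Y n x b w) \<in> hom C A (ob Y (n + 1) b)" if "(x, b) \<in> r" "x \<noteq> b" for b
    using dv_hom[OF that w] by (simp add: hom_def C.sign_simps)
  have "bsum Y (n + 1) x A (\<lambda>b. dd Y (n + 1) x b (Comp C (F.D (G.Tot Y) n x) w)) =
      bsum Y (n + 1) x A (\<lambda>b. Add C (Comp C (df Y n b) (dd Y n x b w)) (sign C n (dv Y n x b w)))"
    by (rule bsum_cong) (use dd_D[OF x w bU(1)] in auto)
  also have "\<dots> = Add C (bsum Y (n + 1) x A (\<lambda>b. Comp C (df Y n b) (dd Y n x b w))) (bsum Y (n + 1) x A (\<lambda>b. sign C n (dv Y n x b w)))"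
    by (rule bsum_Add[OF x A ddf sB])
  also have "bsum Y (n + 1) x A (\<lambda>b. sign C n (dv Y n x b w)) = sign C n ?B"
    by (rule bsum_sign[OF x A]) (use dv_hom[OF _ _ w] in auto)
  also have "bsum Y (n + 1) x A (\<lambda>b. Comp C (df Y n b) (dd Y n x b w)) = Comp C (df Y n x) (bsum Y n x A (\<lambda>b. dd Y n x b w))"
    by (rule bsum_map[symmetric, OF x A dd F.T.df_hom[OF Y] Y]) (use F.T.mp_df[OF Y] in auto)
  finally have 1: "bsum Y (n + 1) x A (\<lambda>b. dd Y (n + 1) x b (Comp C (F.D (G.Tot Y) n x) w)) =
      Add C (Comp C (df Y n x) (bsum Y n x A (\<lambda>b. dd Y n x b w))) (sign C n ?B)" .
  have 2: "bsum Y n x A (\<lambda>b. dd Y n x b w) \<in> hom C A (ob Y n x)" by (rule bsum_hom[OF x A dd])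
  show ?thesis
    unfolding counit_at_row(2)[OF x Dw] counit_at_row(2)[OF x w] 1 dd_D[OF x w up_self[OF x]]
    using B 2 dd_hom[OF x up_self[OF x] w] F.T.df_hom[OF Y x, of n]
    by (simp add: hom_def C.Add_cancel_cross C.Comp_distrib C.cat_simps C.sign_simps)
qed

lemma counit_at_tm:
  assumes yx: "(y, x) \<in> r" and w: "w \<in> hom C A (F.so (G.Tot Y) n x)"
  shows "Comp C (counit_at Y n y) (Comp C (F.tm (G.Tot Y) n x y) w) = Comp C (mp Y n x y) (Comp C (counit_at Y n x) w)"
proof -
  have x: "x \<in> P" and y: "y \<in> P" using r_P[OF yx] by auto
  have A: "A \<in> Obj C" using C.hom_Obj[OF w] by simp
  note tm = F.pr_tm[OF GY x y w]
  note tw = C.Comp_hom[OF w tm(1)]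
  have row: "dd Y n y c (Comp C (F.tm (G.Tot Y) n x y) w) = (if c \<in> up x then dd Y n x c w else Zero C A (ob Y n c))"
    if c: "c \<in> up y" for c
    using tm(2)[OF c] up_P[OF c] G.pr_hom[OF Y _ up_self, of c "n + eps c"] A G.so_Obj[OF Y]
    by (auto simp: dd_def G.Tot_sel dg hom_def C.add_simps)
  show ?thesis
  proof (cases "x = y")
    case True
    have "bsum Y n y A (\<lambda>b. dd Y n y b (Comp C (F.tm (G.Tot Y) n x y) w)) = bsum Y n y A (\<lambda>b. dd Y n x b w)"
      by (rule bsum_cong) (use row True in \<open>auto simp: up_def\<close>)
    moreover have "Comp C (mp Y n x y) (Comp C (counit_at Y n x) w) = Comp C (counit_at Y n x) w"
      using F.T.mp_refl[OF Y x] True C.Comp_Idn_left[OF C.Comp_hom[OF w counit_at_row(1)[OF x w]]] by simp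
    ultimately show ?thesis
      using counit_at_row(2)[OF y tw] counit_at_row(2)[OF x w] row[OF up_self[OF y]] True up_self[OF x] by simp
  next
    case False
    have ux: "up x = {x}" using up_top[of x y] yx False by (auto simp: up_def)
    have ddx: "dd Y n x x w \<in> hom C A (ob Y n x)" by (rule dd_hom[OF x up_self[OF x] w])
    have mh: "mp Y n x y \<in> hom C (ob Y n x) (ob Y n y)" by (rule bmp_hom[OF yx])
    have "bsum Y n y A (\<lambda>b. dd Y n y b (Comp C (F.tm (G.Tot Y) n x y) w)) = Comp C (mp Y n x y) (dd Y n x x w)"
    proof -
      have r0: "dd Y n y x (Comp C (F.tm (G.Tot Y) n x y) w) = dd Y n x x w"
        using row[of x] yx ux by (simp add: up_def[of y])
      have "(if (y, b) \<in> r \<and> y \<noteq> b then Comp C (mp Y n b y) (dd Y n y b (Comp C (F.tm (G.Tot Y) n x y) w))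
          else Zero C A (ob Y n y)) = Zero C A (ob Y n y)" if "b \<noteq> x" for b
        using row[of b] that ux A bmp_hom[of y b n] by (auto simp: up_def[of y] hom_def C.add_simps)
      then show ?thesis
        unfolding bsum_def using r0 yx False C.Comp_hom[OF ddx mh]
        by (subst C.arrow_sum_single[OF finite_P A F.T.ob_Obj[OF Y y] x]) auto
    qed
    moreover have "bsum Y n x A (\<lambda>b. dd Y n x b w) = Zero C A (ob Y n x)"
      by (rule bsum_Zero[OF x A]) (use ux in \<open>auto simp: up_def\<close>)
    moreover have "dd Y n y y (Comp C (F.tm (G.Tot Y) n x y) w) = Zero C A (ob Y n y)"
      using row[OF up_self[OF y]] ux False by simp
    ultimately show ?thesis
      unfolding counit_at_row(2)[OF y tw] counit_at_row(2)[OF x w]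
      using ddx mh A F.T.ob_Obj[OF Y x] F.T.ob_Obj[OF Y y] by (simp add: hom_def C.add_simps)
  qed
qed

lemma counit_map_hom: "counit_map Y \<in> hom F.T.K (F.Tot (G.Tot Y)) Y"
  unfolding counit_map_def
proof (rule F.T.mk_map_hom[OF F.Tot_Obj[OF GY] Y])
  fix n x assume x: "x \<in> P"
  note i = C.Idn_hom[OF F.so_Obj[OF GY x]]
  show "counit_at Y n x \<in> hom C (ob (F.Tot (G.Tot Y)) n x) (ob Y n x)" for n
    using counit_at_row(1)[OF x i] by (simp add: F.Tot_sel x)
  show "Comp C (df Y n x) (counit_at Y n x) = Comp C (counit_at Y (n + 1) x) (df (F.Tot (G.Tot Y)) n x)"
    using counit_at_D[OF x i, of n] C.Comp_Idn_right[OF counit_at_row(1)[OF x i]]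
      C.Comp_Idn_right[OF F.D_hom[OF GY x]] by (simp add: F.Tot_sel x)
next
  fix n x y assume "(x, y) \<in> r\<inverse>"
  then have yx: "(y, x) \<in> r" by simp
  then have x: "x \<in> P" and y: "y \<in> P" using r_P by auto
  note i = C.Idn_hom[OF F.so_Obj[OF GY x]]
  show "Comp C (counit_at Y n y) (mp (F.Tot (G.Tot Y)) n x y) = Comp C (mp Y n x y) (counit_at Y n x)"
    using counit_at_tm[OF yx i, of n] C.Comp_Idn_right[OF counit_at_row(1)[OF x i]]
      C.Comp_Idn_right[OF F.pr_tm(1)[OF GY x y i]] by (simp add: F.Tot_sel yx)
qed

lemma cm_counit_map: "x \<in> P \<Longrightarrow> cm (counit_map Y) n x = counit_at Y n x"
  by (simp add: counit_map_def mk_map_sel)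

text \<open>The inclusion of \<open>Y\<^sub>x\<close> as the factor of \<open>(x, x)\<close> splits the counit degreewise, and the kernel is
  contractible, since the factor of \<open>(x, e)\<close> is mapped isomorphically to that of \<open>(e, e)\<close>. Again the
  preimages are explicit.\<close>

lemma counit_map_quasi_iso: "counit_map Y \<in> quasi_isos F.T.FC"
  unfolding F.T.quasi_iso_iff[OF counit_map_hom]
proof
  fix x assume x: "x \<in> P"
  have e: "(\<lambda>n. cm (counit_map Y) n x) = (\<lambda>n. counit_at Y n x)" "(\<lambda>n. ob (F.Tot (G.Tot Y)) n x) = (\<lambda>n. F.so (G.Tot Y) n x)"
    "(\<lambda>n. df (F.Tot (G.Tot Y)) n x) = (\<lambda>n. F.D (G.Tot Y) n x)"
    using cm_counit_map x by (simp_all add: F.Tot_sel)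
  show "qis C (\<lambda>n. ob (F.Tot (G.Tot Y)) n x, \<lambda>n. df (F.Tot (G.Tot Y)) n x) (\<lambda>n. ob Y n x, \<lambda>n. df Y n x)
      (\<lambda>n. cm (counit_map Y) n x)"
    unfolding qis_def e fst_conv snd_conv
  proof (intro allI impI, elim conjE)
    fix A n w y
    assume w: "w \<in> hom C A (F.so (G.Tot Y) (n + 1) x)" and y: "y \<in> hom C A (ob Y n x)"
      and Dw: "Comp C (F.D (G.Tot Y) (n + 1) x) w = Zero C A (F.so (G.Tot Y) (n + 2) x)"
      and wy: "Comp C (counit_at Y (n + 1) x) w = Comp C (df Y n x) y"
    have A: "A \<in> Obj C" using C.hom_Obj[OF w] by simp
    \<comment> \<open>The element z with \<open>w = D z\<close> and counit y: its component at \<open>(x, x)\<close> is y, the one at \<open>(x, e)\<close> is up to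
      sign that of w at \<open>(e, e)\<close>, the others vanish.\<close>
    let ?s = "\<lambda>e. if e = x then y else sign C n (dd Y (n + 1) x e w)"
    have s: "?s e \<in> hom C A (ob Y (G.dg (n + eps x) e) e)" if e: "e \<in> up x" for e
    proof (cases "e = x")
      case True
      then show ?thesis using y by (simp add: dg)
    next
      case False
      then have "eps x = 1" "eps e = 0" using e eps_less[of x e] by (auto simp: up_def)
      then show ?thesis using False dd_hom[OF x e w] by (simp add: dg hom_def C.sign_simps)
    qed
    define t where "t = tuple C (up x) (G.V Y (n + eps x)) A ?s"
    have t: "t \<in> hom C A (G.so Y (n + eps x) x)" "\<And>e. e \<in> up x \<Longrightarrow> Comp C (G.pr Y (n + eps x) x e) t = ?s e"
      unfolding t_def by (rule G.tuple_so[OF Y x A s]; assumption)+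
    have t': "t \<in> hom C A (ob (G.Tot Y) (F.dg n x) x)" using t(1) by (simp add: G.Tot_sel x dg)
    obtain z where z: "z \<in> hom C A (F.so (G.Tot Y) n x)" "Comp C (F.pr (G.Tot Y) n x x) z = t"
      "\<And>b. b \<in> up x \<Longrightarrow> b \<noteq> x \<Longrightarrow> Comp C (F.pr (G.Tot Y) n x b) z = Zero C A (ob (G.Tot Y) (F.dg n b) b)"
      using F.inj_component[OF GY x up_self[OF x] t'] by blast
    have ddx: "dd Y n x x z = y" using z(2) t(2)[OF up_self[OF x]] by (simp add: dd_def)
    have ddc: "dd Y n x c z = Zero C A (ob Y n c)" if c: "c \<in> up x" "c \<noteq> x" for c
      using z(3)[OF c] up_P[OF c(1)] G.pr_hom[OF Y _ up_self, of c "n + eps c"] A G.so_Obj[OF Y]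
      by (auto simp: dd_def G.Tot_sel dg hom_def C.add_simps)
    have dvz: "dv Y n x e z = sign C n (dd Y (n + 1) x e w)" if "(x, e) \<in> r" "x \<noteq> e" for e
      using t(2)[of e] that z(2) eps_less[OF that] by (auto simp: dv_def up_def)
    let ?B = "bsum Y (n + 1) x A (\<lambda>b. dd Y (n + 1) x b w)"
    have ddw: "dd Y (n + 1) x b w \<in> hom C A (ob Y (n + 1) b)" if "(x, b) \<in> r" for b
      using dd_hom[OF x _ w] that by (auto simp: up_def)
    have B: "?B \<in> hom C A (ob Y (n + 1) x)" by (rule bsum_hom[OF x A ddw])
    note Dz = C.Comp_hom[OF z(1) F.D_hom[OF GY x]]
    have Dz_w: "Comp C (F.D (G.Tot Y) n x) z = w"
    proof (rule counit_eqI[OF x Dz w])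
      fix c assume c: "c \<in> up x"
      then have xc: "(x, c) \<in> r" and cP: "c \<in> P" using up_P by (auto simp: up_def)
      show "dd Y (n + 1) x c (Comp C (F.D (G.Tot Y) n x) z) = dd Y (n + 1) x c w"
      proof (cases "c = x")
        case True
        have "bsum Y (n + 1) x A (\<lambda>b. dv Y n x b z) = bsum Y (n + 1) x A (\<lambda>b. sign C n (dd Y (n + 1) x b w))"
          by (rule bsum_cong) (use dvz in auto)
        also have "\<dots> = sign C n ?B" by (rule bsum_sign[OF x A ddw])
        finally have "dd Y (n + 1) x x (Comp C (F.D (G.Tot Y) n x) z) = Add C (Comp C (df Y n x) y) (Neg C ?B)"
          using dd_D[OF x z(1) up_self[OF x]] ddx B by (simp add: hom_def C.sign_simps)
        also have "\<dots> = dd Y (n + 1) x x w"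
          unfolding wy[symmetric] counit_at_row(2)[OF x w]
          using B ddw[OF r_refl[OF x]] by (simp add: hom_def C.add_simps C.Add_reassoc C.Add_inverse)
        finally show ?thesis using True by simp
      next
        case False
        then show ?thesis
          using dd_D[OF x z(1) c] ddc[OF c False] dvz[OF xc False[symmetric]] ddw[OF xc] F.T.df_hom[OF Y cP, of n] A
            F.T.ob_Obj[OF Y cP]
          by (simp add: hom_def C.add_simps C.sign_simps)
      qed
    next
      fix e assume e: "(x, e) \<in> r" "x \<noteq> e"
      then have eP: "e \<in> P" and eU: "e \<in> up x" using r_P by (auto simp: up_def)
      note h = dv_hom[OF e w] C.Comp_hom[OF ddw[OF e(1)] F.T.df_hom[OF Y eP]]
      have "dd Y (n + 1 + 1) x e (Zero C A (F.so (G.Tot Y) (n + 1 + 1) x)) = Zero C A (ob Y (n + 1 + 1) e)"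
      proof -
        have pF: "F.pr (G.Tot Y) (n + 1 + 1) x e \<in> hom C (F.so (G.Tot Y) (n + 1 + 1) x) (G.so Y (n + 1 + 1 + eps e) e)"
          using F.pr_hom[OF GY x eU, of "n + 1 + 1"] by (simp add: G.Tot_sel eP dg)
        show ?thesis unfolding dd_def
          using pF G.pr_hom[OF Y eP up_self[OF eP], of "n + 1 + 1 + eps e"] A F.so_Obj[OF GY x] G.so_Obj[OF Y eP]
          by (simp add: hom_def C.add_simps dg)
      qed
      then have "Add C (Comp C (df Y (n + 1) e) (dd Y (n + 1) x e w)) (sign C (n + 1) (dv Y (n + 1) x e w)) =
          Zero C A (ob Y (n + 1 + 1) e)"
        using dd_D[OF x w eU] e(2) unfolding Dw by (simp add: add.commute)
      then have "Comp C (df Y (n + 1) e) (dd Y (n + 1) x e w) = sign C n (dv Y (n + 1) x e w)"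
        using h C.Sub_Zero[of "Comp C (df Y (n + 1) e) (dd Y (n + 1) x e w)" "sign C n (dv Y (n + 1) x e w)" A "ob Y (n + 1 + 1) e"]
        by (simp add: hom_def C.sign_simps)
      then have "sign C n (Comp C (df Y (n + 1) e) (dd Y (n + 1) x e w)) = dv Y (n + 1) x e w"
        using h by (simp add: hom_def C.sign_sign)
      then show "dv Y (n + 1) x e (Comp C (F.D (G.Tot Y) n x) z) = dv Y (n + 1) x e w"
        using dv_D[OF e z(1)] dvz[OF e] ddw[OF e(1)] F.T.df_hom[OF Y eP, of "n + 1"]
        by (simp add: hom_def C.sign_simps)
    qed
    have "bsum Y n x A (\<lambda>b. dd Y n x b z) = Zero C A (ob Y n x)"
      by (rule bsum_Zero[OF x A]) (use ddc in \<open>auto simp: up_def\<close>)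
    then have cz: "Comp C (counit_at Y n x) z = y"
      using counit_at_row(2)[OF x z(1)] ddx y by (simp add: hom_def C.Add_0)
    have "Comp C y (Idn C A) = Add C (Comp C (counit_at Y n x) z) (Comp C (df Y (n - 1) x) (Zero C A (ob Y (n - 1) x)))"
      unfolding cz using y A F.T.df_hom[OF Y x, of "n - 1"] F.T.ob_Obj[OF Y x] by (simp add: hom_def C.add_simps)
    then show "\<exists>A' e x' y'. is_epi C e \<and> e \<in> hom C A' A \<and> x' \<in> hom C A' (F.so (G.Tot Y) n x) \<and>
        y' \<in> hom C A' (ob Y (n - 1) x) \<and> Comp C (F.D (G.Tot Y) n x) x' = Comp C w e \<and>
        Comp C y e = Add C (Comp C (counit_at Y n x) x') (Comp C (df Y (n - 1) x) y')"
      using C.epi_Idn[OF A] C.Idn_hom[OF A] z(1) Dz_w C.Comp_Idn_right[OF w] C.Zero_hom[OF A F.T.ob_Obj[OF Y x]] by metis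
  qed
qed

end

lemma counit_map_natural:
  "is_nat_trans F.T.K F.T.K (comp_functor (F.Tot, F.Totm) (G.Tot, G.Totm)) id_functor counit_map"
  unfolding is_nat_trans_def
proof (intro conjI ballI)
  fix Y assume Y: "Y \<in> Obj F.T.K"
  show "counit_map Y \<in> hom F.T.K (fst (comp_functor (F.Tot, F.Totm) (G.Tot, G.Totm)) Y) (fst id_functor Y)"
    using counit_map_hom[OF Y] by (simp add: id_functor_def comp_functor_def)
next
  interpret TK: category F.T.K by (rule F.T.FC.category_complexes)
  fix f assume "f \<in> Arr F.T.K"
  define X Y where "X = Dom F.T.K f" and "Y = Cod F.T.K f"
  have f: "f \<in> hom F.T.K X Y" using \<open>f \<in> Arr F.T.K\<close> by (simp add: hom_def X_def Y_def)
  note X = F.T.f_Obj(1)[OF f] and Y = F.T.f_Obj(2)[OF f]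
  note Gf = G.Totm_hom[OF f]
  note FGf = F.Totm_hom[OF Gf]
  have "Comp F.T.K (counit_map Y) (F.Totm (G.Totm f)) = Comp F.T.K f (counit_map X)"
  proof (rule F.T.diagram_map_eqI[OF TK.Comp_hom[OF FGf counit_map_hom[OF Y]] TK.Comp_hom[OF counit_map_hom[OF X] f]])
    fix n x assume x: "x \<in> P"
    let ?S = "F.so (G.Tot X) n x"
    have S: "?S \<in> Obj C" by (rule F.so_Obj[OF GY[OF X] x])
    note hf = F.T.cm_hom[OF f x, of n] and hX = counit_at_row(1)[OF X x C.Idn_hom[OF S]]
      and hY = counit_at_row(1)[OF Y x C.Idn_hom[OF F.so_Obj[OF GY[OF Y] x]], of n]
    have hF: "cm (F.Totm (G.Totm f)) n x \<in> hom C ?S (F.so (G.Tot Y) n x)"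
      using F.T.cm_hom[OF FGf x, of n] by (simp add: F.Tot_sel x)
    show "cm (Comp F.T.K (counit_map Y) (F.Totm (G.Totm f))) n x = cm (Comp F.T.K f (counit_map X)) n x"
      unfolding F.T.cm_Comp[OF x] cm_counit_map[OF X x] cm_counit_map[OF Y x]
    proof (rule C.eq_by_elements[OF C.Comp_hom[OF hF hY] C.Comp_hom[OF hX hf]])
      fix w assume w: "w \<in> hom C ?S ?S"
      note fw = C.Comp_hom[OF w hF]
      have row: "dd Y n x c (Comp C (cm (F.Totm (G.Totm f)) n x) w) = Comp C (cm f n c) (dd X n x c w)"
        if c: "c \<in> up x" for c
      proof -
        have cP: "c \<in> P" using up_P[OF c] by simp
        show ?thesis
          using F.pr_cm_Totm[OF Gf x w c] G.pr_cm_Totm[OF f cP F_pr_hom[OF X x c w] up_self[OF cP]]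
          by (simp add: dd_def dg)
      qed
      have ddh: "dd X n x b w \<in> hom C ?S (ob X n b)" if "(x, b) \<in> r" for b
        using dd_hom[OF X x _ w] that by (auto simp: up_def)
      have "bsum Y n x ?S (\<lambda>b. dd Y n x b (Comp C (cm (F.Totm (G.Totm f)) n x) w)) =
          bsum Y n x ?S (\<lambda>b. Comp C (cm f n b) (dd X n x b w))"
        by (rule bsum_cong[OF Y]) (use row in \<open>auto simp: up_def\<close>)
      also have "\<dots> = Comp C (cm f n x) (bsum X n x ?S (\<lambda>b. dd X n x b w))"
        by (rule bsum_map[OF X, symmetric, OF x S ddh F.T.cm_hom[OF f] Y]) (use F.T.cm_mp[OF f] in auto)
      finally have "Comp C (counit_at Y n x) (Comp C (cm (F.Totm (G.Totm f)) n x) w) =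
          Comp C (cm f n x) (Comp C (counit_at X n x) w)"
        unfolding counit_at_row(2)[OF Y x fw] counit_at_row(2)[OF X x w] row[OF up_self[OF x]]
        using C.Comp_Add_left[OF ddh[OF r_refl[OF x]] bsum_hom[OF X x S ddh] hf] by simp
      then show "Comp C (Comp C (counit_at Y n x) (cm (F.Totm (G.Totm f)) n x)) w =
          Comp C (Comp C (cm f n x) (counit_at X n x)) w"
        using C.Comp_assoc[OF w hF hY] C.Comp_assoc[OF w hX hf] by simp
    qed
  qed
  then show "Comp F.T.K (counit_map (Cod F.T.K f)) (snd (comp_functor (F.Tot, F.Totm) (G.Tot, G.Totm)) f) =
      Comp F.T.K (snd id_functor f) (counit_map (Dom F.T.K f))"
    by (simp add: id_functor_def comp_functor_def X_def Y_def)
qed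

theorem derived_equivalent_op:
  "triangulated_equivalent (derived_category F.S.FC) (derived_category F.T.FC)"
proof (rule derived_equivalence_criterion[OF F.S.preadditive_FC F.T.preadditive_FC
      F.is_functor_Tot _ G.is_functor_Tot _ unit_map_natural unit_map_quasi_iso
      counit_map_natural counit_map_quasi_iso])
  fix s assume s: "s \<in> quasi_isos F.S.FC"
  then have "s \<in> hom F.S.K (Dom F.S.K s) (Cod F.S.K s)" by (simp add: quasi_isos_def hom_def)
  then show "snd (F.Tot, F.Totm) s \<in> quasi_isos F.T.FC" using F.Totm_quasi_iso s by simp
next
  fix s assume s: "s \<in> quasi_isos F.T.FC"
  then have "s \<in> hom F.T.K (Dom F.T.K s) (Cod F.T.K s)" by (simp add: quasi_isos_def hom_def)
  then show "snd (G.Tot, G.Totm) s \<in> quasi_isos F.S.FC" using G.Totm_quasi_iso s by simp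
next
  fix X assume "X \<in> Obj F.S.K"
  then show "fst (F.Tot, F.Totm) (shift_cpx F.S.FC X) = shift_cpx F.T.FC (fst (F.Tot, F.Totm) X)"
    using F.Tot_shift by simp
next
  fix f assume "f \<in> Arr F.S.K"
  then have "f \<in> hom F.S.K (Dom F.S.K f) (Cod F.S.K f)" by (simp add: hom_def)
  then show "snd (F.Tot, F.Totm) (shift_map F.S.FC f) = shift_map F.T.FC (snd (F.Tot, F.Totm) f)"
    using F.Totm_shift by simp
next
  fix f g h assume "is_cone_triangle F.S.FC f g h"
  then show "is_cone_triangle F.T.FC (snd (F.Tot, F.Totm) f) (snd (F.Tot, F.Totm) g) (snd (F.Tot, F.Totm) h)"
    using F.Tot_cone by simp
qed

end

section \<open>The opposite of a poset of height at most one\<close>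

theorem corollary3p7:
  fixes P :: "'p set" and r :: "'p rel"
  assumes "finite P" and "partial_order_on P r" and "height_at_most_one r"
  shows "universally_derived_equivalent TYPE('o) TYPE('a) P r P (r\<inverse>) \<and>
    (let A = minimal_elements r P; B = P - A
     in admissible_cut P r A B \<and> negative_order r A B = r\<inverse>)"
proof
  show "universally_derived_equivalent TYPE('o) TYPE('a) P r P (r\<inverse>)"
    unfolding universally_derived_equivalent_def
  proof (intro allI impI)
    fix C :: "('o, 'a) addcat"
    assume "abelian_category C"
    then interpret height_one_poset C P r
      using assms by (simp add: height_one_poset_def height_one_poset_axioms_def)
    show "triangulated_equivalent (derived_category (functor_category (poset_category P r) C))
        (derived_category (functor_category (poset_category P (r\<inverse>)) C))"
      by (rule derived_equivalent_op)
  qed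
next
  define A B where "A = minimal_elements r P" and "B = P - A"
  have r: "r \<subseteq> P \<times> P" "\<And>x. x \<in> P \<Longrightarrow> (x, x) \<in> r" "\<And>x y. (x, y) \<in> r \<Longrightarrow> (y, x) \<in> r \<Longrightarrow> x = y"
    using assms(2) by (auto simp: partial_order_on_def preorder_on_def refl_on_def antisymD)
  have chain: "x = y \<or> y = z" if "(x, y) \<in> r" "(y, z) \<in> r" for x y z
    using assms(3) that r(3) unfolding height_at_most_one_def by blast
  have AB: "A \<subseteq> P" "B = P - A" by (auto simp: A_def B_def minimal_elements_def)
  have A_iff: "a \<in> A \<longleftrightarrow> a \<in> P \<and> (\<forall>x. (x, a) \<in> r \<longrightarrow> x = a)" for a
    using r(1) by (auto simp: A_def minimal_elements_def)
  have B_below: "\<exists>x. (x, b) \<in> r \<and> x \<noteq> b" if "b \<in> B" for b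
    using that A_iff[of b] AB by auto
  have B_max: "b = y" if "b \<in> B" "(b, y) \<in> r" for b y
    using B_below[OF that(1)] chain that(2) by blast
  \<comment> \<open>B is an antichain, so every upper bound in B is minimal.\<close>
  have M: "min_upper r B a = {b \<in> B. (a, b) \<in> r}" for a
    using B_max by (auto simp: min_upper_def minimal_elements_def upper_in_def)
  have U: "upper_in r B b = {b}" "lower_in r B b = {b}" if "b \<in> B" for b
    using that B_max r(2) AB by (auto simp: upper_in_def lower_in_def)
  have "admissible_cut P r A B"
    unfolding admissible_cut_def
  proof (intro conjI ballI impI)
    fix a m m' assume "m \<in> min_upper r B a" "m' \<in> min_upper r B a" "m \<noteq> m'"
    then show "upper_in r B m \<inter> upper_in r B m' = {}" "lower_in r B m \<inter> lower_in r B m' = {}"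
      using U by (auto simp: M)
  next
    fix a a' m assume "a \<in> A" "a' \<in> A" "(a, a') \<in> r" "m \<in> min_upper r B a"
    moreover from this have "a = a'" using A_iff by blast
    ultimately show "\<exists>m'\<in>min_upper r B a'. (m, m') \<in> Restr r B"
      using r(2) AB(2) unfolding M by blast
  next
    fix a x assume "a \<in> A" "(x, a) \<in> r"
    then show "x \<in> A" using A_iff by blast
  next
    fix b x assume "b \<in> B" "(b, x) \<in> r"
    then show "x \<in> B" using B_max by blast
  qed (use AB in auto)
  moreover have "negative_order r A B = r\<inverse>"
  proof (rule set_eqI, clarify)
    fix x y
    have "(\<exists>m\<in>min_upper r B y. (x, m) \<in> Restr r B) \<longleftrightarrow> x \<in> B \<and> (y, x) \<in> r"
      unfolding M using B_max r(2) AB(2) by blast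
    then have "(x, y) \<in> negative_order r A B \<longleftrightarrow>
        (x, y) \<in> r \<and> (x \<in> A \<and> y \<in> A \<or> x \<in> B \<and> y \<in> B) \<or> x \<in> B \<and> y \<in> A \<and> (y, x) \<in> r"
      unfolding negative_order_def by blast
    \<comment> \<open>Inside each of the antichains A and B only the diagonal remains.\<close>
    also have "\<dots> \<longleftrightarrow> (y, x) \<in> r"
    proof
      assume "(y, x) \<in> r"
      moreover from this have "x \<in> P" "y \<in> P" using r(1) by auto
      ultimately show "(x, y) \<in> r \<and> (x \<in> A \<and> y \<in> A \<or> x \<in> B \<and> y \<in> B) \<or> x \<in> B \<and> y \<in> A \<and> (y, x) \<in> r"
        using A_iff[of x] B_max[of y x] AB(2) by blast
    next
      assume "(x, y) \<in> r \<and> (x \<in> A \<and> y \<in> A \<or> x \<in> B \<and> y \<in> B) \<or> x \<in> B \<and> y \<in> A \<and> (y, x) \<in> r"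
      then show "(y, x) \<in> r"
        using A_iff[of y] B_max[of x y] by blast
    qed
    finally show "(x, y) \<in> negative_order r A B \<longleftrightarrow> (x, y) \<in> r\<inverse>" by simp
  qed
  ultimately show "let A = minimal_elements r P; B = P - A
     in admissible_cut P r A B \<and> negative_order r A B = r\<inverse>"
    by (simp add: Let_def A_def B_def)
qed

end
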